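(* Let $X$ be a second-countable totally disconnected locally compact Hausdorff space, and let $\sigma$ be an action of $\mathbb{N}^k$ on $X$ by surjective local homeomorphisms $\sigma^n:X\to X$ ($n\in\mathbb{N}^k$). For $0\le p\le k$ let $A^\sigma_p=\bigwedge^p\mathbb{Z}^k\otimes C_c(X,\mathbb{Z})$, and let $A^\sigma_p=\{0\}$ for $p>k$. For $p\ge1$ define $\partial_p:A^\sigma_p\to A^\sigma_{p-1}$, on elements with $1\le i_1<\dots<i_p\le k$ and $f\in C_c(X,\mathbb{Z})$, by $$\partial_p(\varepsilon_{i_1}\wedge\dots\wedge\varepsilon_{i_p}\otimes f)=\begin{cases}1\otimes(\mathrm{id}-\sigma^{e_{i_1}}_* )f&\text{if }p=1,\\ \sum_{j=1}^p(-1)^{j+1}\varepsilon_{i_1}\wedge\dots\wedge\widehat{\varepsilon}_{i_j}\wedge\dots\wedge\varepsilon_{i_p}\otimes(\mathrm{id}-\sigma^{e_{i_j}}_* )f&\text{if }2\le p\le k,\end{cases}$$ and $\partial_p=0$ if $p\ge k+1$. Then $(A^\sigma_*,\partial_* )$ is a complex, and $$H_*(\mathcal{G}(X,\sigma))\cong H_*\big(\mathbb{Z}^k,H_0(\mathcal{G}(X,\sigma)\times_c\mathbb{Z}^k)\big)\cong H_*(A^\sigma_*,\partial_* ).$$ We have $H_p(\mathbb{Z}^k,H_0(\mathcal{G}(X,\sigma)\times_c\mathbb{Z}^k))=0$ for $p>k$.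
   Context: $\varepsilon_1,\dots,\varepsilon_k$ are the standard generators of $\mathbb{Z}^k$, $e_1,\dots,e_k$ the standard generators of $\mathbb{N}^k$; $\bigwedge^0\mathbb{Z}^k=\mathbb{Z}$; a hat denotes omission. $C_c(X,\mathbb{Z})$ is the group of compactly supported continuous (locally constant) $\mathbb{Z}$-valued functions. For a local homeomorphism $\psi:Y\to X$ of locally compact Hausdorff zero-dimensional spaces, $\psi_*:C_c(Y,\mathbb{Z})\to C_c(X,\mathbb{Z})$ is $\psi_*(f)(x)=\sum_{\psi(y)=x}f(y)$. Deaconu–Renault groupoid: $\mathcal{G}(X,\sigma)=\{(x,p-q,y)\in X\times\mathbb{Z}^k\times X: p,q\in\mathbb{N}^k,\ \sigma^p(x)=\sigma^q(y)\}$, with $r(x,n,y)=x$, $s(x,n,y)=y$, $(x,m,y)(y,n,z)=(x,m+n,z)$, $X$ identified with the unit space via $x\mapsto(x,0,x)$, and topology with basis the sets $\{(x,p-q,y):x\in U,y\in V,\sigma^p(x)=\sigma^q(y)\}$ for $U,V\subseteq X$ open and $p,q\in\mathbb{N}^k$. It is an ample Hausdorff groupoid. The cocycle is $c:\mathcal{G}(X,\sigma)\to\mathbb{Z}^k$, $c(x,n,y)=n$. The skew product $\mathcal{G}\times_c\mathbb{Z}^k$ is the set $\mathcal{G}\times\mathbb{Z}^k$ (product topology) with $r(\gamma,a)=(r(\gamma),a)$, $s(\gamma,a)=(s(\gamma),a+c(\gamma))$, $(\gamma,a)(\eta,a+c(\gamma))=(\gamma\eta,a)$. $\mathbb{Z}^k$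 acts on it by $\alpha_b(\gamma,a)=(\gamma,a+b)$; the induced action makes $H_0(\mathcal{G}\times_c\mathbb{Z}^k)$ a $\mathbb{Z}^k$-module, and $H_*(\mathbb{Z}^k,M)$ denotes group homology with coefficients in the module $M$. Groupoid homology: for an ample Hausdorff groupoid $\mathcal{G}$ let $\mathcal{G}^{(n)}$ be the space of composable $n$-tuples ($\mathcal{G}^{(0)}$ the unit space). For $n\ge2$, $d_0(g_1,\dots,g_n)=(g_2,\dots,g_n)$, $d_i(g_1,\dots,g_n)=(g_1,\dots,g_ig_{i+1},\dots,g_n)$ for $1\le i\le n-1$, $d_n(g_1,\dots,g_n)=(g_1,\dots,g_{n-1})$. Put $\partial_0=0$, $\partial_1=s_*-r_*$, $\partial_n=\sum_{i=0}^n(-1)^i(d_i)_*$ for $n\ge2$; $H_*(\mathcal{G})$ is the homology of $(C_c(\mathcal{G}^{( * )},\mathbb{Z}),\partial_* )$. *)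

theory Defs
  imports "HOL-Analysis.Analysis" "HOL-Algebra.Free_Abelian_Groups"
begin

section \<open>Chain complexes of abelian groups\<close>

text \<open>
  A complex is given by groups \<open>C n\<close> and maps \<open>d n\<close> from \<open>C n\<close> to \<open>C (n - 1)\<close> for \<open>n \<ge> 1\<close>.
  The map \<open>d 0\<close> is never used: the boundary map out of degree 0 is zero by convention, so every
  0-chain is a cycle.
\<close>

definition chain_complex :: "(nat \<Rightarrow> 'c monoid) \<Rightarrow> (nat \<Rightarrow> 'c \<Rightarrow> 'c) \<Rightarrow> bool" where
  "chain_complex C d \<longleftrightarrow>
     (\<forall>n. comm_group (C n)) \<and>
     (\<forall>n. d (Suc n) \<in> hom (C (Suc n)) (C n)) \<and>
     (\<forall>n. \<forall>z\<in>carrier (C (Suc (Suc n))). d (Suc n) (d (Suc (Suc n)) z) = \<one>\<^bsub>C n\<^esub>)"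

definition cycles :: "(nat \<Rightarrow> 'c monoid) \<Rightarrow> (nat \<Rightarrow> 'c \<Rightarrow> 'c) \<Rightarrow> nat \<Rightarrow> 'c set" where
  "cycles C d n = (if n = 0 then carrier (C 0) else kernel (C n) (C (n - 1)) (d n))"

definition boundaries :: "(nat \<Rightarrow> 'c monoid) \<Rightarrow> (nat \<Rightarrow> 'c \<Rightarrow> 'c) \<Rightarrow> nat \<Rightarrow> 'c set" where
  "boundaries C d n = d (Suc n) ` carrier (C (Suc n))"

definition homology :: "(nat \<Rightarrow> 'c monoid) \<Rightarrow> (nat \<Rightarrow> 'c \<Rightarrow> 'c) \<Rightarrow> nat \<Rightarrow> 'c set monoid" where
  "homology C d n = (C n)\<lparr>carrier := cycles C d n\<rparr> Mod boundaries C d n"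

text \<open>
  The map into the \<open>n\<close>-th homology of \<open>(C, d)\<close> induced by a chain map \<open>\<phi>\<close>: the class \<open>z + B'\<close>,
  a set of cycles, is sent to \<open>\<phi>(z + B') + B = \<phi>(z) + B\<close>.
\<close>

definition homology_map ::
    "(nat \<Rightarrow> 'c monoid) \<Rightarrow> (nat \<Rightarrow> 'c \<Rightarrow> 'c) \<Rightarrow> nat \<Rightarrow> ('b \<Rightarrow> 'c) \<Rightarrow> 'b set \<Rightarrow> 'c set" where
  "homology_map C d n \<phi> \<xi> = boundaries C d n <#>\<^bsub>C n\<^esub> (\<phi> ` \<xi>)"


section \<open>Compactly supported integer-valued functions\<close>

text \<open>Functions on \<open>topspace Y\<close> are represented by functions on the whole type that vanish
  outside \<open>topspace Y\<close>.\<close>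

definition Cc :: "'y topology \<Rightarrow> ('y \<Rightarrow> int) monoid" where
  "Cc Y = \<lparr>carrier = {f. continuous_map Y (discrete_topology UNIV) f \<and>
                         compactin Y (Y closure_of {y \<in> topspace Y. f y \<noteq> 0}) \<and>
                         (\<forall>y. y \<notin> topspace Y \<longrightarrow> f y = 0)},
           mult = (\<lambda>f g y. f y + g y), one = (\<lambda>y. 0)\<rparr>"

text \<open>The map \<open>\<psi>\<^sub>*\<close>. Restricting the sum to the support of \<open>f\<close> makes it a sum over a finite set
  when \<open>\<psi>\<close> is a local homeomorphism and \<open>f\<close> has compact support.\<close>

definition pushforward :: "('y \<Rightarrow> 'z) \<Rightarrow> ('y \<Rightarrow> int) \<Rightarrow> 'z \<Rightarrow> int" where
  "pushforward \<psi> f z = (\<Sum>y\<in>{y. f y \<noteq> 0 \<and> \<psi> y = z}. f y)"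

definition local_homeomorphism :: "'y topology \<Rightarrow> 'z topology \<Rightarrow> ('y \<Rightarrow> 'z) \<Rightarrow> bool" where
  "local_homeomorphism Y Z \<psi> \<longleftrightarrow>
     (\<forall>y\<in>topspace Y. \<exists>U. openin Y U \<and> y \<in> U \<and> openin Z (\<psi> ` U) \<and>
        homeomorphic_map (subtopology Y U) (subtopology Z (\<psi> ` U)) \<psi>)"

definition totally_disconnected_space :: "'y topology \<Rightarrow> bool" where
  "totally_disconnected_space Y \<longleftrightarrow> (\<forall>S. connectedin Y S \<longrightarrow> (\<exists>y. S \<subseteq> {y}))"


section \<open>Homology of ample groupoids\<close>

text \<open>
  Only the structure that enters the homology is recorded. The unit space is kept as a
  separate topological space instead of a subspace of the arrows; for the groupoids below this is
  the identification of \<open>x\<close> with the arrow \<open>(x, 0, x)\<close>. The product \<open>gcomp G g h\<close> is meaningful when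
  \<open>gsource G g = grange G h\<close>.
\<close>

record ('x, 'g) groupoid =
  units :: "'x topology"
  arrows :: "'g topology"
  grange :: "'g \<Rightarrow> 'x"
  gsource :: "'g \<Rightarrow> 'x"
  gcomp :: "'g \<Rightarrow> 'g \<Rightarrow> 'g"

definition composable :: "('x, 'g) groupoid \<Rightarrow> nat \<Rightarrow> 'g list set" where
  "composable G n = {gs. length gs = n \<and> set gs \<subseteq> topspace (arrows G) \<and>
      (\<forall>i. Suc i < n \<longrightarrow> gsource G (gs ! i) = grange G (gs ! Suc i))}"

text \<open>A common type for the points of all the spaces \<open>G\<^sup>(\<^sup>n\<^sup>)\<close>: units for \<open>n = 0\<close>, and composable
  \<open>n\<close>-tuples for \<open>n \<ge> 1\<close> with the topology of a subspace of the \<open>n\<close>-fold product.\<close>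

datatype ('x, 'g) nerve_point = Unit (the_unit: 'x) | Tuple (the_tuple: "'g list")

definition nerve :: "('x, 'g) groupoid \<Rightarrow> nat \<Rightarrow> ('x, 'g) nerve_point topology" where
  "nerve G n =
    (if n = 0 then pullback_topology (Unit ` topspace (units G)) the_unit (units G)
     else pullback_topology (Tuple ` composable G n) (\<lambda>z. \<lambda>i\<in>{..<n}. the_tuple z ! i)
            (product_topology (\<lambda>_. arrows G) {..<n}))"

text \<open>The face \<open>d\<^sub>i\<close> from \<open>G\<^sup>(\<^sup>n\<^sup>)\<close> to \<open>G\<^sup>(\<^sup>n\<^sup>-\<^sup>1\<^sup>)\<close>, with \<open>d\<^sub>0 = s\<close> and \<open>d\<^sub>1 = r\<close> for \<open>n = 1\<close>. In
  the last case the adjacent entries \<open>g\<^sub>i\<close> and \<open>g\<^sub>i\<^sub>+\<^sub>1\<close> (counted from 1) are multiplied.\<close>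

definition face :: "('x, 'g) groupoid \<Rightarrow> nat \<Rightarrow> nat \<Rightarrow> ('x, 'g) nerve_point \<Rightarrow> ('x, 'g) nerve_point" where
  "face G n i z = (let gs = the_tuple z in
     if n = 1 then Unit (if i = 0 then gsource G (hd gs) else grange G (hd gs))
     else if i = 0 then Tuple (tl gs)
     else if i = n then Tuple (butlast gs)
     else Tuple (take (i - 1) gs @ [gcomp G (gs ! (i - 1)) (gs ! i)] @ drop (i + 1) gs))"

definition groupoid_chains :: "('x, 'g) groupoid \<Rightarrow> nat \<Rightarrow> (('x, 'g) nerve_point \<Rightarrow> int) monoid" where
  "groupoid_chains G n = Cc (nerve G n)"

definition groupoid_boundary ::
    "('x, 'g) groupoid \<Rightarrow> nat \<Rightarrow> (('x, 'g) nerve_point \<Rightarrow> int) \<Rightarrow> ('x, 'g) nerve_point \<Rightarrow> int" where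
  "groupoid_boundary G n f =
     (if n = 0 then (\<lambda>z. 0) else (\<lambda>z. \<Sum>i\<le>n. (-1) ^ i * pushforward (face G n i) f z))"

definition groupoid_homology ::
    "('x, 'g) groupoid \<Rightarrow> nat \<Rightarrow> (('x, 'g) nerve_point \<Rightarrow> int) set monoid" where
  "groupoid_homology G = homology (groupoid_chains G) (groupoid_boundary G)"


section \<open>Deaconu-Renault groupoids and skew products\<close>

text \<open>\<open>\<int>\<^sup>k\<close> and \<open>\<nat>\<^sup>k\<close> consist of the finitely supported functions on \<open>nat\<close> with support in
  \<open>{1..k}\<close>; the generators of \<open>\<int>\<^sup>k\<close> are \<open>frag_of i\<close> and those of \<open>\<nat>\<^sup>k\<close> are
  \<open>Poly_Mapping.single i 1\<close>, for \<open>i \<in> {1..k}\<close>.\<close>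

type_synonym zvec = "nat \<Rightarrow>\<^sub>0 int"
type_synonym nvec = "nat \<Rightarrow>\<^sub>0 nat"

definition Zk :: "nat \<Rightarrow> zvec monoid" where
  "Zk k = free_Abelian_group {1..k}"

definition Nk :: "nat \<Rightarrow> nvec set" where
  "Nk k = {p. Poly_Mapping.keys p \<subseteq> {1..k}}"

definition nk_diff :: "nvec \<Rightarrow> nvec \<Rightarrow> zvec" where
  "nk_diff p q = Poly_Mapping.map int p - Poly_Mapping.map int q"

definition Nk_action :: "nat \<Rightarrow> 'a topology \<Rightarrow> (nvec \<Rightarrow> 'a \<Rightarrow> 'a) \<Rightarrow> bool" where
  "Nk_action k X \<sigma> \<longleftrightarrow>
     (\<forall>x\<in>topspace X. \<sigma> 0 x = x) \<and>
     (\<forall>p\<in>Nk k. \<forall>q\<in>Nk k. \<forall>x\<in>topspace X. \<sigma> (p + q) x = \<sigma> p (\<sigma> q x)) \<and>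
     (\<forall>n\<in>Nk k. local_homeomorphism X X (\<sigma> n) \<and> \<sigma> n ` topspace X = topspace X)"

definition DR_basic_open ::
    "(nvec \<Rightarrow> 'a \<Rightarrow> 'a) \<Rightarrow> 'a set \<Rightarrow> nvec \<Rightarrow> nvec \<Rightarrow> 'a set \<Rightarrow> ('a \<times> zvec \<times> 'a) set" where
  "DR_basic_open \<sigma> U p q V = {(x, nk_diff p q, y) | x y. x \<in> U \<and> y \<in> V \<and> \<sigma> p x = \<sigma> q y}"

text \<open>The set of arrows is the union of the basic open sets (take \<open>U = V = X\<close>), hence the
  \<open>topspace\<close> of the topology they generate.\<close>

definition DR_groupoid ::
    "nat \<Rightarrow> 'a topology \<Rightarrow> (nvec \<Rightarrow> 'a \<Rightarrow> 'a) \<Rightarrow> ('a, 'a \<times> zvec \<times> 'a) groupoid" where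
  "DR_groupoid k X \<sigma> =
     \<lparr>units = X,
      arrows = topology_generated_by
        {DR_basic_open \<sigma> U p q V | U p q V. openin X U \<and> openin X V \<and> p \<in> Nk k \<and> q \<in> Nk k},
      grange = (\<lambda>(x, n, y). x),
      gsource = (\<lambda>(x, n, y). y),
      gcomp = (\<lambda>(x, m, y) (y', n, z). (x, m + n, z))\<rparr>"

definition DR_cocycle :: "'a \<times> zvec \<times> 'a \<Rightarrow> zvec" where
  "DR_cocycle = (\<lambda>(x, n, y). n)"

definition skew_product ::
    "nat \<Rightarrow> ('x, 'g) groupoid \<Rightarrow> ('g \<Rightarrow> zvec) \<Rightarrow> ('x \<times> zvec, 'g \<times> zvec) groupoid" where
  "skew_product k G c =
     \<lparr>units = prod_topology (units G) (discrete_topology (carrier (Zk k))),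
      arrows = prod_topology (arrows G) (discrete_topology (carrier (Zk k))),
      grange = (\<lambda>(\<gamma>, a). (grange G \<gamma>, a)),
      gsource = (\<lambda>(\<gamma>, a). (gsource G \<gamma>, a + c \<gamma>)),
      gcomp = (\<lambda>(\<gamma>, a) (\<eta>, b). (gcomp G \<gamma> \<eta>, a))\<rparr>"

definition skew_translation ::
    "zvec \<Rightarrow> ('x \<times> zvec, 'g \<times> zvec) nerve_point \<Rightarrow> ('x \<times> zvec, 'g \<times> zvec) nerve_point" where
  "skew_translation b = map_nerve_point (\<lambda>(x, a). (x, a + b)) (\<lambda>(\<gamma>, a). (\<gamma>, a + b))"

text \<open>The induced action of \<open>b \<in> \<int>\<^sup>k\<close> on the zeroth homology of the skew product.\<close>

definition skew_action ::
    "nat \<Rightarrow> ('x, 'g) groupoid \<Rightarrow> ('g \<Rightarrow> zvec) \<Rightarrow> zvec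
      \<Rightarrow> (('x \<times> zvec, 'g \<times> zvec) nerve_point \<Rightarrow> int) set
      \<Rightarrow> (('x \<times> zvec, 'g \<times> zvec) nerve_point \<Rightarrow> int) set" where
  "skew_action k G c b =
     homology_map (groupoid_chains (skew_product k G c)) (groupoid_boundary (skew_product k G c)) 0
       (pushforward (skew_translation b))"


section \<open>Group homology with coefficients\<close>

text \<open>
  For a group \<open>\<Gamma>\<close> and a left \<open>\<Gamma>\<close>-module given by an abelian group \<open>M\<close> and an action \<open>act\<close>, the
  homology of \<open>\<Gamma>\<close> with coefficients in \<open>M\<close> is that of the complex obtained by tensoring the bar
  resolution of \<open>\<int>\<close> by free right modules with \<open>M\<close>. An \<open>n\<close>-chain is a finitely supported family of
  elements of \<open>M\<close> indexed by \<open>\<Gamma>\<^sup>n\<close>; writing \<open>[g\<^sub>1|\<dots>|g\<^sub>n] m\<close> for the family supported at one tuple,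
  the boundary is
  \<open>[g\<^sub>2|\<dots>|g\<^sub>n] m + \<Sum>\<^sub>0\<^sub><\<^sub>i\<^sub><\<^sub>n (-1)\<^sup>i [g\<^sub>1|\<dots>|g\<^sub>i g\<^sub>i\<^sub>+\<^sub>1|\<dots>|g\<^sub>n] m + (-1)\<^sup>n [g\<^sub>1|\<dots>|g\<^sub>n\<^sub>-\<^sub>1] g\<^sub>n m\<close>.
\<close>

definition bar_tuples :: "'g monoid \<Rightarrow> nat \<Rightarrow> 'g list set" where
  "bar_tuples \<Gamma> n = {gs. length gs = n \<and> set gs \<subseteq> carrier \<Gamma>}"

definition bar_face :: "'g monoid \<Rightarrow> nat \<Rightarrow> nat \<Rightarrow> 'g list \<Rightarrow> 'g list" where
  "bar_face \<Gamma> n i gs =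
     (if i = 0 then tl gs
      else if i = n then butlast gs
      else take (i - 1) gs @ [gs ! (i - 1) \<otimes>\<^bsub>\<Gamma>\<^esub> gs ! i] @ drop (i + 1) gs)"

definition bar_coeff :: "('g \<Rightarrow> 'm \<Rightarrow> 'm) \<Rightarrow> nat \<Rightarrow> nat \<Rightarrow> 'g list \<Rightarrow> 'm \<Rightarrow> 'm" where
  "bar_coeff act n i gs m = (if i = n then act (last gs) m else m)"

definition bar_chains :: "'g monoid \<Rightarrow> 'm monoid \<Rightarrow> nat \<Rightarrow> ('g list \<Rightarrow> 'm) monoid" where
  "bar_chains \<Gamma> M n = sum_group (bar_tuples \<Gamma> n) (\<lambda>_. M)"

definition bar_boundary ::
    "'g monoid \<Rightarrow> 'm monoid \<Rightarrow> ('g \<Rightarrow> 'm \<Rightarrow> 'm) \<Rightarrow> nat \<Rightarrow> ('g list \<Rightarrow> 'm) \<Rightarrow> 'g list \<Rightarrow> 'm" where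
  "bar_boundary \<Gamma> M act n f = (\<lambda>hs\<in>bar_tuples \<Gamma> (n - 1).
     finprod M
       (\<lambda>i. gfinprod M (\<lambda>gs. bar_coeff act n i gs (f gs))
              {gs \<in> bar_tuples \<Gamma> n. bar_face \<Gamma> n i gs = hs} [^]\<^bsub>M\<^esub> ((-1 :: int) ^ i))
       {..n})"

definition group_homology ::
    "'g monoid \<Rightarrow> 'm monoid \<Rightarrow> ('g \<Rightarrow> 'm \<Rightarrow> 'm) \<Rightarrow> nat \<Rightarrow> ('g list \<Rightarrow> 'm) set monoid" where
  "group_homology \<Gamma> M act = homology (bar_chains \<Gamma> M) (bar_boundary \<Gamma> M act)"


section \<open>Tensor products and exterior powers of abelian groups\<close>

definition tensor_relations :: "'a monoid \<Rightarrow> 'b monoid \<Rightarrow> ('a \<times> 'b \<Rightarrow>\<^sub>0 int) set" where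
  "tensor_relations A B =
     {frag_of (a \<otimes>\<^bsub>A\<^esub> a', b) - frag_of (a, b) - frag_of (a', b) | a a' b.
        a \<in> carrier A \<and> a' \<in> carrier A \<and> b \<in> carrier B} \<union>
     {frag_of (a, b \<otimes>\<^bsub>B\<^esub> b') - frag_of (a, b) - frag_of (a, b') | a b b'.
        a \<in> carrier A \<and> b \<in> carrier B \<and> b' \<in> carrier B}"

definition tensor_kernel :: "'a monoid \<Rightarrow> 'b monoid \<Rightarrow> ('a \<times> 'b \<Rightarrow>\<^sub>0 int) set" where
  "tensor_kernel A B =
     generate (free_Abelian_group (carrier A \<times> carrier B)) (tensor_relations A B)"

definition tensor_group :: "'a monoid \<Rightarrow> 'b monoid \<Rightarrow> ('a \<times> 'b \<Rightarrow>\<^sub>0 int) set monoid" where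
  "tensor_group A B = free_Abelian_group (carrier A \<times> carrier B) Mod tensor_kernel A B"

definition tensor :: "'a monoid \<Rightarrow> 'b monoid \<Rightarrow> 'a \<Rightarrow> 'b \<Rightarrow> ('a \<times> 'b \<Rightarrow>\<^sub>0 int) set" where
  "tensor A B a b =
     tensor_kernel A B #>\<^bsub>free_Abelian_group (carrier A \<times> carrier B)\<^esub> frag_of (a, b)"

text \<open>The \<open>p\<close>-th exterior power of \<open>A\<close> is the abelian group generated by the wedges of \<open>p\<close>-tuples,
  subject to additivity in every entry and to the vanishing of wedges with a repeated entry. For
  \<open>p = 0\<close> it is infinite cyclic, with the empty wedge in the role of \<open>1 \<in> \<int>\<close>.\<close>

definition ext_tuples :: "nat \<Rightarrow> 'a monoid \<Rightarrow> 'a list set" where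
  "ext_tuples p A = {xs. length xs = p \<and> set xs \<subseteq> carrier A}"

definition ext_relations :: "nat \<Rightarrow> 'a monoid \<Rightarrow> ('a list \<Rightarrow>\<^sub>0 int) set" where
  "ext_relations p A =
     {frag_of (xs[i := a \<otimes>\<^bsub>A\<^esub> b]) - frag_of (xs[i := a]) - frag_of (xs[i := b]) | xs i a b.
        xs \<in> ext_tuples p A \<and> i < p \<and> a \<in> carrier A \<and> b \<in> carrier A} \<union>
     {frag_of xs | xs. xs \<in> ext_tuples p A \<and> \<not> distinct xs}"

definition ext_kernel :: "nat \<Rightarrow> 'a monoid \<Rightarrow> ('a list \<Rightarrow>\<^sub>0 int) set" where
  "ext_kernel p A = generate (free_Abelian_group (ext_tuples p A)) (ext_relations p A)"

definition ext_power :: "nat \<Rightarrow> 'a monoid \<Rightarrow> ('a list \<Rightarrow>\<^sub>0 int) set monoid" where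
  "ext_power p A = free_Abelian_group (ext_tuples p A) Mod ext_kernel p A"

definition wedge :: "nat \<Rightarrow> 'a monoid \<Rightarrow> 'a list \<Rightarrow> ('a list \<Rightarrow>\<^sub>0 int) set" where
  "wedge p A xs = ext_kernel p A #>\<^bsub>free_Abelian_group (ext_tuples p A)\<^esub> frag_of xs"


section \<open>The complex of an action\<close>

type_synonym 'a action_chain = "((zvec list \<Rightarrow>\<^sub>0 int) set \<times> ('a \<Rightarrow> int) \<Rightarrow>\<^sub>0 int) set"

definition action_complex :: "nat \<Rightarrow> 'a topology \<Rightarrow> nat \<Rightarrow> 'a action_chain monoid" where
  "action_complex k X p =
     (if p \<le> k then tensor_group (ext_power p (Zk k)) (Cc X) else singleton_group undefined)"

text \<open>The element \<open>\<epsilon>\<^sub>i\<^sub>1 \<and> \<dots> \<and> \<epsilon>\<^sub>i\<^sub>p \<otimes> f\<close>, where \<open>is = [i\<^sub>1, \<dots>, i\<^sub>p]\<close>.\<close>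

definition action_elem ::
    "nat \<Rightarrow> 'a topology \<Rightarrow> nat \<Rightarrow> nat list \<Rightarrow> ('a \<Rightarrow> int) \<Rightarrow> 'a action_chain" where
  "action_elem k X p is f =
     tensor (ext_power p (Zk k)) (Cc X) (wedge p (Zk k) (map frag_of is)) f"

definition id_minus_push :: "(nvec \<Rightarrow> 'a \<Rightarrow> 'a) \<Rightarrow> nat \<Rightarrow> ('a \<Rightarrow> int) \<Rightarrow> 'a \<Rightarrow> int" where
  "id_minus_push \<sigma> i f = (\<lambda>x. f x - pushforward (\<sigma> (Poly_Mapping.single i 1)) f x)"

text \<open>
  \<open>is_action_boundary k X \<sigma> d\<close> says that the maps \<open>d p\<close> are the homomorphisms prescribed on the
  generators \<open>\<epsilon>\<^sub>i\<^sub>1 \<and> \<dots> \<and> \<epsilon>\<^sub>i\<^sub>p \<otimes> f\<close> with \<open>1 \<le> i\<^sub>1 < \<dots> < i\<^sub>p \<le> k\<close>, and zero for \<open>p > k\<close>. Entries are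
  counted from 1, so \<open>take (j - 1) is @ drop j is\<close> omits the \<open>j\<close>-th one. For \<open>p = 1\<close> the sum has
  the single term \<open>1 \<otimes> (id - \<sigma>\<^sub>*) f\<close>, the empty wedge being \<open>1\<close>.
\<close>

definition is_action_boundary ::
    "nat \<Rightarrow> 'a topology \<Rightarrow> (nvec \<Rightarrow> 'a \<Rightarrow> 'a)
      \<Rightarrow> (nat \<Rightarrow> 'a action_chain \<Rightarrow> 'a action_chain) \<Rightarrow> bool" where
  "is_action_boundary k X \<sigma> d \<longleftrightarrow>
     (\<forall>p\<ge>1. d p \<in> hom (action_complex k X p) (action_complex k X (p - 1))) \<and>
     (\<forall>p is f. 1 \<le> p \<and> p \<le> k \<and> length is = p \<and> sorted_wrt (<) is \<and> set is \<subseteq> {1..k} \<and>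
        f \<in> carrier (Cc X) \<longrightarrow>
        d p (action_elem k X p is f) =
          finprod (action_complex k X (p - 1))
            (\<lambda>j. action_elem k X (p - 1) (take (j - 1) is @ drop j is)
                   (id_minus_push \<sigma> (is ! (j - 1)) f)
                 [^]\<^bsub>action_complex k X (p - 1)\<^esub> ((-1 :: int) ^ (j + 1)))
            {1..p}) \<and>
     (\<forall>p>k. \<forall>z\<in>carrier (action_complex k X p). 1 \<le> p \<longrightarrow> d p z = \<one>\<^bsub>action_complex k X (p - 1)\<^esub>)"

end

(*
An N^k-action gives, for every n, the induced Z^k-module of finitely supported functions from Z^k to
C_c of the n-th nerve of G. These modules, with the face maps of the skew product, resolve H_0 of the
skew product: any compactly supported chain lies over points that all flow into one common degree of
Z^k, and coning off towards that degree contracts it. The Koszul complex of the commuting operators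
"identity minus push along a generator" on C_c(X x Z^k) is a second resolution of the same module by
induced modules, because the grading by Z^k makes these operators a regular sequence. For any such
resolution P, the double complex formed from P and the bar complex of Z^k compares the group homology
of H_0 with the homology of the coinvariants of P: these are the groupoid chains in the first case and
the complex A in the second.
*)
theory Submission
  imports Defs "HOL-Library.Function_Algebras"
begin

section \<open>Signed sums of pushforwards\<close>

text \<open>An arrow of the skew product is determined by its end points, since its cocycle
  component is the difference of their degrees. Simplices are therefore vertex lists, faces are
  deletions, and a contraction need only name a new first vertex. The natural cone point over (x, a)
  is the image of x under \<sigma> with exponent (N, ..., N) - a. All vertices of a simplex share it
  only once N is large for that simplex: this is where compact support enters, and N depends on the
  chain. The cone map is etale, so it acts on compactly supported functions by pushforward. The same
  flow to degree N identifies the cokernel of the Koszul complex with H_0. The groups of the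
  statement are quotients, hence sets of cosets, while the double complex argument is additive
  algebra. So chains are functions with values in a type of abelian groups, and the quotients are
  met only along the edges, through surjections with known kernel or through bijections. The edges
  are compared by staircases in the total complex instead of a spectral sequence. Vanishing above k
  is read off from the length of the second complex.\<close>

definition push :: "('y \<Rightarrow> 'z) \<Rightarrow> ('y \<Rightarrow> 'v::ab_group_add) \<Rightarrow> 'z \<Rightarrow> 'v" where
  "push \<phi> f z = (\<Sum>y\<in>{y. f y \<noteq> 0 \<and> \<phi> y = z}. f y)"

text \<open>\<open>push\<close> is total, an infinite sum counting as 0, but its additivity and
  functoriality are proved under this condition. Finite support gives it for bar chains; compact
  support together with etale maps gives it for the nerve.\<close>

definition fin_fibres :: "('y \<Rightarrow> 'z) \<Rightarrow> ('y \<Rightarrow> 'v::zero) \<Rightarrow> bool" where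
  "fin_fibres \<phi> f \<longleftrightarrow> (\<forall>z. finite {y. f y \<noteq> 0 \<and> \<phi> y = z})"

text \<open>Multiplication by (-1)^i on values that carry only an abelian group structure.\<close>

definition alt_sign :: "nat \<Rightarrow> 'v \<Rightarrow> 'v::ab_group_add" where
  "alt_sign i x = (if even i then x else - x)"

definition bd :: "(nat \<Rightarrow> 'y \<Rightarrow> 'z) \<Rightarrow> nat \<Rightarrow> ('y \<Rightarrow> 'v::ab_group_add) \<Rightarrow> 'z \<Rightarrow> 'v" where
  "bd d n f = (\<Sum>i\<le>n. alt_sign i (push (d i) f))"

lemma pushforward_eq_push: "pushforward = push"
  by (simp add: fun_eq_iff pushforward_def push_def)

lemma fun_sum_apply: "(\<Sum>i\<in>A. f i) x = (\<Sum>i\<in>A. f i x)"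
  for f :: "'i \<Rightarrow> 'y \<Rightarrow> 'v::comm_monoid_add"
  by (induction A rule: infinite_finite_induct) auto

lemma alt_sign_0 [simp]: "alt_sign 0 x = x" "alt_sign i 0 = 0"
  and alt_sign_Suc [simp]: "alt_sign (Suc i) x = - alt_sign i x"
  and alt_sign_minus: "alt_sign i (- x) = - alt_sign i x"
  and alt_sign_add: "alt_sign i (x + y) = alt_sign i x + alt_sign i y"
  and alt_sign_alt_sign: "alt_sign i (alt_sign j x) = alt_sign (i + j) x"
  and alt_sign_eq_0_iff [simp]: "alt_sign i x = 0 \<longleftrightarrow> x = 0"
  by (auto simp: alt_sign_def)

lemma alt_sign_sum: "alt_sign i (sum f A) = (\<Sum>x\<in>A. alt_sign i (f x))"
  by (auto simp: alt_sign_def sum_negf)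

lemma alt_sign_apply: "alt_sign i f x = alt_sign i (f x)"
  by (simp add: alt_sign_def)

lemma alt_sign_int: "(-1) ^ i * x = alt_sign i x" for x :: int
  by (simp add: alt_sign_def)

lemma fin_fibresD: "fin_fibres \<phi> f \<Longrightarrow> finite {y. f y \<noteq> 0 \<and> \<phi> y = z}"
  by (simp add: fin_fibres_def)

lemma fin_fibres_finite: "finite {y. f y \<noteq> 0} \<Longrightarrow> fin_fibres \<phi> f"
  by (auto simp: fin_fibres_def intro: rev_finite_subset)

lemma fin_fibres_cong:
  assumes "\<And>y. f y \<noteq> 0 \<Longrightarrow> \<phi> y = \<psi> y"
  shows "fin_fibres \<phi> f = fin_fibres \<psi> f"
proof -
  have "{y. f y \<noteq> 0 \<and> \<phi> y = z} = {y. f y \<noteq> 0 \<and> \<psi> y = z}" for z using assms by auto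
  then show ?thesis by (simp add: fin_fibres_def)
qed

lemma fin_fibres_inj:
  assumes "inj_on \<phi> {y. f y \<noteq> 0}" shows "fin_fibres \<phi> f"
  unfolding fin_fibres_def
proof
  fix z
  have "\<exists>w. {y. f y \<noteq> 0 \<and> \<phi> y = z} \<subseteq> {w}" using assms unfolding inj_on_def by blast
  then show "finite {y. f y \<noteq> 0 \<and> \<phi> y = z}" using finite_subset by auto
qed

lemma push_0 [simp]: "push \<phi> 0 = 0"
  by (simp add: push_def fun_eq_iff)

lemma push_uminus: "push \<phi> (- f) = - push \<phi> f"
  by (simp add: push_def fun_eq_iff sum_negf)

lemma push_eq_sum:
  assumes "finite B" "{y. f y \<noteq> 0 \<and> \<phi> y = z} \<subseteq> B" "\<And>y. y \<in> B \<Longrightarrow> f y \<noteq> 0 \<Longrightarrow> \<phi> y = z"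
  shows "push \<phi> f z = sum f B"
  unfolding push_def using assms by (intro sum.mono_neutral_left) auto

lemma push_cong:
  assumes "\<And>y. f y \<noteq> 0 \<Longrightarrow> \<phi> y = \<psi> y" shows "push \<phi> f = push \<psi> f"
proof -
  have "{y. f y \<noteq> 0 \<and> \<phi> y = z} = {y. f y \<noteq> 0 \<and> \<psi> y = z}" for z using assms by auto
  then show ?thesis by (simp add: push_def fun_eq_iff)
qed

lemma fin_fibres_uminus [simp]: "fin_fibres \<phi> (- f) = fin_fibres \<phi> f"
  for f :: "'y \<Rightarrow> 'v::ab_group_add"
  by (simp add: fin_fibres_def)

lemma fin_fibres_add:
  fixes f :: "'y \<Rightarrow> 'v::ab_group_add"
  assumes "fin_fibres \<phi> f" "fin_fibres \<phi> g" shows "fin_fibres \<phi> (f + g)"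
  unfolding fin_fibres_def
proof
  fix z
  have "{y. (f + g) y \<noteq> 0 \<and> \<phi> y = z} \<subseteq> {y. f y \<noteq> 0 \<and> \<phi> y = z} \<union> {y. g y \<noteq> 0 \<and> \<phi> y = z}" by auto
  then show "finite {y. (f + g) y \<noteq> 0 \<and> \<phi> y = z}"
    by (rule finite_subset) (simp add: assms fin_fibresD)
qed

lemma push_add:
  assumes "fin_fibres \<phi> f" "fin_fibres \<phi> g"
  shows "push \<phi> (f + g) = push \<phi> f + push \<phi> g"
proof
  fix z
  define B where "B = {y. f y \<noteq> 0 \<and> \<phi> y = z} \<union> {y. g y \<noteq> 0 \<and> \<phi> y = z}"
  have B: "finite B" using assms by (simp add: B_def fin_fibresD)
  have "push \<phi> f z = sum f B" by (rule push_eq_sum[OF B]) (auto simp: B_def)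
  moreover have "push \<phi> g z = sum g B" by (rule push_eq_sum[OF B]) (auto simp: B_def)
  moreover have "push \<phi> (f + g) z = sum (f + g) B" by (rule push_eq_sum[OF B]) (auto simp: B_def)
  ultimately show "push \<phi> (f + g) z = (push \<phi> f + push \<phi> g) z" by (simp add: sum.distrib)
qed

lemma fin_fibres_sum:
  fixes f :: "'i \<Rightarrow> 'y \<Rightarrow> 'v::ab_group_add"
  assumes "\<And>i. i \<in> A \<Longrightarrow> fin_fibres \<phi> (f i)" shows "fin_fibres \<phi> (sum f A)"
  using assms
  by (induction A rule: infinite_finite_induct) (auto simp: fin_fibres_add fin_fibres_finite)

lemma push_sum:
  assumes "\<And>i. i \<in> A \<Longrightarrow> fin_fibres \<phi> (f i)"
  shows "push \<phi> (sum f A) = (\<Sum>i\<in>A. push \<phi> (f i))"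
  using assms
  by (induction A rule: infinite_finite_induct) (auto simp: push_add fin_fibres_sum)

lemma push_alt_sign: "push \<phi> (alt_sign i f) = alt_sign i (push \<phi> f)"
  by (simp add: alt_sign_def push_uminus)

lemma fin_fibres_alt_sign [simp]: "fin_fibres \<phi> (alt_sign i f) = fin_fibres \<phi> f"
  for f :: "'y \<Rightarrow> 'v::ab_group_add"
  by (simp add: alt_sign_def)

lemma push_nonzeroD: "push \<phi> f z \<noteq> 0 \<Longrightarrow> \<exists>y. f y \<noteq> 0 \<and> \<phi> y = z"
  unfolding push_def by (metis (mono_tags, lifting) mem_Collect_eq sum.not_neutral_contains_not_neutral)

lemma fin_fibres_push:
  assumes "fin_fibres (\<psi> \<circ> \<phi>) f" shows "fin_fibres \<psi> (push \<phi> f)"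
  unfolding fin_fibres_def
proof
  fix z
  have "{y. push \<phi> f y \<noteq> 0 \<and> \<psi> y = z} \<subseteq> \<phi> ` {y. f y \<noteq> 0 \<and> (\<psi> \<circ> \<phi>) y = z}"
    by (auto dest!: push_nonzeroD)
  then show "finite {y. push \<phi> f y \<noteq> 0 \<and> \<psi> y = z}"
    by (rule finite_subset) (rule finite_imageI, rule fin_fibresD[OF assms])
qed

text \<open>Both sides regroup one finite sum over the fibre of the composite; its finiteness also
  bounds the intermediate points that can contribute.\<close>

lemma push_push:
  assumes "fin_fibres (\<psi> \<circ> \<phi>) f"
  shows "push \<psi> (push \<phi> f) = push (\<psi> \<circ> \<phi>) f"
proof
  fix z
  define S where "S = {y. f y \<noteq> 0 \<and> \<psi> (\<phi> y) = z}"
  have S: "finite S" using fin_fibresD[OF assms] by (simp add: S_def)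
  have "push \<psi> (push \<phi> f) z = (\<Sum>w\<in>\<phi> ` S. push \<phi> f w)"
    by (rule push_eq_sum) (use S in \<open>auto simp: S_def dest!: push_nonzeroD\<close>)
  also have "\<dots> = (\<Sum>w\<in>\<phi> ` S. \<Sum>y\<in>{y\<in>S. \<phi> y = w}. f y)"
  proof (intro sum.cong refl push_eq_sum)
    show "finite {y \<in> S. \<phi> y = w}" for w using S by simp
  qed (auto simp: S_def)
  also have "\<dots> = sum f S"
    by (rule sum.image_gen[OF S, symmetric])
  also have "\<dots> = push (\<psi> \<circ> \<phi>) f z"
    by (rule push_eq_sum[symmetric]) (use S in \<open>auto simp: S_def\<close>)
  finally show "push \<psi> (push \<phi> f) z = push (\<psi> \<circ> \<phi>) f z" .
qed

lemma push_ident: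
  assumes "\<And>y. f y \<noteq> 0 \<Longrightarrow> \<phi> y = y" shows "push \<phi> f = f"
proof
  fix z
  have "{y. f y \<noteq> 0 \<and> \<phi> y = z} = (if f z = 0 then {} else {z})" using assms by auto
  then show "push \<phi> f z = f z" by (auto simp: push_def split: if_splits)
qed

lemma bd_apply: "bd d n f z = (\<Sum>i\<le>n. alt_sign i (push (d i) f z))"
  by (simp add: bd_def fun_sum_apply alt_sign_apply)

lemma bd_add:
  assumes "\<And>i. i \<le> n \<Longrightarrow> fin_fibres (d i) f" "\<And>i. i \<le> n \<Longrightarrow> fin_fibres (d i) g"
  shows "bd d n (f + g) = bd d n f + bd d n g"
  using assms by (simp add: bd_def push_add alt_sign_add sum.distrib)

text \<open>The map \<open>h\<close> adds a cone point in front of a simplex.\<close>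

lemma bd_cone:
  assumes h0: "\<And>z. f z \<noteq> 0 \<Longrightarrow> e 0 (h z) = z"
    and hS: "\<And>z i. f z \<noteq> 0 \<Longrightarrow> i \<le> n \<Longrightarrow> e (Suc i) (h z) = h (d i z)"
    and fin: "\<And>i. i \<le> n \<Longrightarrow> fin_fibres (h \<circ> d i) f"
  shows "bd e (Suc n) (push h f) = f - push h (bd d n f)"
proof -
  have 0: "push (e 0) (push h f) = f"
  proof -
    have c: "fin_fibres (e 0 \<circ> h) f"
    proof -
      have "fin_fibres (e 0 \<circ> h) f = fin_fibres id f" by (rule fin_fibres_cong) (simp add: h0)
      moreover have "fin_fibres id f" by (rule fin_fibres_inj) auto
      ultimately show ?thesis by simp
    qed
    show ?thesis unfolding push_push[OF c] by (rule push_ident) (simp add: h0)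
  qed
  have S: "push (e (Suc i)) (push h f) = push h (push (d i) f)" if "i \<le> n" for i
  proof -
    have eq: "(e (Suc i) \<circ> h) z = (h \<circ> d i) z" if "f z \<noteq> 0" for z using hS that \<open>i \<le> n\<close> by simp
    have c: "fin_fibres (e (Suc i) \<circ> h) f" using fin[OF that] fin_fibres_cong[of f "e (Suc i) \<circ> h" "h \<circ> d i"] eq by blast
    show ?thesis unfolding push_push[OF c] push_push[OF fin[OF that]] by (rule push_cong) (rule eq)
  qed
  have "push h (bd d n f) = (\<Sum>i\<le>n. alt_sign i (push h (push (d i) f)))"
    unfolding bd_def
    by (subst push_sum) (auto simp: push_alt_sign fin_fibres_push fin)
  then have "f - push h (bd d n f) = f + (\<Sum>i\<le>n. alt_sign (Suc i) (push (e (Suc i)) (push h f)))"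
    by (simp add: S sum_negf)
  also have "\<dots> = bd e (Suc n) (push h f)"
    by (simp add: bd_def sum.atMost_Suc_shift 0 del: sum.atMost_Suc)
  finally show ?thesis by simp
qed

text \<open>Index pairs with i < j and with j \<le> i cancel: (i, j) goes to (j - 1, i), which keeps
  the composite by the simplicial identity and changes i + j by one. The identity is demanded only
  on the support of f.\<close>

lemma bd_bd:
  assumes simp: "\<And>z i j. f z \<noteq> 0 \<Longrightarrow> i < j \<Longrightarrow> j \<le> Suc n \<Longrightarrow> d i (e j z) = d (j - 1) (e i z)"
    and fin: "\<And>i j. i \<le> n \<Longrightarrow> j \<le> Suc n \<Longrightarrow> fin_fibres (d i \<circ> e j) f"
  shows "bd d n (bd e (Suc n) f) = 0"
proof -
  define T where "T = (\<lambda>(i, j). alt_sign (i + j) (push (d i \<circ> e j) f))"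
  define A where "A = {(i, j). i \<le> n \<and> j \<le> Suc n \<and> i < j}"
  define B where "B = {(i, j). i \<le> n \<and> j \<le> Suc n \<and> j \<le> i}"
  have "bd d n (bd e (Suc n) f) = (\<Sum>i\<le>n. \<Sum>j\<le>Suc n. T (i, j))"
    unfolding bd_def T_def
    by (intro sum.cong refl, subst push_sum)
      (auto simp: fin_fibres_push fin push_alt_sign push_push alt_sign_sum alt_sign_alt_sign
        simp del: sum.atMost_Suc intro!: sum.cong)
  also have "\<dots> = sum T ({..n} \<times> {..Suc n})"
    by (subst sum.cartesian_product) (simp add: split_def)
  also have "{..n} \<times> {..Suc n} = A \<union> B" by (auto simp: A_def B_def)
  also have "sum T (A \<union> B) = sum T A + sum T B"
  proof (rule sum.union_disjoint)
    show "finite A" "finite B"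
      by (rule finite_subset[of _ "{..n} \<times> {..Suc n}"], auto simp: A_def B_def)+
  qed (auto simp: A_def B_def)
  also have "sum T A = (\<Sum>z\<in>B. - T z)"
  proof (rule sum.reindex_bij_witness[where i = "\<lambda>(i, j). (j, Suc i)" and j = "\<lambda>(i, j). (j - 1, i)"])
    fix z assume "z \<in> A"
    then obtain i j where z: "z = (i, j)" "i < j" "j \<le> Suc n" "i \<le> n" by (auto simp: A_def)
    have "push (d i \<circ> e j) f = push (d (j - 1) \<circ> e i) f"
      by (rule push_cong) (use z simp in auto)
    then show "- T (case z of (i, j) \<Rightarrow> (j - 1, i)) = T z"
      using z by (cases j) (auto simp: T_def add.commute)
  qed (auto simp: A_def B_def)
  finally show ?thesis by (simp add: sum_negf zero_fun_def)
qed

section \<open>Homology of a double complex\<close>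

lemma subgroup_cycles:
  assumes "chain_complex C d" shows "subgroup (cycles C d n) (C n)"
proof (cases n)
  case 0
  interpret comm_group "C 0" using assms by (simp add: chain_complex_def)
  show ?thesis by (simp add: 0 cycles_def subgroup_self)
next
  case (Suc m)
  interpret group_hom "C (Suc m)" "C m" "d (Suc m)"
    using assms by (simp add: chain_complex_def group_hom_def group_hom_axioms_def comm_group_def)
  show ?thesis by (simp add: Suc cycles_def subgroup_kernel)
qed

lemma comm_group_cycles:
  assumes "chain_complex C d" shows "comm_group ((C n)\<lparr>carrier := cycles C d n\<rparr>)"
proof -
  interpret comm_group "C n" using assms by (simp add: chain_complex_def)
  have "group ((C n)\<lparr>carrier := cycles C d n\<rparr>)"
    by (rule subgroup.subgroup_is_group[OF subgroup_cycles[OF assms] is_group])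
  then show ?thesis
    by (rule group.group_comm_groupI)
      (use subgroup.subset[OF subgroup_cycles[OF assms, of n]] in \<open>auto intro: m_comm\<close>)
qed

lemma boundaries_subset_cycles:
  assumes "chain_complex C d" shows "boundaries C d n \<subseteq> cycles C d n"
proof -
  have "d (Suc n) ` carrier (C (Suc n)) \<subseteq> carrier (C n)"
    using assms by (auto simp: chain_complex_def hom_def)
  then show ?thesis
    using assms by (cases n) (auto simp: boundaries_def cycles_def kernel_def chain_complex_def)
qed

lemma subgroup_boundaries:
  assumes "chain_complex C d" shows "subgroup (boundaries C d n) ((C n)\<lparr>carrier := cycles C d n\<rparr>)"
proof -
  interpret group_hom "C (Suc n)" "C n" "d (Suc n)"
    using assms by (simp add: chain_complex_def group_hom_def group_hom_axioms_def comm_group_def)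
  have "subgroup (boundaries C d n) (C n)" by (simp add: boundaries_def img_is_subgroup)
  then show ?thesis
    by (rule H.subgroup_incl[OF _ subgroup_cycles[OF assms] boundaries_subset_cycles[OF assms]])
qed

lemma normal_boundaries:
  assumes "chain_complex C d" shows "boundaries C d n \<lhd> (C n)\<lparr>carrier := cycles C d n\<rparr>"
  by (rule comm_group.subgroup_imp_normal[OF comm_group_cycles subgroup_boundaries]) fact+

lemma comm_group_homology:
  assumes "chain_complex C d" shows "comm_group (homology C d n)"
  unfolding homology_def
  by (rule comm_group.abelian_FactGroup[OF comm_group_cycles subgroup_boundaries]) fact+

text \<open>The first isomorphism theorem for the map sending a cycle to the coset of its image:
  \<open>inj\<close> identifies the kernel with the boundaries and \<open>surj\<close> makes the map
  onto. Stating both for elements keeps cosets out of the later arguments.\<close>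

lemma homology_iso:
  assumes C: "chain_complex C d" and E: "chain_complex E e"
    and hom: "\<And>n. \<phi> n \<in> hom (C n) (E n)"
    and comm: "\<And>n z. z \<in> carrier (C (Suc n)) \<Longrightarrow> e (Suc n) (\<phi> (Suc n) z) = \<phi> n (d (Suc n) z)"
    and surj: "\<And>a. a \<in> cycles E e n \<Longrightarrow> \<exists>x\<in>cycles C d n. \<exists>b\<in>boundaries E e n. a = b \<otimes>\<^bsub>E n\<^esub> \<phi> n x"
    and inj: "\<And>x. x \<in> cycles C d n \<Longrightarrow> \<phi> n x \<in> boundaries E e n \<Longrightarrow> x \<in> boundaries C d n"
  shows "homology C d n \<cong> homology E e n"
proof -
  define Z where "Z = (C n)\<lparr>carrier := cycles C d n\<rparr>"
  define Y where "Y = (E n)\<lparr>carrier := cycles E e n\<rparr>"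
  define B where "B = boundaries E e n"
  interpret Z: comm_group Z unfolding Z_def by (rule comm_group_cycles[OF C])
  interpret Y: comm_group Y unfolding Y_def by (rule comm_group_cycles[OF E])
  interpret B: normal B Y unfolding B_def Y_def by (rule normal_boundaries[OF E])
  interpret En: comm_group "E n" using E by (simp add: chain_complex_def)
  have one: "\<phi> m \<one>\<^bsub>C m\<^esub> = \<one>\<^bsub>E m\<^esub>" for m
    using C E hom by (simp add: chain_complex_def comm_group_def hom_one)
  have cyc: "\<phi> n z \<in> cycles E e n" if "z \<in> cycles C d n" for z
  proof (cases n)
    case 0
    then show ?thesis using that hom[of 0] by (auto simp: cycles_def hom_def)
  next
    case (Suc m)
    then show ?thesis using that hom[of n] comm[of z m] one[of m]
      by (auto simp: cycles_def hom_def kernel_def)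
  qed
  have cc: "cycles C d n \<subseteq> carrier (C n)" using subgroup.subset[OF subgroup_cycles[OF C]] .
  have "\<phi> n \<in> hom Z Y"
    using hom[of n] cyc cc by (auto simp: hom_def Z_def Y_def subset_iff)
  then have hh: "(\<lambda>z. B #>\<^bsub>Y\<^esub> \<phi> n z) \<in> hom Z (Y Mod B)"
    using hom_compose[OF _ B.r_coset_hom_Mod, of "\<phi> n" Z] by (simp add: o_def)
  interpret h: group_hom Z "Y Mod B" "\<lambda>z. B #>\<^bsub>Y\<^esub> \<phi> n z"
    using hh B.factorgroup_is_group by (simp add: group_hom_def group_hom_axioms_def)
  have ker: "kernel Z (Y Mod B) (\<lambda>z. B #>\<^bsub>Y\<^esub> \<phi> n z) = boundaries C d n"
  proof
    show "kernel Z (Y Mod B) (\<lambda>z. B #>\<^bsub>Y\<^esub> \<phi> n z) \<subseteq> boundaries C d n"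
    proof
      fix z assume "z \<in> kernel Z (Y Mod B) (\<lambda>z. B #>\<^bsub>Y\<^esub> \<phi> n z)"
      then have z: "z \<in> cycles C d n" "B #>\<^bsub>Y\<^esub> \<phi> n z = B" by (auto simp: kernel_def Z_def)
      then have "\<phi> n z \<in> B"
        using Y.rcos_self[OF _ B.subgroup_axioms, of "\<phi> n z"] cyc by (auto simp: Y_def)
      then show "z \<in> boundaries C d n" using inj z by (simp add: B_def)
    qed
    show "boundaries C d n \<subseteq> kernel Z (Y Mod B) (\<lambda>z. B #>\<^bsub>Y\<^esub> \<phi> n z)"
    proof
      fix z assume z: "z \<in> boundaries C d n"
      then obtain w where w: "w \<in> carrier (C (Suc n))" "z = d (Suc n) w" by (auto simp: boundaries_def)
      have "\<phi> n z = e (Suc n) (\<phi> (Suc n) w)" using comm w by simp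
      moreover have "\<phi> (Suc n) w \<in> carrier (E (Suc n))" using hom w by (auto simp: hom_def)
      ultimately have "\<phi> n z \<in> B" by (auto simp: B_def boundaries_def)
      moreover have zc: "z \<in> cycles C d n" using boundaries_subset_cycles[OF C] z by blast
      ultimately have "B #>\<^bsub>Y\<^esub> \<phi> n z = B"
        using Y.coset_join2[OF _ B.subgroup_axioms, of "\<phi> n z"] cyc[OF zc] by (simp add: Y_def)
      then show "z \<in> kernel Z (Y Mod B) (\<lambda>z. B #>\<^bsub>Y\<^esub> \<phi> n z)" using zc by (simp add: kernel_def Z_def)
    qed
  qed
  have im: "(\<lambda>z. B #>\<^bsub>Y\<^esub> \<phi> n z) ` carrier Z = carrier (Y Mod B)"
  proof
    show "(\<lambda>z. B #>\<^bsub>Y\<^esub> \<phi> n z) ` carrier Z \<subseteq> carrier (Y Mod B)" by auto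
    show "carrier (Y Mod B) \<subseteq> (\<lambda>z. B #>\<^bsub>Y\<^esub> \<phi> n z) ` carrier Z"
    proof
      fix \<xi> assume "\<xi> \<in> carrier (Y Mod B)"
      then obtain a where a: "a \<in> carrier Y" "\<xi> = B #>\<^bsub>Y\<^esub> a" by (auto simp: carrier_FactGroup)
      then obtain x b where x: "x \<in> cycles C d n" "b \<in> B" "a = b \<otimes>\<^bsub>Y\<^esub> \<phi> n x"
        using surj[of a] by (auto simp: Y_def B_def)
      have "\<phi> n x \<in> carrier Y" using cyc[OF x(1)] by (simp add: Y_def)
      then have "\<xi> = B #>\<^bsub>Y\<^esub> \<phi> n x"
        using x a by (metis B.is_subgroup B.subset Y.coset_join2 Y.coset_mult_assoc subsetD)
      then show "\<xi> \<in> (\<lambda>z. B #>\<^bsub>Y\<^esub> \<phi> n z) ` carrier Z" using x(1) by (auto simp: Z_def)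
    qed
  qed
  have "Z Mod boundaries C d n \<cong> Y Mod B"
    using h.FactGroup_iso[OF im] by (simp add: ker)
  then show ?thesis by (simp add: homology_def Z_def Y_def B_def)
qed

text \<open>The differentials anticommute, a sign being absorbed into one of them, so that their
  plain sum squares to zero. All cells are subsets of one type, which makes a total chain a function
  of p and q.\<close>

locale double_complex =
  fixes D :: "nat \<Rightarrow> nat \<Rightarrow> 'd::ab_group_add set" and dh dv :: "nat \<Rightarrow> nat \<Rightarrow> 'd \<Rightarrow> 'd"
  assumes D_0: "0 \<in> D p q"
    and D_diff: "x \<in> D p q \<Longrightarrow> y \<in> D p q \<Longrightarrow> x - y \<in> D p q"
    and dh_in: "x \<in> D (Suc p) q \<Longrightarrow> dh p q x \<in> D p q"
    and dv_in: "x \<in> D p (Suc q) \<Longrightarrow> dv p q x \<in> D p q"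
    and dh_add: "x \<in> D (Suc p) q \<Longrightarrow> y \<in> D (Suc p) q \<Longrightarrow> dh p q (x + y) = dh p q x + dh p q y"
    and dv_add: "x \<in> D p (Suc q) \<Longrightarrow> y \<in> D p (Suc q) \<Longrightarrow> dv p q (x + y) = dv p q x + dv p q y"
    and dh_dh: "x \<in> D (Suc (Suc p)) q \<Longrightarrow> dh p q (dh (Suc p) q x) = 0"
    and dv_dv: "x \<in> D p (Suc (Suc q)) \<Longrightarrow> dv p q (dv p (Suc q) x) = 0"
    and anti: "x \<in> D (Suc p) (Suc q) \<Longrightarrow> dh p q (dv (Suc p) q x) + dv p q (dh p (Suc q) x) = 0"
begin

text \<open>Exchanging the directions lets a single augmentation theorem serve both edges.\<close>

lemma flip: "double_complex (\<lambda>p q. D q p) (\<lambda>p q. dv q p) (\<lambda>p q. dh q p)"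
proof
  fix x p q assume "x \<in> D (Suc q) (Suc p)"
  then show "dv q p (dh q (Suc p) x) + dh q p (dv (Suc q) p x) = 0"
    using anti[of x q p] by (simp only: add.commute)
qed (fact D_0 D_diff dh_in dv_in dh_add dv_add dh_dh dv_dv)+

lemma D_minus: "x \<in> D p q \<Longrightarrow> - x \<in> D p q" using D_diff[OF D_0, of x] by simp

lemma D_add: "x \<in> D p q \<Longrightarrow> y \<in> D p q \<Longrightarrow> x + y \<in> D p q"
  using D_diff[OF _ D_minus, of x p q y] by simp

lemma dh_0 [simp]: "dh p q 0 = 0" using dh_add[OF D_0 D_0, of p q] by simp

lemma dv_0 [simp]: "dv p q 0 = 0" using dv_add[OF D_0 D_0, of p q] by simp

lemma dh_minus: "x \<in> D (Suc p) q \<Longrightarrow> dh p q (- x) = - dh p q x"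
  using dh_add[OF _ D_minus, of x p q x] by (simp add: eq_neg_iff_add_eq_0 add.commute)

lemma dv_minus: "x \<in> D p (Suc q) \<Longrightarrow> dv p q (- x) = - dv p q x"
  using dv_add[OF _ D_minus, of x p q x] by (simp add: eq_neg_iff_add_eq_0 add.commute)

definition total :: "nat \<Rightarrow> (nat \<Rightarrow> nat \<Rightarrow> 'd) set" where
  "total n = {x. \<forall>p q. x p q \<in> (if p + q = n then D p q else {0})}"

definition tot_d :: "(nat \<Rightarrow> nat \<Rightarrow> 'd) \<Rightarrow> nat \<Rightarrow> nat \<Rightarrow> 'd" where
  "tot_d x p q = dh p q (x (Suc p) q) + dv p q (x p (Suc q))"

definition tot_group :: "nat \<Rightarrow> (nat \<Rightarrow> nat \<Rightarrow> 'd) monoid" where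
  "tot_group n = \<lparr>carrier = total n, mult = (+), one = 0\<rparr>"

lemma totalD: "x \<in> total n \<Longrightarrow> x p q \<in> D p q"
  using D_0 by (fastforce simp: total_def split: if_splits)

lemma total_zero: "x \<in> total n \<Longrightarrow> p + q \<noteq> n \<Longrightarrow> x p q = 0"
  by (fastforce simp: total_def split: if_splits)

lemma totalI: "(\<And>p q. p + q = n \<Longrightarrow> x p q \<in> D p q) \<Longrightarrow> (\<And>p q. p + q \<noteq> n \<Longrightarrow> x p q = 0) \<Longrightarrow> x \<in> total n"
  by (auto simp: total_def)

lemma total_0: "0 \<in> total n" by (rule totalI) (auto simp: D_0)

lemma total_add:
  assumes x: "x \<in> total n" and y: "y \<in> total n" shows "x + y \<in> total n"
  by (rule totalI)
    (auto simp: D_add totalD[OF x] totalD[OF y] total_zero[OF x] total_zero[OF y])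

lemma total_diff:
  assumes x: "x \<in> total n" and y: "y \<in> total n" shows "x - y \<in> total n"
  by (rule totalI)
    (auto simp: D_diff totalD[OF x] totalD[OF y] total_zero[OF x] total_zero[OF y])

lemma tot_d_in:
  assumes x: "x \<in> total (Suc n)" shows "tot_d x \<in> total n"
  by (rule totalI) (auto simp: tot_d_def total_zero[OF x] intro!: D_add dh_in dv_in totalD[OF x])

lemma tot_d_add:
  assumes x: "x \<in> total n" and y: "y \<in> total n" shows "tot_d (x + y) = tot_d x + tot_d y"
  by (simp add: fun_eq_iff tot_d_def dh_add dv_add totalD[OF x] totalD[OF y] algebra_simps)

lemma tot_d_diff: "x \<in> total n \<Longrightarrow> y \<in> total n \<Longrightarrow> tot_d (x - y) = tot_d x - tot_d y"
  using tot_d_add[OF total_diff, of x n y y] by (simp add: algebra_simps)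

lemma tot_d_tot_d: "x \<in> total n \<Longrightarrow> tot_d (tot_d x) = 0"
proof (intro ext)
  fix p q assume x: "x \<in> total n"
  let ?y = "x (Suc p) (Suc q)"
  have "tot_d (tot_d x) p q = dh p q (dh (Suc p) q (x (Suc (Suc p)) q)) + dh p q (dv (Suc p) q ?y)
      + (dv p q (dh p (Suc q) ?y) + dv p q (dv p (Suc q) (x p (Suc (Suc q)))))"
    unfolding tot_d_def by (simp add: dh_add dv_add dh_in dv_in totalD[OF x])
  also have "\<dots> = 0"
    using anti[OF totalD[OF x], of p q] by (simp add: dh_dh dv_dv totalD[OF x])
  finally show "tot_d (tot_d x) p q = 0 p q" by simp
qed

lemma comm_group_tot: "comm_group (tot_group n)"
proof (rule comm_groupI)
  fix x assume "x \<in> carrier (tot_group n)"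
  then show "\<exists>y\<in>carrier (tot_group n). y \<otimes>\<^bsub>tot_group n\<^esub> x = \<one>\<^bsub>tot_group n\<^esub>"
    using total_diff[OF total_0, of x n] by (intro bexI[of _ "- x"]) (simp_all add: tot_group_def)
qed (simp_all add: tot_group_def total_0 total_add add.assoc add.commute)

lemma chain_complex_tot: "chain_complex tot_group (\<lambda>n. tot_d)"
  using comm_group_tot
  by (auto simp: chain_complex_def tot_group_def hom_def tot_d_in tot_d_add tot_d_tot_d)

lemma cycles_tot: "cycles tot_group (\<lambda>n. tot_d) n = {x \<in> total n. tot_d x = 0}"
proof (cases n)
  case 0
  have "tot_d x = 0" if x: "x \<in> total 0" for x
    using total_zero[OF x] by (simp add: fun_eq_iff tot_d_def)
  then show ?thesis by (auto simp: 0 cycles_def tot_group_def)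
qed (auto simp: cycles_def tot_group_def kernel_def)

lemma boundaries_tot: "boundaries tot_group (\<lambda>n. tot_d) n = tot_d ` total (Suc n)"
  by (simp add: boundaries_def tot_group_def)

definition single :: "nat \<Rightarrow> nat \<Rightarrow> 'd \<Rightarrow> nat \<Rightarrow> nat \<Rightarrow> 'd" where
  "single p q x = (\<lambda>p' q'. if p' = p \<and> q' = q then x else 0)"

lemma single_total: "x \<in> D p q \<Longrightarrow> single p q x \<in> total (p + q)"
  by (rule totalI) (auto simp: single_def D_0)

end

text \<open>Transposing the bigrading is a chain map that is bijective in every total
  degree.\<close>

lemma homology_tot_flip:
  assumes "double_complex D dh dv"
  shows "homology (double_complex.tot_group (\<lambda>p q. D q p))
            (\<lambda>n. double_complex.tot_d (\<lambda>p q. dv q p) (\<lambda>p q. dh q p)) n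
       \<cong> homology (double_complex.tot_group D) (\<lambda>n. double_complex.tot_d dh dv) n"
proof -
  interpret T: double_complex D dh dv by fact
  interpret F: double_complex "\<lambda>p q. D q p" "\<lambda>p q. dv q p" "\<lambda>p q. dh q p" by (rule T.flip)
  let ?\<phi> = "\<lambda>(n::nat) x p q. x q p"
  have tot: "?\<phi> n x \<in> T.total n \<longleftrightarrow> x \<in> F.total n" for x n
    by (auto simp: T.total_def F.total_def add.commute)
  have tot': "?\<phi> n x \<in> F.total n \<longleftrightarrow> x \<in> T.total n" for x n
    by (auto simp: T.total_def F.total_def add.commute)
  have comm: "T.tot_d (?\<phi> n x) = ?\<phi> n (F.tot_d x)" for x
    by (simp add: fun_eq_iff T.tot_d_def F.tot_d_def add.commute)
  have comm': "F.tot_d (?\<phi> n x) = ?\<phi> n (T.tot_d x)" for x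
    by (simp add: fun_eq_iff T.tot_d_def F.tot_d_def add.commute)
  have flip0: "(\<lambda>p q. x q p) = 0 \<longleftrightarrow> x = 0" for x :: "nat \<Rightarrow> nat \<Rightarrow> 'a"
    by (auto simp: fun_eq_iff)
  show ?thesis
  proof (rule homology_iso[where \<phi> = ?\<phi>, OF F.chain_complex_tot T.chain_complex_tot])
    show "?\<phi> n \<in> hom (F.tot_group n) (T.tot_group n)" for n
      using tot by (auto simp: hom_def F.tot_group_def T.tot_group_def fun_eq_iff)
    show "T.tot_d (?\<phi> (Suc n) z) = ?\<phi> n (F.tot_d z)" for n z using comm by simp
    fix a assume a: "a \<in> cycles T.tot_group (\<lambda>n. T.tot_d) n"
    have b: "0 \<in> boundaries T.tot_group (\<lambda>n. T.tot_d) n"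
      unfolding T.boundaries_tot
      by (rule image_eqI[of _ _ 0]) (auto simp: T.total_0 T.tot_d_def fun_eq_iff)
    show "\<exists>x\<in>cycles F.tot_group (\<lambda>n. F.tot_d) n. \<exists>b\<in>boundaries T.tot_group (\<lambda>n. T.tot_d) n.
        a = b \<otimes>\<^bsub>T.tot_group n\<^esub> ?\<phi> n x"
      using a b tot'[of a n] comm'[of a] flip0[of "T.tot_d a"]
      by (intro bexI[of _ "?\<phi> n a"] bexI[of _ 0]) (auto simp: T.cycles_tot F.cycles_tot T.tot_group_def)
  next
    fix x assume "x \<in> cycles F.tot_group (\<lambda>n. F.tot_d) n"
      "?\<phi> n x \<in> boundaries T.tot_group (\<lambda>n. T.tot_d) n"
    then obtain y where y: "y \<in> T.total (Suc n)" "?\<phi> n x = T.tot_d y" by (auto simp: T.boundaries_tot)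
    have "x = (\<lambda>p q. T.tot_d y q p)" using y(2) by (simp add: fun_eq_iff)
    then have "x = F.tot_d (?\<phi> n y)" using comm'[of y] by simp
    then show "x \<in> boundaries F.tot_group (\<lambda>n. F.tot_d) n"
      using y tot' by (auto simp: F.boundaries_tot)
  qed
qed

text \<open>Each column p is a resolution of \<open>A p\<close>: exact above the bottom row, with
  cokernel \<open>A p\<close> there. The cokernel is given by a surjection with prescribed kernel,
  so that \<open>A\<close> may consist of cosets. On \<open>dA\<close> only compatibility with
  \<open>dh\<close> is demanded; additivity and square zero descend along \<epsilon>.\<close>

locale augmented_double_complex = double_complex +
  fixes A :: "nat \<Rightarrow> 'c monoid" and dA :: "nat \<Rightarrow> 'c \<Rightarrow> 'c" and \<epsilon> :: "nat \<Rightarrow> 'a \<Rightarrow> 'c"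
  assumes exact: "x \<in> D p (Suc q) \<Longrightarrow> dv p q x = 0 \<Longrightarrow> \<exists>y\<in>D p (Suc (Suc q)). dv p (Suc q) y = x"
    and A_comm: "comm_group (A n)"
    and \<epsilon>_onto: "\<epsilon> n ` D n 0 = carrier (A n)"
    and \<epsilon>_add: "x \<in> D n 0 \<Longrightarrow> y \<in> D n 0 \<Longrightarrow> \<epsilon> n (x + y) = \<epsilon> n x \<otimes>\<^bsub>A n\<^esub> \<epsilon> n y"
    and \<epsilon>_kernel: "x \<in> D n 0 \<Longrightarrow> \<epsilon> n x = \<one>\<^bsub>A n\<^esub> \<longleftrightarrow> x \<in> dv n 0 ` D n (Suc 0)"
    and \<epsilon>_dh: "x \<in> D (Suc n) 0 \<Longrightarrow> dA (Suc n) (\<epsilon> (Suc n) x) = \<epsilon> n (dh n 0 x)"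
begin

lemma \<epsilon>_in: "x \<in> D n 0 \<Longrightarrow> \<epsilon> n x \<in> carrier (A n)" using \<epsilon>_onto[of n] by blast

lemma \<epsilon>_0: "\<epsilon> n 0 = \<one>\<^bsub>A n\<^esub>"
proof -
  have "0 \<in> dv n 0 ` D n (Suc 0)" by (rule image_eqI[OF _ D_0]) simp
  then show ?thesis using \<epsilon>_kernel[OF D_0] by simp
qed

lemma chain_complex_A: "chain_complex A dA"
  unfolding chain_complex_def
proof (intro conjI allI ballI)
  show "comm_group (A n)" for n by (rule A_comm)
  show "dA (Suc n) \<in> hom (A (Suc n)) (A n)" for n
  proof (rule homI)
    fix a b assume "a \<in> carrier (A (Suc n))" "b \<in> carrier (A (Suc n))"
    then obtain x y where xy: "x \<in> D (Suc n) 0" "y \<in> D (Suc n) 0" "a = \<epsilon> (Suc n) x" "b = \<epsilon> (Suc n) y"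
      by (auto simp flip: \<epsilon>_onto)
    then show "dA (Suc n) a \<in> carrier (A n)" by (simp add: \<epsilon>_dh \<epsilon>_in dh_in)
    show "dA (Suc n) (a \<otimes>\<^bsub>A (Suc n)\<^esub> b) = dA (Suc n) a \<otimes>\<^bsub>A n\<^esub> dA (Suc n) b"
      using xy by (simp add: D_add dh_in \<epsilon>_dh dh_add flip: \<epsilon>_add)
  qed
  show "dA (Suc n) (dA (Suc (Suc n)) a) = \<one>\<^bsub>A n\<^esub>" if "a \<in> carrier (A (Suc (Suc n)))" for n a
  proof -
    obtain x where "x \<in> D (Suc (Suc n)) 0" "a = \<epsilon> (Suc (Suc n)) x" using \<epsilon>_onto[of "Suc (Suc n)"] \<open>a \<in> _\<close> by blast
    then show ?thesis by (simp add: \<epsilon>_dh dh_in dh_dh \<epsilon>_0)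
  qed
qed

text \<open>A staircase upwards from the bottom row: the entry at (p, i + 1) is chosen so that its
  vertical boundary cancels the horizontal boundary of the entry at (p + 1, i). That boundary is a
  vertical cycle, hence has a preimage; on the bottom row the hypothesis \<open>cyc\<close> supplies
  the preimage.\<close>

lemma lift_cycle:
  assumes a: "a \<in> D n 0" and cyc: "\<And>m. n = Suc m \<Longrightarrow> dh m 0 a \<in> dv m 0 ` D m (Suc 0)"
  shows "\<exists>x\<in>total n. tot_d x = 0 \<and> x n 0 = a"
proof -
  \<comment> \<open>Invariant: nothing lives above row i yet, and the total boundary vanishes in the
    rows below i.\<close>
  have "\<exists>x\<in>total n. x n 0 = a \<and> (\<forall>p q. p + Suc q = n \<longrightarrow> q < i \<longrightarrow> tot_d x p q = 0)
      \<and> (\<forall>p q. i < q \<longrightarrow> x p q = 0)" if "i \<le> n" for i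
    using that
  proof (induction i)
    case 0
    show ?case using single_total[OF a]
      by (intro bexI[of _ "single n 0 a"]) (auto simp: single_def)
  next
    case (Suc i)
    then obtain x where x: "x \<in> total n" "x n 0 = a" "\<And>p q. p + Suc q = n \<Longrightarrow> q < i \<Longrightarrow> tot_d x p q = 0"
      "\<And>p q. i < q \<Longrightarrow> x p q = 0" by auto
    define p where "p = n - Suc i"
    have p: "p + Suc i = n" using Suc.prems by (simp add: p_def)
    let ?b = "dh p i (x (Suc p) i)"
    have "\<exists>y\<in>D p (Suc i). dv p i y = - ?b"
    proof (cases i)
      case 0
      then obtain w where "w \<in> D p (Suc 0)" "dh p 0 a = dv p 0 w" using cyc[of p] p by auto
      then show ?thesis using x(2) p 0 by (intro bexI[of _ "- w"]) (auto simp: dv_minus D_minus)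
    next
      case (Suc j)
      have xD: "x (Suc p) (Suc j) \<in> D (Suc p) (Suc j)" by (rule totalD[OF x(1)])
      \<comment> \<open>The invariant one row down turns the vertical boundary of this entry into a
        horizontal one, which \<open>dh_dh\<close> kills.\<close>
      have "tot_d x (Suc p) j = 0" by (rule x(3)) (use p Suc in auto)
      then have e: "dv (Suc p) j (x (Suc p) (Suc j)) = - dh (Suc p) j (x (Suc (Suc p)) j)"
        by (simp add: tot_d_def eq_neg_iff_add_eq_0 add.commute)
      have "dv p j (- ?b) = dh p j (dv (Suc p) j (x (Suc p) (Suc j)))"
        using anti[OF xD] by (simp add: Suc dv_minus dh_in xD eq_neg_iff_add_eq_0 neg_eq_iff_add_eq_0 add.commute)
      also have "\<dots> = 0"
        unfolding e by (simp add: dh_minus dh_in totalD[OF x(1)] dh_dh)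
      finally show ?thesis
        using exact[of "- ?b" p j] by (simp add: Suc D_minus dh_in xD)
    qed
    then obtain y where y: "y \<in> D p (Suc i)" "dv p i y = - ?b" by blast
    show ?case
    proof (intro bexI[of _ "x + single p (Suc i) y"] conjI allI impI)
      show "x + single p (Suc i) y \<in> total n" using total_add[OF x(1)] single_total[OF y(1)] p by simp
      show "(x + single p (Suc i) y) n 0 = a" using x(2) by (simp add: single_def)
      show "(x + single p (Suc i) y) p' q = 0" if "Suc i < q" for p' q
        using x(4)[of q p'] that by (simp add: single_def)
      fix p' q assume pq: "p' + Suc q = n" "q < Suc i"
      show "tot_d (x + single p (Suc i) y) p' q = 0"
      proof (cases "q = i")
        case True
        then have "p' = p" using pq p by simp
        then show ?thesis using True x(4)[of "Suc i" p] y by (simp add: tot_d_def single_def)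
      next
        case False
        then show ?thesis using x(3)[of p' q] pq by (simp add: tot_d_def single_def)
      qed
    qed
  qed
  from this[of n] obtain x where x: "x \<in> total n" "x n 0 = a"
    "\<And>p q. p + Suc q = n \<Longrightarrow> q < n \<Longrightarrow> tot_d x p q = 0" by auto
  have "tot_d x p q = 0" for p q
  proof (cases "p + Suc q = n")
    case False
    then show ?thesis using total_zero[OF x(1)] by (simp add: tot_d_def)
  qed (use x in auto)
  then show ?thesis using x by (auto simp: fun_eq_iff)
qed

text \<open>The staircase run on the whole cycle: total boundaries are subtracted until x is zero in
  the rows below i. The entry in row i is then a vertical cycle, and a vertical preimage removes it
  at the cost of changing the next row.\<close>

lemma bound_cycle:
  assumes x: "x \<in> total n" "tot_d x = 0"
    and b: "b \<in> D (Suc n) 0" "c \<in> D n (Suc 0)" "x n 0 = dh n 0 b + dv n 0 c"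
  shows "x \<in> tot_d ` total (Suc n)"
proof -
  have key: "\<exists>y\<in>total (Suc n). \<forall>p q. q < i \<longrightarrow> (x - tot_d y) p q = 0" if "1 \<le> i" "i \<le> Suc n" for i
    using that
  proof (induction i rule: dec_induct)
    case base
    define y where "y = single (Suc n) 0 b + single n (Suc 0) c"
    have y: "y \<in> total (Suc n)" unfolding y_def
      using single_total[OF b(1)] single_total[OF b(2)] by (auto intro: total_add)
    have "(x - tot_d y) p 0 = 0" for p
      using b total_zero[OF x(1), of p 0]
      by (cases "p = n") (auto simp: tot_d_def single_def y_def)
    then show ?case using y by (intro bexI[of _ y]) auto
  next
    case (step i)
    then obtain y where y: "y \<in> total (Suc n)" "\<And>p q. q < i \<Longrightarrow> (x - tot_d y) p q = 0" by auto
    define z where "z = x - tot_d y"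
    have z: "z \<in> total n" unfolding z_def by (intro total_diff x tot_d_in y)
    have dz: "tot_d z = 0"
      unfolding z_def using tot_d_diff[OF x(1) tot_d_in[OF y(1)]] tot_d_tot_d[OF y(1)] x(2) by simp
    obtain j where j: "i = Suc j" using step.hyps by (cases i) auto
    define p where "p = n - i"
    have p: "p + i = n" using step.prems by (simp add: p_def)
    have "tot_d z p j = 0" using dz by simp
    moreover have "z (Suc p) j = 0" using y(2)[of j "Suc p"] j by (simp add: z_def)
    ultimately have "dv p j (z p (Suc j)) = 0" by (simp add: tot_d_def)
    then obtain w where w: "w \<in> D p (Suc (Suc j))" "dv p (Suc j) w = z p (Suc j)"
      using exact[OF totalD[OF z]] by blast
    let ?s = "single p (Suc i) w"
    have s: "?s \<in> total (Suc n)" using single_total[of w p "Suc i"] w p j by simp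
    have "(x - tot_d (y + ?s)) p' q = 0" if "q < Suc i" for p' q
    proof -
      have "(x - tot_d (y + ?s)) p' q = z p' q - tot_d ?s p' q"
        using tot_d_add[OF y(1) s] by (simp add: z_def algebra_simps)
      also have "\<dots> = 0"
      proof (cases "q = i")
        case True
        then show ?thesis using w j total_zero[OF z, of p' i] p
          by (cases "p' = p") (auto simp: tot_d_def single_def)
      next
        case False
        then have "q < i" using that by simp
        then show ?thesis using y(2)[of q p'] by (simp add: z_def tot_d_def single_def)
      qed
      finally show ?thesis .
    qed
    then show ?case using total_add[OF y(1) s] by blast
  qed
  \<comment> \<open>Degree n has no entries beyond row n, so i = n + 1 clears all of x.\<close>
  obtain y where y: "y \<in> total (Suc n)" "\<And>p q. q < Suc n \<Longrightarrow> (x - tot_d y) p q = 0"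
    using key[of "Suc n"] by auto
  have "(x - tot_d y) p q = 0" for p q
    using y(2)[of q p] total_zero[OF total_diff[OF x(1) tot_d_in[OF y(1)]], of p q] by (cases "q < Suc n") auto
  then have "x = tot_d y" by (simp add: fun_eq_iff)
  then show ?thesis using y by blast
qed

text \<open>The comparison map keeps the bottom entry of a total chain and applies \<epsilon>;
  \<open>lift_cycle\<close> makes it onto in homology and \<open>bound_cycle\<close> makes it
  reflect boundaries.\<close>

theorem homology_tot: "homology tot_group (\<lambda>n. tot_d) n \<cong> homology A dA n"
proof (rule homology_iso[where \<phi> = "\<lambda>n x. \<epsilon> n (x n 0)", OF chain_complex_tot chain_complex_A])
  show "(\<lambda>x. \<epsilon> n (x n 0)) \<in> hom (tot_group n) (A n)" for n
    by (rule homI) (auto simp: tot_group_def intro!: \<epsilon>_in \<epsilon>_add totalD)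
  show "dA (Suc n) (\<epsilon> (Suc n) (z (Suc n) 0)) = \<epsilon> n (tot_d z n 0)"
    if z: "z \<in> carrier (tot_group (Suc n))" for n z
  proof -
    have z: "z p q \<in> D p q" for p q using that by (auto simp: tot_group_def totalD)
    have "\<epsilon> n (dv n 0 (z n (Suc 0))) = \<one>\<^bsub>A n\<^esub>"
      using \<epsilon>_kernel[of "dv n 0 (z n (Suc 0))" n] z dv_in by blast
    then show ?thesis
      using z \<epsilon>_in[of "dh n 0 (z (Suc n) 0)" n] A_comm[of n]
      by (simp add: \<epsilon>_dh tot_d_def \<epsilon>_add dh_in dv_in comm_group_def group.is_monoid)
  qed
next
  interpret An: comm_group "A n" by (rule A_comm)
  fix a assume a: "a \<in> cycles A dA n"
  then obtain f where f: "f \<in> D n 0" "a = \<epsilon> n f"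
    using subgroup.subset[OF subgroup_cycles[OF chain_complex_A, of n]] \<epsilon>_onto[of n] by blast
  have "dh m 0 f \<in> dv m 0 ` D m (Suc 0)" if "n = Suc m" for m
    using a f that \<epsilon>_kernel[of "dh m 0 f" m] by (auto simp: cycles_def kernel_def \<epsilon>_dh dh_in)
  then obtain x where x: "x \<in> total n" "tot_d x = 0" "x n 0 = f" using lift_cycle f by blast
  have "\<one>\<^bsub>A n\<^esub> \<in> boundaries A dA n"
    using subgroup.one_closed[OF subgroup_boundaries[OF chain_complex_A]] by simp
  then show "\<exists>x\<in>cycles tot_group (\<lambda>n. tot_d) n. \<exists>b\<in>boundaries A dA n. a = b \<otimes>\<^bsub>A n\<^esub> \<epsilon> n (x n 0)"
    using x f \<epsilon>_in[OF f(1)] by (intro bexI[of _ x] bexI[of _ "\<one>\<^bsub>A n\<^esub>"]) (auto simp: cycles_tot)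
next
  interpret An: comm_group "A n" by (rule A_comm)
  fix x assume x: "x \<in> cycles tot_group (\<lambda>n. tot_d) n" and b: "\<epsilon> n (x n 0) \<in> boundaries A dA n"
  then have xt: "x \<in> total n" "tot_d x = 0" by (auto simp: cycles_tot)
  obtain g where g: "g \<in> D (Suc n) 0" "\<epsilon> n (x n 0) = \<epsilon> n (dh n 0 g)"
    using b by (auto simp: boundaries_def \<epsilon>_dh simp flip: \<epsilon>_onto)
  have xn: "x n 0 \<in> D n 0" by (rule totalD[OF xt(1)])
  \<comment> \<open>The bottom entry is a horizontal boundary only after applying \<epsilon>; the
    discrepancy r lies in the kernel and is therefore a vertical boundary.\<close>
  define r where "r = x n 0 - dh n 0 g"
  have r: "r \<in> D n 0" unfolding r_def by (intro D_diff xn dh_in g)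
  have "\<epsilon> n (x n 0) = \<epsilon> n r \<otimes>\<^bsub>A n\<^esub> \<epsilon> n (dh n 0 g)"
    using \<epsilon>_add[OF r dh_in[OF g(1)]] by (simp add: r_def)
  then have "\<epsilon> n r = \<one>\<^bsub>A n\<^esub>"
    using g(2) An.right_cancel[OF \<epsilon>_in[OF dh_in[OF g(1)]] \<epsilon>_in[OF r] An.one_closed]
      An.l_one[OF \<epsilon>_in[OF dh_in[OF g(1)]]] by simp
  then obtain c where c: "c \<in> D n (Suc 0)" "r = dv n 0 c" using \<epsilon>_kernel[OF r] by auto
  have "x n 0 = dh n 0 g + dv n 0 c" using c by (simp add: r_def algebra_simps)
  then show "x \<in> boundaries tot_group (\<lambda>n. tot_d) n"
    using bound_cycle[OF xt g(1) c(1)] by (simp add: boundaries_tot)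
qed

end

section \<open>Deletion of entries and the bar construction\<close>

definition del :: "nat \<Rightarrow> 'a list \<Rightarrow> 'a list" where
  "del i xs = take i xs @ drop (Suc i) xs"

lemma del_simps [simp]: "del 0 (x # xs) = xs" "del (Suc i) (x # xs) = x # del i xs" "del i [] = []"
  by (simp_all add: del_def)

lemma del_del: "i < j \<Longrightarrow> j < length xs \<Longrightarrow> del i (del j xs) = del (j - 1) (del i xs)"
proof (induction xs arbitrary: i j)
  case (Cons x xs)
  then obtain j' where j: "j = Suc j'" by (cases j) auto
  show ?case
  proof (cases i)
    case (Suc i')
    then show ?thesis using Cons.IH[of i' j'] Cons.prems j by (cases j') auto
  qed (use j in auto)
qed simp

lemma del_last: "del (length xs) (xs @ [x]) = xs"
  by (simp add: del_def)

lemma carrier_Zk: "carrier (Zk k) = {c. Poly_Mapping.keys c \<subseteq> {1..k}}"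
  and mult_Zk: "x \<otimes>\<^bsub>Zk k\<^esub> y = x + y"
  and one_Zk: "\<one>\<^bsub>Zk k\<^esub> = 0"
  by (simp_all add: Zk_def free_Abelian_group_def)

lemma Zk_closed: "0 \<in> carrier (Zk k)"
  "a \<in> carrier (Zk k) \<Longrightarrow> - a \<in> carrier (Zk k)"
  "a \<in> carrier (Zk k) \<Longrightarrow> b \<in> carrier (Zk k) \<Longrightarrow> a + b \<in> carrier (Zk k)"
  "a \<in> carrier (Zk k) \<Longrightarrow> b \<in> carrier (Zk k) \<Longrightarrow> a - b \<in> carrier (Zk k)"
  using keys_add[of a b] keys_diff[of a b] by (auto simp: carrier_Zk)

text \<open>The vertices of the simplex \<open>[g\<^sub>1|\<dots>|g\<^sub>n] a\<close>: the faces delete one of them.\<close>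

fun tails :: "zvec list \<Rightarrow> zvec \<Rightarrow> zvec list" where
  "tails [] a = [a]"
| "tails (g # gs) a = (g + hd (tails gs a)) # tails gs a"

text \<open>The pair stands for the bar simplex [g_1|...|g_n] with the group element a as
  coefficient. The last face moves g_n into a, as the action on coefficients does in
  \<open>bar_boundary\<close>.\<close>

definition bar_point_face :: "nat \<Rightarrow> nat \<Rightarrow> nat \<Rightarrow> zvec list \<times> zvec \<Rightarrow> zvec list \<times> zvec" where
  "bar_point_face k n i = (\<lambda>(gs, a). (bar_face (Zk k) n i gs, if i = n then a + last gs else a))"

text \<open>The new entry makes the new leading vertex 0 and keeps all others: a cone towards the
  neutral element.\<close>

definition bar_cone :: "zvec list \<times> zvec \<Rightarrow> zvec list \<times> zvec" where
  "bar_cone = (\<lambda>(gs, a). (- hd (tails gs a) # gs, a))"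

lemma length_tails [simp]: "length (tails gs a) = Suc (length gs)"
  by (induction gs) auto

lemma tails_nonempty [simp]: "tails gs a \<noteq> []"
  using length_tails[of gs a] by force

text \<open>Since the vertices determine the simplex, every identity between faces and cones reduces
  to one between lists.\<close>

lemma tails_inj: "tails gs a = tails gs' a' \<Longrightarrow> gs = gs' \<and> a = a'"
proof (induction gs arbitrary: gs')
  case Nil
  then show ?case by (cases gs') (auto dest: arg_cong[of _ _ length])
next
  case (Cons g gs)
  then show ?case by (cases gs') (fastforce dest: arg_cong[of _ _ length])+
qed

lemma bar_face_Cons:
  assumes "length gs = n" "1 \<le> i" "i \<le> n"
  shows "bar_face G (Suc n) (Suc i) (g # gs) = g # bar_face G n i gs"
  using assms by (cases i) (auto simp: bar_face_def)

text \<open>The vertices are the sums g_(j+1) + ... + g_n + a, ending in a itself. Adding two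
  neighbouring entries removes the vertex between them, and absorbing g_n into a removes the old
  last vertex.\<close>

lemma tails_bar_face:
  assumes "length gs = n" "1 \<le> n" "i \<le> n" "bar_point_face k n i (gs, a) = (gs', a')"
  shows "tails gs' a' = del i (tails gs a)"
  using assms
proof (induction gs arbitrary: n i gs')
  case (Cons g gs)
  show ?case
  proof (cases i)
    case 0
    then show ?thesis using Cons.prems by (auto simp: bar_point_face_def bar_face_def split: if_splits)
  next
    case (Suc j)
    show ?thesis
    proof (cases gs)
      case Nil
      then show ?thesis using Cons.prems Suc
        by (auto simp: bar_point_face_def bar_face_def add.commute)
    next
      case gs: (Cons g2 gs2)
      show ?thesis
      proof (cases j)
        case 0
        then show ?thesis using Cons.prems Suc gs
          by (auto simp: bar_point_face_def bar_face_def add.assoc mult_Zk)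
      next
        case j: (Suc j')
        define m where "m = length gs"
        have m: "n = Suc m" "1 \<le> j" "j \<le> m" "1 \<le> m" using Cons.prems Suc j gs by (auto simp: m_def)
        have gs': "gs' = g # bar_face (Zk k) m j gs" and a': "a' = (if j = m then a + last gs else a)"
          using Cons.prems Suc m bar_face_Cons[of gs m j "Zk k" g] gs by (auto simp: bar_point_face_def m_def)
        have "tails (bar_face (Zk k) m j gs) a' = del j (tails gs a)"
          by (rule Cons.IH[of m j]) (use m a' in \<open>auto simp: m_def bar_point_face_def\<close>)
        then show ?thesis using gs' Suc j gs by simp
      qed
    qed
  qed
qed simp

lemma length_bar_face: "length gs = Suc n \<Longrightarrow> i \<le> Suc n \<Longrightarrow> length (bar_face G (Suc n) i gs) = n"
  by (auto simp: bar_face_def)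

lemma bar_face_tuples:
  assumes "gs \<in> bar_tuples (Zk k) (Suc n)" "i \<le> Suc n"
  shows "bar_face (Zk k) (Suc n) i gs \<in> bar_tuples (Zk k) n"
proof -
  have gs: "length gs = Suc n" "set gs \<subseteq> carrier (Zk k)" using assms by (auto simp: bar_tuples_def)
  have "set (bar_face (Zk k) (Suc n) i gs) \<subseteq> carrier (Zk k)"
  proof (cases "i = 0 \<or> i = Suc n")
    case True
    then show ?thesis using gs by (auto simp: bar_face_def dest: list.set_sel(2)[rotated] in_set_butlastD)
  next
    case False
    then have "gs ! (i - 1) \<in> carrier (Zk k)" "gs ! i \<in> carrier (Zk k)"
      using assms gs nth_mem[of "i - 1" gs] nth_mem[of i gs] by auto
    then show ?thesis
      using gs False set_take_subset[of "i - 1" gs] set_drop_subset[of "Suc i" gs]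
      by (auto simp: bar_face_def mult_Zk intro: Zk_closed)
  qed
  then show ?thesis using gs assms(2) by (simp add: bar_tuples_def length_bar_face)
qed

lemma bar_point_face_face:
  assumes "length (fst z) = Suc (Suc p)" "i < j" "j \<le> Suc (Suc p)"
  shows "bar_point_face k (Suc p) i (bar_point_face k (Suc (Suc p)) j z)
    = bar_point_face k (Suc p) (j - 1) (bar_point_face k (Suc (Suc p)) i z)"
proof -
  obtain gs a where z: "z = (gs, a)" by force
  obtain gj aj where j: "bar_point_face k (Suc (Suc p)) j z = (gj, aj)" by force
  obtain gi ai where i: "bar_point_face k (Suc (Suc p)) i z = (gi, ai)" by force
  obtain gij aij where ij: "bar_point_face k (Suc p) i (gj, aj) = (gij, aij)" by force
  obtain gji aji where ji: "bar_point_face k (Suc p) (j - 1) (gi, ai) = (gji, aji)" by force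
  have l: "length gj = Suc p" "length gi = Suc p"
    using i j assms z length_bar_face[of gs "Suc p" _ "Zk k"] by (auto simp: bar_point_face_def)
  have "tails gij aij = del i (del j (tails gs a))"
    using tails_bar_face[OF l(1) _ _ ij] tails_bar_face[OF _ _ _ j[unfolded z]] assms z by simp
  moreover have "tails gji aji = del (j - 1) (del i (tails gs a))"
    using tails_bar_face[OF l(2) _ _ ji] tails_bar_face[OF _ _ _ i[unfolded z]] assms z by simp
  moreover have "del i (del j (tails gs a)) = del (j - 1) (del i (tails gs a))"
    using assms z by (intro del_del) auto
  ultimately show ?thesis using i j ij ji tails_inj[of gij aij gji aji] by simp
qed

lemma tails_bar_cone: "bar_cone (gs, a) = (gs', a') \<Longrightarrow> tails gs' a' = 0 # tails gs a"
  by (auto simp: bar_cone_def)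

lemma bar_cone_face_0: "bar_point_face k (Suc n) 0 (bar_cone z) = z"
  by (auto simp: bar_cone_def bar_point_face_def bar_face_def split: prod.splits)

lemma bar_cone_face_Suc:
  assumes "length (fst z) = Suc p" "i \<le> Suc p"
  shows "bar_point_face k (Suc (Suc p)) (Suc i) (bar_cone z) = bar_cone (bar_point_face k (Suc p) i z)"
proof -
  obtain gs a where z: "z = (gs, a)" by force
  obtain gc ac where c: "bar_cone (gs, a) = (gc, ac)" by force
  obtain gj aj where j: "bar_point_face k (Suc (Suc p)) (Suc i) (gc, ac) = (gj, aj)" by force
  obtain gi ai where i: "bar_point_face k (Suc p) i (gs, a) = (gi, ai)" by force
  obtain ge ae where e: "bar_cone (gi, ai) = (ge, ae)" by force
  have "length gc = Suc (Suc p)" using c assms z by (auto simp: bar_cone_def)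
  then have "tails gj aj = del (Suc i) (tails gc ac)" using tails_bar_face[OF _ _ _ j] assms by simp
  also have "\<dots> = 0 # del i (tails gs a)" using tails_bar_cone[OF c] by simp
  also have "\<dots> = tails ge ae" using tails_bar_cone[OF e] tails_bar_face[OF _ _ _ i] assms z by simp
  finally show ?thesis using c j i e z tails_inj by simp
qed

section \<open>Homology of \<open>\<int>\<^sup>k\<close> from a resolution by induced modules\<close>

text \<open>The induced module of Q, that is, the group ring of Z^k tensored with Q, with Z^k acting
  by \<open>shift\<close>. Its coinvariants are Q again, by summation over the group, which is
  \<open>coinv\<close>.\<close>

definition induced :: "nat \<Rightarrow> 'q::ab_group_add set \<Rightarrow> (zvec \<Rightarrow> 'q) set" where
  "induced k Q = {f. finite {a. f a \<noteq> 0} \<and> (\<forall>a. f a \<in> Q) \<and> (\<forall>a. f a \<noteq> 0 \<longrightarrow> a \<in> carrier (Zk k))}"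

definition shift :: "zvec \<Rightarrow> (zvec \<Rightarrow> 'q) \<Rightarrow> zvec \<Rightarrow> 'q" where
  "shift b f = (\<lambda>a. f (a - b))"

definition coinv :: "(zvec \<Rightarrow> 'q::ab_group_add) \<Rightarrow> 'q" where
  "coinv f = (\<Sum>a | f a \<noteq> 0. f a)"

lemma sum_in_group:
  fixes Q :: "'q::ab_group_add set"
  assumes "0 \<in> Q" "\<And>x y. x \<in> Q \<Longrightarrow> y \<in> Q \<Longrightarrow> x - y \<in> Q"
  shows "(\<And>i. i \<in> I \<Longrightarrow> f i \<in> Q) \<Longrightarrow> sum f I \<in> Q"
proof (induction I rule: infinite_finite_induct)
  case (insert i I)
  have "f i - (0 - sum f I) \<in> Q" using insert assms by (metis insertCI)
  then show ?case using insert by simp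
qed (use assms in auto)

lemma alt_sign_in_group:
  assumes "0 \<in> Q" "\<And>x y. x \<in> Q \<Longrightarrow> y \<in> Q \<Longrightarrow> x - y \<in> Q" "x \<in> Q"
  shows "alt_sign i x \<in> Q"
  using assms(2)[OF assms(1,3)] assms by (auto simp: alt_sign_def)

lemma push_const: "finite {a. f a \<noteq> 0} \<Longrightarrow> coinv f = push (\<lambda>_. ()) f ()"
  by (simp add: coinv_def push_def)

lemma shift_0 [simp]: "shift 0 f = f"
  by (simp add: shift_def)

lemma shift_add: "shift b (f + g) = shift b f + shift b g"
  by (simp add: shift_def fun_eq_iff)

lemma shift_alt_sign: "shift b (alt_sign i f) = alt_sign i (shift b f)"
  by (simp add: shift_def alt_sign_def fun_eq_iff)

lemma induced_shift:
  assumes "f \<in> induced k Q" "b \<in> carrier (Zk k)" shows "shift b f \<in> induced k Q"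
proof -
  have eq: "{a. shift b f a \<noteq> 0} = (\<lambda>a. a + b) ` {a. f a \<noteq> 0}"
    by (force simp: shift_def image_iff intro: exI[of _ "_ - b"])
  have "a \<in> carrier (Zk k)" if "f (a - b) \<noteq> 0" for a
    using Zk_closed(3)[of "a - b" k b] that assms by (auto simp: induced_def)
  then show ?thesis using assms eq by (auto simp: induced_def shift_def)
qed

text \<open>Bridge between two views of a bar chain: a function of (gs, a), to which the simplicial
  lemmas apply, and a family of module elements, on which the resolution acts. Moving the last entry
  into a becomes a shift.\<close>

lemma push_bar_point_face:
  fixes F :: "zvec list \<Rightarrow> zvec \<Rightarrow> 'q::ab_group_add"
  assumes S: "finite S" "{gs. F gs \<noteq> 0} \<subseteq> S"
  shows "(\<lambda>a. push (bar_point_face k n i) (case_prod F) (hs, a)) =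
    (\<Sum>gs\<in>{gs\<in>S. bar_face (Zk k) n i gs = hs}. shift (if i = n then last gs else 0) (F gs))"
proof
  fix a
  define c :: "zvec list \<Rightarrow> zvec" where "c gs = (if i = n then last gs else 0)" for gs
  define B where "B = {gs\<in>S. bar_face (Zk k) n i gs = hs}"
  have "push (bar_point_face k n i) (case_prod F) (hs, a)
      = sum (case_prod F) ((\<lambda>gs. (gs, a - c gs)) ` B)"
  proof (rule push_eq_sum)
    show "{y. (case y of (x, xa) \<Rightarrow> F x xa) \<noteq> 0 \<and> bar_point_face k n i y = (hs, a)}
        \<subseteq> (\<lambda>gs. (gs, a - c gs)) ` B"
    proof clarify
      fix gs b assume *: "F gs b \<noteq> 0" "bar_point_face k n i (gs, b) = (hs, a)"
      then have "F gs \<noteq> 0" by (auto simp: fun_eq_iff)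
      then have "gs \<in> B" "b = a - c gs" using * S by (auto simp: B_def bar_point_face_def c_def)
      then show "(gs, b) \<in> (\<lambda>gs. (gs, a - c gs)) ` B" by blast
    qed
  qed (auto simp: B_def S bar_point_face_def c_def)
  also have "\<dots> = (\<Sum>gs\<in>B. F gs (a - c gs))"
    by (subst sum.reindex) (auto simp: inj_on_def)
  finally show "push (bar_point_face k n i) (case_prod F) (hs, a) =
    (\<Sum>gs\<in>{gs\<in>S. bar_face (Zk k) n i gs = hs}. shift (if i = n then last gs else 0) (F gs)) a"
    by (simp add: fun_sum_apply shift_def B_def c_def)
qed

lemma case_prod_add: "case_prod (F + G) = case_prod F + case_prod G"
  for F G :: "'x \<Rightarrow> 'y \<Rightarrow> 'z::plus"
  by (auto simp: fun_eq_iff)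

text \<open>An interface filled twice, by the nerve and by the Koszul complex. The induced modules
  of \<open>Q\<close> resolve \<open>M\<close>; \<open>dQ\<close> is the differential left on
  coinvariants, and \<xi> names the same complex inside \<open>A\<close>, which may be built from
  quotients.\<close>

locale induced_resolution =
  fixes k :: nat and Q :: "nat \<Rightarrow> 'q::ab_group_add set"
    and dP :: "nat \<Rightarrow> (zvec \<Rightarrow> 'q) \<Rightarrow> zvec \<Rightarrow> 'q" and dQ :: "nat \<Rightarrow> 'q \<Rightarrow> 'q"
    and M :: "'m monoid" and act :: "zvec \<Rightarrow> 'm \<Rightarrow> 'm" and \<pi> :: "(zvec \<Rightarrow> 'q) \<Rightarrow> 'm"
    and A :: "nat \<Rightarrow> 'c monoid" and dA :: "nat \<Rightarrow> 'c \<Rightarrow> 'c" and \<xi> :: "nat \<Rightarrow> 'q \<Rightarrow> 'c"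
  assumes Q_0: "0 \<in> Q n"
    and Q_diff: "x \<in> Q n \<Longrightarrow> y \<in> Q n \<Longrightarrow> x - y \<in> Q n"
    and dP_in: "f \<in> induced k (Q (Suc n)) \<Longrightarrow> dP n f \<in> induced k (Q n)"
    and dP_add: "f \<in> induced k (Q (Suc n)) \<Longrightarrow> g \<in> induced k (Q (Suc n)) \<Longrightarrow> dP n (f + g) = dP n f + dP n g"
    and dP_shift: "b \<in> carrier (Zk k) \<Longrightarrow> f \<in> induced k (Q (Suc n)) \<Longrightarrow> dP n (shift b f) = shift b (dP n f)"
    and dP_dP: "f \<in> induced k (Q (Suc (Suc n))) \<Longrightarrow> dP n (dP (Suc n) f) = 0"
    and dP_exact: "f \<in> induced k (Q (Suc n)) \<Longrightarrow> dP n f = 0 \<Longrightarrow> \<exists>g\<in>induced k (Q (Suc (Suc n))). dP (Suc n) g = f"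
    and dP_dQ: "f \<in> induced k (Q (Suc n)) \<Longrightarrow> coinv (dP n f) = dQ n (coinv f)"
    and M_comm: "comm_group M"
    and \<pi>_onto: "\<pi> ` induced k (Q 0) = carrier M"
    and \<pi>_add: "f \<in> induced k (Q 0) \<Longrightarrow> g \<in> induced k (Q 0) \<Longrightarrow> \<pi> (f + g) = \<pi> f \<otimes>\<^bsub>M\<^esub> \<pi> g"
    and \<pi>_kernel: "f \<in> induced k (Q 0) \<Longrightarrow> \<pi> f = \<one>\<^bsub>M\<^esub> \<longleftrightarrow> f \<in> dP 0 ` induced k (Q (Suc 0))"
    and act_\<pi>: "b \<in> carrier (Zk k) \<Longrightarrow> f \<in> induced k (Q 0) \<Longrightarrow> act b (\<pi> f) = \<pi> (shift b f)"
    and A_comm: "comm_group (A n)"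
    and \<xi>_bij: "bij_betw (\<xi> n) (Q n) (carrier (A n))"
    and \<xi>_add: "x \<in> Q n \<Longrightarrow> y \<in> Q n \<Longrightarrow> \<xi> n (x + y) = \<xi> n x \<otimes>\<^bsub>A n\<^esub> \<xi> n y"
    and dA_\<xi>: "x \<in> Q (Suc n) \<Longrightarrow> dA (Suc n) (\<xi> (Suc n) x) = \<xi> n (dQ n x)"
begin

abbreviation P :: "nat \<Rightarrow> (zvec \<Rightarrow> 'q) set" where "P n \<equiv> induced k (Q n)"

text \<open>Bar chains of degree p with coefficients in \<open>P q\<close>. The support is finite in
  (gs, a) jointly; \<open>D_iff\<close> gives the reading as finite families in
  \<open>P q\<close>.\<close>

definition D :: "nat \<Rightarrow> nat \<Rightarrow> (zvec list \<Rightarrow> zvec \<Rightarrow> 'q) set" where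
  "D p q = {F. finite {z. case_prod F z \<noteq> 0} \<and>
     (\<forall>z. case_prod F z \<in> Q q \<and> (case_prod F z \<noteq> 0 \<longrightarrow> z \<in> bar_tuples (Zk k) p \<times> carrier (Zk k)))}"

definition dh :: "nat \<Rightarrow> nat \<Rightarrow> (zvec list \<Rightarrow> zvec \<Rightarrow> 'q) \<Rightarrow> zvec list \<Rightarrow> zvec \<Rightarrow> 'q" where
  "dh p q F = curry (bd (bar_point_face k (Suc p)) (Suc p) (case_prod F))"

text \<open>The sign (-1)^p makes \<open>dv\<close> anticommute with \<open>dh\<close>, which lowers
  p by one.\<close>

definition dv :: "nat \<Rightarrow> nat \<Rightarrow> (zvec list \<Rightarrow> zvec \<Rightarrow> 'q) \<Rightarrow> zvec list \<Rightarrow> zvec \<Rightarrow> 'q" where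
  "dv p q F = (\<lambda>gs. alt_sign p (dP q (F gs)))"

lemma Q_sum: "(\<And>i. i \<in> I \<Longrightarrow> f i \<in> Q n) \<Longrightarrow> sum f I \<in> Q n"
  by (rule sum_in_group[OF Q_0 Q_diff])

lemma P_0: "0 \<in> P n" by (simp add: induced_def Q_0)

lemma P_diff: assumes "f \<in> P n" "g \<in> P n" shows "f - g \<in> P n"
proof -
  have "{a. (f - g) a \<noteq> 0} \<subseteq> {a. f a \<noteq> 0} \<union> {a. g a \<noteq> 0}" by auto
  moreover have "finite ({a. f a \<noteq> 0} \<union> {a. g a \<noteq> 0})" using assms by (simp add: induced_def)
  ultimately have "finite {a. (f - g) a \<noteq> 0}" by (rule finite_subset)
  moreover have "a \<in> carrier (Zk k)" if "f a \<noteq> g a" for a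
    using assms that by (cases "f a = 0") (auto simp: induced_def)
  ultimately show ?thesis using assms by (simp add: induced_def Q_diff)
qed

lemma P_sum: "(\<And>i. i \<in> I \<Longrightarrow> f i \<in> P n) \<Longrightarrow> sum f I \<in> P n"
  by (rule sum_in_group[OF P_0 P_diff])

lemma P_alt_sign: "f \<in> P n \<Longrightarrow> alt_sign i f \<in> P n"
  by (rule alt_sign_in_group[OF P_0 P_diff])

lemma P_shift: "f \<in> P n \<Longrightarrow> b \<in> carrier (Zk k) \<Longrightarrow> shift b f \<in> P n"
  by (rule induced_shift)

lemma dP_zero [simp]: "dP n 0 = 0" using dP_add[OF P_0 P_0, of n] by simp

lemma dP_sum: "(\<And>i. i \<in> I \<Longrightarrow> f i \<in> P (Suc n)) \<Longrightarrow> dP n (sum f I) = (\<Sum>i\<in>I. dP n (f i))"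
  by (induction I rule: infinite_finite_induct) (simp_all add: dP_add P_sum)

lemma dP_alt_sign: assumes "f \<in> P (Suc n)" shows "dP n (alt_sign i f) = alt_sign i (dP n f)"
proof -
  have "- f \<in> P (Suc n)" using P_diff[OF P_0 assms] by simp
  then have "dP n f + dP n (- f) = 0" using dP_add[OF assms, of "- f"] by simp
  then show ?thesis by (auto simp: alt_sign_def eq_neg_iff_add_eq_0 add.commute)
qed

lemma D_finite: "F \<in> D p q \<Longrightarrow> finite {gs. F gs \<noteq> 0}"
proof -
  assume "F \<in> D p q"
  then have "finite (fst ` {z. case_prod F z \<noteq> 0})" by (simp add: D_def)
  moreover have "gs \<in> fst ` {z. case_prod F z \<noteq> 0}" if nz: "F gs \<noteq> 0" for gs
  proof -
    obtain a where "F gs a \<noteq> 0" using nz by (auto simp: fun_eq_iff)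
    then show ?thesis by (intro image_eqI[of _ _ "(gs, a)"]) auto
  qed
  then have "{gs. F gs \<noteq> 0} \<subseteq> fst ` {z. case_prod F z \<noteq> 0}" by blast
  ultimately show ?thesis using finite_subset by blast
qed

lemma D_iff:
  "F \<in> D p q \<longleftrightarrow> finite {gs. F gs \<noteq> 0} \<and> (\<forall>gs. F gs \<in> P q) \<and> (\<forall>gs. F gs \<noteq> 0 \<longrightarrow> gs \<in> bar_tuples (Zk k) p)"
proof
  assume F: "F \<in> D p q"
  have "finite {a. F gs a \<noteq> 0}" for gs
  proof -
    have "finite (snd ` {z. case_prod F z \<noteq> 0})" using F by (simp add: D_def)
    moreover have "{a. F gs a \<noteq> 0} \<subseteq> snd ` {z. case_prod F z \<noteq> 0}"
      by (auto intro!: image_eqI[of _ _ "(gs, _)"])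
    ultimately show ?thesis by (rule rev_finite_subset)
  qed
  then have "\<forall>gs. F gs \<in> P q" using F by (auto simp: D_def induced_def)
  moreover have "gs \<in> bar_tuples (Zk k) p" if nz: "F gs \<noteq> 0" for gs
  proof -
    obtain a where "F gs a \<noteq> 0" using nz by (auto simp: fun_eq_iff)
    then show ?thesis using F by (force simp: D_def)
  qed
  ultimately show "finite {gs. F gs \<noteq> 0} \<and> (\<forall>gs. F gs \<in> P q) \<and> (\<forall>gs. F gs \<noteq> 0 \<longrightarrow> gs \<in> bar_tuples (Zk k) p)"
    using D_finite[OF F] by blast
next
  assume *: "finite {gs. F gs \<noteq> 0} \<and> (\<forall>gs. F gs \<in> P q) \<and> (\<forall>gs. F gs \<noteq> 0 \<longrightarrow> gs \<in> bar_tuples (Zk k) p)"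
  have "{z. case_prod F z \<noteq> 0} \<subseteq> (SIGMA gs:{gs. F gs \<noteq> 0}. {a. F gs a \<noteq> 0})" by (auto simp: fun_eq_iff)
  moreover have "finite (SIGMA gs:{gs. F gs \<noteq> 0}. {a. F gs a \<noteq> 0})"
    using * by (intro finite_SigmaI) (auto simp: induced_def)
  ultimately have "finite {z. case_prod F z \<noteq> 0}" by (rule finite_subset)
  moreover have "gs \<in> bar_tuples (Zk k) p \<and> a \<in> carrier (Zk k)" if "F gs a \<noteq> 0" for gs a
    using * that by (auto simp: induced_def fun_eq_iff)
  ultimately show "F \<in> D p q" using * by (auto simp: D_def induced_def)
qed

lemma D_P: "F \<in> D p q \<Longrightarrow> F gs \<in> P q" by (simp add: D_iff)

lemma D_fin_fibres: "F \<in> D p q \<Longrightarrow> fin_fibres \<phi> (case_prod F)"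
  by (rule fin_fibres_finite) (simp add: D_def)

lemma D_zero: "0 \<in> D p q" by (simp add: D_iff P_0)

lemma D_minus: assumes "F \<in> D p q" "G \<in> D p q" shows "F - G \<in> D p q"
proof -
  have "{gs. (F - G) gs \<noteq> 0} \<subseteq> {gs. F gs \<noteq> 0} \<union> {gs. G gs \<noteq> 0}" by auto
  moreover have "finite ({gs. F gs \<noteq> 0} \<union> {gs. G gs \<noteq> 0})" using assms by (simp add: D_iff)
  ultimately have "finite {gs. (F - G) gs \<noteq> 0}" by (rule finite_subset)
  moreover have "gs \<in> bar_tuples (Zk k) p" if "F gs - G gs \<noteq> 0" for gs
    using that assms by (cases "F gs = 0") (auto simp: D_iff)
  ultimately show ?thesis using assms P_diff by (auto simp: D_iff)
qed

lemma D_sum: "(\<And>i. i \<in> I \<Longrightarrow> F i \<in> D p q) \<Longrightarrow> sum F I \<in> D p q"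
  by (rule sum_in_group[OF D_zero D_minus])

lemma push_in_D:
  assumes F: "F \<in> D p q"
    and \<phi>: "\<And>z. z \<in> bar_tuples (Zk k) p \<times> carrier (Zk k) \<Longrightarrow> \<phi> z \<in> bar_tuples (Zk k) p' \<times> carrier (Zk k)"
  shows "curry (push \<phi> (case_prod F)) \<in> D p' q"
proof -
  have "{z. push \<phi> (case_prod F) z \<noteq> 0} \<subseteq> \<phi> ` {z. case_prod F z \<noteq> 0}"
    using push_nonzeroD[of \<phi> "case_prod F"] by blast
  moreover have "finite (\<phi> ` {z. case_prod F z \<noteq> 0})" using F by (simp add: D_def)
  ultimately have "finite {z. push \<phi> (case_prod F) z \<noteq> 0}" by (rule finite_subset)
  moreover have "push \<phi> (case_prod F) z \<in> Q q" for z
    unfolding push_def by (rule Q_sum) (use F in \<open>auto simp: D_def\<close>)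
  moreover have "z \<in> bar_tuples (Zk k) p' \<times> carrier (Zk k)" if nz: "push \<phi> (case_prod F) z \<noteq> 0" for z
  proof -
    obtain y where y: "case_prod F y \<noteq> 0" "\<phi> y = z" using push_nonzeroD[OF nz] by blast
    have "y \<in> bar_tuples (Zk k) p \<times> carrier (Zk k)" using F y(1) unfolding D_def by blast
    then show ?thesis using \<phi> y(2) by blast
  qed
  ultimately show ?thesis unfolding D_def mem_Collect_eq case_prod_curry by blast
qed

lemma bar_point_face_in:
  assumes "z \<in> bar_tuples (Zk k) (Suc p) \<times> carrier (Zk k)" "i \<le> Suc p"
  shows "bar_point_face k (Suc p) i z \<in> bar_tuples (Zk k) p \<times> carrier (Zk k)"
proof -
  obtain gs a where z: "z = (gs, a)" by force
  have "gs \<noteq> []" "set gs \<subseteq> carrier (Zk k)" using assms z by (auto simp: bar_tuples_def)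
  then have "last gs \<in> carrier (Zk k)" using last_in_set by blast
  then show ?thesis using assms z bar_face_tuples[of gs k p i] by (auto simp: bar_point_face_def Zk_closed)
qed

lemma dh_sum:
  assumes "F \<in> D (Suc p) q"
  shows "dh p q F = (\<Sum>i\<le>Suc p. alt_sign i (curry (push (bar_point_face k (Suc p) i) (case_prod F))))"
  by (simp add: dh_def fun_eq_iff fun_sum_apply bd_apply alt_sign_apply)

lemma dh_apply:
  assumes "finite S" "{gs. F gs \<noteq> 0} \<subseteq> S"
  shows "dh p q F hs = (\<Sum>i\<le>Suc p. alt_sign i (\<Sum>gs\<in>{gs\<in>S. bar_face (Zk k) (Suc p) i gs = hs}.
      shift (if i = Suc p then last gs else 0) (F gs)))"
  unfolding push_bar_point_face[OF assms, symmetric]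
  by (simp add: dh_def fun_eq_iff fun_sum_apply bd_apply alt_sign_apply)

lemma dh_in: assumes F: "F \<in> D (Suc p) q" shows "dh p q F \<in> D p q"
  unfolding dh_sum[OF F]
  by (intro D_sum alt_sign_in_group[OF D_zero D_minus] push_in_D[OF F] bar_point_face_in) auto

lemma last_in_Zk:
  assumes "gs \<in> bar_tuples (Zk k) (Suc p)" shows "last gs \<in> carrier (Zk k)"
proof -
  have "gs \<noteq> []" "set gs \<subseteq> carrier (Zk k)" using assms by (auto simp: bar_tuples_def)
  then show ?thesis using last_in_set by blast
qed

lemma shift_F_in:
  assumes "F \<in> D (Suc p) q"
  shows "shift (if i = Suc p then last gs else 0) (F gs) \<in> P q"
proof (cases "F gs = 0")
  case True
  then show ?thesis using P_0 by (simp add: shift_def zero_fun_def)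
next
  case False
  then show ?thesis
    using P_shift[of "F gs" q] D_P[OF assms] assms last_in_Zk[of gs p] by (auto simp: D_iff)
qed

text \<open>Apart from the sign this is equivariance: the faces act on coefficients by shifts, and
  \<open>dP\<close> commutes with shifts and with finite sums.\<close>

lemma dh_dv:
  assumes F: "F \<in> D (Suc p) (Suc q)"
  shows "dh p q (dv (Suc p) q F) + dv p q (dh p (Suc q) F) = 0"
proof
  fix hs
  define S where "S = {gs. F gs \<noteq> 0}"
  have S: "finite S" "{gs. F gs \<noteq> 0} \<subseteq> S" "{gs. dv (Suc p) q F gs \<noteq> 0} \<subseteq> S"
    using D_finite[OF F] by (auto simp: S_def dv_def alt_sign_def)
  let ?s = "\<lambda>i gs. shift (if i = Suc p then last gs else 0)"
  have eq: "dP q (?s i gs (F gs)) = ?s i gs (dP q (F gs))" for i gs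
  proof (cases "F gs = 0")
    case True
    then show ?thesis by (simp add: shift_def flip: zero_fun_def)
  next
    case False
    then show ?thesis using D_P[OF F, of gs] F last_in_Zk[of gs p]
      by (auto simp: dP_shift D_iff)
  qed
  have "dv p q (dh p (Suc q) F) hs = alt_sign p (dP q (\<Sum>i\<le>Suc p. alt_sign i
      (\<Sum>gs\<in>{gs\<in>S. bar_face (Zk k) (Suc p) i gs = hs}. ?s i gs (F gs))))"
    unfolding dv_def dh_apply[OF S(1,2)] ..
  also have "\<dots> = alt_sign p (\<Sum>i\<le>Suc p. alt_sign i
      (\<Sum>gs\<in>{gs\<in>S. bar_face (Zk k) (Suc p) i gs = hs}. ?s i gs (dP q (F gs))))"
    using shift_F_in[OF F]
    by (simp only: dP_sum dP_alt_sign P_alt_sign P_sum eq)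
  also have "\<dots> = - dh p q (dv (Suc p) q F) hs"
  proof -
    have "?s i gs (dv (Suc p) q F gs) = - alt_sign p (?s i gs (dP q (F gs)))" for i gs
      by (simp add: dv_def shift_def alt_sign_def fun_eq_iff)
    then show ?thesis
      unfolding dh_apply[OF S(1,3)]
      by (simp only: alt_sign_sum alt_sign_alt_sign sum_negf alt_sign_minus add.commute[of _ p] minus_minus)
  qed
  finally show "(dh p q (dv (Suc p) q F) + dv p q (dh p (Suc q) F)) hs = 0 hs" by simp
qed

lemma dv_in: assumes F: "F \<in> D p (Suc q)" shows "dv p q F \<in> D p q"
proof -
  have "{gs. dv p q F gs \<noteq> 0} \<subseteq> {gs. F gs \<noteq> 0}" by (auto simp: dv_def)
  then have "finite {gs. dv p q F gs \<noteq> 0}" using D_finite[OF F] finite_subset by blast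
  moreover have "dv p q F gs \<in> P q" for gs
    using P_alt_sign dP_in D_P[OF F] by (simp add: dv_def)
  moreover have "gs \<in> bar_tuples (Zk k) p" if "dv p q F gs \<noteq> 0" for gs
    using that F by (cases "F gs = 0") (auto simp: D_iff dv_def)
  ultimately show ?thesis by (simp add: D_iff)
qed

lemma dh_add: "F \<in> D (Suc p) q \<Longrightarrow> G \<in> D (Suc p) q \<Longrightarrow> dh p q (F + G) = dh p q F + dh p q G"
  by (simp add: dh_def case_prod_add bd_add D_fin_fibres) (simp add: fun_eq_iff)

lemma dh_dh: assumes F: "F \<in> D (Suc (Suc p)) q" shows "dh p q (dh (Suc p) q F) = 0"
proof -
  have "bd (bar_point_face k (Suc p)) (Suc p) (bd (bar_point_face k (Suc (Suc p))) (Suc (Suc p)) (case_prod F)) = 0"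
  proof (rule bd_bd)
    fix z i j assume z: "case_prod F z \<noteq> 0" and ij: "i < j" "j \<le> Suc (Suc p)"
    have "z \<in> bar_tuples (Zk k) (Suc (Suc p)) \<times> carrier (Zk k)" using z F unfolding D_def by blast
    then have "length (fst z) = Suc (Suc p)" by (auto simp: bar_tuples_def)
    then show "bar_point_face k (Suc p) i (bar_point_face k (Suc (Suc p)) j z)
        = bar_point_face k (Suc p) (j - 1) (bar_point_face k (Suc (Suc p)) i z)"
      using ij by (rule bar_point_face_face)
  qed (rule D_fin_fibres[OF F])
  then show ?thesis by (simp add: dh_def) (simp add: fun_eq_iff)
qed

sublocale double_complex D dh dv
proof
  show "dv p q (F + G) = dv p q F + dv p q G" if "F \<in> D p (Suc q)" "G \<in> D p (Suc q)" for F G p q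
    using that by (simp add: dv_def dP_add D_P alt_sign_add fun_eq_iff)
  show "dv p q (dv p (Suc q) F) = 0" if "F \<in> D p (Suc (Suc q))" for F p q
    using that by (simp add: dv_def fun_eq_iff dP_alt_sign dP_in D_P dP_dP)
qed (fact D_zero D_minus dh_in dv_in dh_add dh_dh dh_dv)+

section \<open>Exactness in both directions\<close>

lemma dv_exact:
  assumes F: "F \<in> D p (Suc q)" "dv p q F = 0"
  shows "\<exists>G\<in>D p (Suc (Suc q)). dv p (Suc q) G = F"
proof -
  have "\<exists>g\<in>P (Suc (Suc q)). dP (Suc q) g = alt_sign p (F gs)" for gs
  proof (rule dP_exact)
    show "alt_sign p (F gs) \<in> P (Suc q)" by (rule P_alt_sign[OF D_P[OF F(1)]])
    have "alt_sign p (dP q (F gs)) = 0" using F(2) by (simp add: dv_def fun_eq_iff)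
    then show "dP q (alt_sign p (F gs)) = 0" using D_P[OF F(1)] by (simp add: dP_alt_sign)
  qed
  then obtain g where g: "\<And>gs. g gs \<in> P (Suc (Suc q))" "\<And>gs. dP (Suc q) (g gs) = alt_sign p (F gs)"
    by metis
  \<comment> \<open>Preimages are replaced by 0 off the support of F, which keeps the family
    finite.\<close>
  define G where "G = (\<lambda>gs. if F gs = 0 then 0 else g gs)"
  have "{gs. G gs \<noteq> 0} \<subseteq> {gs. F gs \<noteq> 0}" by (auto simp: G_def)
  then have "finite {gs. G gs \<noteq> 0}" using D_finite[OF F(1)] finite_subset by blast
  then have "G \<in> D p (Suc (Suc q))" using g(1) P_0 F(1) by (auto simp: D_iff G_def)
  moreover have "dv p (Suc q) G = F"
    by (auto simp: dv_def G_def fun_eq_iff g(2) alt_sign_alt_sign) (simp add: alt_sign_def)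
  ultimately show ?thesis by blast
qed

lemma bar_cone_in:
  "z \<in> bar_tuples (Zk k) p \<times> carrier (Zk k) \<Longrightarrow> bar_cone z \<in> bar_tuples (Zk k) (Suc p) \<times> carrier (Zk k)"
proof -
  assume z: "z \<in> bar_tuples (Zk k) p \<times> carrier (Zk k)"
  obtain gs a where z': "z = (gs, a)" by force
  have "set gs \<subseteq> carrier (Zk k) \<Longrightarrow> hd (tails gs a) \<in> carrier (Zk k)"
    by (induction gs) (use z z' in \<open>auto simp: Zk_closed\<close>)
  then show ?thesis using z z' by (auto simp: bar_cone_def bar_tuples_def Zk_closed)
qed

text \<open>The bar direction is exact because the coefficients are induced: coning towards the
  neutral element contracts the bar simplices, whatever the resolution is.\<close>

lemma dh_exact:
  assumes F: "F \<in> D (Suc p) q" "dh p q F = 0"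
  shows "\<exists>G\<in>D (Suc (Suc p)) q. dh (Suc p) q G = F"
proof (intro bexI)
  let ?G = "curry (push bar_cone (case_prod F))"
  show "?G \<in> D (Suc (Suc p)) q" by (rule push_in_D[OF F(1) bar_cone_in])
  have len: "length (fst z) = Suc p" if "case_prod F z \<noteq> 0" for z
  proof -
    have "z \<in> bar_tuples (Zk k) (Suc p) \<times> carrier (Zk k)" using that F(1) unfolding D_def by blast
    then show ?thesis by (auto simp: bar_tuples_def)
  qed
  have b0: "bd (bar_point_face k (Suc p)) (Suc p) (case_prod F) = 0"
    using F(2) by (simp add: dh_def fun_eq_iff)
  have "bd (bar_point_face k (Suc (Suc p))) (Suc (Suc p)) (push bar_cone (case_prod F)) = case_prod F"
    by (subst bd_cone[where d = "bar_point_face k (Suc p)"])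
      (use len in \<open>simp_all add: bar_cone_face_0 bar_cone_face_Suc D_fin_fibres[OF F(1)] b0\<close>)
  then show "dh (Suc p) q ?G = F" by (simp add: dh_def)
qed

lemma coinv_D_0:
  assumes "F \<in> D 0 q" shows "coinv (F []) = push (\<lambda>_. ()) (case_prod F) ()"
proof -
  have *: "gs = []" if "F gs a \<noteq> 0" for gs a
    using assms that by (auto simp: D_iff bar_tuples_def fun_eq_iff)
  have "push (\<lambda>_. ()) (case_prod F) () = sum (case_prod F) (Pair [] ` {a. F [] a \<noteq> 0})"
    by (rule push_eq_sum) (use D_P[OF assms, of "[]"] * in \<open>auto simp: induced_def\<close>)
  also have "\<dots> = coinv (F [])" by (subst sum.reindex) (auto simp: inj_on_def coinv_def)
  finally show ?thesis by simp
qed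

lemma coinv_in: "f \<in> P n \<Longrightarrow> coinv f \<in> Q n"
  unfolding coinv_def by (rule Q_sum) (simp add: induced_def)

lemma coinv_add: "f \<in> P n \<Longrightarrow> g \<in> P n \<Longrightarrow> coinv (f + g) = coinv f + coinv g"
proof -
  assume fg: "f \<in> P n" "g \<in> P n"
  have "f + g \<in> P n" using P_diff[OF fg(1) P_diff[OF P_0 fg(2)]] by simp
  then show ?thesis using fg
    by (simp add: push_const induced_def fin_fibres_finite push_add)
qed

text \<open>In degree 0 the cone of ([], a) has the faces ([], a) and ([], 0), so F differs from a
  boundary by its total sum placed at 0. Conversely, the two faces of a 1-chain have the same total
  sum.\<close>

lemma coinv_kernel:
  assumes F: "F \<in> D 0 q"
  shows "coinv (F []) = 0 \<longleftrightarrow> F \<in> dh 0 q ` D (Suc 0) q"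
proof
  assume c0: "coinv (F []) = 0"
  let ?f = "case_prod F"
  let ?G = "curry (push bar_cone ?f)"
  have G: "?G \<in> D (Suc 0) q" by (rule push_in_D[OF F bar_cone_in])
  have *: "gs = []" if "F gs a \<noteq> 0" for gs a
    using F that by (auto simp: D_iff bar_tuples_def fun_eq_iff)
  have "push (bar_point_face k (Suc 0) 0) (push bar_cone ?f) = ?f"
    by (subst push_push) (auto intro: D_fin_fibres[OF F] push_ident simp: bar_cone_face_0)
  moreover have "push (bar_point_face k (Suc 0) 1) (push bar_cone ?f) = 0"
  proof -
    have "push (bar_point_face k (Suc 0) 1) (push bar_cone ?f) = push ((\<lambda>_. ([], 0)) \<circ> (\<lambda>_. ())) ?f"
      unfolding push_push[OF D_fin_fibres[OF F]]
      by (rule push_cong) (use * in \<open>force simp: bar_point_face_def bar_cone_def bar_face_def\<close>)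
    also have "\<dots> = push (\<lambda>_. ([], 0)) (push (\<lambda>_. ()) ?f)"
      by (rule push_push[symmetric]) (rule D_fin_fibres[OF F])
    also have "push (\<lambda>_. ()) ?f = 0" using c0 coinv_D_0[OF F] by (simp add: fun_eq_iff)
    finally show ?thesis by (simp only: push_0)
  qed
  ultimately have "dh 0 q ?G = F" by (simp add: dh_def bd_def)
  then show "F \<in> dh 0 q ` D (Suc 0) q" using G by force
next
  assume "F \<in> dh 0 q ` D (Suc 0) q"
  then obtain G where G: "G \<in> D (Suc 0) q" "F = dh 0 q G" by blast
  let ?g = "case_prod G"
  have eq: "case_prod F = push (bar_point_face k (Suc 0) 0) ?g + - push (bar_point_face k (Suc 0) 1) ?g"
    using G(2) by (simp add: dh_def bd_def)
  have "push (\<lambda>_. ()) (case_prod F) = push (\<lambda>_. ()) (push (bar_point_face k (Suc 0) 0) ?g)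
      + push (\<lambda>_. ()) (- push (bar_point_face k (Suc 0) 1) ?g)"
    unfolding eq by (rule push_add) (simp_all add: fin_fibres_push D_fin_fibres[OF G(1)])
  also have "\<dots> = 0"
    by (simp add: push_uminus push_push D_fin_fibres[OF G(1)] o_def)
  finally show "coinv (F []) = 0" using coinv_D_0[OF F] by simp
qed

lemma \<xi>_0: "\<xi> n 0 = \<one>\<^bsub>A n\<^esub>"
proof -
  interpret comm_group "A n" by (rule A_comm)
  have "\<xi> n 0 \<in> carrier (A n)" using \<xi>_bij Q_0 by (auto simp: bij_betw_def)
  then show ?thesis using \<xi>_add[OF Q_0 Q_0, of n] l_cancel_one[of "\<xi> n 0" "\<xi> n 0"] by simp
qed

lemma \<pi>_in: "f \<in> P 0 \<Longrightarrow> \<pi> f \<in> carrier M" using \<pi>_onto by blast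

lemma \<pi>_0: "\<pi> 0 = \<one>\<^bsub>M\<^esub>"
proof -
  have "0 \<in> dP 0 ` P (Suc 0)" by (rule image_eqI[OF _ P_0]) simp
  then show ?thesis using \<pi>_kernel[OF P_0] by simp
qed

lemma \<pi>_sum: "(\<And>i. i \<in> I \<Longrightarrow> f i \<in> P 0) \<Longrightarrow> finite I \<Longrightarrow> \<pi> (sum f I) = finprod M (\<lambda>i. \<pi> (f i)) I"
proof -
  interpret M: comm_group M by (rule M_comm)
  assume f: "\<And>i. i \<in> I \<Longrightarrow> f i \<in> P 0" and "finite I"
  from this(2,1) show "\<pi> (sum f I) = finprod M (\<lambda>i. \<pi> (f i)) I"
  proof (induction I rule: finite_induct)
    case (insert i I)
    have "\<pi> (f i + sum f I) = \<pi> (f i) \<otimes>\<^bsub>M\<^esub> \<pi> (sum f I)"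
      by (rule \<pi>_add) (auto intro: P_sum insert.prems)
    also have "\<pi> (sum f I) = finprod M (\<lambda>i. \<pi> (f i)) I" by (rule insert.IH) (use insert.prems in auto)
    also have "\<pi> (f i) \<otimes>\<^bsub>M\<^esub> finprod M (\<lambda>i. \<pi> (f i)) I = finprod M (\<lambda>i. \<pi> (f i)) (insert i I)"
      by (rule M.finprod_insert[symmetric]) (use insert.hyps insert.prems \<pi>_in in auto)
    also have "f i + sum f I = sum f (insert i I)" by (rule sum.insert[OF insert.hyps, symmetric])
    finally show ?case .
  qed (simp add: \<pi>_0)
qed

lemma \<pi>_alt_sign: assumes "f \<in> P 0" shows "\<pi> (alt_sign i f) = \<pi> f [^]\<^bsub>M\<^esub> ((-1 :: int) ^ i)"
proof -
  interpret M: comm_group M by (rule M_comm)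
  have m: "- f \<in> P 0" using P_diff[OF P_0 assms] by simp
  have "\<pi> f \<otimes>\<^bsub>M\<^esub> \<pi> (- f) = \<one>\<^bsub>M\<^esub>" using \<pi>_add[OF assms m] \<pi>_0 by simp
  then have "\<pi> (- f) = inv\<^bsub>M\<^esub> \<pi> f"
    using M.inv_equality[of "\<pi> (- f)" "\<pi> f"] \<pi>_in[OF m] \<pi>_in[OF assms] by (simp add: M.m_comm)
  moreover have "\<pi> f [^]\<^bsub>M\<^esub> (- 1 :: int) = inv\<^bsub>M\<^esub> \<pi> f"
    using M.int_pow_neg[OF \<pi>_in[OF assms], of 1] M.int_pow_1[OF \<pi>_in[OF assms]] by simp
  ultimately show ?thesis
    using M.int_pow_1[OF \<pi>_in[OF assms]] by (auto simp: alt_sign_def)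
qed

section \<open>Augmentation to the bar complex and to the coinvariants\<close>

definition to_bar :: "nat \<Rightarrow> (zvec list \<Rightarrow> zvec \<Rightarrow> 'q) \<Rightarrow> zvec list \<Rightarrow> 'm" where
  "to_bar n F = (\<lambda>gs\<in>bar_tuples (Zk k) n. \<pi> (F gs))"

text \<open>The products in \<open>bar_boundary\<close> may run over infinitely many tuples;
  restricting to the finite support of F turns them into finite ones, over which \<pi>
  distributes.\<close>

lemma bar_boundary_to_bar:
  assumes F: "F \<in> D (Suc n) 0"
  shows "bar_boundary (Zk k) M act (Suc n) (to_bar (Suc n) F) = to_bar n (dh n 0 F)"
proof
  interpret M: comm_group M by (rule M_comm)
  fix hs
  define S where "S = {gs. F gs \<noteq> 0}"
  have S: "finite S" "{gs. F gs \<noteq> 0} \<subseteq> S" "S \<subseteq> bar_tuples (Zk k) (Suc n)"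
    using D_finite[OF F] F by (auto simp: S_def D_iff)
  let ?s = "\<lambda>i gs. shift (if i = Suc n then last gs else 0) (F gs)"
  let ?B = "\<lambda>i. {gs\<in>S. bar_face (Zk k) (Suc n) i gs = hs}"
  have inner: "gfinprod M (\<lambda>gs. bar_coeff act (Suc n) i gs (to_bar (Suc n) F gs))
      {gs \<in> bar_tuples (Zk k) (Suc n). bar_face (Zk k) (Suc n) i gs = hs} = \<pi> (\<Sum>gs\<in>?B i. ?s i gs)" for i
  proof -
    have coeff: "bar_coeff act (Suc n) i gs (to_bar (Suc n) F gs) = \<pi> (?s i gs)"
      if "gs \<in> bar_tuples (Zk k) (Suc n)" for gs
      using that act_\<pi>[OF last_in_Zk[OF that] D_P[OF F]] by (simp add: bar_coeff_def to_bar_def)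
    have "gfinprod M (\<lambda>gs. bar_coeff act (Suc n) i gs (to_bar (Suc n) F gs))
        {gs \<in> bar_tuples (Zk k) (Suc n). bar_face (Zk k) (Suc n) i gs = hs}
      = gfinprod M (\<lambda>gs. \<pi> (?s i gs)) (?B i)"
    proof (rule M.gfinprod_mono_neutral_cong_right)
      show "?B i \<subseteq> {gs \<in> bar_tuples (Zk k) (Suc n). bar_face (Zk k) (Suc n) i gs = hs}" using S by auto
      fix gs assume gs: "gs \<in> {gs \<in> bar_tuples (Zk k) (Suc n). bar_face (Zk k) (Suc n) i gs = hs} - ?B i"
      then have "?s i gs = 0" by (auto simp: S_def shift_def fun_eq_iff)
      then show "bar_coeff act (Suc n) i gs (to_bar (Suc n) F gs) = \<one>\<^bsub>M\<^esub>" using gs coeff \<pi>_0 by simp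
    qed (use coeff S shift_F_in[OF F] \<pi>_in in auto)
    also have "\<dots> = finprod M (\<lambda>gs. \<pi> (?s i gs)) (?B i)"
      using S(1) shift_F_in[OF F] \<pi>_in by (intro M.gfinprod_eq_finprod) auto
    also have "\<dots> = \<pi> (\<Sum>gs\<in>?B i. ?s i gs)"
      using S(1) shift_F_in[OF F] by (intro \<pi>_sum[symmetric]) auto
    finally show ?thesis .
  qed
  show "bar_boundary (Zk k) M act (Suc n) (to_bar (Suc n) F) hs = to_bar n (dh n 0 F) hs"
  proof (cases "hs \<in> bar_tuples (Zk k) n")
    case True
    have in_P: "(\<Sum>gs\<in>?B i. ?s i gs) \<in> P 0" for i by (rule P_sum) (rule shift_F_in[OF F])
    have "bar_boundary (Zk k) M act (Suc n) (to_bar (Suc n) F) hs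
        = finprod M (\<lambda>i. \<pi> (\<Sum>gs\<in>?B i. ?s i gs) [^]\<^bsub>M\<^esub> ((-1 :: int) ^ i)) {..Suc n}"
      using True by (simp add: bar_boundary_def inner)
    also have "\<dots> = \<pi> (\<Sum>i\<le>Suc n. alt_sign i (\<Sum>gs\<in>?B i. ?s i gs))"
      by (subst \<pi>_sum) (auto simp: P_alt_sign in_P \<pi>_alt_sign simp del: sum.atMost_Suc)
    also have "\<dots> = to_bar n (dh n 0 F) hs"
      using True by (simp add: to_bar_def dh_apply[OF S(1,2)] del: sum.atMost_Suc)
    finally show ?thesis .
  qed (simp add: bar_boundary_def to_bar_def)
qed

lemma to_bar_onto: "to_bar n ` D n 0 = carrier (bar_chains (Zk k) M n)"
proof -
  interpret M: comm_group M by (rule M_comm)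
  have carr: "carrier (bar_chains (Zk k) M n)
    = {x \<in> \<Pi>\<^sub>E i\<in>bar_tuples (Zk k) n. carrier M. finite {i \<in> bar_tuples (Zk k) n. x i \<noteq> \<one>\<^bsub>M\<^esub>}}"
    unfolding bar_chains_def by (rule carrier_sum_group) (rule M.is_group)
  show ?thesis unfolding carr
  proof (intro equalityI subsetI)
    fix x assume "x \<in> to_bar n ` D n 0"
    then obtain F where F: "F \<in> D n 0" "x = to_bar n F" by blast
    have "{i \<in> bar_tuples (Zk k) n. x i \<noteq> \<one>\<^bsub>M\<^esub>} \<subseteq> {gs. F gs \<noteq> 0}"
      using F(2) \<pi>_0 by (auto simp: to_bar_def)
    then have "finite {i \<in> bar_tuples (Zk k) n. x i \<noteq> \<one>\<^bsub>M\<^esub>}" using D_finite[OF F(1)] finite_subset by blast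
    then show "x \<in> {x \<in> \<Pi>\<^sub>E i\<in>bar_tuples (Zk k) n. carrier M. finite {i \<in> bar_tuples (Zk k) n. x i \<noteq> \<one>\<^bsub>M\<^esub>}}"
      using F \<pi>_in D_P[OF F(1)] by (auto simp: to_bar_def)
  next
    fix x assume x: "x \<in> {x \<in> \<Pi>\<^sub>E i\<in>bar_tuples (Zk k) n. carrier M. finite {i \<in> bar_tuples (Zk k) n. x i \<noteq> \<one>\<^bsub>M\<^esub>}}"
    define S where "S = {i \<in> bar_tuples (Zk k) n. x i \<noteq> \<one>\<^bsub>M\<^esub>}"
    \<comment> \<open>Preimages under \<pi> are chosen on the finite support only, so that F is a
      finite family.\<close>
    define F where "F = (\<lambda>gs. if gs \<in> S then (SOME f. f \<in> P 0 \<and> \<pi> f = x gs) else 0)"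
    have F': "F gs \<in> P 0 \<and> \<pi> (F gs) = x gs" if "gs \<in> S" for gs
    proof -
      have "x gs \<in> \<pi> ` P 0" using x that \<pi>_onto by (auto simp: S_def)
      then have "\<exists>f. f \<in> P 0 \<and> \<pi> f = x gs" by auto
      from someI_ex[OF this] show ?thesis using that by (simp add: F_def)
    qed
    have "{gs. F gs \<noteq> 0} \<subseteq> S" by (auto simp: F_def)
    moreover have "finite S" using x by (simp add: S_def)
    ultimately have "F \<in> D n 0"
      using F' P_0 finite_subset by (auto simp: D_iff F_def S_def)
    moreover have "to_bar n F = x"
    proof
      fix gs
      show "to_bar n F gs = x gs"
        using F'[of gs] x \<pi>_0 by (cases "gs \<in> S") (auto simp: to_bar_def F_def S_def PiE_def extensional_def)
    qed
    ultimately show "x \<in> to_bar n ` D n 0" by blast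
  qed
qed

lemma to_bar_kernel:
  assumes F: "F \<in> D n 0"
  shows "to_bar n F = \<one>\<^bsub>bar_chains (Zk k) M n\<^esub> \<longleftrightarrow> F \<in> dv n 0 ` D n (Suc 0)"
proof
  assume "F \<in> dv n 0 ` D n (Suc 0)"
  then obtain G where G: "G \<in> D n (Suc 0)" "F = dv n 0 G" by blast
  have "\<pi> (F gs) = \<one>\<^bsub>M\<^esub>" for gs
  proof -
    have "F gs = dP 0 (alt_sign n (G gs))" using D_P[OF G(1)] by (simp add: G(2) dv_def dP_alt_sign)
    then show ?thesis using \<pi>_kernel[OF D_P[OF F]] P_alt_sign[OF D_P[OF G(1)]] by blast
  qed
  then show "to_bar n F = \<one>\<^bsub>bar_chains (Zk k) M n\<^esub>" by (simp add: to_bar_def bar_chains_def)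
next
  assume one: "to_bar n F = \<one>\<^bsub>bar_chains (Zk k) M n\<^esub>"
  have "\<exists>g\<in>P (Suc 0). dP 0 g = alt_sign n (F gs)" for gs
  proof (cases "F gs = 0")
    case True
    then show ?thesis using P_0 by (intro bexI[of _ 0]) auto
  next
    case False
    then have "gs \<in> bar_tuples (Zk k) n" using F by (auto simp: D_iff)
    then have "\<pi> (F gs) = \<one>\<^bsub>M\<^esub>" using fun_cong[OF one, of gs] by (simp add: to_bar_def bar_chains_def)
    then obtain g where g: "g \<in> P (Suc 0)" "F gs = dP 0 g" using \<pi>_kernel[OF D_P[OF F]] by blast
    then show ?thesis using P_alt_sign[OF g(1)] by (intro bexI[of _ "alt_sign n g"]) (auto simp: dP_alt_sign)
  qed
  then obtain g where g: "\<And>gs. g gs \<in> P (Suc 0)" "\<And>gs. dP 0 (g gs) = alt_sign n (F gs)" by metis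
  define G where "G = (\<lambda>gs. if F gs = 0 then 0 else g gs)"
  have "{gs. G gs \<noteq> 0} \<subseteq> {gs. F gs \<noteq> 0}" by (auto simp: G_def)
  then have "finite {gs. G gs \<noteq> 0}" using D_finite[OF F] finite_subset by blast
  then have "G \<in> D n (Suc 0)" using g(1) P_0 F by (auto simp: D_iff G_def)
  moreover have "dv n 0 G = F"
    by (auto simp: dv_def G_def fun_eq_iff g(2) alt_sign_alt_sign) (simp add: alt_sign_def)
  ultimately show "F \<in> dv n 0 ` D n (Suc 0)" by blast
qed

text \<open>The first edge: homology in the resolution direction leaves bar chains with coefficients
  in \<open>M\<close>.\<close>

sublocale bar: augmented_double_complex D dh dv "bar_chains (Zk k) M" "bar_boundary (Zk k) M act" to_bar
proof (intro augmented_double_complex.intro augmented_double_complex_axioms.intro double_complex_axioms)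
  interpret M: comm_group M by (rule M_comm)
  show "comm_group (bar_chains (Zk k) M n)" for n
    unfolding bar_chains_def
    by (rule group.group_comm_groupI)
      (auto simp: carrier_sum_group M.is_group fun_eq_iff M.m_comm PiE_iff)
  show "to_bar n (F + G) = to_bar n F \<otimes>\<^bsub>bar_chains (Zk k) M n\<^esub> to_bar n G"
    if "F \<in> D n 0" "G \<in> D n 0" for F G n
    using D_P[OF that(1)] D_P[OF that(2)] by (auto simp: to_bar_def bar_chains_def \<pi>_add)
qed (fact dv_exact to_bar_onto to_bar_kernel bar_boundary_to_bar)+

text \<open>The second edge: homology in the bar direction leaves the coinvariants \<open>Q\<close>,
  hence \<open>A\<close>. Bar chains of degree 0 live on the empty tuple.\<close>

lemma augmented_flip:
  "augmented_double_complex (\<lambda>p q. D q p) (\<lambda>p q. dv q p) (\<lambda>p q. dh q p) A dA (\<lambda>n F. \<xi> n (coinv (F [])))"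
proof (intro augmented_double_complex.intro augmented_double_complex_axioms.intro)
  show "double_complex (\<lambda>p q. D q p) (\<lambda>p q. dv q p) (\<lambda>p q. dh q p)" by (rule flip)
  show "\<exists>y\<in>D (Suc (Suc q)) p. dh (Suc q) p y = x" if "x \<in> D (Suc q) p" "dh q p x = 0" for x p q
    using dh_exact that by blast
  show "comm_group (A n)" for n by (rule A_comm)
  show "(\<lambda>F. \<xi> n (coinv (F []))) ` D 0 n = carrier (A n)" for n
  proof (intro equalityI subsetI)
    fix x assume "x \<in> (\<lambda>F. \<xi> n (coinv (F []))) ` D 0 n"
    then show "x \<in> carrier (A n)" using \<xi>_bij[of n] coinv_in D_P by (auto simp: bij_betw_def)
  next
    fix x assume "x \<in> carrier (A n)"
    then obtain q where q: "q \<in> Q n" "x = \<xi> n q" using \<xi>_bij[of n] by (auto simp: bij_betw_def)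
    \<comment> \<open>A section of \<open>coinv\<close>: the value q is placed at the neutral
      element.\<close>
    define f where "f = (\<lambda>a::zvec. if a = 0 then q else 0)"
    have supp: "{a. f a \<noteq> 0} = (if q = 0 then {} else {0})" by (auto simp: f_def)
    have f: "f \<in> P n" using q Q_0 supp Zk_closed(1) by (auto simp: induced_def f_def split: if_splits)
    have "coinv f = q" unfolding coinv_def supp by (auto simp: f_def)
    moreover have "(\<lambda>gs. if gs = [] then f else 0) \<in> D 0 n"
    proof -
      have "finite {gs. (if gs = ([] :: zvec list) then f else 0) \<noteq> 0}"
        by (rule finite_subset[of _ "{[]}"]) (auto split: if_splits)
      then show ?thesis using f P_0 by (auto simp: D_iff bar_tuples_def)
    qed
    ultimately show "x \<in> (\<lambda>F. \<xi> n (coinv (F []))) ` D 0 n"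
      using q by (intro image_eqI[of _ _ "\<lambda>gs. if gs = [] then f else 0"]) auto
  qed
  show "\<xi> n (coinv ((F + G) [])) = \<xi> n (coinv (F [])) \<otimes>\<^bsub>A n\<^esub> \<xi> n (coinv (G []))"
    if "F \<in> D 0 n" "G \<in> D 0 n" for F G n
    using D_P[OF that(1)] D_P[OF that(2)] by (simp add: coinv_add[of _ n] \<xi>_add coinv_in)
  show "\<xi> n (coinv (F [])) = \<one>\<^bsub>A n\<^esub> \<longleftrightarrow> F \<in> dh 0 n ` D (Suc 0) n" if F: "F \<in> D 0 n" for F n
  proof -
    have "\<xi> n (coinv (F [])) = \<xi> n 0 \<longleftrightarrow> coinv (F []) = 0"
      using \<xi>_bij[of n] coinv_in[OF D_P[OF F]] Q_0[of n]
      inj_on_eq_iff[of "\<xi> n" "Q n" "coinv (F [])" 0] unfolding bij_betw_def by blast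
    then show ?thesis using coinv_kernel[OF F] by (simp add: \<xi>_0)
  qed
  show "dA (Suc n) (\<xi> (Suc n) (coinv (F []))) = \<xi> n (coinv (dv 0 n F []))" if F: "F \<in> D 0 (Suc n)" for F n
    using D_P[OF F] by (simp add: dv_def dA_\<xi> coinv_in dP_dQ)
qed

theorem chain_complex_A: "chain_complex A dA"
  by (rule augmented_double_complex.chain_complex_A[OF augmented_flip])

theorem group_homology_iso: "group_homology (Zk k) M act n \<cong> homology A dA n"
proof -
  interpret F: augmented_double_complex "\<lambda>p q. D q p" "\<lambda>p q. dv q p" "\<lambda>p q. dh q p" A dA
    "\<lambda>n F. \<xi> n (coinv (F []))"
    by (rule augmented_flip)
  have g: "group (homology tot_group (\<lambda>n. tot_d) n)" "group (homology F.tot_group (\<lambda>n. F.tot_d) n)"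
    using comm_group_homology[OF chain_complex_tot] comm_group_homology[OF F.chain_complex_tot]
    by (auto simp: comm_group_def)
  have "homology (bar_chains (Zk k) M) (bar_boundary (Zk k) M act) n \<cong> homology tot_group (\<lambda>n. tot_d) n"
    by (rule group.iso_sym[OF g(1) bar.homology_tot])
  also have "\<dots> \<cong> homology F.tot_group (\<lambda>n. F.tot_d) n"
    by (rule group.iso_sym[OF g(2) homology_tot_flip[OF double_complex_axioms]])
  also have "\<dots> \<cong> homology A dA n" by (rule F.homology_tot)
  finally have "homology (bar_chains (Zk k) M) (bar_boundary (Zk k) M act) n \<cong> homology A dA n" .
  then show ?thesis by (simp add: group_homology_def)
qed

end

section \<open>Etale maps and compactly supported functions\<close>

text \<open>Local homeomorphisms, phrased by openness and local injectivity because these pass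
  easily through composition and cancellation.\<close>

definition etale :: "'y topology \<Rightarrow> 'z topology \<Rightarrow> ('y \<Rightarrow> 'z) \<Rightarrow> bool" where
  "etale Y Z \<phi> \<longleftrightarrow> continuous_map Y Z \<phi> \<and> open_map Y Z \<phi> \<and>
     (\<forall>y\<in>topspace Y. \<exists>U. openin Y U \<and> y \<in> U \<and> inj_on \<phi> U)"

lemma etale_continuous: "etale Y Z \<phi> \<Longrightarrow> continuous_map Y Z \<phi>"
  and etale_open: "etale Y Z \<phi> \<Longrightarrow> openin Y U \<Longrightarrow> openin Z (\<phi> ` U)"
  and etale_inj: "etale Y Z \<phi> \<Longrightarrow> y \<in> topspace Y \<Longrightarrow> \<exists>U. openin Y U \<and> y \<in> U \<and> inj_on \<phi> U"
  by (auto simp: etale_def open_map_def)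

lemma etale_in: "etale Y Z \<phi> \<Longrightarrow> y \<in> topspace Y \<Longrightarrow> \<phi> y \<in> topspace Z"
  using continuous_map_funspace[OF etale_continuous] by blast

lemma openin_vimage:
  "continuous_map Y Z \<phi> \<Longrightarrow> openin Z W \<Longrightarrow> openin Y {y \<in> topspace Y. \<phi> y \<in> W}"
  by (rule openin_continuous_map_preimage)

lemma continuous_map_localI:
  assumes "\<phi> \<in> topspace Y \<rightarrow> topspace Z"
    and "\<And>y W. y \<in> topspace Y \<Longrightarrow> openin Z W \<Longrightarrow> \<phi> y \<in> W \<Longrightarrow> \<exists>U. openin Y U \<and> y \<in> U \<and> \<phi> ` U \<subseteq> W"
  shows "continuous_map Y Z \<phi>"
  unfolding continuous_map
proof (intro conjI allI impI)
  show "\<phi> ` topspace Y \<subseteq> topspace Z" using assms(1) by blast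
  fix W assume W: "openin Z W"
  show "openin Y {y \<in> topspace Y. \<phi> y \<in> W}"
  proof (subst openin_subopen, intro ballI)
    fix y assume "y \<in> {y \<in> topspace Y. \<phi> y \<in> W}"
    then obtain U where U: "openin Y U" "y \<in> U" "\<phi> ` U \<subseteq> W" using assms(2) W by blast
    then show "\<exists>T. openin Y T \<and> y \<in> T \<and> T \<subseteq> {y \<in> topspace Y. \<phi> y \<in> W}"
      using openin_subset by (intro exI[of _ U]) blast
  qed
qed

lemma local_homeomorphism_imp_etale:
  assumes "local_homeomorphism Y Z \<phi>" shows "etale Y Z \<phi>"
proof -
  have loc: "\<exists>U. openin Y U \<and> y \<in> U \<and> openin Z (\<phi> ` U) \<and>
      homeomorphic_map (subtopology Y U) (subtopology Z (\<phi> ` U)) \<phi>" if "y \<in> topspace Y" for y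
    using assms that by (auto simp: local_homeomorphism_def)
  have "continuous_map Y Z \<phi>"
  proof (rule continuous_map_localI)
    show "\<phi> \<in> topspace Y \<rightarrow> topspace Z"
    proof
      fix y assume "y \<in> topspace Y"
      then obtain U where "y \<in> U" "openin Z (\<phi> ` U)" using loc by blast
      then show "\<phi> y \<in> topspace Z" using openin_subset by blast
    qed
    fix y W assume y: "y \<in> topspace Y" "openin Z W" "\<phi> y \<in> W"
    obtain U where U: "openin Y U" "y \<in> U" "openin Z (\<phi> ` U)"
      "homeomorphic_map (subtopology Y U) (subtopology Z (\<phi> ` U)) \<phi>" using loc[OF y(1)] by blast
    have "continuous_map (subtopology Y U) Z \<phi>"
      using homeomorphic_imp_continuous_map[OF U(4)] by (simp add: continuous_map_in_subtopology)
    from openin_vimage[OF this y(2)] have "openin (subtopology Y U) {u \<in> topspace (subtopology Y U). \<phi> u \<in> W}" .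
    then have "openin Y {u \<in> topspace (subtopology Y U). \<phi> u \<in> W}"
      using U(1) by (metis openin_open_subtopology)
    then show "\<exists>U. openin Y U \<and> y \<in> U \<and> \<phi> ` U \<subseteq> W"
      using y U by (intro exI[of _ "{u \<in> topspace (subtopology Y U). \<phi> u \<in> W}"]) auto
  qed
  moreover have "open_map Y Z \<phi>"
    unfolding open_map_def
  proof (intro allI impI)
    fix S assume S: "openin Y S"
    show "openin Z (\<phi> ` S)"
    proof (subst openin_subopen, intro ballI)
      fix z assume "z \<in> \<phi> ` S"
      then obtain y where y: "y \<in> S" "z = \<phi> y" by blast
      then have "y \<in> topspace Y" using openin_subset[OF S] by blast
      then obtain U where U: "openin Y U" "y \<in> U" "openin Z (\<phi> ` U)"
        "homeomorphic_map (subtopology Y U) (subtopology Z (\<phi> ` U)) \<phi>" using loc by blast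
      have "openin (subtopology Y U) (S \<inter> U)" using S by (auto simp: openin_subtopology)
      then have "openin (subtopology Z (\<phi> ` U)) (\<phi> ` (S \<inter> U))"
        using homeomorphic_imp_open_map[OF U(4)] by (simp add: open_map_def)
      then have "openin Z (\<phi> ` (S \<inter> U))" using U(3) by (metis openin_open_subtopology)
      then show "\<exists>T. openin Z T \<and> z \<in> T \<and> T \<subseteq> \<phi> ` S"
        using y U(2) by (intro exI[of _ "\<phi> ` (S \<inter> U)"]) blast
    qed
  qed
  moreover have "\<exists>U. openin Y U \<and> y \<in> U \<and> inj_on \<phi> U" if y: "y \<in> topspace Y" for y
  proof -
    obtain U where U: "openin Y U" "y \<in> U"
      "homeomorphic_map (subtopology Y U) (subtopology Z (\<phi> ` U)) \<phi>" using loc[OF y] by blast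
    have "topspace (subtopology Y U) = U" using openin_subset[OF U(1)] by auto
    then have "inj_on \<phi> U" using homeomorphic_imp_injective_map[OF U(3)] by simp
    then show ?thesis using U by blast
  qed
  ultimately show ?thesis by (simp add: etale_def)
qed

lemma etale_comp:
  assumes "etale Y Z \<phi>" "etale Z X \<psi>" shows "etale Y X (\<psi> \<circ> \<phi>)"
proof -
  have "\<exists>U. openin Y U \<and> y \<in> U \<and> inj_on (\<psi> \<circ> \<phi>) U" if y: "y \<in> topspace Y" for y
  proof -
    obtain U where U: "openin Y U" "y \<in> U" "inj_on \<phi> U" using etale_inj[OF assms(1) y] by blast
    obtain V where V: "openin Z V" "\<phi> y \<in> V" "inj_on \<psi> V"
      using etale_inj[OF assms(2) etale_in[OF assms(1) y]] by blast
    have "openin Y (U \<inter> {y \<in> topspace Y. \<phi> y \<in> V})"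
      using U openin_vimage[OF etale_continuous[OF assms(1)] V(1)] by blast
    moreover have "inj_on (\<psi> \<circ> \<phi>) (U \<inter> {y \<in> topspace Y. \<phi> y \<in> V})"
      using U(3) V(3) by (auto simp: inj_on_def)
    ultimately show ?thesis using y U V by blast
  qed
  then show ?thesis
    using assms continuous_map_compose[of Y Z \<phi> X \<psi>] open_map_compose[of Y Z \<phi> X \<psi>]
    by (auto simp: etale_def)
qed

lemma etale_cong:
  assumes "etale Y Z \<phi>" "\<And>y. y \<in> topspace Y \<Longrightarrow> \<phi> y = \<psi> y" shows "etale Y Z \<psi>"
proof -
  have sub: "\<phi> ` U = \<psi> ` U" if "openin Y U" for U
    by (rule image_cong) (use openin_subset[OF that] assms(2) in auto)
  have "\<exists>U. openin Y U \<and> y \<in> U \<and> inj_on \<psi> U" if y: "y \<in> topspace Y" for y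
  proof -
    obtain U where U: "openin Y U" "y \<in> U" "inj_on \<phi> U" using etale_inj[OF assms(1) y] by blast
    then have "inj_on \<psi> U" using openin_subset[OF U(1)] assms(2) inj_on_cong[of U \<phi> \<psi>] by blast
    then show ?thesis using U by blast
  qed
  then show ?thesis
    using assms sub continuous_map_eq[of Y Z \<phi> \<psi>] by (auto simp: etale_def open_map_def)
qed

text \<open>Near a point, the image of a small open set S' under \<phi> is cut out of V by the open
  set \<psi>(\<phi>(S')), as \<psi> is injective on V. Maps into a nerve are shown etale in this
  way: composed with a vertex map they become a vertex map, and only continuity is left.\<close>

lemma etale_cancel:
  assumes "etale Y X (\<psi> \<circ> \<phi>)" "etale Z X \<psi>" "continuous_map Y Z \<phi>"
  shows "etale Y Z \<phi>"
  unfolding etale_def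
proof (intro conjI ballI)
  show "\<exists>U. openin Y U \<and> y \<in> U \<and> inj_on \<phi> U" if y: "y \<in> topspace Y" for y
    using etale_inj[OF assms(1) y] inj_on_imageI2 by blast
  show "open_map Y Z \<phi>"
    unfolding open_map_def
  proof (intro allI impI)
    fix S assume S: "openin Y S"
    show "openin Z (\<phi> ` S)"
    proof (subst openin_subopen, intro ballI)
      fix z assume "z \<in> \<phi> ` S"
      then obtain y where y: "y \<in> S" "z = \<phi> y" by blast
      have "\<phi> y \<in> topspace Z"
        using y openin_subset[OF S] continuous_map_funspace[OF assms(3)] by blast
      then obtain V where V: "openin Z V" "\<phi> y \<in> V" "inj_on \<psi> V" using etale_inj[OF assms(2)] by blast
      define S' where "S' = S \<inter> {y \<in> topspace Y. \<phi> y \<in> V}"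
      have S': "openin Y S'" unfolding S'_def using S openin_vimage[OF assms(3) V(1)] by blast
      have "openin X ((\<psi> \<circ> \<phi>) ` S')" by (rule etale_open[OF assms(1) S'])
      then have "openin Z (V \<inter> {z \<in> topspace Z. \<psi> z \<in> (\<psi> \<circ> \<phi>) ` S'})"
        using openin_vimage[OF etale_continuous[OF assms(2)]] V(1) by blast
      moreover have "V \<inter> {z \<in> topspace Z. \<psi> z \<in> (\<psi> \<circ> \<phi>) ` S'} = \<phi> ` S'"
        using V(3) openin_subset[OF V(1)] by (fastforce simp: S'_def inj_on_def)
      ultimately have "openin Z (\<phi> ` S')" by simp
      moreover have "y \<in> S'" using y V openin_subset[OF S] by (auto simp: S'_def)
      ultimately show "\<exists>T. openin Z T \<and> z \<in> T \<and> T \<subseteq> \<phi> ` S"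
        using y by (intro exI[of _ "\<phi> ` S'"]) (auto simp: S'_def)
    qed
  qed
qed (fact assms(3))

section \<open>Compactly supported functions and their pushforwards\<close>

lemma locally_constant_iff:
  "continuous_map Y (discrete_topology UNIV) f \<longleftrightarrow>
    (\<forall>y\<in>topspace Y. \<exists>U. openin Y U \<and> y \<in> U \<and> (\<forall>u\<in>U. f y = f u))"
proof
  assume c: "continuous_map Y (discrete_topology UNIV) f"
  show "\<forall>y\<in>topspace Y. \<exists>U. openin Y U \<and> y \<in> U \<and> (\<forall>u\<in>U. f y = f u)"
  proof
    fix y assume "y \<in> topspace Y"
    then show "\<exists>U. openin Y U \<and> y \<in> U \<and> (\<forall>u\<in>U. f y = f u)"
      using openin_vimage[OF c, of "{f y}"] by (intro exI[of _ "{u \<in> topspace Y. f u \<in> {f y}}"]) auto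
  qed
next
  assume *: "\<forall>y\<in>topspace Y. \<exists>U. openin Y U \<and> y \<in> U \<and> (\<forall>u\<in>U. f y = f u)"
  show "continuous_map Y (discrete_topology UNIV) f"
  proof (rule continuous_map_localI)
    fix y W assume y: "y \<in> topspace Y" "f y \<in> W"
    then obtain U where U: "openin Y U" "y \<in> U" "\<forall>u\<in>U. f y = f u" using * by blast
    have "f ` U \<subseteq> W" by (rule image_subsetI) (use U(3) y(2) in metis)
    then show "\<exists>U. openin Y U \<and> y \<in> U \<and> f ` U \<subseteq> W" using U by blast
  qed simp
qed

text \<open>A continuous integer-valued function has clopen support, so no closure need be taken,
  and a compact support already lies in the space.\<close>

lemma Cc_iff:
  "f \<in> carrier (Cc Y) \<longleftrightarrow> continuous_map Y (discrete_topology UNIV) f \<and> compactin Y {y. f y \<noteq> 0}"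
proof -
  have eq: "{y \<in> topspace Y. f y \<noteq> 0} = {y. f y \<noteq> 0}" if "\<forall>y. y \<notin> topspace Y \<longrightarrow> f y = 0"
    using that by auto
  have clo: "Y closure_of {y \<in> topspace Y. f y \<noteq> 0} = {y \<in> topspace Y. f y \<noteq> 0}"
    if "continuous_map Y (discrete_topology UNIV) f"
    using closedin_continuous_map_preimage[OF that, of "- {0}"] by (simp add: closure_of_eq)
  have "\<forall>y. y \<notin> topspace Y \<longrightarrow> f y = 0" if "compactin Y {y. f y \<noteq> 0}"
    using compactin_subset_topspace[OF that] by auto
  then show ?thesis using eq clo by (auto simp: Cc_def)
qed

lemma Cc_mult: "f \<otimes>\<^bsub>Cc Y\<^esub> g = f + g" and Cc_one: "\<one>\<^bsub>Cc Y\<^esub> = 0"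
  by (auto simp: Cc_def fun_eq_iff)

lemma Cc_zero_outside: "f \<in> carrier (Cc Y) \<Longrightarrow> y \<notin> topspace Y \<Longrightarrow> f y = 0"
  by (simp add: Cc_def)

lemma Cc_local:
  assumes "f \<in> carrier (Cc Y)" "y \<in> topspace Y"
  shows "\<exists>U. openin Y U \<and> y \<in> U \<and> (\<forall>u\<in>U. f y = f u)"
  using assms locally_constant_iff[of Y f] by (auto simp: Cc_iff)

text \<open>The support of \<open>f\<close> is clopen, hence compact once it lies in a compact set.\<close>

lemma CcI:
  assumes loc: "\<And>y. y \<in> topspace Y \<Longrightarrow> \<exists>U. openin Y U \<and> y \<in> U \<and> (\<forall>u\<in>U. f y = f u)"
    and K: "compactin Y K" "\<And>y. f y \<noteq> 0 \<Longrightarrow> y \<in> K"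
  shows "f \<in> carrier (Cc Y)"
proof -
  have c: "continuous_map Y (discrete_topology UNIV) f" using loc locally_constant_iff[of Y f] by blast
  have "{y. f y \<noteq> 0} = {y \<in> topspace Y. f y \<in> - {0}}"
    using K compactin_subset_topspace by fastforce
  then have "closedin Y {y. f y \<noteq> 0}" using closedin_continuous_map_preimage[OF c, of "- {0}"] by simp
  then have "compactin Y {y. f y \<noteq> 0}" using K by (auto intro: closed_compactin)
  then show ?thesis using c by (simp add: Cc_iff)
qed

lemma Cc_zero: "0 \<in> carrier (Cc Y)"
  by (rule CcI[where K = "{}"]) auto

lemma Cc_diff:
  assumes "f \<in> carrier (Cc Y)" "g \<in> carrier (Cc Y)" shows "f - g \<in> carrier (Cc Y)"
proof (rule CcI)
  show "compactin Y ({y. f y \<noteq> 0} \<union> {y. g y \<noteq> 0})" using assms by (auto simp: Cc_iff intro: compactin_Un)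
  fix y assume y: "y \<in> topspace Y"
  obtain U where U: "openin Y U" "y \<in> U" "\<forall>u\<in>U. f y = f u" using Cc_local[OF assms(1) y] by blast
  obtain V where V: "openin Y V" "y \<in> V" "\<forall>u\<in>V. g y = g u" using Cc_local[OF assms(2) y] by blast
  have "\<forall>u\<in>U \<inter> V. (f - g) y = (f - g) u"
  proof
    fix u assume "u \<in> U \<inter> V"
    then have "f y = f u" "g y = g u" using U V by blast+
    then show "(f - g) y = (f - g) u" by simp
  qed
  then show "\<exists>U. openin Y U \<and> y \<in> U \<and> (\<forall>u\<in>U. (f - g) y = (f - g) u)"
    using U V by (intro exI[of _ "U \<inter> V"]) (blast intro: openin_Int)
qed auto

lemma Cc_add:
  "f \<in> carrier (Cc Y) \<Longrightarrow> g \<in> carrier (Cc Y) \<Longrightarrow> f + g \<in> carrier (Cc Y)"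
  using Cc_diff[OF _ Cc_diff[OF Cc_zero]] by fastforce

lemma Cc_sum: "(\<And>i. i \<in> I \<Longrightarrow> f i \<in> carrier (Cc Y)) \<Longrightarrow> sum f I \<in> carrier (Cc Y)"
  by (rule sum_in_group[OF Cc_zero Cc_diff])

lemma comm_group_Cc: "comm_group (Cc Y)"
proof (rule comm_groupI)
  fix f assume "f \<in> carrier (Cc Y)"
  then show "\<exists>g\<in>carrier (Cc Y). g \<otimes>\<^bsub>Cc Y\<^esub> f = \<one>\<^bsub>Cc Y\<^esub>"
    using Cc_diff[OF Cc_zero, of f] by (intro bexI[of _ "- f"]) (auto simp: Cc_mult Cc_one)
qed (simp_all add: Cc_mult Cc_one Cc_zero Cc_add add.assoc add.commute)

text \<open>The support is covered by finitely many open sets on which \<phi> is injective, and each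
  of them meets a fibre at most once.\<close>

lemma etale_fin_fibres:
  assumes f: "f \<in> carrier (Cc Y)" and \<phi>: "etale Y Z \<phi>"
  shows "fin_fibres \<phi> f"
  unfolding fin_fibres_def
proof
  fix z
  have K: "compactin Y {y. f y \<noteq> 0}" using f by (simp add: Cc_iff)
  define \<U> where "\<U> = {U. openin Y U \<and> inj_on \<phi> U}"
  have "{y. f y \<noteq> 0} \<subseteq> \<Union> \<U>"
    using etale_inj[OF \<phi>] compactin_subset_topspace[OF K] by (fastforce simp: \<U>_def)
  moreover have "\<forall>U\<in>\<U>. openin Y U" by (simp add: \<U>_def)
  ultimately obtain \<F> where F: "finite \<F>" "\<F> \<subseteq> \<U>" "{y. f y \<noteq> 0} \<subseteq> \<Union> \<F>"
    using K unfolding compactin_def by meson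
  have "finite {y \<in> U. \<phi> y = z}" if "U \<in> \<F>" for U
  proof -
    have "inj_on \<phi> U" using that F(2) by (auto simp: \<U>_def)
    then have "inj_on \<phi> {y \<in> U. \<phi> y = z}" by (rule inj_on_subset) auto
    moreover have "finite (\<phi> ` {y \<in> U. \<phi> y = z})" by (rule finite_subset[of _ "{z}"]) auto
    ultimately show ?thesis using finite_imageD by blast
  qed
  then have "finite (\<Union>U\<in>\<F>. {y \<in> U. \<phi> y = z})" using F(1) by blast
  then show "finite {y. f y \<noteq> 0 \<and> \<phi> y = z}" by (rule rev_finite_subset) (use F(3) in blast)
qed

text \<open>Separating sets are chosen for ordered pairs of points; intersecting
  \<open>A y y'\<close> with \<open>B y' y\<close> makes the asymmetric choice harmless.\<close>

lemma Hausdorff_finite_separation: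
  assumes "Hausdorff_space Y" "finite F" "F \<subseteq> topspace Y"
  obtains N where "\<And>y. y \<in> F \<Longrightarrow> openin Y (N y) \<and> y \<in> N y"
    "\<And>y y'. y \<in> F \<Longrightarrow> y' \<in> F \<Longrightarrow> y \<noteq> y' \<Longrightarrow> N y \<inter> N y' = {}"
proof -
  have "\<forall>y y'. \<exists>A B. y \<in> F \<longrightarrow> y' \<in> F \<longrightarrow> y \<noteq> y' \<longrightarrow>
      openin Y A \<and> openin Y B \<and> y \<in> A \<and> y' \<in> B \<and> A \<inter> B = {}"
    using assms(1,3) unfolding Hausdorff_space_def disjnt_def by (meson subsetD)
  then obtain A B where AB: "\<And>y y'. y \<in> F \<Longrightarrow> y' \<in> F \<Longrightarrow> y \<noteq> y' \<Longrightarrow>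
      openin Y (A y y') \<and> openin Y (B y y') \<and> y \<in> A y y' \<and> y' \<in> B y y' \<and> A y y' \<inter> B y y' = {}"
    by metis
  define N where "N y = topspace Y \<inter> (\<Inter>y'\<in>F - {y}. A y y' \<inter> B y' y)" for y
  show thesis
  proof (rule that[of N])
    fix y assume y: "y \<in> F"
    have "openin Y (N y)"
    proof (cases "F - {y} = {}")
      case False
      have "openin Y (\<Inter>y'\<in>F - {y}. A y y' \<inter> B y' y)"
        using False AB y assms(2) by (intro openin_INT2) auto
      then show ?thesis by (simp add: N_def openin_Int)
    next
      case True
      then show ?thesis unfolding N_def True by simp
    qed
    then show "openin Y (N y) \<and> y \<in> N y" using AB y assms(3) by (auto simp: N_def)
  next
    fix y y' assume "y \<in> F" "y' \<in> F" "y \<noteq> y'"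
    then show "N y \<inter> N y' = {}" using AB[of y y'] by (fastforce simp: N_def)
  qed
qed

text \<open>The point is local constancy. Around the finitely many support points over z lie
  disjoint sheets on which f is constant and \<phi> is injective. The rest of the support is
  compact, so its image is closed and misses z; over a small neighbourhood of z the sheets carry the
  whole sum.\<close>

lemma push_Cc:
  assumes f: "f \<in> carrier (Cc Y)" and \<phi>: "etale Y Z \<phi>" and Y: "Hausdorff_space Y" and Z: "Hausdorff_space Z"
  shows "push \<phi> f \<in> carrier (Cc Z)"
proof (rule CcI)
  define K where "K = {y. f y \<noteq> 0}"
  have K: "compactin Y K" using f by (simp add: K_def Cc_iff)
  show "compactin Z (\<phi> ` K)" by (rule image_compactin[OF K etale_continuous[OF \<phi>]])
  show "z \<in> \<phi> ` K" if nz: "push \<phi> f z \<noteq> 0" for z using push_nonzeroD[OF nz] by (auto simp: K_def)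
  fix z assume z: "z \<in> topspace Z"
  define F where "F = {y. f y \<noteq> 0 \<and> \<phi> y = z}"
  have finF: "finite F" unfolding F_def by (rule fin_fibresD[OF etale_fin_fibres[OF f \<phi>]])
  have FY: "F \<subseteq> topspace Y" using compactin_subset_topspace[OF K] by (auto simp: F_def K_def)
  obtain N where N: "\<And>y. y \<in> F \<Longrightarrow> openin Y (N y) \<and> y \<in> N y"
    "\<And>y y'. y \<in> F \<Longrightarrow> y' \<in> F \<Longrightarrow> y \<noteq> y' \<Longrightarrow> N y \<inter> N y' = {}"
    using Hausdorff_finite_separation[OF Y finF FY] by blast
  have "\<exists>U. openin Y U \<and> y \<in> U \<and> U \<subseteq> N y \<and> inj_on \<phi> U \<and> (\<forall>u\<in>U. f y = f u)" if y: "y \<in> F" for y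
  proof -
    obtain U where U: "openin Y U" "y \<in> U" "inj_on \<phi> U" using etale_inj[OF \<phi>] y FY by blast
    obtain V where V: "openin Y V" "y \<in> V" "\<forall>u\<in>V. f y = f u" using Cc_local[OF f] y FY by blast
    show ?thesis
      using U V N(1)[OF y] inj_on_subset[OF U(3), of "U \<inter> V \<inter> N y"]
      by (intro exI[of _ "U \<inter> V \<inter> N y"] conjI openin_Int) blast+
  qed
  then obtain U where U: "\<And>y. y \<in> F \<Longrightarrow> openin Y (U y) \<and> y \<in> U y \<and> U y \<subseteq> N y \<and> inj_on \<phi> (U y) \<and> (\<forall>u\<in>U y. f y = f u)"
    by metis
  define L where "L = K \<inter> (topspace Y - (\<Union>y\<in>F. U y))"
  have "openin Y (\<Union>y\<in>F. U y)" using U by blast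
  then have "compactin Y L" unfolding L_def by (intro compact_Int_closedin K) auto
  then have L: "closedin Z (\<phi> ` L)"
    using compactin_imp_closedin[OF Z] image_compactin[OF _ etale_continuous[OF \<phi>]] by blast
  define W where "W = (topspace Z \<inter> (\<Inter>y\<in>F. \<phi> ` U y)) - \<phi> ` L"
  have "openin Z (topspace Z \<inter> (\<Inter>y\<in>F. \<phi> ` U y))"
  proof (cases "F = {}")
    case False
    have "openin Z (\<Inter>y\<in>F. \<phi> ` U y)"
      using False finF etale_open[OF \<phi>] U by (intro openin_INT2) auto
    then show ?thesis by (simp add: openin_Int)
  qed simp
  then have "openin Z W" unfolding W_def using L by (rule openin_diff)
  moreover have "z \<in> W"
  proof -
    have "z \<notin> \<phi> ` L" using U by (auto simp: L_def F_def K_def)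
    moreover have "z \<in> \<phi> ` U y" if "y \<in> F" for y using U[OF that] that by (auto simp: F_def)
    ultimately show ?thesis using z by (simp add: W_def)
  qed
  \<comment> \<open>Each sheet contains exactly one point over w, and f has there the value it has
    at the support point over z.\<close>
  moreover have "push \<phi> f w = sum f F" if w: "w \<in> W" for w
  proof -
    have "\<forall>y\<in>F. \<exists>u\<in>U y. \<phi> u = w" using w by (auto simp: W_def)
    then obtain u where u: "\<And>y. y \<in> F \<Longrightarrow> u y \<in> U y \<and> \<phi> (u y) = w" by metis
    have inj: "inj_on u F"
    proof (rule inj_onI, rule ccontr)
      fix y y' assume "y \<in> F" "y' \<in> F" "u y = u y'" "y \<noteq> y'"
      then show False using u[of y] u[of y'] U[of y] U[of y'] N(2)[of y y'] by auto
    qed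
    have "push \<phi> f w = sum f (u ` F)"
    proof (rule push_eq_sum)
      show "{v. f v \<noteq> 0 \<and> \<phi> v = w} \<subseteq> u ` F"
      proof clarify
        fix v assume v: "f v \<noteq> 0" "w = \<phi> v"
        then have "v \<in> K" "v \<notin> L" using w by (auto simp: K_def W_def)
        then obtain y where y: "y \<in> F" "v \<in> U y"
          using compactin_subset_topspace[OF K] by (auto simp: L_def)
        then have "v = u y" using U[OF y(1)] u[OF y(1)] v(2) by (auto simp: inj_on_def)
        then show "v \<in> u ` F" using y by blast
      qed
    qed (use finF u in auto)
    also have "\<dots> = (\<Sum>y\<in>F. f (u y))" by (simp add: sum.reindex[OF inj])
    also have "\<dots> = sum f F" 
    proof (rule sum.cong)
      fix y assume y: "y \<in> F"
      have "\<forall>v\<in>U y. f y = f v" using U[OF y] by blast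
      then have "f y = f (u y)" using u[OF y] by blast
      then show "f (u y) = f y" by simp
    qed simp
    finally show ?thesis .
  qed
  ultimately show "\<exists>U. openin Z U \<and> z \<in> U \<and> (\<forall>u\<in>U. push \<phi> f z = push \<phi> f u)"
    by (intro exI[of _ W]) auto
qed

section \<open>Products with a discrete factor\<close>

lemma etale_snd: "etale (prod_topology (discrete_topology S) Z) Z snd"
  unfolding etale_def
proof (intro conjI ballI)
  show "continuous_map (prod_topology (discrete_topology S) Z) Z snd" by (rule continuous_map_snd)
  show "open_map (prod_topology (discrete_topology S) Z) Z snd" by (rule open_map_snd)
  fix y assume y: "y \<in> topspace (prod_topology (discrete_topology S) Z)"
  have "openin (prod_topology (discrete_topology S) Z) ({fst y} \<times> topspace Z)"
    using y by (auto simp: openin_prod_Times_iff)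
  moreover have "y \<in> {fst y} \<times> topspace Z" using y by (cases y) auto
  moreover have "inj_on snd ({fst y} \<times> topspace Z)" by (auto simp: inj_on_def)
  ultimately show "\<exists>U. openin (prod_topology (discrete_topology S) Z) U \<and> y \<in> U \<and> inj_on snd U"
    by (intro exI[of _ "{fst y} \<times> topspace Z"] conjI)
qed

lemma locally_constant_map:
  assumes "\<And>y. y \<in> topspace Y \<Longrightarrow> f y \<in> S"
    and "\<And>y. y \<in> topspace Y \<Longrightarrow> \<exists>U. openin Y U \<and> y \<in> U \<and> (\<forall>u\<in>U. f y = f u)"
  shows "continuous_map Y (discrete_topology S) f"
proof (rule continuous_map_localI)
  fix y W assume *: "y \<in> topspace Y" "f y \<in> W"
  then obtain U where U: "openin Y U" "y \<in> U" "\<forall>u\<in>U. f y = f u" using assms(2) by blast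
  have "f ` U \<subseteq> W" by (rule image_subsetI) (use U(3) *(2) in metis)
  then show "\<exists>U. openin Y U \<and> y \<in> U \<and> f ` U \<subseteq> W" using U by blast
qed (use assms(1) in auto)

lemma etale_discrete_family:
  assumes \<phi>: "\<And>a. a \<in> S \<Longrightarrow> etale Y Z (\<phi> a)"
  shows "etale (prod_topology (discrete_topology S) Y) Z (\<lambda>(a, y). \<phi> a y)"
  unfolding etale_def
proof (intro conjI ballI)
  let ?P = "prod_topology (discrete_topology S) Y"
  have box: "openin ?P ({a} \<times> U)" if "a \<in> S" "openin Y U" for a U
    using that by (auto simp: openin_prod_Times_iff)
  show "continuous_map ?P Z (\<lambda>(a, y). \<phi> a y)"
  proof (rule continuous_map_localI)
    fix z W assume z: "z \<in> topspace ?P" and W: "openin Z W" "(case z of (a, y) \<Rightarrow> \<phi> a y) \<in> W"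
    obtain a y where ay: "z = (a, y)" "a \<in> S" "y \<in> topspace Y" using z by auto
    have "openin Y {y \<in> topspace Y. \<phi> a y \<in> W}" by (rule openin_vimage[OF etale_continuous[OF \<phi>[OF ay(2)]] W(1)])
    then show "\<exists>U. openin ?P U \<and> z \<in> U \<and> (\<lambda>(a, y). \<phi> a y) ` U \<subseteq> W"
      using ay W box by (intro exI[of _ "{a} \<times> {y \<in> topspace Y. \<phi> a y \<in> W}"]) auto
  qed (use etale_in[OF \<phi>] in auto)
  show "open_map ?P Z (\<lambda>(a, y). \<phi> a y)"
    unfolding open_map_def
  proof (intro allI impI)
    fix T assume T: "openin ?P T"
    have sl: "openin Y {y \<in> topspace Y. (a, y) \<in> T}" if "a \<in> S" for a
      by (rule openin_vimage[OF _ T]) (simp add: continuous_map_pairwise o_def that)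
    have "(\<lambda>(a, y). \<phi> a y) ` T = (\<Union>a\<in>S. \<phi> a ` {y \<in> topspace Y. (a, y) \<in> T})"
      using openin_subset[OF T] by force
    also have "openin Z \<dots>" using etale_open[OF \<phi> sl] by blast
    finally show "openin Z ((\<lambda>(a, y). \<phi> a y) ` T)" .
  qed
  fix z assume "z \<in> topspace ?P"
  then obtain a y where ay: "z = (a, y)" "a \<in> S" "y \<in> topspace Y" by auto
  obtain U where U: "openin Y U" "y \<in> U" "inj_on (\<phi> a) U" using etale_inj[OF \<phi>[OF ay(2)] ay(3)] by blast
  have "inj_on (\<lambda>(a, y). \<phi> a y) ({a} \<times> U)" using U(3) by (auto simp: inj_on_def)
  then show "\<exists>U. openin ?P U \<and> z \<in> U \<and> inj_on (\<lambda>(a, y). \<phi> a y) U"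
    using box[OF ay(2) U(1)] U(2) ay(1) by (intro exI[of _ "{a} \<times> U"] conjI) auto
qed

text \<open>The discrete coordinate may change by a locally constant amount, as it does on face 0
  through the cocycle. Cancelling the second projection reduces the claim to the maps
  \<open>\<phi> a\<close> and to continuity of \<kappa>.\<close>

lemma etale_prod_discrete:
  assumes \<phi>: "\<And>a. a \<in> S \<Longrightarrow> etale Y Z (\<phi> a)"
    and \<kappa>: "\<And>a y. a \<in> S \<Longrightarrow> y \<in> topspace Y \<Longrightarrow> \<kappa> a y \<in> S"
    and loc: "\<And>a y. a \<in> S \<Longrightarrow> y \<in> topspace Y \<Longrightarrow> \<exists>U. openin Y U \<and> y \<in> U \<and> (\<forall>u\<in>U. \<kappa> a y = \<kappa> a u)"
  shows "etale (prod_topology (discrete_topology S) Y) (prod_topology (discrete_topology S) Z)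
    (\<lambda>(a, y). (\<kappa> a y, \<phi> a y))"
proof (rule etale_cancel[OF _ etale_snd])
  let ?P = "prod_topology (discrete_topology S) Y"
  have e: "snd \<circ> (\<lambda>(a, y). (\<kappa> a y, \<phi> a y)) = (\<lambda>(a, y). \<phi> a y)" by auto
  show 1: "etale ?P Z (snd \<circ> (\<lambda>(a, y). (\<kappa> a y, \<phi> a y)))" unfolding e by (rule etale_discrete_family[OF \<phi>])
  have "continuous_map ?P (discrete_topology S) (\<lambda>(a, y). \<kappa> a y)"
  proof (rule locally_constant_map)
    fix z assume "z \<in> topspace ?P"
    then obtain a y where z: "z = (a, y)" "a \<in> S" "y \<in> topspace Y" by auto
    then show "(case z of (a, y) \<Rightarrow> \<kappa> a y) \<in> S" using \<kappa> by auto
    obtain U where U: "openin Y U" "y \<in> U" "\<forall>u\<in>U. \<kappa> a y = \<kappa> a u" using loc[OF z(2,3)] by blast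
    have "(case z of (a, y) \<Rightarrow> \<kappa> a y) = (case u of (a, y) \<Rightarrow> \<kappa> a y)" if u: "u \<in> {a} \<times> U" for u
    proof -
      obtain v where "u = (a, v)" "v \<in> U" using u by auto
      moreover from this have "\<kappa> a y = \<kappa> a v" using U(3) by blast
      ultimately show ?thesis using z(1) by simp
    qed
    moreover have "openin ?P ({a} \<times> U)" "z \<in> {a} \<times> U" using U z by (auto simp: openin_prod_Times_iff)
    ultimately show "\<exists>U. openin ?P U \<and> z \<in> U \<and> (\<forall>u\<in>U. (case z of (a, y) \<Rightarrow> \<kappa> a y) = (case u of (a, y) \<Rightarrow> \<kappa> a y))"
      by (intro exI[of _ "{a} \<times> U"] conjI ballI)
  qed
  moreover have "continuous_map ?P Z (\<lambda>(a, y). \<phi> a y)" using etale_continuous[OF 1] e by simp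
  ultimately show "continuous_map ?P (prod_topology (discrete_topology S) Z) (\<lambda>(a, y). (\<kappa> a y, \<phi> a y))"
    by (simp add: continuous_map_pairwise o_def split_def)
qed

lemma Hausdorff_prod_discrete:
  "Hausdorff_space Y \<Longrightarrow> Hausdorff_space (prod_topology (discrete_topology S) Y)"
  by (simp add: Hausdorff_space_prod_topology)

text \<open>A compact set in the product with a discrete space meets finitely many slices. So an
  induced module of functions on Y consists of functions on Z^k x Y, where the lemmas on etale maps
  apply.\<close>

lemma induced_iff_Cc:
  "f \<in> induced k (carrier (Cc Y)) \<longleftrightarrow>
   case_prod f \<in> carrier (Cc (prod_topology (discrete_topology (carrier (Zk k))) Y))"
proof
  let ?P = "prod_topology (discrete_topology (carrier (Zk k))) Y"
  assume f: "f \<in> induced k (carrier (Cc Y))"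
  show "case_prod f \<in> carrier (Cc ?P)"
  proof (rule CcI)
    show "compactin ?P (\<Union>a\<in>{a. f a \<noteq> 0}. {a} \<times> {y. f a y \<noteq> 0})"
      using f by (intro compactin_Union) (auto simp: induced_def Cc_iff compactin_Times)
    show "z \<in> (\<Union>a\<in>{a. f a \<noteq> 0}. {a} \<times> {y. f a y \<noteq> 0})" if "case_prod f z \<noteq> 0" for z
      using that by (cases z) (auto simp: fun_eq_iff)
    fix z assume "z \<in> topspace ?P"
    then obtain a y where z: "z = (a, y)" "a \<in> carrier (Zk k)" "y \<in> topspace Y" by auto
    have "f a \<in> carrier (Cc Y)" using f by (simp add: induced_def)
    then obtain U where U: "openin Y U" "y \<in> U" "\<forall>u\<in>U. f a y = f a u" using Cc_local[OF _ z(3)] by blast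
    have "case_prod f z = case_prod f u" if u: "u \<in> {a} \<times> U" for u
    proof -
      obtain v where "u = (a, v)" "v \<in> U" using u by auto
      moreover from this have "f a y = f a v" using U(3) by blast
      ultimately show ?thesis using z(1) by simp
    qed
    moreover have "openin ?P ({a} \<times> U)" "z \<in> {a} \<times> U" using U z by (auto simp: openin_prod_Times_iff)
    ultimately show "\<exists>U. openin ?P U \<and> z \<in> U \<and> (\<forall>u\<in>U. case_prod f z = case_prod f u)"
      by (intro exI[of _ "{a} \<times> U"] conjI ballI)
  qed
next
  let ?P = "prod_topology (discrete_topology (carrier (Zk k))) Y"
  assume f: "case_prod f \<in> carrier (Cc ?P)"
  define K where "K = {z. case_prod f z \<noteq> 0}"
  have K: "compactin ?P K" using f by (simp add: Cc_iff K_def)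
  have "compactin (discrete_topology (carrier (Zk k))) (fst ` K)"
    by (rule image_compactin[OF K continuous_map_fst])
  then have fK: "finite (fst ` K)" "fst ` K \<subseteq> carrier (Zk k)" by (auto simp: compactin_discrete_topology)
  have nz: "a \<in> fst ` K" if fa: "f a \<noteq> 0" for a
  proof -
    obtain y where "f a y \<noteq> 0" using fa by (auto simp: fun_eq_iff)
    then show ?thesis by (intro image_eqI[of _ _ "(a, y)"]) (auto simp: K_def)
  qed
  have "f a \<in> carrier (Cc Y)" for a
  proof (cases "a \<in> carrier (Zk k)")
    case True
    show ?thesis
    proof (rule CcI)
      show "compactin Y (snd ` K)" by (rule image_compactin[OF K continuous_map_snd])
      show "y \<in> snd ` K" if "f a y \<noteq> 0" for y
        using that by (intro image_eqI[of _ _ "(a, y)"]) (auto simp: K_def)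
      fix y assume y: "y \<in> topspace Y"
      then have "(a, y) \<in> topspace ?P" using True by simp
      then obtain W where W: "openin ?P W" "(a, y) \<in> W" "\<forall>w\<in>W. case_prod f (a, y) = case_prod f w"
        using Cc_local[OF f] by blast
      have "\<exists>U V. openin (discrete_topology (carrier (Zk k))) U \<and> openin Y V \<and> a \<in> U \<and> y \<in> V \<and> U \<times> V \<subseteq> W"
        using W(1)[unfolded openin_prod_topology_alt, rule_format, OF W(2)] .
      then obtain U V where V: "openin Y V" "a \<in> U" "y \<in> V" "U \<times> V \<subseteq> W" by metis
      have "f a y = f a u" if "u \<in> V" for u
      proof -
        have "(a, u) \<in> W" using V that by blast
        then have "case_prod f (a, y) = case_prod f (a, u)" using W(3) by blast
        then show ?thesis by simp
      qed
      then show "\<exists>U. openin Y U \<and> y \<in> U \<and> (\<forall>u\<in>U. f a y = f a u)"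
        using V by (intro exI[of _ V] conjI ballI)
    qed
  next
    case False
    then have "f a = 0" using nz fK(2) by blast
    then show ?thesis by (simp add: Cc_zero)
  qed
  moreover have "finite {a. f a \<noteq> 0}" using nz fK(1) by (auto intro: rev_finite_subset)
  ultimately show "f \<in> induced k (carrier (Cc Y))" using nz fK(2) by (auto simp: induced_def)
qed

lemma homeomorphic_maps_etale:
  assumes "homeomorphic_maps Y Z \<phi> \<psi>" shows "etale Y Z \<phi>"
proof -
  have h: "homeomorphic_map Y Z \<phi>" using assms homeomorphic_map_maps by blast
  show ?thesis
    unfolding etale_def
  proof (intro conjI ballI)
    show "continuous_map Y Z \<phi>" by (rule homeomorphic_imp_continuous_map[OF h])
    show "open_map Y Z \<phi>" by (rule homeomorphic_imp_open_map[OF h])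
    show "\<exists>U. openin Y U \<and> y \<in> U \<and> inj_on \<phi> U" if "y \<in> topspace Y" for y
      using that homeomorphic_imp_injective_map[OF h] openin_topspace by blast
  qed
qed

section \<open>The nerve of an etale groupoid\<close>

lemma Hausdorff_prod_injective:
  assumes "Hausdorff_space Z" "continuous_map Y Z f" "inj_on f (topspace Y)"
  shows "Hausdorff_space Y"
  unfolding Hausdorff_space_def
proof (intro allI impI)
  fix x y assume xy: "x \<in> topspace Y \<and> y \<in> topspace Y \<and> x \<noteq> y"
  then have "f x \<in> topspace Z" "f y \<in> topspace Z" "f x \<noteq> f y"
    using continuous_map_funspace[OF assms(2)] assms(3) by (auto simp: inj_on_def)
  then obtain U V where "openin Z U" "openin Z V" "f x \<in> U" "f y \<in> V" "disjnt U V"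
    using assms(1) unfolding Hausdorff_space_def by metis
  then show "\<exists>U V. openin Y U \<and> openin Y V \<and> x \<in> U \<and> y \<in> V \<and> disjnt U V"
    using xy openin_vimage[OF assms(2)]
    by (intro exI[of _ "{u \<in> topspace Y. f u \<in> U}"] exI[of _ "{u \<in> topspace Y. f u \<in> V}"])
      (auto simp: disjnt_def)
qed

text \<open>Continuity of the product is stated by neighbourhoods of the two factors, the form
  needed when one side of a box in the nerve is split in two.\<close>

locale etale_groupoid =
  fixes G :: "('x, 'g) groupoid"
  assumes units_Hausdorff: "Hausdorff_space (units G)"
    and arrows_Hausdorff: "Hausdorff_space (arrows G)"
    and grange_etale: "etale (arrows G) (units G) (grange G)"
    and gsource_etale: "etale (arrows G) (units G) (gsource G)"
    and gcomp_in: "g \<in> topspace (arrows G) \<Longrightarrow> h \<in> topspace (arrows G) \<Longrightarrow> gsource G g = grange G h \<Longrightarrow>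
      gcomp G g h \<in> topspace (arrows G)"
    and grange_gcomp: "g \<in> topspace (arrows G) \<Longrightarrow> h \<in> topspace (arrows G) \<Longrightarrow> gsource G g = grange G h \<Longrightarrow>
      grange G (gcomp G g h) = grange G g"
    and gsource_gcomp: "g \<in> topspace (arrows G) \<Longrightarrow> h \<in> topspace (arrows G) \<Longrightarrow> gsource G g = grange G h \<Longrightarrow>
      gsource G (gcomp G g h) = gsource G h"
    and gcomp_continuous: "g \<in> topspace (arrows G) \<Longrightarrow> h \<in> topspace (arrows G) \<Longrightarrow> gsource G g = grange G h \<Longrightarrow>
      openin (arrows G) W \<Longrightarrow> gcomp G g h \<in> W \<Longrightarrow>
      \<exists>U V. openin (arrows G) U \<and> openin (arrows G) V \<and> g \<in> U \<and> h \<in> V \<and>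
        (\<forall>g'\<in>U. \<forall>h'\<in>V. gsource G g' = grange G h' \<longrightarrow> gcomp G g' h' \<in> W)"
begin

definition chain :: "'g list \<Rightarrow> bool" where
  "chain gs \<longleftrightarrow> set gs \<subseteq> topspace (arrows G) \<and> successively (\<lambda>g h. gsource G g = grange G h) gs"

lemma composable_iff: "gs \<in> composable G n \<longleftrightarrow> length gs = n \<and> chain gs"
  by (auto simp: composable_def chain_def successively_conv_nth)

text \<open>By \<open>openin_boxed\<close> and \<open>nerve_boxed\<close> the boxes with open sides
  form a neighbourhood base of the nerve in positive degrees.\<close>

definition boxed :: "'g set list \<Rightarrow> ('x, 'g) nerve_point set" where
  "boxed Us = {Tuple gs | gs. chain gs \<and> list_all2 (\<in>) gs Us}"

definition first_vertex :: "('x, 'g) nerve_point \<Rightarrow> 'x" where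
  "first_vertex z = (case z of Unit x \<Rightarrow> x | Tuple gs \<Rightarrow> grange G (hd gs))"

definition last_vertex :: "('x, 'g) nerve_point \<Rightarrow> 'x" where
  "last_vertex z = (case z of Unit x \<Rightarrow> x | Tuple gs \<Rightarrow> gsource G (last gs))"

lemma topspace_nerve_0: "topspace (nerve G 0) = Unit ` topspace (units G)"
  by (auto simp: nerve_def topspace_pullback_topology)

lemma topspace_nerve: "n \<noteq> 0 \<Longrightarrow> topspace (nerve G n) = Tuple ` composable G n"
  by (auto simp: nerve_def topspace_pullback_topology composable_def subset_iff PiE_iff)

lemma openin_nerve_0: "openin (nerve G 0) S \<longleftrightarrow> (\<exists>U. openin (units G) U \<and> S = Unit ` U)"
proof -
  have "the_unit -` U \<inter> Unit ` topspace (units G) = Unit ` U" if "openin (units G) U" for U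
    using openin_subset[OF that] by auto
  then show ?thesis unfolding nerve_def openin_pullback_topology if_P[OF refl] by metis
qed

lemma openin_boxed:
  assumes "Us \<noteq> []" "\<And>U. U \<in> set Us \<Longrightarrow> openin (arrows G) U"
  shows "openin (nerve G (length Us)) (boxed Us)"
proof -
  let ?n = "length Us"
  have "openin (product_topology (\<lambda>_. arrows G) {..<?n}) (PiE {..<?n} (\<lambda>i. Us ! i))"
    using assms(2) by (simp add: openin_PiE)
  moreover have "boxed Us = (\<lambda>z. \<lambda>i\<in>{..<?n}. the_tuple z ! i) -` PiE {..<?n} (\<lambda>i. Us ! i) \<inter> Tuple ` composable G ?n"
    by (auto simp: boxed_def composable_iff list_all2_conv_all_nth)
  ultimately show ?thesis
    using assms(1) by (auto simp: nerve_def openin_pullback_topology)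
qed

lemma nerve_boxed:
  assumes S: "openin (nerve G n) S" "Tuple gs \<in> S" and n: "n \<noteq> 0"
  obtains Us where "length Us = n" "\<And>U. U \<in> set Us \<Longrightarrow> openin (arrows G) U" "Tuple gs \<in> boxed Us" "boxed Us \<subseteq> S"
proof -
  let ?f = "\<lambda>z :: ('x, 'g) nerve_point. \<lambda>i\<in>{..<n}. the_tuple z ! i"
  obtain T where T: "openin (product_topology (\<lambda>_. arrows G) {..<n}) T" "S = ?f -` T \<inter> Tuple ` composable G n"
    using S(1) n by (auto simp: nerve_def openin_pullback_topology)
  then have fT: "?f (Tuple gs) \<in> T" and gs: "gs \<in> composable G n" using S(2) by auto
  from bspec[OF T(1)[unfolded openin_product_topology_alt] fT]
  obtain U where U: "\<And>i. i < n \<Longrightarrow> openin (arrows G) (U i)" "?f (Tuple gs) \<in> PiE {..<n} U" "PiE {..<n} U \<subseteq> T"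
    by blast
  show thesis
  proof (rule that[of "map U [0..<n]"])
    show "Tuple gs \<in> boxed (map U [0..<n])"
      using U(2) gs by (auto simp: boxed_def composable_iff list_all2_conv_all_nth PiE_iff)
    show "boxed (map U [0..<n]) \<subseteq> S"
    proof
      fix z assume "z \<in> boxed (map U [0..<n])"
      then obtain hs where hs: "z = Tuple hs" "chain hs" "list_all2 (\<in>) hs (map U [0..<n])"
        by (auto simp: boxed_def)
      then have h: "hs \<in> composable G n" "?f z \<in> PiE {..<n} U"
        by (auto simp: composable_iff list_all2_conv_all_nth PiE_iff)
      then have "?f z \<in> T" using U(3) by blast
      then show "z \<in> S" unfolding T(2) using h(1) hs(1) by blast
    qed
  qed (use U(1) in auto)
qed

lemma nerve_Hausdorff: "Hausdorff_space (nerve G n)"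
proof (cases "n = 0")
  case True
  have "continuous_map (nerve G 0) (units G) (id \<circ> the_unit)"
    unfolding nerve_def if_P[OF refl] by (rule continuous_map_pullback) simp
  then show ?thesis unfolding True
    by (rule Hausdorff_prod_injective[OF units_Hausdorff]) (auto simp: topspace_nerve_0 inj_on_def)
next
  case False
  let ?f = "\<lambda>z :: ('x, 'g) nerve_point. \<lambda>i\<in>{..<n}. the_tuple z ! i"
  have "continuous_map (nerve G n) (product_topology (\<lambda>_. arrows G) {..<n}) (id \<circ> ?f)"
    unfolding nerve_def if_not_P[OF False] by (rule continuous_map_pullback) simp
  moreover have "Hausdorff_space (product_topology (\<lambda>_. arrows G) {..<n})"
    by (simp add: Hausdorff_space_product_topology arrows_Hausdorff)
  moreover have "inj_on (id \<circ> ?f) (topspace (nerve G n))"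
  proof (rule inj_onI)
    fix z w assume "z \<in> topspace (nerve G n)" "w \<in> topspace (nerve G n)" and eq: "(id \<circ> ?f) z = (id \<circ> ?f) w"
    then obtain gs hs where *: "z = Tuple gs" "w = Tuple hs" "length gs = n" "length hs = n"
      by (auto simp: topspace_nerve[OF False] composable_def)
    have "gs ! i = hs ! i" if "i < n" for i using fun_cong[OF eq, of i] that * by simp
    then show "z = w" using * by (simp add: nth_equalityI)
  qed
  ultimately show ?thesis using Hausdorff_prod_injective by blast
qed

lemma chain_Cons: "gs \<noteq> [] \<Longrightarrow> chain (g # gs) \<longleftrightarrow> g \<in> topspace (arrows G) \<and> gsource G g = grange G (hd gs) \<and> chain gs"
  by (cases gs) (auto simp: chain_def)

lemma chain_snoc: "gs \<noteq> [] \<Longrightarrow> chain (gs @ [g]) \<longleftrightarrow> g \<in> topspace (arrows G) \<and> gsource G (last gs) = grange G g \<and> chain gs"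
  by (auto simp: chain_def successively_append_iff)

text \<open>Induction along the tuple: the admissible first arrows are those in U whose source lies
  in the open set of first vertices of the remaining box, and the range map is open.\<close>

lemma open_first:
  assumes "Us \<noteq> []" "\<And>U. U \<in> set Us \<Longrightarrow> openin (arrows G) U"
  shows "openin (units G) (first_vertex ` boxed Us)"
  using assms
proof (induction Us rule: list_nonempty_induct)
  case (single U)
  have "first_vertex ` boxed [U] = grange G ` U"
    using openin_subset[OF single(1)[of U]]
    by (force simp: boxed_def first_vertex_def chain_def list_all2_Cons2 image_iff)
  then show ?case using etale_open[OF grange_etale] single by simp
next
  case (cons U Us)
  define W where "W = U \<inter> {g \<in> topspace (arrows G). gsource G g \<in> first_vertex ` boxed Us}"
  have "first_vertex ` boxed (U # Us) = grange G ` W"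
  proof (intro equalityI subsetI)
    fix x assume "x \<in> first_vertex ` boxed (U # Us)"
    then obtain g gs where g: "x = grange G g" "g \<in> U" "list_all2 (\<in>) gs Us" "chain (g # gs)"
      by (auto simp: boxed_def first_vertex_def list_all2_Cons2)
    then have ne: "gs \<noteq> []" using cons.hyps by auto
    have "gsource G g = first_vertex (Tuple gs)" "Tuple gs \<in> boxed Us" "g \<in> topspace (arrows G)"
      using g chain_Cons[OF ne] by (auto simp: first_vertex_def boxed_def)
    then show "x \<in> grange G ` W" using g by (auto simp: W_def)
  next
    fix x assume "x \<in> grange G ` W"
    then obtain g gs where g: "x = grange G g" "g \<in> U" "g \<in> topspace (arrows G)" "list_all2 (\<in>) gs Us" "chain gs"
      "gsource G g = grange G (hd gs)"
      by (auto simp: W_def boxed_def first_vertex_def)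
    then have "gs \<noteq> []" using cons.hyps by auto
    then have "Tuple (g # gs) \<in> boxed (U # Us)" using g by (auto simp: boxed_def chain_Cons)
    then show "x \<in> first_vertex ` boxed (U # Us)" using g by (force simp: first_vertex_def)
  qed
  moreover have "openin (arrows G) W"
    unfolding W_def using cons openin_vimage[OF etale_continuous[OF gsource_etale]] by (auto intro!: openin_Int)
  ultimately show ?case using etale_open[OF grange_etale] by simp
qed

lemma open_last:
  assumes "Us \<noteq> []" "\<And>U. U \<in> set Us \<Longrightarrow> openin (arrows G) U"
  shows "openin (units G) (last_vertex ` boxed Us)"
  using assms
proof (induction Us rule: rev_nonempty_induct)
  case (single U)
  have "last_vertex ` boxed [U] = gsource G ` U"
    using openin_subset[OF single(1)[of U]]
    by (force simp: boxed_def last_vertex_def chain_def list_all2_Cons2 image_iff)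
  then show ?case using etale_open[OF gsource_etale] single by simp
next
  case (snoc U Us)
  define W where "W = U \<inter> {g \<in> topspace (arrows G). grange G g \<in> last_vertex ` boxed Us}"
  have "last_vertex ` boxed (Us @ [U]) = gsource G ` W"
  proof (intro equalityI subsetI)
    fix x assume "x \<in> last_vertex ` boxed (Us @ [U])"
    then obtain g gs where g: "x = gsource G g" "g \<in> U" "list_all2 (\<in>) gs Us" "chain (gs @ [g])"
      by (auto simp: boxed_def last_vertex_def list_all2_append2 list_all2_Cons2)
    then have ne: "gs \<noteq> []" using snoc.hyps by auto
    have "grange G g = last_vertex (Tuple gs)" "Tuple gs \<in> boxed Us" "g \<in> topspace (arrows G)"
      using g chain_snoc[OF ne] by (auto simp: last_vertex_def boxed_def)
    then show "x \<in> gsource G ` W" using g by (auto simp: W_def)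
  next
    fix x assume "x \<in> gsource G ` W"
    then obtain g gs where g: "x = gsource G g" "g \<in> U" "g \<in> topspace (arrows G)" "list_all2 (\<in>) gs Us" "chain gs"
      "grange G g = gsource G (last gs)"
      by (auto simp: W_def boxed_def last_vertex_def)
    then have "gs \<noteq> []" using snoc.hyps by auto
    then have "Tuple (gs @ [g]) \<in> boxed (Us @ [U])" using g by (auto simp: boxed_def chain_snoc list_all2_appendI)
    then show "x \<in> last_vertex ` boxed (Us @ [U])" using g by (force simp: last_vertex_def)
  qed
  moreover have "openin (arrows G) W"
    unfolding W_def using snoc openin_vimage[OF etale_continuous[OF grange_etale]] by (auto intro!: openin_Int)
  ultimately show ?case using etale_open[OF gsource_etale] by simp
qed

text \<open>The first vertex determines the first arrow within its side, and the source of that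
  arrow is the first vertex of the remaining tuple.\<close>

lemma chain_first_inj:
  "list_all2 (\<in>) gs Us \<Longrightarrow> list_all2 (\<in>) hs Us \<Longrightarrow> chain gs \<Longrightarrow> chain hs \<Longrightarrow> \<forall>U\<in>set Us. inj_on (grange G) U \<Longrightarrow>
    gs \<noteq> [] \<Longrightarrow> grange G (hd gs) = grange G (hd hs) \<Longrightarrow> gs = hs"
proof (induction Us arbitrary: gs hs)
  case (Cons U Us)
  then obtain g gs' h hs' where e: "gs = g # gs'" "hs = h # hs'" "g \<in> U" "h \<in> U"
    "list_all2 (\<in>) gs' Us" "list_all2 (\<in>) hs' Us" by (auto simp: list_all2_Cons2)
  then have gh: "g = h" using Cons.prems by (auto simp: inj_on_def)
  show ?case
  proof (cases "Us = []")
    case False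
    then have ne: "gs' \<noteq> []" "hs' \<noteq> []" using e by auto
    then have "gs' = hs'"
      using Cons.IH[of gs' hs'] Cons.prems e gh by (simp add: chain_Cons)
    then show ?thesis using e gh by simp
  qed (use e gh in auto)
qed simp

lemma chain_last_inj:
  "list_all2 (\<in>) gs Us \<Longrightarrow> list_all2 (\<in>) hs Us \<Longrightarrow> chain gs \<Longrightarrow> chain hs \<Longrightarrow> \<forall>U\<in>set Us. inj_on (gsource G) U \<Longrightarrow>
    gs \<noteq> [] \<Longrightarrow> gsource G (last gs) = gsource G (last hs) \<Longrightarrow> gs = hs"
proof (induction Us arbitrary: gs hs rule: rev_induct)
  case (snoc U Us)
  then obtain g gs' h hs' where e: "gs = gs' @ [g]" "hs = hs' @ [h]" "g \<in> U" "h \<in> U"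
    "list_all2 (\<in>) gs' Us" "list_all2 (\<in>) hs' Us" by (auto simp: list_all2_append2 list_all2_Cons2)
  then have gh: "g = h" using snoc.prems by (auto simp: inj_on_def)
  show ?case
  proof (cases "Us = []")
    case False
    then have ne: "gs' \<noteq> []" "hs' \<noteq> []" using e by auto
    then have "gs' = hs'"
      using snoc.IH[of gs' hs'] snoc.prems e gh by (simp add: chain_snoc)
    then show ?thesis using e gh by simp
  qed (use e gh in auto)
qed simp

text \<open>One argument for both ends: v with f is either the first vertex with the range map or
  the last vertex with the source map.\<close>

lemma etale_vertex:
  assumes v: "v = first_vertex \<and> f = grange G \<or> v = last_vertex \<and> f = gsource G"
  shows "etale (nerve G n) (units G) v"
proof (cases "n = 0")
  case True
  have vU: "v (Unit x) = x" for x using v by (auto simp: first_vertex_def last_vertex_def)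
  show ?thesis
    unfolding etale_def True
  proof (intro conjI ballI)
    show "continuous_map (nerve G 0) (units G) v"
    proof (rule continuous_map_localI)
      fix z W assume *: "z \<in> topspace (nerve G 0)" "openin (units G) W" "v z \<in> W"
      then show "\<exists>U. openin (nerve G 0) U \<and> z \<in> U \<and> v ` U \<subseteq> W"
        by (intro exI[of _ "Unit ` W"]) (auto simp: openin_nerve_0 topspace_nerve_0 vU)
    qed (auto simp: topspace_nerve_0 vU)
    show "open_map (nerve G 0) (units G) v"
      by (auto simp: open_map_def openin_nerve_0 image_image vU)
    show "\<exists>U. openin (nerve G 0) U \<and> z \<in> U \<and> inj_on v U" if "z \<in> topspace (nerve G 0)" for z
      using that openin_topspace[of "nerve G 0"]
      by (intro exI[of _ "topspace (nerve G 0)"]) (simp_all add: inj_on_def topspace_nerve_0 vU)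
  qed
next
  case False
  have f: "etale (arrows G) (units G) f" using v grange_etale gsource_etale by blast
  have op: "openin (units G) (v ` boxed Us)" if "Us \<noteq> []" "\<And>U. U \<in> set Us \<Longrightarrow> openin (arrows G) U" for Us
    using v open_first[OF that] open_last[OF that] by blast
  have vf: "\<exists>g\<in>set gs. v (Tuple gs) = f g \<and> (v = first_vertex \<and> g = hd gs \<or> v = last_vertex \<and> g = last gs)" if "gs \<noteq> []" for gs
    using v that by (auto simp: first_vertex_def last_vertex_def)
  have top: "v (Tuple gs) \<in> topspace (units G)" if "gs \<in> composable G n" for gs
  proof -
    have gs: "gs \<noteq> []" "set gs \<subseteq> topspace (arrows G)" using that False by (auto simp: composable_def)
    obtain g where "g \<in> set gs" "v (Tuple gs) = f g" using vf[OF gs(1)] by blast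
    then show ?thesis using gs etale_in[OF f] by auto
  qed
  show ?thesis
    unfolding etale_def
  proof (intro conjI ballI)
    show "continuous_map (nerve G n) (units G) v"
    proof (rule continuous_map_localI)
      fix z W assume z: "z \<in> topspace (nerve G n)" "openin (units G) W" "v z \<in> W"
      then obtain gs where gs: "z = Tuple gs" "gs \<in> composable G n" by (auto simp: topspace_nerve[OF False])
      define V where "V = {g \<in> topspace (arrows G). f g \<in> W}"
      have V: "openin (arrows G) V" unfolding V_def by (rule openin_vimage[OF etale_continuous[OF f] z(2)])
      define Us where "Us = (if v = first_vertex \<and> f = grange G then V # replicate (n - 1) (topspace (arrows G))
         else replicate (n - 1) (topspace (arrows G)) @ [V])"
      have Us: "length Us = n" "Us \<noteq> []" "\<And>U. U \<in> set Us \<Longrightarrow> openin (arrows G) U"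
        using V False by (auto simp: Us_def split: if_splits)
      have mem: "list_all2 (\<in>) hs Us \<longleftrightarrow> v (Tuple hs) \<in> W" if hs: "hs \<in> composable G n" for hs
      proof -
        have h: "length hs = n" "set hs \<subseteq> topspace (arrows G)" "hs \<noteq> []" using hs False by (auto simp: composable_def)
        show ?thesis
        proof (cases "v = first_vertex \<and> f = grange G")
          case True
          obtain h' hs' where c: "hs = h' # hs'" using h by (cases hs) auto
          have "list_all2 (\<in>) hs' (replicate (n - 1) (topspace (arrows G)))"
            using h c by (auto simp: list_all2_conv_all_nth subset_iff)
          then show ?thesis using True h c by (auto simp: Us_def V_def first_vertex_def)
        next
          case F: False
          then have v': "v = last_vertex" "f = gsource G" using v by auto
          obtain h' hs' where c: "hs = hs' @ [h']" using h by (cases hs rule: rev_cases) auto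
          have "list_all2 (\<in>) hs' (replicate (n - 1) (topspace (arrows G)))"
            using h c by (auto simp: list_all2_conv_all_nth subset_iff)
          then show ?thesis
            using v' F h c list_all2_lengthD by (auto simp: Us_def V_def last_vertex_def list_all2_append)
        qed
      qed
      show "\<exists>U. openin (nerve G n) U \<and> z \<in> U \<and> v ` U \<subseteq> W"
      proof (intro exI conjI)
        show "openin (nerve G n) (boxed Us)" using openin_boxed[OF Us(2,3)] Us(1) by simp
        show "z \<in> boxed Us" using mem[OF gs(2)] gs z(3) by (auto simp: boxed_def composable_iff)
        show "v ` boxed Us \<subseteq> W" using mem Us(1) by (auto simp: boxed_def composable_iff dest: list_all2_lengthD)
      qed
    qed (auto simp: topspace_nerve[OF False] top)
    show "open_map (nerve G n) (units G) v"
      unfolding open_map_def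
    proof (intro allI impI)
      fix S assume S: "openin (nerve G n) S"
      show "openin (units G) (v ` S)"
      proof (subst openin_subopen, intro ballI)
        fix x assume "x \<in> v ` S"
        then obtain gs where gs: "Tuple gs \<in> S" "x = v (Tuple gs)"
          using openin_subset[OF S] by (auto simp: topspace_nerve[OF False])
        obtain Us where Us: "length Us = n" "\<And>U. U \<in> set Us \<Longrightarrow> openin (arrows G) U" "Tuple gs \<in> boxed Us" "boxed Us \<subseteq> S"
          using nerve_boxed[OF S gs(1) False] by blast
        have "Us \<noteq> []" using Us(1) False by auto
        then show "\<exists>T. openin (units G) T \<and> x \<in> T \<and> T \<subseteq> v ` S"
          using op[OF _ Us(2)] Us gs by (intro exI[of _ "v ` boxed Us"]) auto
      qed
    qed
    show "\<exists>U. openin (nerve G n) U \<and> z \<in> U \<and> inj_on v U" if z: "z \<in> topspace (nerve G n)" for z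
    proof -
      obtain gs where gs: "z = Tuple gs" "gs \<in> composable G n" using z by (auto simp: topspace_nerve[OF False])
      have "\<forall>g\<in>topspace (arrows G). \<exists>U. openin (arrows G) U \<and> g \<in> U \<and> inj_on f U"
        using etale_inj[OF f] by blast
      then obtain B where B: "\<And>g. g \<in> topspace (arrows G) \<Longrightarrow> openin (arrows G) (B g) \<and> g \<in> B g \<and> inj_on f (B g)"
        by metis
      have sub: "set gs \<subseteq> topspace (arrows G)" "length gs = n" "gs \<noteq> []" using gs False by (auto simp: composable_def)
      have "openin (nerve G n) (boxed (map B gs))"
        using openin_boxed[of "map B gs"] B sub by auto
      moreover have "z \<in> boxed (map B gs)"
        using gs sub B by (auto simp: boxed_def composable_iff list_all2_map2 list_all2_same)
      moreover have "inj_on v (boxed (map B gs))"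
      proof (rule inj_onI)
        fix z w assume "z \<in> boxed (map B gs)" "w \<in> boxed (map B gs)" and eq: "v z = v w"
        then obtain hs js where hs: "z = Tuple hs" "w = Tuple js" "chain hs" "chain js"
          "list_all2 (\<in>) hs (map B gs)" "list_all2 (\<in>) js (map B gs)" by (auto simp: boxed_def)
        have inj: "\<forall>U\<in>set (map B gs). inj_on f U" using B sub by auto
        have ne: "hs \<noteq> []" using hs(5) sub(3) by auto
        from v show "z = w"
        proof
          assume "v = first_vertex \<and> f = grange G"
          then show ?thesis
            using chain_first_inj[OF hs(5,6,3,4) _ ne] inj eq hs(1,2) by (simp add: first_vertex_def)
        next
          assume "v = last_vertex \<and> f = gsource G"
          then show ?thesis
            using chain_last_inj[OF hs(5,6,3,4) _ ne] inj eq hs(1,2) by (simp add: last_vertex_def)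
        qed
      qed
      ultimately show ?thesis by blast
    qed
  qed
qed

lemmas etale_first_vertex = etale_vertex[OF disjI1, OF conjI, OF refl refl]
lemmas etale_last_vertex = etale_vertex[OF disjI2, OF conjI, OF refl refl]

section \<open>Face maps of the nerve\<close>

lemma face_1: "face G (Suc 0) i (Tuple gs) = Unit (if i = 0 then gsource G (hd gs) else grange G (hd gs))"
  by (simp add: face_def)

lemma chain_sub: "chain (xs @ ys) \<Longrightarrow> chain xs \<and> chain ys"
  by (auto simp: chain_def successively_append_iff)

lemma chain_gcomp:
  assumes "chain (xs @ [g, h] @ ys)" shows "chain (xs @ [gcomp G g h] @ ys)"
proof -
  have gh: "g \<in> topspace (arrows G)" "h \<in> topspace (arrows G)" "gsource G g = grange G h"
    using assms by (auto simp: chain_def successively_append_iff)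
  show ?thesis
    using assms gcomp_in[OF gh] grange_gcomp[OF gh] gsource_gcomp[OF gh]
    by (cases ys) (auto simp: chain_def successively_append_iff)
qed

lemma face_inner:
  assumes "length xs = i - 1" "0 < i" "i < n" "n \<noteq> 1"
  shows "face G n i (Tuple (xs @ [g, h] @ ys)) = Tuple (xs @ [gcomp G g h] @ ys)"
  using assms by (auto simp: face_def Let_def nth_append)

lemma split_inner:
  assumes "length gs = n" "0 < i" "i < n"
  obtains xs g h ys where "gs = xs @ [g, h] @ ys" "length xs = i - 1"
proof -
  have "drop (i - 1) gs = gs ! (i - 1) # drop i gs"
    using assms Cons_nth_drop_Suc[of "i - 1" gs] by simp
  moreover have "drop i gs = gs ! i # drop (Suc i) gs"
    using assms Cons_nth_drop_Suc[of i gs] by simp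
  ultimately have "gs = take (i - 1) gs @ [gs ! (i - 1), gs ! i] @ drop (Suc i) gs"
    using append_take_drop_id[of "i - 1" gs] by simp
  then show thesis
    using that[of "take (i - 1) gs" "gs ! (i - 1)" "gs ! i" "drop (Suc i) gs"] assms by auto
qed

lemma face_in:
  assumes "z \<in> topspace (nerve G (Suc n))" "i \<le> Suc n"
  shows "face G (Suc n) i z \<in> topspace (nerve G n)"
proof -
  obtain gs where gs: "z = Tuple gs" "length gs = Suc n" "chain gs"
    using assms by (auto simp: topspace_nerve composable_iff)
  show ?thesis
  proof (cases "n = 0")
    case True
    then have "hd gs \<in> topspace (arrows G)" using gs by (cases gs) (auto simp: chain_def)
    then show ?thesis
      using True gs etale_in[OF gsource_etale] etale_in[OF grange_etale] by (auto simp: topspace_nerve_0 face_1)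
  next
    case False
    consider "i = 0" | "i = Suc n" | "0 < i" "i < Suc n" using assms(2) by linarith
    then show ?thesis
    proof cases
      case 1
      obtain g gs' where "gs = g # gs'" using gs by (cases gs) auto
      then show ?thesis using 1 gs False chain_sub[of "[g]" gs']
        by (auto simp: topspace_nerve composable_iff face_def Let_def)
    next
      case 2
      obtain g gs' where "gs = gs' @ [g]" using gs by (cases gs rule: rev_cases) auto
      then show ?thesis using 2 gs False chain_sub[of gs' "[g]"]
        by (auto simp: topspace_nerve composable_iff face_def Let_def)
    next
      case 3
      obtain xs g h ys where e: "gs = xs @ [g, h] @ ys" "length xs = i - 1" using split_inner[OF gs(2) 3] .
      then show ?thesis
        using 3 gs False chain_gcomp[of xs g h ys] face_inner[of xs i "Suc n" g h ys]
        by (auto simp: topspace_nerve composable_iff)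
    qed
  qed
qed

lemma face_vertex:
  assumes "z \<in> topspace (nerve G (Suc n))" "i \<le> Suc n"
  shows "i \<noteq> 0 \<Longrightarrow> first_vertex (face G (Suc n) i z) = first_vertex z"
    and "i \<noteq> Suc n \<Longrightarrow> last_vertex (face G (Suc n) i z) = last_vertex z"
proof -
  obtain gs where gs: "z = Tuple gs" "length gs = Suc n" "chain gs"
    using assms by (auto simp: topspace_nerve composable_iff)
  have "(i \<noteq> 0 \<longrightarrow> first_vertex (face G (Suc n) i z) = first_vertex z) \<and>
      (i \<noteq> Suc n \<longrightarrow> last_vertex (face G (Suc n) i z) = last_vertex z)"
  proof (cases "n = 0")
    case True
    then obtain g where "gs = [g]" using gs by (cases gs) auto
    then show ?thesis using True gs assms(2) by (auto simp: face_1 first_vertex_def last_vertex_def)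
  next
    case False
    consider "i = 0" | "i = Suc n" | "0 < i" "i < Suc n" using assms(2) by linarith
    then show ?thesis
    proof cases
      case 1
      obtain g gs' where "gs = g # gs'" "gs' \<noteq> []" using gs False by (cases gs) auto
      then show ?thesis using 1 gs False by (auto simp: face_def Let_def last_vertex_def)
    next
      case 2
      obtain g gs' where "gs = gs' @ [g]" "gs' \<noteq> []" using gs False by (cases gs rule: rev_cases) auto
      then show ?thesis using 2 gs False by (auto simp: face_def Let_def first_vertex_def)
    next
      case 3
      obtain xs g h ys where e: "gs = xs @ [g, h] @ ys" "length xs = i - 1" using split_inner[OF gs(2) 3] .
      have gh: "g \<in> topspace (arrows G)" "h \<in> topspace (arrows G)" "gsource G g = grange G h"
        using gs(3) e by (auto simp: chain_def successively_append_iff)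
      have "face G (Suc n) i z = Tuple (xs @ [gcomp G g h] @ ys)"
        using 3 e gs False face_inner[of xs i "Suc n" g h ys] by simp
      then show ?thesis
        using e gs grange_gcomp[OF gh] gsource_gcomp[OF gh]
        by (cases xs; cases ys) (auto simp: first_vertex_def last_vertex_def)
    qed
  qed
  then show "i \<noteq> 0 \<Longrightarrow> first_vertex (face G (Suc n) i z) = first_vertex z"
    and "i \<noteq> Suc n \<Longrightarrow> last_vertex (face G (Suc n) i z) = last_vertex z" by auto
qed

text \<open>A face that drops an end arrow is continuous because the box may be padded there by the
  space of all arrows; for an inner face, continuity of the product splits one side of the box into
  two. In the lowest degree the faces are the vertex maps.\<close>

lemma continuous_face:
  assumes i: "i \<le> Suc n" shows "continuous_map (nerve G (Suc n)) (nerve G n) (face G (Suc n) i)"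
proof (rule continuous_map_localI)
  show "face G (Suc n) i \<in> topspace (nerve G (Suc n)) \<rightarrow> topspace (nerve G n)" using face_in i by blast
  fix z W assume z: "z \<in> topspace (nerve G (Suc n))" and W: "openin (nerve G n) W" "face G (Suc n) i z \<in> W"
  obtain gs where gs: "z = Tuple gs" "length gs = Suc n" "chain gs"
    using z by (auto simp: topspace_nerve composable_iff)
  show "\<exists>U. openin (nerve G (Suc n)) U \<and> z \<in> U \<and> face G (Suc n) i ` U \<subseteq> W"
  proof (cases "n = 0")
    case True
    obtain V where V: "openin (units G) V" "W = Unit ` V" using W True openin_nerve_0 by auto
    define v where "v = (if i = 0 then last_vertex else first_vertex)"
    have "etale (nerve G (Suc n)) (units G) v"
      using etale_first_vertex etale_last_vertex by (auto simp: v_def)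
    then have "openin (nerve G (Suc n)) {w \<in> topspace (nerve G (Suc n)). v w \<in> V}"
      using openin_vimage[OF etale_continuous] V(1) by blast
    moreover have "face G (Suc n) i w = Unit (v w)" if w: "w \<in> topspace (nerve G (Suc n))" for w
    proof -
      obtain hs where "w = Tuple hs" "length hs = 1"
        using w True by (auto simp: topspace_nerve composable_iff)
      then show ?thesis using True by (cases hs) (auto simp: face_1 v_def first_vertex_def last_vertex_def)
    qed
    ultimately show ?thesis
      using z W V by (intro exI[of _ "{w \<in> topspace (nerve G (Suc n)). v w \<in> V}"]) auto
  next
    case False
    have "\<exists>Us. length Us = Suc n \<and> (\<forall>U\<in>set Us. openin (arrows G) U) \<and> list_all2 (\<in>) gs Us \<and>
        (\<forall>hs. chain hs \<longrightarrow> list_all2 (\<in>) hs Us \<longrightarrow> face G (Suc n) i (Tuple hs) \<in> W)"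
    proof -
      consider "i = 0" | "i = Suc n" | "0 < i" "i < Suc n" using i by linarith
      then show ?thesis
      proof cases
        case 1
        obtain g gs' where c: "gs = g # gs'" using gs by (cases gs) auto
        have fc: "face G (Suc n) i (Tuple (h # hs)) = Tuple hs" for h hs
          using 1 False by (simp add: face_def Let_def)
        obtain Vs where Vs: "length Vs = n" "\<And>U. U \<in> set Vs \<Longrightarrow> openin (arrows G) U" "Tuple gs' \<in> boxed Vs" "boxed Vs \<subseteq> W"
          using nerve_boxed[OF W(1) _ False, of gs'] W(2) gs c fc by auto
        show ?thesis
        proof (intro exI[of _ "topspace (arrows G) # Vs"] conjI allI impI)
          show "list_all2 (\<in>) gs (topspace (arrows G) # Vs)"
            using Vs(3) gs(3) c by (auto simp: boxed_def chain_def)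
          fix hs assume hs: "chain hs" "list_all2 (\<in>) hs (topspace (arrows G) # Vs)"
          then obtain h hs' where "hs = h # hs'" "list_all2 (\<in>) hs' Vs" by (auto simp: list_all2_Cons2)
          then have "Tuple hs' \<in> boxed Vs" using hs chain_sub[of "[h]" hs'] by (auto simp: boxed_def)
          then show "face G (Suc n) i (Tuple hs) \<in> W" using Vs(4) fc \<open>hs = h # hs'\<close> by auto
        qed (use Vs in auto)
      next
        case 2
        obtain g gs' where c: "gs = gs' @ [g]" using gs by (cases gs rule: rev_cases) auto
        have fc: "face G (Suc n) i (Tuple (hs @ [h])) = Tuple hs" for h hs
          using 2 False by (simp add: face_def Let_def)
        obtain Vs where Vs: "length Vs = n" "\<And>U. U \<in> set Vs \<Longrightarrow> openin (arrows G) U" "Tuple gs' \<in> boxed Vs" "boxed Vs \<subseteq> W"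
          using nerve_boxed[OF W(1) _ False, of gs'] W(2) gs c fc by auto
        show ?thesis
        proof (intro exI[of _ "Vs @ [topspace (arrows G)]"] conjI allI impI)
          show "list_all2 (\<in>) gs (Vs @ [topspace (arrows G)])"
            using Vs(3) gs(3) c by (auto simp: boxed_def chain_def intro!: list_all2_appendI)
          fix hs assume hs: "chain hs" "list_all2 (\<in>) hs (Vs @ [topspace (arrows G)])"
          then obtain h hs' where e: "hs = hs' @ [h]" "list_all2 (\<in>) hs' Vs"
            by (auto simp: list_all2_append2 list_all2_Cons2)
          then have "Tuple hs' \<in> boxed Vs" using hs chain_sub[of hs' "[h]"] by (auto simp: boxed_def)
          then show "face G (Suc n) i (Tuple hs) \<in> W" using Vs(4) fc e by auto
        qed (use Vs in auto)
      next
        case 3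
        obtain xs g h ys where e: "gs = xs @ [g, h] @ ys" "length xs = i - 1" using split_inner[OF gs(2) 3] .
        have fc: "face G (Suc n) i (Tuple (xs @ [g, h] @ ys)) = Tuple (xs @ [gcomp G g h] @ ys)"
          if "length xs = i - 1" for xs g h ys
          using face_inner[OF that] 3 False by simp
        have gh: "g \<in> topspace (arrows G)" "h \<in> topspace (arrows G)" "gsource G g = grange G h"
          using gs(3) e by (auto simp: chain_def successively_append_iff)
        obtain Vs where Vs: "length Vs = n" "\<And>U. U \<in> set Vs \<Longrightarrow> openin (arrows G) U"
          "Tuple (xs @ [gcomp G g h] @ ys) \<in> boxed Vs" "boxed Vs \<subseteq> W"
          using nerve_boxed[OF W(1) _ False] W(2) gs e fc by metis
        then obtain Vx V Vy where V: "Vs = Vx @ V # Vy" "list_all2 (\<in>) xs Vx" "gcomp G g h \<in> V" "list_all2 (\<in>) ys Vy"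
          by (auto simp: boxed_def list_all2_append1 list_all2_Cons1)
        obtain A B where AB: "openin (arrows G) A" "openin (arrows G) B" "g \<in> A" "h \<in> B"
          "\<forall>g'\<in>A. \<forall>h'\<in>B. gsource G g' = grange G h' \<longrightarrow> gcomp G g' h' \<in> V"
          using gcomp_continuous[OF gh, of V] V Vs(2) by auto
        show ?thesis
        proof (intro exI[of _ "Vx @ [A, B] @ Vy"] conjI allI impI)
          show "list_all2 (\<in>) gs (Vx @ [A, B] @ Vy)"
            using e V AB by (auto intro!: list_all2_appendI)
          show "length (Vx @ [A, B] @ Vy) = Suc n" using V Vs(1) by simp
          show "\<forall>U\<in>set (Vx @ [A, B] @ Vy). openin (arrows G) U" using V AB Vs(2) by auto
          fix hs assume hs: "chain hs" "list_all2 (\<in>) hs (Vx @ [A, B] @ Vy)"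
          then obtain xs' g' h' ys' where e': "hs = xs' @ [g', h'] @ ys'" "list_all2 (\<in>) xs' Vx"
            "g' \<in> A" "h' \<in> B" "list_all2 (\<in>) ys' Vy"
            by (auto simp: list_all2_append2 list_all2_Cons2)
          have l: "length xs' = i - 1" using e' V e list_all2_lengthD by metis
          have "gsource G g' = grange G h'" using hs(1) e' by (auto simp: chain_def successively_append_iff)
          then have "gcomp G g' h' \<in> V" using AB e' by blast
          then have "Tuple (xs' @ [gcomp G g' h'] @ ys') \<in> boxed Vs"
            using hs(1) e' V chain_gcomp[of xs' g' h' ys'] by (auto simp: boxed_def intro!: list_all2_appendI)
          then show "face G (Suc n) i (Tuple hs) \<in> W" using Vs(4) fc[OF l] e' by auto
        qed
      qed
    qed
    then obtain Us where Us: "length Us = Suc n" "\<forall>U\<in>set Us. openin (arrows G) U" "list_all2 (\<in>) gs Us"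
      "\<And>hs. chain hs \<Longrightarrow> list_all2 (\<in>) hs Us \<Longrightarrow> face G (Suc n) i (Tuple hs) \<in> W" by blast
    have "Us \<noteq> []" using Us(1) by auto
    then have "openin (nerve G (Suc n)) (boxed Us)" using openin_boxed[of Us] Us by simp
    then show ?thesis
      using Us gs by (intro exI[of _ "boxed Us"]) (auto simp: boxed_def)
  qed
qed

text \<open>Face 0 keeps the last vertex and all other faces keep the first, so composed with that
  vertex map a face is again a vertex map; \<open>etale_cancel\<close> does the rest.\<close>

lemma etale_face:
  assumes i: "i \<le> Suc n" shows "etale (nerve G (Suc n)) (nerve G n) (face G (Suc n) i)"
proof (cases "i = 0")
  case True
  have "etale (nerve G (Suc n)) (units G) (last_vertex \<circ> face G (Suc n) i)"
    by (rule etale_cong[OF etale_last_vertex]) (use face_vertex(2)[OF _ i] True in simp)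
  then show ?thesis using etale_cancel[OF _ etale_last_vertex continuous_face[OF i]] by blast
next
  case False
  have "etale (nerve G (Suc n)) (units G) (first_vertex \<circ> face G (Suc n) i)"
    by (rule etale_cong[OF etale_first_vertex]) (use face_vertex(1)[OF _ i] False in simp)
  then show ?thesis using etale_cancel[OF _ etale_first_vertex continuous_face[OF i]] by blast
qed

end

section \<open>The Deaconu-Renault groupoid is etale\<close>

lemma Nk_0: "0 \<in> Nk k" by (simp add: Nk_def)

lemma Nk_add: "p \<in> Nk k \<Longrightarrow> q \<in> Nk k \<Longrightarrow> p + q \<in> Nk k"
  using keys_add[of p q] by (auto simp: Nk_def)

lemma lookup_nk_diff: "Poly_Mapping.lookup (nk_diff p q) i = int (Poly_Mapping.lookup p i) - int (Poly_Mapping.lookup q i)"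
  by (simp add: nk_diff_def lookup_minus Poly_Mapping.map.rep_eq when_def)

lemma nk_diff_in: "p \<in> Nk k \<Longrightarrow> q \<in> Nk k \<Longrightarrow> nk_diff p q \<in> carrier (Zk k)"
proof -
  assume pq: "p \<in> Nk k" "q \<in> Nk k"
  have "i \<in> {1..k}" if "i \<in> Poly_Mapping.keys (nk_diff p q)" for i
  proof -
    have "Poly_Mapping.lookup p i \<noteq> 0 \<or> Poly_Mapping.lookup q i \<noteq> 0"
      using that by (auto simp: in_keys_iff lookup_nk_diff)
    then have "i \<in> Poly_Mapping.keys p \<or> i \<in> Poly_Mapping.keys q" by (simp add: in_keys_iff)
    then show ?thesis using pq unfolding Nk_def by blast
  qed
  then show ?thesis unfolding carrier_Zk by blast
qed

lemma nk_diff_add: "nk_diff (p + p') (q + q') = nk_diff p q + nk_diff p' q'"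
  by (rule poly_mapping_eqI) (simp add: lookup_nk_diff lookup_add)

lemma nk_diff_eqD: "nk_diff p q = nk_diff p' q' \<Longrightarrow> p + q' = p' + q"
proof (rule poly_mapping_eqI)
  fix i assume "nk_diff p q = nk_diff p' q'"
  then have "Poly_Mapping.lookup (nk_diff p q) i = Poly_Mapping.lookup (nk_diff p' q') i" by simp
  then show "Poly_Mapping.lookup (p + q') i = Poly_Mapping.lookup (p' + q) i" by (simp add: lookup_nk_diff lookup_add)
qed

lemma nk_diff_0 [simp]: "nk_diff 0 0 = 0"
  by (rule poly_mapping_eqI) (simp add: lookup_nk_diff)

locale dr_action =
  fixes k :: nat and X :: "'a topology" and \<sigma> :: "nvec \<Rightarrow> 'a \<Rightarrow> 'a"
  assumes action: "Nk_action k X \<sigma>" and Hausdorff: "Hausdorff_space X"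
begin

abbreviation G :: "('a, 'a \<times> zvec \<times> 'a) groupoid" where "G \<equiv> DR_groupoid k X \<sigma>"

lemma \<sigma>_0: "x \<in> topspace X \<Longrightarrow> \<sigma> 0 x = x"
  and \<sigma>_add: "p \<in> Nk k \<Longrightarrow> q \<in> Nk k \<Longrightarrow> x \<in> topspace X \<Longrightarrow> \<sigma> (p + q) x = \<sigma> p (\<sigma> q x)"
  and \<sigma>_etale: "p \<in> Nk k \<Longrightarrow> etale X X (\<sigma> p)"
  using action by (auto simp: Nk_action_def local_homeomorphism_imp_etale)

lemma \<sigma>_in: "p \<in> Nk k \<Longrightarrow> x \<in> topspace X \<Longrightarrow> \<sigma> p x \<in> topspace X"
  using etale_in[OF \<sigma>_etale] .

lemma DR_simps: "units G = X" "grange G (x, n, y) = x" "gsource G (x, n, y) = y"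
  "gcomp G (x, m, y) (y', n, z) = (x, m + n, z)"
  by (simp_all add: DR_groupoid_def)

definition basic :: "'a set \<Rightarrow> nvec \<Rightarrow> nvec \<Rightarrow> 'a set \<Rightarrow> bool" where
  "basic U p q V \<longleftrightarrow> openin X U \<and> openin X V \<and> p \<in> Nk k \<and> q \<in> Nk k"

lemma mem_DR_basic_open:
  "(x, n, y) \<in> DR_basic_open \<sigma> U p q V \<longleftrightarrow> n = nk_diff p q \<and> x \<in> U \<and> y \<in> V \<and> \<sigma> p x = \<sigma> q y"
  by (auto simp: DR_basic_open_def)

text \<open>One arrow can be presented by (p, q) and by (p', q') with p + q' = p' + q. For nearby u,
  v with \<open>\<sigma> p u = \<sigma> q v\<close> this gives
  \<open>\<sigma> p (\<sigma> p' u) = \<sigma> p (\<sigma> q' v)\<close>, and local injectivity of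
  \<open>\<sigma> p\<close> cancels the outer map. So the generating sets form a base.\<close>

lemma basic_refine:
  assumes B: "basic U p q V" "basic U' p' q' V'"
    and g: "(x, n, y) \<in> DR_basic_open \<sigma> U p q V" "(x, n, y) \<in> DR_basic_open \<sigma> U' p' q' V'"
  shows "\<exists>U'' V''. basic U'' p q V'' \<and> (x, n, y) \<in> DR_basic_open \<sigma> U'' p q V'' \<and>
    DR_basic_open \<sigma> U'' p q V'' \<subseteq> DR_basic_open \<sigma> U p q V \<inter> DR_basic_open \<sigma> U' p' q' V'"
proof -
  have Nk: "p \<in> Nk k" "q \<in> Nk k" "p' \<in> Nk k" "q' \<in> Nk k" using B by (auto simp: basic_def)
  have n: "n = nk_diff p q" "n = nk_diff p' q'" using g by (auto simp: mem_DR_basic_open)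
  then have pq: "q + p' = p + q'" using nk_diff_eqD[of p q p' q'] by (simp add: add.commute)
  have UV: "U \<subseteq> topspace X" "V \<subseteq> topspace X" using B openin_subset by (auto simp: basic_def)
  have xy: "x \<in> topspace X" "y \<in> topspace X" using g UV by (auto simp: mem_DR_basic_open)
  obtain W where W: "openin X W" "\<sigma> p' x \<in> W" "inj_on (\<sigma> p) W"
    using etale_inj[OF \<sigma>_etale[OF Nk(1)] \<sigma>_in[OF Nk(3) xy(1)]] by blast
  define U'' where "U'' = U \<inter> U' \<inter> {x \<in> topspace X. \<sigma> p' x \<in> W}"
  define V'' where "V'' = V \<inter> V' \<inter> {y \<in> topspace X. \<sigma> q' y \<in> W}"
  have "basic U'' p q V''"
    using B W(1) openin_vimage[OF etale_continuous[OF \<sigma>_etale]] Nk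
    by (auto simp: basic_def U''_def V''_def intro!: openin_Int)
  moreover have "(x, n, y) \<in> DR_basic_open \<sigma> U'' p q V''"
    using g W(2) xy by (auto simp: mem_DR_basic_open U''_def V''_def)
  moreover have "DR_basic_open \<sigma> U'' p q V'' \<subseteq> DR_basic_open \<sigma> U p q V \<inter> DR_basic_open \<sigma> U' p' q' V'"
  proof
    fix g assume "g \<in> DR_basic_open \<sigma> U'' p q V''"
    then obtain u v where uv: "g = (u, n, v)" "u \<in> U''" "v \<in> V''" "\<sigma> p u = \<sigma> q v"
      using n by (cases g) (auto simp: mem_DR_basic_open)
    have t: "u \<in> topspace X" "v \<in> topspace X" using uv UV by (auto simp: U''_def V''_def)
    have "\<sigma> p (\<sigma> p' u) = \<sigma> p' (\<sigma> p u)" using \<sigma>_add[of p p' u] \<sigma>_add[of p' p u] Nk t by (simp add: add.commute)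
    also have "\<dots> = \<sigma> (q + p') v" using \<sigma>_add[of p' q v] uv(4) Nk t by (simp add: add.commute)
    also have "\<dots> = \<sigma> p (\<sigma> q' v)" using \<sigma>_add[of p q' v] pq Nk t by simp
    finally have "\<sigma> p' u = \<sigma> q' v" using W(3) uv by (auto simp: inj_on_def U''_def V''_def)
    then show "g \<in> DR_basic_open \<sigma> U p q V \<inter> DR_basic_open \<sigma> U' p' q' V'"
      using uv n by (auto simp: mem_DR_basic_open U''_def V''_def)
  qed
  ultimately show ?thesis by blast
qed

lemma openin_basic: "basic U p q V \<Longrightarrow> openin (arrows G) (DR_basic_open \<sigma> U p q V)"
  by (auto simp: DR_groupoid_def basic_def intro!: topology_generated_by_Basis)

lemma openin_arrowsD:
  assumes "openin (arrows G) S" "g \<in> S"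
  shows "\<exists>U p q V. basic U p q V \<and> g \<in> DR_basic_open \<sigma> U p q V \<and> DR_basic_open \<sigma> U p q V \<subseteq> S"
proof -
  have "generate_topology_on {DR_basic_open \<sigma> U p q V | U p q V.
      openin X U \<and> openin X V \<and> p \<in> Nk k \<and> q \<in> Nk k} S"
    using assms(1) by (simp add: DR_groupoid_def openin_topology_generated_by_iff)
  then show ?thesis using assms(2)
  proof (induction S arbitrary: g)
    case (Int S T)
    obtain x n y where g: "g = (x, n, y)" by (cases g) auto
    obtain U p q V where 1: "basic U p q V" "g \<in> DR_basic_open \<sigma> U p q V" "DR_basic_open \<sigma> U p q V \<subseteq> S"
      using Int by blast
    obtain U' p' q' V' where 2: "basic U' p' q' V'" "g \<in> DR_basic_open \<sigma> U' p' q' V'" "DR_basic_open \<sigma> U' p' q' V' \<subseteq> T"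
      using Int by blast
    show ?case using basic_refine[OF 1(1) 2(1)] 1 2 unfolding g by (meson Int_mono order_trans)
  next
    case (UN K)
    then obtain S where "S \<in> K" "g \<in> S" by blast
    with UN obtain U p q V where "basic U p q V" "g \<in> DR_basic_open \<sigma> U p q V" "DR_basic_open \<sigma> U p q V \<subseteq> S"
      by meson
    then show ?case using \<open>S \<in> K\<close> by blast
  next
    case (Basis S)
    then show ?case by (auto simp: basic_def)
  qed simp
qed

text \<open>A basic neighbourhood inside S is intersected with the largest basic set for the wanted
  exponents; \<open>basic_refine\<close> keeps the exponents of its first argument.\<close>

lemma basic_neighbourhood:
  assumes S: "openin (arrows G) S" "(x, nk_diff p q, y) \<in> S"
    and pq: "p \<in> Nk k" "q \<in> Nk k" "\<sigma> p x = \<sigma> q y" "x \<in> topspace X" "y \<in> topspace X"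
  shows "\<exists>U V. basic U p q V \<and> x \<in> U \<and> y \<in> V \<and> DR_basic_open \<sigma> U p q V \<subseteq> S"
proof -
  obtain U' p' q' V' where 2: "basic U' p' q' V'" "(x, nk_diff p q, y) \<in> DR_basic_open \<sigma> U' p' q' V'"
    "DR_basic_open \<sigma> U' p' q' V' \<subseteq> S" using openin_arrowsD[OF S] by blast
  have 1: "basic (topspace X) p q (topspace X)" using pq by (simp add: basic_def)
  have "(x, nk_diff p q, y) \<in> DR_basic_open \<sigma> (topspace X) p q (topspace X)"
    using pq by (simp add: mem_DR_basic_open)
  from basic_refine[OF 1 2(1) this 2(2)] obtain U V where UV: "basic U p q V" "(x, nk_diff p q, y) \<in> DR_basic_open \<sigma> U p q V"
    "DR_basic_open \<sigma> U p q V \<subseteq> S" using 2(3) by blast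
  then have "x \<in> U" "y \<in> V" by (simp_all add: mem_DR_basic_open)
  then show ?thesis using UV by blast
qed

lemma mem_arrows:
  "(x, n, y) \<in> topspace (arrows G) \<longleftrightarrow>
    (\<exists>p\<in>Nk k. \<exists>q\<in>Nk k. n = nk_diff p q \<and> \<sigma> p x = \<sigma> q y \<and> x \<in> topspace X \<and> y \<in> topspace X)"
proof
  assume "(x, n, y) \<in> topspace (arrows G)"
  then obtain U p q V where "basic U p q V" "(x, n, y) \<in> DR_basic_open \<sigma> U p q V"
    using openin_arrowsD[OF openin_topspace] by blast
  then show "\<exists>p\<in>Nk k. \<exists>q\<in>Nk k. n = nk_diff p q \<and> \<sigma> p x = \<sigma> q y \<and> x \<in> topspace X \<and> y \<in> topspace X"
  proof -
    assume B: "basic U p q V" and g: "(x, n, y) \<in> DR_basic_open \<sigma> U p q V"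
    have "U \<subseteq> topspace X" "V \<subseteq> topspace X" using B by (simp_all add: basic_def openin_subset)
    then show ?thesis using B g by (auto simp: basic_def mem_DR_basic_open)
  qed
next
  assume "\<exists>p\<in>Nk k. \<exists>q\<in>Nk k. n = nk_diff p q \<and> \<sigma> p x = \<sigma> q y \<and> x \<in> topspace X \<and> y \<in> topspace X"
  then obtain p q where pq: "p \<in> Nk k" "q \<in> Nk k" "n = nk_diff p q" "\<sigma> p x = \<sigma> q y" "x \<in> topspace X" "y \<in> topspace X"
    by blast
  have "openin (arrows G) (DR_basic_open \<sigma> (topspace X) p q (topspace X))"
    by (rule openin_basic) (simp add: basic_def pq)
  moreover have "(x, n, y) \<in> DR_basic_open \<sigma> (topspace X) p q (topspace X)"
    using pq by (simp add: mem_DR_basic_open)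
  ultimately show "(x, n, y) \<in> topspace (arrows G)" using openin_subset by blast
qed

lemma basic_whole:
  assumes "g \<in> topspace (arrows G)"
  obtains x p q y where "p \<in> Nk k" "q \<in> Nk k" "g = (x, nk_diff p q, y)" "x \<in> topspace X" "y \<in> topspace X" "\<sigma> p x = \<sigma> q y"
  using assms by (cases g) (auto simp: mem_arrows)

lemma cocycle_locally_constant:
  assumes "g \<in> topspace (arrows G)"
  shows "\<exists>U. openin (arrows G) U \<and> g \<in> U \<and> (\<forall>h\<in>U. DR_cocycle h = DR_cocycle g)"
proof -
  obtain x p q y where g: "p \<in> Nk k" "q \<in> Nk k" "g = (x, nk_diff p q, y)" "x \<in> topspace X" "y \<in> topspace X" "\<sigma> p x = \<sigma> q y"
    using basic_whole[OF assms] .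
  let ?B = "DR_basic_open \<sigma> (topspace X) p q (topspace X)"
  have "openin (arrows G) ?B" by (rule openin_basic) (simp add: basic_def g)
  moreover have "g \<in> ?B" "\<forall>h\<in>?B. DR_cocycle h = DR_cocycle g"
    using g by (auto simp: mem_DR_basic_open DR_cocycle_def)
  ultimately show ?thesis by blast
qed

lemma grange_basic: "grange G ` DR_basic_open \<sigma> U p q V = {x \<in> U. \<sigma> p x \<in> \<sigma> q ` V}"
proof (intro equalityI subsetI)
  fix x assume "x \<in> {x \<in> U. \<sigma> p x \<in> \<sigma> q ` V}"
  then obtain v where "x \<in> U" "v \<in> V" "\<sigma> p x = \<sigma> q v" by auto
  then show "x \<in> grange G ` DR_basic_open \<sigma> U p q V"
    by (intro image_eqI[of _ _ "(x, nk_diff p q, v)"]) (simp_all add: mem_DR_basic_open DR_simps)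
qed (auto simp: DR_basic_open_def DR_simps)

text \<open>On the basic set given by p, q and V the range is injective once
  \<open>\<sigma> q\<close> is injective on V, since the source y solves
  \<open>\<sigma> q y = \<sigma> p x\<close>. The range image of a basic set is described by
  \<open>grange_basic\<close> and is open.\<close>

lemma grange_etale_DR: "etale (arrows G) X (grange G)"
  unfolding etale_def
proof (intro conjI ballI)
  show "continuous_map (arrows G) X (grange G)"
  proof (rule continuous_map_localI)
    show "grange G \<in> topspace (arrows G) \<rightarrow> topspace X"
    proof
      fix g assume "g \<in> topspace (arrows G)"
      then show "grange G g \<in> topspace X" by (cases g) (auto simp: mem_arrows DR_simps)
    qed
    fix g W assume g: "g \<in> topspace (arrows G)" "openin X W" "grange G g \<in> W"
    obtain x p q y where pq: "p \<in> Nk k" "q \<in> Nk k" "g = (x, nk_diff p q, y)" "x \<in> topspace X" "y \<in> topspace X" "\<sigma> p x = \<sigma> q y"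
      using basic_whole[OF g(1)] .
    have "openin (arrows G) (DR_basic_open \<sigma> W p q (topspace X))"
      by (rule openin_basic) (simp add: basic_def pq g)
    moreover have "g \<in> DR_basic_open \<sigma> W p q (topspace X)" "grange G ` DR_basic_open \<sigma> W p q (topspace X) \<subseteq> W"
      using pq g by (auto simp: mem_DR_basic_open DR_simps DR_basic_open_def)
    ultimately show "\<exists>U. openin (arrows G) U \<and> g \<in> U \<and> grange G ` U \<subseteq> W" by blast
  qed
  show "open_map (arrows G) X (grange G)"
    unfolding open_map_def
  proof (intro allI impI)
    fix S assume S: "openin (arrows G) S"
    show "openin X (grange G ` S)"
    proof (subst openin_subopen, intro ballI)
      fix x assume "x \<in> grange G ` S"
      then obtain n y where g: "(x, n, y) \<in> S" by (auto simp: DR_groupoid_def)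
      then obtain U p q V where B: "basic U p q V" "(x, n, y) \<in> DR_basic_open \<sigma> U p q V" "DR_basic_open \<sigma> U p q V \<subseteq> S"
        using openin_arrowsD[OF S] by blast
      have nk: "p \<in> Nk k" "q \<in> Nk k" and op: "openin X U" "openin X V" using B(1) by (simp_all add: basic_def)
      have "openin X (U \<inter> {x \<in> topspace X. \<sigma> p x \<in> \<sigma> q ` V})"
        by (intro openin_Int op openin_vimage[OF etale_continuous[OF \<sigma>_etale]] etale_open[OF \<sigma>_etale] nk)
      moreover have "U \<inter> {x \<in> topspace X. \<sigma> p x \<in> \<sigma> q ` V} = grange G ` DR_basic_open \<sigma> U p q V"
        unfolding grange_basic using openin_subset[OF op(1)] openin_subset[OF op(2)] by blast
      moreover have "x \<in> grange G ` DR_basic_open \<sigma> U p q V"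
        unfolding grange_basic using B(2) by (auto simp: mem_DR_basic_open)
      moreover have "grange G ` DR_basic_open \<sigma> U p q V \<subseteq> grange G ` S" using B(3) by blast
      ultimately show "\<exists>T. openin X T \<and> x \<in> T \<and> T \<subseteq> grange G ` S" by metis
    qed
  qed
  fix g assume g: "g \<in> topspace (arrows G)"
  obtain x p q y where pq: "p \<in> Nk k" "q \<in> Nk k" "g = (x, nk_diff p q, y)" "x \<in> topspace X" "y \<in> topspace X" "\<sigma> p x = \<sigma> q y"
    using basic_whole[OF g] .
  obtain V where V: "openin X V" "y \<in> V" "inj_on (\<sigma> q) V" using etale_inj[OF \<sigma>_etale[OF pq(2)] pq(5)] by blast
  have "openin (arrows G) (DR_basic_open \<sigma> (topspace X) p q V)"
    by (rule openin_basic) (simp add: basic_def pq V)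
  moreover have "g \<in> DR_basic_open \<sigma> (topspace X) p q V" using pq V by (simp add: mem_DR_basic_open)
  moreover have "inj_on (grange G) (DR_basic_open \<sigma> (topspace X) p q V)"
    using V(3) by (auto simp: inj_on_def DR_basic_open_def DR_simps)
  ultimately show "\<exists>U. openin (arrows G) U \<and> g \<in> U \<and> inj_on (grange G) U" by blast
qed

text \<open>Inversion of arrows, which carries etaleness from the range map over to the source
  map.\<close>

definition flip :: "'a \<times> zvec \<times> 'a \<Rightarrow> 'a \<times> zvec \<times> 'a" where
  "flip = (\<lambda>(x, n, y). (y, - n, x))"

lemma mem_flip: "flip g \<in> DR_basic_open \<sigma> U p q V \<longleftrightarrow> g \<in> DR_basic_open \<sigma> V q p U"
proof -
  obtain x n y where g: "g = (x, n, y)" by (cases g) auto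
  have "nk_diff p q = - nk_diff q p" by (simp add: nk_diff_def)
  then have "- n = nk_diff p q \<longleftrightarrow> n = nk_diff q p" by (simp only: neg_equal_iff_equal)
  then show ?thesis by (auto simp: g flip_def mem_DR_basic_open)
qed

lemma flip_in: assumes "g \<in> topspace (arrows G)" shows "flip g \<in> topspace (arrows G)"
proof -
  obtain x p q y where g: "p \<in> Nk k" "q \<in> Nk k" "g = (x, nk_diff p q, y)" "x \<in> topspace X" "y \<in> topspace X" "\<sigma> p x = \<sigma> q y"
    using basic_whole[OF assms] .
  have f: "flip g = (y, nk_diff q p, x)" by (simp add: g(3) flip_def nk_diff_def)
  show ?thesis unfolding f mem_arrows by (intro bexI[of _ q] bexI[of _ p] conjI refl g g(6)[symmetric])
qed

lemma flip_flip: "flip (flip g) = g"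
  by (cases g) (simp add: flip_def)

lemma flip_homeo: "homeomorphic_maps (arrows G) (arrows G) flip flip"
proof -
  have "continuous_map (arrows G) (arrows G) flip"
  proof (rule continuous_map_localI)
    fix g W assume W: "openin (arrows G) W" "flip g \<in> W"
    then obtain U p q V where B: "basic U p q V" "flip g \<in> DR_basic_open \<sigma> U p q V" "DR_basic_open \<sigma> U p q V \<subseteq> W"
      using openin_arrowsD by blast
    have "openin (arrows G) (DR_basic_open \<sigma> V q p U)" using B(1) by (intro openin_basic) (simp add: basic_def)
    moreover have "g \<in> DR_basic_open \<sigma> V q p U" using B(2) by (simp only: mem_flip)
    moreover have "flip ` DR_basic_open \<sigma> V q p U \<subseteq> W"
    proof (rule image_subsetI)
      fix h assume "h \<in> DR_basic_open \<sigma> V q p U"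
      then have "flip h \<in> DR_basic_open \<sigma> U p q V" by (simp only: mem_flip)
      then show "flip h \<in> W" using B(3) by blast
    qed
    ultimately show "\<exists>T. openin (arrows G) T \<and> g \<in> T \<and> flip ` T \<subseteq> W" by blast
  qed (use flip_in in blast)
  then show ?thesis by (simp add: homeomorphic_maps_def flip_flip)
qed

lemma gsource_etale_DR: "etale (arrows G) X (gsource G)"
  by (rule etale_cong[OF etale_comp[OF homeomorphic_maps_etale[OF flip_homeo] grange_etale_DR]])
    (auto simp: flip_def DR_simps)

text \<open>The exponents add: applying p' to the first relation and q to the second makes both pass
  through \<open>\<sigma> (q + p') y\<close>.\<close>

lemma gcomp_DR:
  assumes "g \<in> topspace (arrows G)" "h \<in> topspace (arrows G)" "gsource G g = grange G h"
  obtains x p q y p' q' z where "p \<in> Nk k" "q \<in> Nk k" "p' \<in> Nk k" "q' \<in> Nk k"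
    "x \<in> topspace X" "y \<in> topspace X" "z \<in> topspace X" "\<sigma> p x = \<sigma> q y" "\<sigma> p' y = \<sigma> q' z"
    "g = (x, nk_diff p q, y)" "h = (y, nk_diff p' q', z)"
    "gcomp G g h = (x, nk_diff (p + p') (q + q'), z)" "\<sigma> (p + p') x = \<sigma> (q + q') z"
proof -
  obtain x p q y where g: "p \<in> Nk k" "q \<in> Nk k" "g = (x, nk_diff p q, y)" "x \<in> topspace X" "y \<in> topspace X" "\<sigma> p x = \<sigma> q y"
    using basic_whole[OF assms(1)] .
  obtain y' p' q' z where h: "p' \<in> Nk k" "q' \<in> Nk k" "h = (y', nk_diff p' q', z)" "y' \<in> topspace X" "z \<in> topspace X" "\<sigma> p' y' = \<sigma> q' z"
    using basic_whole[OF assms(2)] .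
  have y: "y' = y" using assms(3) g h by (simp add: DR_simps)
  have "\<sigma> (p + p') x = \<sigma> p' (\<sigma> p x)" using \<sigma>_add[of p' p x] g h by (simp add: add.commute)
  also have "\<dots> = \<sigma> q (\<sigma> p' y)" using \<sigma>_add[of p' q y] \<sigma>_add[of q p' y] g h by (simp add: add.commute)
  also have "\<dots> = \<sigma> (q + q') z" using \<sigma>_add[of q q' z] g h y by simp
  finally show thesis using that g h y by (simp add: DR_simps nk_diff_add)
qed

sublocale etale_groupoid G
proof
  show "Hausdorff_space (units G)" using Hausdorff by (simp add: DR_simps)
  show "etale (arrows G) (units G) (grange G)" "etale (arrows G) (units G) (gsource G)"
    using grange_etale_DR gsource_etale_DR by (simp_all add: DR_simps)
  show "Hausdorff_space (arrows G)"
    unfolding Hausdorff_space_def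
  proof (intro allI impI)
    fix g h assume gh: "g \<in> topspace (arrows G) \<and> h \<in> topspace (arrows G) \<and> g \<noteq> h"
    have sep: "\<exists>U V. openin (arrows G) U \<and> openin (arrows G) V \<and> g \<in> U \<and> h \<in> V \<and> disjnt U V"
      if f: "continuous_map (arrows G) X f" and ne: "f g \<noteq> f h" for f
    proof -
      have "f g \<in> topspace X" "f h \<in> topspace X" using gh continuous_map_funspace[OF f] by auto
      then obtain U V where "openin X U" "openin X V" "f g \<in> U" "f h \<in> V" "disjnt U V"
        using ne Hausdorff unfolding Hausdorff_space_def by metis
      then show ?thesis using gh openin_vimage[OF f]
        by (intro exI[of _ "{u \<in> topspace (arrows G). f u \<in> U}"] exI[of _ "{u \<in> topspace (arrows G). f u \<in> V}"])
          (auto simp: disjnt_def)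
    qed
    \<comment> \<open>Distinct arrows differ in range, source or degree: the first two are separated
      in X, the third by local constancy of the cocycle.\<close>
    consider "grange G g \<noteq> grange G h" | "gsource G g \<noteq> gsource G h" | "DR_cocycle g \<noteq> DR_cocycle h"
      using gh by (cases g; cases h) (auto simp: DR_simps DR_cocycle_def)
    then show "\<exists>U V. openin (arrows G) U \<and> openin (arrows G) V \<and> g \<in> U \<and> h \<in> V \<and> disjnt U V"
    proof cases
      case 3
      obtain U where U: "openin (arrows G) U" "g \<in> U" "\<forall>u\<in>U. DR_cocycle u = DR_cocycle g"
        using cocycle_locally_constant gh by blast
      obtain V where V: "openin (arrows G) V" "h \<in> V" "\<forall>u\<in>V. DR_cocycle u = DR_cocycle h"
        using cocycle_locally_constant gh by blast
      have "disjnt U V" unfolding disjnt_iff using U(3) V(3) 3 by metis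
      then show ?thesis using U V by blast
    qed (use sep[OF etale_continuous[OF grange_etale_DR]] sep[OF etale_continuous[OF gsource_etale_DR]] in auto)
  qed
  fix g h assume gh: "g \<in> topspace (arrows G)" "h \<in> topspace (arrows G)" "gsource G g = grange G h"
  obtain x p q y p' q' z where e: "p \<in> Nk k" "q \<in> Nk k" "p' \<in> Nk k" "q' \<in> Nk k"
    "x \<in> topspace X" "y \<in> topspace X" "z \<in> topspace X" "\<sigma> p x = \<sigma> q y" "\<sigma> p' y = \<sigma> q' z"
    "g = (x, nk_diff p q, y)" "h = (y, nk_diff p' q', z)"
    "gcomp G g h = (x, nk_diff (p + p') (q + q'), z)" "\<sigma> (p + p') x = \<sigma> (q + q') z"
    using gcomp_DR[OF gh] .
  show "gcomp G g h \<in> topspace (arrows G)"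
    unfolding e(12) mem_arrows
    by (intro bexI[of _ "p + p'"] bexI[of _ "q + q'"]) (simp_all add: e Nk_add)
  show "grange G (gcomp G g h) = grange G g" "gsource G (gcomp G g h) = gsource G h"
    using e by (simp_all add: DR_simps)
  fix W assume W: "openin (arrows G) W" "gcomp G g h \<in> W"
  obtain U V where UV: "basic U (p + p') (q + q') V" "x \<in> U" "z \<in> V" "DR_basic_open \<sigma> U (p + p') (q + q') V \<subseteq> W"
    using basic_neighbourhood[OF W(1), of x "p + p'" "q + q'" z] W(2) e Nk_add by auto
  let ?A = "DR_basic_open \<sigma> U p q (topspace X)" and ?B = "DR_basic_open \<sigma> (topspace X) p' q' V"
  have "openin (arrows G) ?A" "openin (arrows G) ?B"
    using e UV by (auto intro!: openin_basic simp: basic_def)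
  moreover have "g \<in> ?A" "h \<in> ?B" using e UV by (auto simp: mem_DR_basic_open)
  moreover have "gcomp G g' h' \<in> W" if A: "g' \<in> ?A" and B: "h' \<in> ?B" and c: "gsource G g' = grange G h'" for g' h'
  proof -
    have gt: "g' \<in> topspace (arrows G)" "h' \<in> topspace (arrows G)"
      using A B calculation(1,2) openin_subset by blast+
    obtain u v w where uvw: "g' = (u, nk_diff p q, v)" "h' = (v, nk_diff p' q', w)" "u \<in> U" "w \<in> V"
      "\<sigma> p u = \<sigma> q v" "\<sigma> p' v = \<sigma> q' w"
      using A B c by (auto simp: DR_basic_open_def DR_simps)
    have t: "u \<in> topspace X" "v \<in> topspace X" "w \<in> topspace X" using gt uvw by (auto simp: mem_arrows)
    have "\<sigma> (p + p') u = \<sigma> p' (\<sigma> p u)" using \<sigma>_add[of p' p u] e t by (simp add: add.commute)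
    also have "\<dots> = \<sigma> q (\<sigma> p' v)" using \<sigma>_add[of p' q v] \<sigma>_add[of q p' v] e t uvw by (simp add: add.commute)
    also have "\<dots> = \<sigma> (q + q') w" using \<sigma>_add[of q q' w] e t uvw by simp
    finally have "gcomp G g' h' \<in> DR_basic_open \<sigma> U (p + p') (q + q') V"
      using uvw by (simp add: DR_simps mem_DR_basic_open nk_diff_add)
    then show ?thesis using UV by blast
  qed
  ultimately show "\<exists>U V. openin (arrows G) U \<and> openin (arrows G) V \<and> g \<in> U \<and> h \<in> V \<and>
        (\<forall>g'\<in>U. \<forall>h'\<in>V. gsource G g' = grange G h' \<longrightarrow> gcomp G g' h' \<in> W)" by blast
qed

end

section \<open>Acyclicity of the skew product\<close>

lemma lookup_sum_single:
  "finite S \<Longrightarrow> Poly_Mapping.lookup (\<Sum>i\<in>S. Poly_Mapping.single i (f i)) j = (if j \<in> S then f j else 0)"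
  by (simp add: lookup_sum lookup_single when_def)

lemma Zk_lookup_outside: "a \<in> carrier (Zk k) \<Longrightarrow> i \<notin> {1..k} \<Longrightarrow> Poly_Mapping.lookup a i = 0"
  unfolding carrier_Zk by (metis in_keys_iff mem_Collect_eq subsetD)

lemma Nk_lookup_outside: "p \<in> Nk k \<Longrightarrow> i \<notin> {1..k} \<Longrightarrow> Poly_Mapping.lookup p i = 0"
  unfolding Nk_def by (metis in_keys_iff mem_Collect_eq subsetD)

lemma del_append: "length xs = i \<Longrightarrow> del i (xs @ y # ys) = xs @ ys"
  by (simp add: del_def)

lemma curry_inject: "curry f = curry g \<longleftrightarrow> f = g"
  by (metis case_prod_curry)

lemma groupoid_boundary_bd: "groupoid_boundary G (Suc n) f = bd (face G (Suc n)) (Suc n) f"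
  by (simp add: groupoid_boundary_def fun_eq_iff bd_apply pushforward_eq_push alt_sign_int)

fun walk :: "zvec \<Rightarrow> ('a \<times> zvec \<times> 'a) list \<Rightarrow> ('a \<times> zvec) list" where
  "walk a [] = []"
| "walk a ((x, m, y) # gs) = (y, a + m) # walk (a + m) gs"

text \<open>The vertices of a simplex in the nerve of the skew product, which is an equivalence relation
  on \<open>X \<times> \<int>\<^sup>k\<close>.\<close>

definition vertices :: "zvec \<Rightarrow> ('a, 'a \<times> zvec \<times> 'a) nerve_point \<Rightarrow> ('a \<times> zvec) list" where
  "vertices a z = (case z of Unit x \<Rightarrow> [(x, a)] | Tuple gs \<Rightarrow> (fst (hd gs), a) # walk a gs)"

lemma length_walk [simp]: "length (walk a gs) = length gs"
  by (induction a gs rule: walk.induct) auto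

lemma walk_append: "walk a (xs @ ys) = walk a xs @ walk (a + sum_list (map DR_cocycle xs)) ys"
  by (induction a xs rule: walk.induct) (auto simp: DR_cocycle_def add.assoc)

context dr_action
begin

lemma grange_fst: "grange G g = fst g" and gsource_snd: "gsource G g = snd (snd g)"
  by (cases g; simp add: DR_simps)+

text \<open>The nerve of the skew product is represented as Z^k times the nerve of G, the extra
  coordinate being the degree of the first vertex. Only face 0 removes that vertex.\<close>

definition skew_face ::
    "nat \<Rightarrow> nat \<Rightarrow> zvec \<times> ('a, 'a \<times> zvec \<times> 'a) nerve_point \<Rightarrow> zvec \<times> ('a, 'a \<times> zvec \<times> 'a) nerve_point" where
  "skew_face n i = (\<lambda>(a, z). (if i = 0 then a + DR_cocycle (hd (the_tuple z)) else a, face G n i z))"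

lemma vertices_skew_face:
  assumes z: "z \<in> topspace (nerve G (Suc n))" and i: "i \<le> Suc n"
  shows "case_prod vertices (skew_face (Suc n) i (a, z)) = del i (vertices a z)"
proof -
  obtain gs where gs: "z = Tuple gs" "length gs = Suc n" "chain gs"
    using z by (auto simp: topspace_nerve composable_iff)
  show ?thesis
  proof (cases "n = 0")
    case True
    then obtain x m y where "gs = [(x, m, y)]" using gs by (cases gs) auto
    then show ?thesis using gs i True
      by (cases i) (auto simp: skew_face_def vertices_def face_1 DR_simps DR_cocycle_def)
  next
    case False
    consider "i = 0" | "i = Suc n" | "0 < i" "i < Suc n" using i by linarith
    then show ?thesis
    proof cases
      case 1
      obtain x m y gs' where c: "gs = (x, m, y) # gs'" using gs by (cases gs) auto
      then have "gs' \<noteq> []" using gs False by auto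
      then have "fst (hd gs') = y" using gs(3) c chain_Cons[of gs' "(x, m, y)"] by (simp add: gsource_snd grange_fst)
      then show ?thesis using 1 gs c False
        by (simp add: skew_face_def vertices_def face_def Let_def DR_cocycle_def)
    next
      case 2
      obtain x m y gs' where c: "gs = gs' @ [(x, m, y)]" using gs by (cases gs rule: rev_cases) auto
      then have ne: "gs' \<noteq> []" and l: "length gs' = n" using gs False by auto
      have "vertices a z = ((fst (hd gs'), a) # walk a gs') @ [(y, a + sum_list (map DR_cocycle gs') + m)]"
        using gs c ne by (simp add: vertices_def walk_append)
      then have "del i (vertices a z) = (fst (hd gs'), a) # walk a gs'"
        using del_last[of "(fst (hd gs'), a) # walk a gs'"] 2 l by simp
      then show ?thesis using 2 gs c False
        by (simp add: skew_face_def vertices_def face_def Let_def)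
    next
      case 3
      obtain xs g h ys where e: "gs = xs @ [g, h] @ ys" "length xs = i - 1" using split_inner[OF gs(2) 3] .
      obtain x m y where g: "g = (x, m, y)" by (cases g) auto
      obtain y' m' w where h: "h = (y', m', w)" by (cases h) auto
      let ?b = "a + sum_list (map DR_cocycle xs)"
      have f: "face G (Suc n) i z = Tuple (xs @ [(x, m + m', w)] @ ys)"
        using face_inner[OF e(2) 3, of g h ys] gs e False g h by (simp add: DR_simps)
      have v: "vertices a z = ((fst (hd gs), a) # walk a xs) @ (y, ?b + m) # (w, ?b + m + m') # walk (?b + m + m') ys"
        using gs e g h by (simp add: vertices_def walk_append)
      have "del i (vertices a z) = ((fst (hd gs), a) # walk a xs) @ (w, ?b + m + m') # walk (?b + m + m') ys"
        unfolding v by (rule del_append) (use e 3 in simp)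
      moreover have "vertices a (Tuple (xs @ [(x, m + m', w)] @ ys))
          = ((fst (hd gs), a) # walk a xs) @ (w, ?b + m + m') # walk (?b + m + m') ys"
      proof -
        have "fst (hd gs) = fst (hd (xs @ [(x, m + m', w)] @ ys))" using e g by (cases xs) simp_all
        then show ?thesis by (simp add: vertices_def walk_append add.assoc)
      qed
      ultimately show ?thesis using f 3 by (simp add: skew_face_def)
    qed
  qed
qed

lemma length_vertices: "z \<in> topspace (nerve G n) \<Longrightarrow> length (vertices a z) = Suc n"
  by (cases "n = 0") (auto simp: topspace_nerve_0 topspace_nerve composable_iff vertices_def)

lemma hd_vertices: "hd (vertices a z) = (first_vertex z, a)"
  by (cases z) (auto simp: vertices_def first_vertex_def grange_fst)

lemma walk_inj:
  "chain gs \<Longrightarrow> chain hs \<Longrightarrow> length gs = length hs \<Longrightarrow> (gs \<noteq> [] \<Longrightarrow> fst (hd gs) = fst (hd hs)) \<Longrightarrow>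
    walk a gs = walk a hs \<Longrightarrow> gs = hs"
proof (induction gs arbitrary: a hs)
  case (Cons g gs)
  then obtain h hs' where hs: "hs = h # hs'" by (cases hs) auto
  obtain x m y where g: "g = (x, m, y)" by (cases g) auto
  obtain x' m' y' where h: "h = (x', m', y')" by (cases h) auto
  have eq: "x = x'" "y = y'" "m = m'" "walk (a + m) gs = walk (a + m) hs'" "length gs = length hs'"
    using Cons.prems hs g h by auto
  have "gs = hs'"
  proof (cases "gs = []")
    case False
    then have ne: "hs' \<noteq> []" using eq by auto
    show ?thesis
      using Cons.IH[of hs' "a + m"] Cons.prems(1,2) eq chain_Cons[OF False, of g] chain_Cons[OF ne, of h] g h hs
      by (simp add: gsource_snd grange_fst)
  qed (use eq in auto)
  then show ?case using hs g h eq by simp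
qed simp

text \<open>An arrow of the skew product is recovered from its end points: its degree is the
  difference of theirs.\<close>

lemma vertices_inj:
  assumes "z \<in> topspace (nerve G n)" "w \<in> topspace (nerve G n)" "vertices a z = vertices b w"
  shows "a = b" "z = w"
proof -
  show "a = b" using hd_vertices[of a z] hd_vertices[of b w] assms(3) by simp
  show "z = w"
  proof (cases "n = 0")
    case True
    then show ?thesis using assms by (auto simp: topspace_nerve_0 vertices_def)
  next
    case False
    then obtain gs hs where *: "z = Tuple gs" "w = Tuple hs" "chain gs" "chain hs" "length gs = length hs"
      using assms by (auto simp: topspace_nerve composable_iff)
    have "(fst (hd gs), a) # walk a gs = (fst (hd hs), a) # walk a hs"
      using assms(3) \<open>a = b\<close> unfolding * vertices_def by simp
    then show ?thesis using walk_inj[of gs hs a] * by simp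
  qed
qed

lemma skew_face_in: "z \<in> topspace (nerve G (Suc n)) \<Longrightarrow> i \<le> Suc n \<Longrightarrow> snd (skew_face (Suc n) i (a, z)) \<in> topspace (nerve G n)"
  by (simp add: skew_face_def face_in)

lemma skew_face_face:
  assumes z: "z \<in> topspace (nerve G (Suc (Suc n)))" and ij: "i < j" "j \<le> Suc (Suc n)"
  shows "skew_face (Suc n) i (skew_face (Suc (Suc n)) j (a, z))
    = skew_face (Suc n) (j - 1) (skew_face (Suc (Suc n)) i (a, z))"
proof -
  obtain b w where w: "skew_face (Suc (Suc n)) j (a, z) = (b, w)" by force
  obtain c v where v: "skew_face (Suc (Suc n)) i (a, z) = (c, v)" by force
  have in1: "w \<in> topspace (nerve G (Suc n))" "v \<in> topspace (nerve G (Suc n))"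
    using skew_face_in[OF z, of j a] skew_face_in[OF z, of i a] w v ij by auto
  obtain b' w' where w': "skew_face (Suc n) i (b, w) = (b', w')" by force
  obtain c' v' where v': "skew_face (Suc n) (j - 1) (c, v) = (c', v')" by force
  have in2: "w' \<in> topspace (nerve G n)" "v' \<in> topspace (nerve G n)"
    using skew_face_in[OF in1(1), of i b] skew_face_in[OF in1(2), of "j - 1" c] w' v' ij by auto
  have "vertices b' w' = del i (del j (vertices a z))"
    using vertices_skew_face[OF in1(1), of i b] vertices_skew_face[OF z, of j a] ij w w' by simp
  also have "\<dots> = del (j - 1) (del i (vertices a z))"
    by (rule del_del) (use ij length_vertices[OF z, of a] in auto)
  also have "\<dots> = vertices c' v'"
    using vertices_skew_face[OF in1(2), of "j - 1" c] vertices_skew_face[OF z, of i a] ij v v' by simp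
  finally show ?thesis using vertices_inj[OF in2] w v w' v' by simp
qed

section \<open>Flow to a common degree\<close>

definition below :: "int \<Rightarrow> zvec \<Rightarrow> bool" where
  "below N a \<longleftrightarrow> a \<in> carrier (Zk k) \<and> (\<forall>i\<in>{1..k}. Poly_Mapping.lookup a i \<le> N)"

definition corner :: "int \<Rightarrow> zvec" where
  "corner N = (\<Sum>i\<in>{1..k}. Poly_Mapping.single i N)"

text \<open>The exponent (N, ..., N) - a that carries degree a to \<open>corner N\<close>; under
  \<open>below N a\<close> the truncation by \<open>nat\<close> has no effect.\<close>

definition gap :: "int \<Rightarrow> zvec \<Rightarrow> nvec" where
  "gap N a = (\<Sum>i\<in>{1..k}. Poly_Mapping.single i (nat (N - Poly_Mapping.lookup a i)))"

lemma lookup_corner: "Poly_Mapping.lookup (corner N) i = (if i \<in> {1..k} then N else 0)"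
  by (simp add: corner_def lookup_sum_single)

lemma lookup_gap: "Poly_Mapping.lookup (gap N a) i = (if i \<in> {1..k} then nat (N - Poly_Mapping.lookup a i) else 0)"
  by (simp add: gap_def lookup_sum_single)

lemma corner_in: "corner N \<in> carrier (Zk k)"
  unfolding carrier_Zk by (auto simp: in_keys_iff lookup_corner split: if_splits)

lemma gap_in: "gap N a \<in> Nk k"
  unfolding Nk_def by (auto simp: in_keys_iff lookup_gap split: if_splits)

lemma nk_diff_gap: "below N a \<Longrightarrow> nk_diff 0 (gap N a) = a - corner N"
  by (rule poly_mapping_eqI)
    (auto simp: lookup_nk_diff lookup_gap lookup_minus lookup_corner below_def Zk_lookup_outside)

lemma below_exists: "a \<in> carrier (Zk k) \<Longrightarrow> \<exists>N. below N a"
proof -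
  assume a: "a \<in> carrier (Zk k)"
  have "Poly_Mapping.lookup a i \<le> (\<Sum>j\<in>{1..k}. \<bar>Poly_Mapping.lookup a j\<bar>)" if "i \<in> {1..k}" for i
    using member_le_sum[of i "{1..k}" "\<lambda>j. \<bar>Poly_Mapping.lookup a j\<bar>"] that by simp
  then have "below (\<Sum>j\<in>{1..k}. \<bar>Poly_Mapping.lookup a j\<bar>) a" unfolding below_def using a by blast
  then show ?thesis ..
qed

lemma below_mono: "below N a \<Longrightarrow> N \<le> N' \<Longrightarrow> below N' a"
  by (force simp: below_def)

text \<open>The two gaps exceed the gap of a + p by p and by q respectively. Hence
  \<open>\<sigma> p x = \<sigma> q y\<close> implies that (x, a) and (y, a + p - q) flow to the same
  point in degree N.\<close>

lemma gap_shift: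
  assumes "p \<in> Nk k" "q \<in> Nk k" "a \<in> carrier (Zk k)" "below N (a + nk_diff p 0)"
  shows "below N a" "below N (a + nk_diff p q)" "gap N a = gap N (a + nk_diff p 0) + p"
    "gap N (a + nk_diff p q) = gap N (a + nk_diff p 0) + q"
proof -
  have le: "Poly_Mapping.lookup a i + int (Poly_Mapping.lookup p i) \<le> N" if "i \<in> {1..k}" for i
    using assms(4) that by (auto simp: below_def lookup_add lookup_nk_diff)
  then have le': "Poly_Mapping.lookup a i \<le> N"
    "Poly_Mapping.lookup a i + (int (Poly_Mapping.lookup p i) - int (Poly_Mapping.lookup q i)) \<le> N"
    if "i \<in> {1..k}" for i
    using that by force+
  show "below N a" using le' assms(3) by (auto simp: below_def)
  show "below N (a + nk_diff p q)"
    using le' Zk_closed(3)[OF assms(3) nk_diff_in[OF assms(1,2)]] by (auto simp: below_def lookup_add lookup_nk_diff)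
  show "gap N a = gap N (a + nk_diff p 0) + p"
  proof (rule poly_mapping_eqI)
    fix i
    show "Poly_Mapping.lookup (gap N a) i = Poly_Mapping.lookup (gap N (a + nk_diff p 0) + p) i"
      using le[of i] assms(1) Nk_lookup_outside[of p k i]
      by (cases "i \<in> {1..k}") (auto simp: lookup_gap lookup_add lookup_nk_diff)
  qed
  show "gap N (a + nk_diff p q) = gap N (a + nk_diff p 0) + q"
  proof (rule poly_mapping_eqI)
    fix i
    show "Poly_Mapping.lookup (gap N (a + nk_diff p q)) i = Poly_Mapping.lookup (gap N (a + nk_diff p 0) + q) i"
      using le[of i] assms(2) Nk_lookup_outside[of q k i]
      by (cases "i \<in> {1..k}") (auto simp: lookup_gap lookup_add lookup_nk_diff)
  qed
qed

text \<open>The bound is imposed on a + p and not only on the ends a and a + p - q: the end points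
  of the arrow are known to meet only after p steps from the one and q steps from the other.\<close>

fun bounded :: "int \<Rightarrow> zvec \<Rightarrow> ('a \<times> zvec \<times> 'a) list \<Rightarrow> bool" where
  "bounded N a [] = True"
| "bounded N a ((x, m, y) # gs) \<longleftrightarrow>
    (\<exists>p\<in>Nk k. \<exists>q\<in>Nk k. m = nk_diff p q \<and> \<sigma> p x = \<sigma> q y \<and> below N (a + nk_diff p 0)) \<and> bounded N (a + m) gs"

text \<open>All vertices \<open>(y, b)\<close> of a good simplex have \<open>b \<le> N\<close> and the same image \<open>\<sigma>\<^sup>N\<^sup>-\<^sup>b y\<close>.\<close>

definition good :: "int \<Rightarrow> zvec \<Rightarrow> ('a, 'a \<times> zvec \<times> 'a) nerve_point \<Rightarrow> bool" where
  "good N a z \<longleftrightarrow> below N a \<and> (case z of Unit x \<Rightarrow> True | Tuple gs \<Rightarrow> bounded N a gs)"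

text \<open>Induction along the arrows, each of which preserves the flow image by
  \<open>gap_shift\<close>.\<close>

lemma bounded_walk:
  "chain gs \<Longrightarrow> gs \<noteq> [] \<Longrightarrow> a \<in> carrier (Zk k) \<Longrightarrow> bounded N a gs \<Longrightarrow> (y, b) \<in> set (walk a gs) \<Longrightarrow>
    below N b \<and> \<sigma> (gap N b) y = \<sigma> (gap N a) (fst (hd gs))"
proof (induction gs arbitrary: a)
  case (Cons g gs)
  obtain x m v where g: "g = (x, m, v)" by (cases g) auto
  obtain p q where pq: "p \<in> Nk k" "q \<in> Nk k" "m = nk_diff p q" "\<sigma> p x = \<sigma> q v" "below N (a + nk_diff p 0)"
    and gs: "bounded N (a + m) gs" using Cons.prems(4) g by auto
  have t: "x \<in> topspace X" "v \<in> topspace X" using Cons.prems(1) g by (auto simp: chain_def mem_arrows)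
  note s = gap_shift[OF pq(1,2) Cons.prems(3) pq(5)]
  have am: "a + m \<in> carrier (Zk k)" using s(2) pq(3) by (simp add: below_def)
  have head: "\<sigma> (gap N (a + m)) v = \<sigma> (gap N a) x"
    unfolding pq(3) s(3) s(4) using pq t by (simp add: \<sigma>_add gap_in)
  show ?case
  proof (cases "(y, b) = (v, a + m)")
    case True
    then show ?thesis using head s(2) pq(3) g by simp
  next
    case False
    then have yb: "(y, b) \<in> set (walk (a + m) gs)" using Cons.prems(5) g by auto
    then have ne: "gs \<noteq> []" by auto
    then have c: "chain gs" "fst (hd gs) = v"
      using Cons.prems(1) g chain_Cons[OF ne, of g] by (simp_all add: gsource_snd grange_fst)
    show ?thesis using Cons.IH[OF c(1) ne am gs yb] c(2) head g by simp
  qed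
qed simp

lemma good_vertices:
  assumes "z \<in> topspace (nerve G n)" "good N a z" "(y, b) \<in> set (vertices a z)"
  shows "below N b" "\<sigma> (gap N b) y = \<sigma> (gap N a) (first_vertex z)"
proof -
  have a: "below N a" "a \<in> carrier (Zk k)" using assms(2) by (auto simp: good_def below_def)
  have "below N b \<and> \<sigma> (gap N b) y = \<sigma> (gap N a) (first_vertex z)"
  proof (cases z)
    case (Unit x)
    then show ?thesis using assms a by (auto simp: vertices_def first_vertex_def)
  next
    case (Tuple gs)
    then have "n \<noteq> 0" using assms(1) by (cases "n = 0") (auto simp: topspace_nerve_0)
    then have gs: "chain gs" "gs \<noteq> []" using assms(1) Tuple by (auto simp: topspace_nerve composable_iff)
    show ?thesis
    proof (cases "(y, b) \<in> set (walk a gs)")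
      case True
      then show ?thesis
        using bounded_walk[OF gs a(2) _ True] assms(2) Tuple by (auto simp: good_def first_vertex_def grange_fst)
    next
      case False
      then show ?thesis using assms(3) a Tuple by (auto simp: vertices_def first_vertex_def grange_fst)
    qed
  qed
  then show "below N b" "\<sigma> (gap N b) y = \<sigma> (gap N a) (first_vertex z)" by auto
qed

lemma bounded_mono: "bounded N a gs \<Longrightarrow> N \<le> N' \<Longrightarrow> bounded N' a gs"
  by (induction N a gs rule: bounded.induct) (auto intro: below_mono)

lemma good_mono: "good N a z \<Longrightarrow> N \<le> N' \<Longrightarrow> good N' a z"
  by (auto simp: good_def intro: below_mono bounded_mono split: nerve_point.splits)

text \<open>A presentation (p, q) of an arrow is valid on a whole basic neighbourhood, so the
  finitely many arrows of the tuple yield one bound for all nearby tuples.\<close>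

lemma bounded_open:
  assumes "set gs \<subseteq> topspace (arrows G)" "a \<in> carrier (Zk k)"
  shows "\<exists>N Us. list_all2 (\<in>) gs Us \<and> (\<forall>U\<in>set Us. openin (arrows G) U) \<and>
    (\<forall>hs. list_all2 (\<in>) hs Us \<longrightarrow> bounded N a hs)"
  using assms
proof (induction gs arbitrary: a)
  case Nil
  then show ?case by (intro exI[of _ 0] exI[of _ "[]"]) auto
next
  case (Cons g gs)
  have gt: "g \<in> topspace (arrows G)" using Cons.prems(1) by auto
  obtain x p q y where g: "p \<in> Nk k" "q \<in> Nk k" "g = (x, nk_diff p q, y)" "x \<in> topspace X" "y \<in> topspace X" "\<sigma> p x = \<sigma> q y"
    using basic_whole[OF gt] .
  have am: "a + nk_diff p q \<in> carrier (Zk k)" "a + nk_diff p 0 \<in> carrier (Zk k)"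
    using Cons.prems(2) g by (auto intro: Zk_closed nk_diff_in Nk_0)
  obtain N Us where IH: "list_all2 (\<in>) gs Us" "\<forall>U\<in>set Us. openin (arrows G) U"
    "\<And>hs. list_all2 (\<in>) hs Us \<Longrightarrow> bounded N (a + nk_diff p q) hs"
    using Cons.IH[OF _ am(1)] Cons.prems(1) by auto
  obtain N' where N': "below N' (a + nk_diff p 0)" using below_exists[OF am(2)] ..
  let ?B = "DR_basic_open \<sigma> (topspace X) p q (topspace X)"
  have "bounded (max N N') a hs" if hs: "list_all2 (\<in>) hs (?B # Us)" for hs
  proof -
    obtain h hs' where h: "hs = h # hs'" "h \<in> ?B" "list_all2 (\<in>) hs' Us" using hs by (auto simp: list_all2_Cons2)
    obtain u v where "h = (u, nk_diff p q, v)" "\<sigma> p u = \<sigma> q v" using h(2) by (auto simp: DR_basic_open_def)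
    moreover have "below (max N N') (a + nk_diff p 0)" "bounded (max N N') (a + nk_diff p q) hs'"
      using below_mono[OF N'] bounded_mono[OF IH(3)[OF h(3)]] by auto
    ultimately show ?thesis using h(1) g(1,2) by auto
  qed
  moreover have "list_all2 (\<in>) (g # gs) (?B # Us)" using g IH(1) by (simp add: mem_DR_basic_open)
  moreover have "openin (arrows G) ?B" by (rule openin_basic) (simp add: basic_def g)
  ultimately show ?case using IH(2) by (intro exI[of _ "max N N'"] exI[of _ "?B # Us"]) auto
qed

lemma good_open:
  assumes z: "z \<in> topspace (nerve G n)" and a: "a \<in> carrier (Zk k)"
  shows "\<exists>N U. openin (nerve G n) U \<and> z \<in> U \<and> (\<forall>w\<in>U. good N a w)"
proof -
  obtain N where N: "below N a" using below_exists[OF a] ..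
  show ?thesis
  proof (cases "n = 0")
    case True
    have "good N a w" if "w \<in> topspace (nerve G n)" for w
      using that True N by (auto simp: topspace_nerve_0 good_def)
    then show ?thesis using z by (intro exI[of _ N] exI[of _ "topspace (nerve G n)"]) auto
  next
    case False
    then obtain gs where gs: "z = Tuple gs" "length gs = n" "chain gs"
      using z by (auto simp: topspace_nerve composable_iff)
    obtain N' Us where Us: "list_all2 (\<in>) gs Us" "\<forall>U\<in>set Us. openin (arrows G) U"
      "\<And>hs. list_all2 (\<in>) hs Us \<Longrightarrow> bounded N' a hs"
      using bounded_open[OF _ a, of gs] gs(3) by (auto simp: chain_def)
    have l: "length Us = n" using Us(1) gs(2) list_all2_lengthD by fastforce
    then have "Us \<noteq> []" using False by auto
    then have "openin (nerve G n) (boxed Us)" using openin_boxed[of Us] Us(2) l by simp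
    moreover have "z \<in> boxed Us" using gs Us(1) by (auto simp: boxed_def)
    moreover have "good (max N N') a w" if "w \<in> boxed Us" for w
      using that below_mono[OF N] bounded_mono[OF Us(3)] by (auto simp: boxed_def good_def)
    ultimately show ?thesis by blast
  qed
qed

abbreviation skew_space :: "nat \<Rightarrow> (zvec \<times> ('a, 'a \<times> zvec \<times> 'a) nerve_point) topology" where
  "skew_space n \<equiv> prod_topology (discrete_topology (carrier (Zk k))) (nerve G n)"

text \<open>Some N works on a neighbourhood of each point, and larger N still work; compactness of
  the support gives a common N.\<close>

lemma support_good:
  assumes F: "F \<in> carrier (Cc (skew_space n))"
  shows "\<exists>N. \<forall>a z. F (a, z) \<noteq> 0 \<longrightarrow> good N a z"
proof -
  define \<U> where "\<U> = {W. openin (skew_space n) W \<and> (\<exists>N. \<forall>(a, z)\<in>W. good N a z)}"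
  have K: "compactin (skew_space n) {y. F y \<noteq> 0}" using F by (simp add: Cc_iff)
  have "{y. F y \<noteq> 0} \<subseteq> \<Union> \<U>"
  proof
    fix y assume "y \<in> {y. F y \<noteq> 0}"
    then have "y \<in> topspace (skew_space n)" using compactin_subset_topspace[OF K] by blast
    then obtain a z where y: "y = (a, z)" "a \<in> carrier (Zk k)" "z \<in> topspace (nerve G n)" by auto
    obtain N U where U: "openin (nerve G n) U" "z \<in> U" "\<forall>w\<in>U. good N a w" using good_open[OF y(3,2)] by blast
    have "openin (skew_space n) ({a} \<times> U)" using U(1) y(2) by (auto simp: openin_prod_Times_iff)
    then have "{a} \<times> U \<in> \<U>" using U(3) by (auto simp: \<U>_def)
    then show "y \<in> \<Union> \<U>" using y(1) U(2) by blast
  qed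
  moreover have "\<forall>U\<in>\<U>. openin (skew_space n) U" by (simp add: \<U>_def)
  ultimately obtain \<F> where \<F>: "finite \<F>" "\<F> \<subseteq> \<U>" "{y. F y \<noteq> 0} \<subseteq> \<Union> \<F>"
    using K unfolding compactin_def by meson
  have "\<forall>W\<in>\<F>. \<exists>N. \<forall>(a, z)\<in>W. good N a z" using \<F>(2) by (auto simp: \<U>_def)
  then obtain M where M: "\<And>W a z. W \<in> \<F> \<Longrightarrow> (a, z) \<in> W \<Longrightarrow> good (M W) a z" by (metis case_prodD)
  have "good (Max (insert 0 (M ` \<F>))) a z" if nz: "F (a, z) \<noteq> 0" for a z
  proof -
    obtain W where W: "W \<in> \<F>" "(a, z) \<in> W" using \<F>(3) nz by blast
    then show ?thesis using good_mono[OF M[OF W]] \<F>(1) by simp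
  qed
  then show ?thesis by blast
qed

text \<open>For \<open>m = gap N a\<close> with \<open>below N a\<close>, the added arrow joins the
  cone point in degree \<open>corner N\<close> to the first vertex in degree a, because
  \<open>nk_diff 0 m\<close> is then \<open>a - corner N\<close>.\<close>

definition prefix :: "nvec \<Rightarrow> ('a, 'a \<times> zvec \<times> 'a) nerve_point \<Rightarrow> ('a, 'a \<times> zvec \<times> 'a) nerve_point" where
  "prefix m z = Tuple ((\<sigma> m (first_vertex z), nk_diff 0 m, first_vertex z) #
     (case z of Unit x \<Rightarrow> [] | Tuple gs \<Rightarrow> gs))"

lemma first_vertex_in: "z \<in> topspace (nerve G n) \<Longrightarrow> first_vertex z \<in> topspace X"
  using etale_in[OF etale_first_vertex] by (simp add: DR_simps)

lemma section_in: "m \<in> Nk k \<Longrightarrow> x \<in> topspace X \<Longrightarrow> (\<sigma> m x, nk_diff 0 m, x) \<in> topspace (arrows G)"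
  unfolding mem_arrows by (intro bexI[of _ 0] bexI[of _ m]) (simp_all add: \<sigma>_0 \<sigma>_in Nk_0)

lemma continuous_section:
  assumes m: "m \<in> Nk k" shows "continuous_map X (arrows G) (\<lambda>x. (\<sigma> m x, nk_diff 0 m, x))"
proof (rule continuous_map_localI)
  show "(\<lambda>x. (\<sigma> m x, nk_diff 0 m, x)) \<in> topspace X \<rightarrow> topspace (arrows G)" using section_in[OF m] by blast
  fix x W assume x: "x \<in> topspace X" "openin (arrows G) W" "(\<sigma> m x, nk_diff 0 m, x) \<in> W"
  obtain U V where UV: "basic U 0 m V" "\<sigma> m x \<in> U" "x \<in> V" "DR_basic_open \<sigma> U 0 m V \<subseteq> W"
    using basic_neighbourhood[OF x(2,3) Nk_0 m] x(1) by (auto simp: \<sigma>_0 \<sigma>_in m)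
  let ?T = "V \<inter> {y \<in> topspace X. \<sigma> m y \<in> U}"
  have "openin X ?T"
    using UV(1) openin_vimage[OF etale_continuous[OF \<sigma>_etale[OF m]]] by (auto simp: basic_def intro!: openin_Int)
  moreover have "x \<in> ?T" using x UV by auto
  moreover have "(\<lambda>x. (\<sigma> m x, nk_diff 0 m, x)) ` ?T \<subseteq> W"
    using UV(4) by (auto simp: mem_DR_basic_open \<sigma>_0 \<sigma>_in m)
  ultimately show "\<exists>T. openin X T \<and> x \<in> T \<and> (\<lambda>x. (\<sigma> m x, nk_diff 0 m, x)) ` T \<subseteq> W" by blast
qed

lemma prefix_in:
  assumes "m \<in> Nk k" "z \<in> topspace (nerve G n)"
  shows "prefix m z \<in> topspace (nerve G (Suc n))"
proof (cases "n = 0")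
  case True
  then show ?thesis using assms section_in[OF assms(1) first_vertex_in[OF assms(2)]]
    by (auto simp: topspace_nerve_0 topspace_nerve composable_iff prefix_def chain_def)
next
  case False
  then obtain gs where gs: "z = Tuple gs" "length gs = n" "chain gs"
    using assms by (auto simp: topspace_nerve composable_iff)
  then have ne: "gs \<noteq> []" using False by auto
  show ?thesis
    using gs section_in[OF assms(1) first_vertex_in[OF assms(2)]]
    by (auto simp: topspace_nerve composable_iff prefix_def chain_Cons[OF ne] DR_simps first_vertex_def)
qed

lemma last_vertex_prefix: "z \<in> topspace (nerve G n) \<Longrightarrow> last_vertex (prefix m z) = last_vertex z"
  by (cases "n = 0")
    (auto simp: topspace_nerve_0 topspace_nerve composable_iff prefix_def last_vertex_def first_vertex_def DR_simps)

text \<open>The last vertex is unchanged, so by \<open>etale_cancel\<close> only continuity has to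
  be proved, and that rests on \<open>continuous_section\<close>.\<close>

lemma etale_prefix:
  assumes m: "m \<in> Nk k" shows "etale (nerve G n) (nerve G (Suc n)) (prefix m)"
proof (rule etale_cancel[OF _ etale_last_vertex])
  show "etale (nerve G n) (units G) (last_vertex \<circ> prefix m)"
    by (rule etale_cong[OF etale_last_vertex]) (simp add: last_vertex_prefix)
  show "continuous_map (nerve G n) (nerve G (Suc n)) (prefix m)"
  proof (rule continuous_map_localI)
    show "prefix m \<in> topspace (nerve G n) \<rightarrow> topspace (nerve G (Suc n))" using prefix_in[OF m] by blast
    fix z W assume z: "z \<in> topspace (nerve G n)" and W: "openin (nerve G (Suc n)) W" "prefix m z \<in> W"
    define zs where "zs z = (case z of Unit x \<Rightarrow> [] | Tuple gs \<Rightarrow> gs)" for z :: "('a, 'a \<times> zvec \<times> 'a) nerve_point"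
    obtain Vs' where Vs': "length Vs' = Suc n" "\<And>U. U \<in> set Vs' \<Longrightarrow> openin (arrows G) U" "prefix m z \<in> boxed Vs'" "boxed Vs' \<subseteq> W"
      using nerve_boxed[OF W(1) W(2)[unfolded prefix_def]] by (auto simp: prefix_def)
    then obtain V Vs where V: "Vs' = V # Vs" by (cases Vs') auto
    have mem: "(\<sigma> m (first_vertex z), nk_diff 0 m, first_vertex z) \<in> V" "list_all2 (\<in>) (zs z) Vs"
      using Vs'(3) by (auto simp: boxed_def prefix_def zs_def V)
    define T where "T = {x \<in> topspace X. (\<sigma> m x, nk_diff 0 m, x) \<in> V}"
    have T: "openin X T" unfolding T_def by (rule openin_vimage[OF continuous_section[OF m]]) (simp add: Vs' V)
    define B where "B = (if n = 0 then topspace (nerve G n) else boxed Vs)"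
    have B: "openin (nerve G n) B" "z \<in> B"
      using Vs' V z mem openin_boxed[of Vs]
      by (auto simp: B_def topspace_nerve composable_iff boxed_def zs_def)
    define U where "U = B \<inter> {w \<in> topspace (nerve G n). first_vertex w \<in> T}"
    have "openin (nerve G n) U"
      unfolding U_def
      using openin_vimage[OF etale_continuous[OF etale_first_vertex], of T n] T B(1) by (simp add: DR_simps openin_Int)
    moreover have "z \<in> U" using z B(2) mem first_vertex_in[OF z] by (auto simp: U_def T_def)
    moreover have "prefix m w \<in> W" if w: "w \<in> U" for w
    proof -
      have wt: "w \<in> topspace (nerve G n)" using w by (auto simp: U_def)
      have "list_all2 (\<in>) (zs w) Vs"
      proof (cases "n = 0")
        case True
        then show ?thesis using wt Vs'(1) V by (auto simp: topspace_nerve_0 zs_def)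
      next
        case False
        then show ?thesis using w by (auto simp: U_def B_def boxed_def zs_def)
      qed
      moreover have "(\<sigma> m (first_vertex w), nk_diff 0 m, first_vertex w) \<in> V" using w by (auto simp: U_def T_def)
      ultimately have "prefix m w \<in> boxed Vs'"
        using prefix_in[OF m wt] by (auto simp: boxed_def V prefix_def zs_def topspace_nerve composable_iff)
      then show ?thesis using Vs'(4) by blast
    qed
    ultimately show "\<exists>U. openin (nerve G n) U \<and> z \<in> U \<and> prefix m ` U \<subseteq> W" by blast
  qed
qed

definition cone :: "int \<Rightarrow> zvec \<times> ('a, 'a \<times> zvec \<times> 'a) nerve_point \<Rightarrow> zvec \<times> ('a, 'a \<times> zvec \<times> 'a) nerve_point" where
  "cone N = (\<lambda>(a, z). (corner N, prefix (gap N a) z))"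

lemma vertices_cone:
  "below N a \<Longrightarrow> case_prod vertices (cone N (a, z)) = (\<sigma> (gap N a) (first_vertex z), corner N) # vertices a z"
  by (cases z) (auto simp: cone_def prefix_def vertices_def nk_diff_gap first_vertex_def grange_fst)

lemma cone_face_0:
  assumes z: "z \<in> topspace (nerve G n)" and b: "below N a"
  shows "skew_face (Suc n) 0 (cone N (a, z)) = (a, z)"
proof -
  obtain c w where w: "cone N (a, z) = (c, w)" by force
  then have wt: "w \<in> topspace (nerve G (Suc n))" using prefix_in[OF gap_in z] by (auto simp: cone_def)
  obtain c' w' where w': "skew_face (Suc n) 0 (c, w) = (c', w')" by force
  then have w't: "w' \<in> topspace (nerve G n)" using skew_face_in[OF wt, of 0 c] by simp
  have "vertices c' w' = vertices a z"
    using vertices_skew_face[OF wt, of 0 c] vertices_cone[OF b, of z] w w' by simp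
  then show ?thesis using vertices_inj[OF w't z] w w' by simp
qed

text \<open>Deleting the first vertex moves the starting point of the cone construction; the cone
  point survives because all vertices of a good simplex flow to the same point.\<close>

lemma cone_face_Suc:
  assumes z: "z \<in> topspace (nerve G (Suc n))" and g: "good N a z" and i: "i \<le> Suc n"
  shows "skew_face (Suc (Suc n)) (Suc i) (cone N (a, z)) = cone N (skew_face (Suc n) i (a, z))"
proof -
  have b: "below N a" using g by (simp add: good_def)
  obtain c w where w: "cone N (a, z) = (c, w)" by force
  then have wt: "w \<in> topspace (nerve G (Suc (Suc n)))" using prefix_in[OF gap_in z] by (auto simp: cone_def)
  obtain c' w' where w': "skew_face (Suc (Suc n)) (Suc i) (c, w) = (c', w')" by force
  then have w't: "w' \<in> topspace (nerve G (Suc n))" using skew_face_in[OF wt, of "Suc i" c] i by simp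
  obtain d v where v: "skew_face (Suc n) i (a, z) = (d, v)" by force
  then have vt: "v \<in> topspace (nerve G n)" using skew_face_in[OF z i, of a] by simp
  obtain d' v' where v': "cone N (d, v) = (d', v')" by force
  then have v't: "v' \<in> topspace (nerve G (Suc n))" using prefix_in[OF gap_in vt] by (auto simp: cone_def)
  have vert: "vertices d v = del i (vertices a z)" using vertices_skew_face[OF z i, of a] v by simp
  have "hd (vertices d v) \<in> set (vertices d v)" using length_vertices[OF vt, of d] by (intro hd_in_set) auto
  also have "set (vertices d v) \<subseteq> set (vertices a z)"
    unfolding vert del_def using set_take_subset[of i "vertices a z"] set_drop_subset[of "Suc i" "vertices a z"] by auto
  finally have mem: "(first_vertex v, d) \<in> set (vertices a z)" by (simp add: hd_vertices)
  note gv = good_vertices[OF z g mem]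
  have "vertices c' w' = (\<sigma> (gap N a) (first_vertex z), corner N) # del i (vertices a z)"
    using vertices_skew_face[OF wt, of "Suc i" c] vertices_cone[OF b, of z] w w' i by simp
  also have "\<dots> = vertices d' v'"
    using vertices_cone[OF gv(1), of v] v' gv(2) vert by simp
  finally show ?thesis using vertices_inj[OF w't v't] w w' v v' by simp
qed

lemma etale_skew_face:
  assumes i: "i \<le> Suc n" shows "etale (skew_space (Suc n)) (skew_space n) (skew_face (Suc n) i)"
  unfolding skew_face_def
proof (rule etale_prod_discrete)
  show "etale (nerve G (Suc n)) (nerve G n) (face G (Suc n) i)" by (rule etale_face[OF i])
  fix a z assume a: "a \<in> carrier (Zk k)" and z: "z \<in> topspace (nerve G (Suc n))"
  obtain gs where gs: "z = Tuple gs" "length gs = Suc n" "chain gs"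
    using z by (auto simp: topspace_nerve composable_iff)
  then obtain g gs' where g: "gs = g # gs'" by (cases gs) auto
  have gt: "g \<in> topspace (arrows G)" using gs g by (auto simp: chain_def)
  obtain x p q y where pq: "p \<in> Nk k" "q \<in> Nk k" "g = (x, nk_diff p q, y)" using basic_whole[OF gt] .
  show "(if i = 0 then a + DR_cocycle (hd (the_tuple z)) else a) \<in> carrier (Zk k)"
    using a gs g pq by (auto simp: DR_cocycle_def intro: Zk_closed nk_diff_in)
  obtain U where U: "openin (arrows G) U" "g \<in> U" "\<forall>h\<in>U. DR_cocycle h = DR_cocycle g"
    using cocycle_locally_constant[OF gt] by blast
  let ?Us = "U # replicate n (topspace (arrows G))"
  have "openin (nerve G (Suc n)) (boxed ?Us)"
    using openin_boxed[of ?Us] U(1) by auto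
  moreover have "list_all2 (\<in>) gs' (replicate n (topspace (arrows G)))"
    using gs g by (auto simp: list_all2_conv_all_nth chain_def)
  then have "z \<in> boxed ?Us" using gs g U(2) by (auto simp: boxed_def)
  moreover have "(if i = 0 then a + DR_cocycle (hd (the_tuple z)) else a)
      = (if i = 0 then a + DR_cocycle (hd (the_tuple w)) else a)" if "w \<in> boxed ?Us" for w
    using that U(3) gs g by (auto simp: boxed_def list_all2_Cons2)
  ultimately show "\<exists>U. openin (nerve G (Suc n)) U \<and> z \<in> U \<and> (\<forall>u\<in>U.
      (if i = 0 then a + DR_cocycle (hd (the_tuple z)) else a) = (if i = 0 then a + DR_cocycle (hd (the_tuple u)) else a))"
    by blast
qed

lemma etale_cone: "etale (skew_space n) (skew_space (Suc n)) (cone N)"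
  unfolding cone_def
proof (rule etale_prod_discrete)
  show "etale (nerve G n) (nerve G (Suc n)) (prefix (gap N a))" for a by (rule etale_prefix[OF gap_in])
  show "corner N \<in> carrier (Zk k)" by (rule corner_in)
  show "\<exists>U. openin (nerve G n) U \<and> z \<in> U \<and> (\<forall>u\<in>U. corner N = corner N)" if "z \<in> topspace (nerve G n)" for z
    using that by blast
qed

lemma skew_Hausdorff: "Hausdorff_space (skew_space n)"
  by (rule Hausdorff_prod_discrete[OF nerve_Hausdorff])

section \<open>The resolution by chains of the skew product\<close>

definition skew_boundary ::
    "nat \<Rightarrow> (zvec \<Rightarrow> ('a, 'a \<times> zvec \<times> 'a) nerve_point \<Rightarrow> int) \<Rightarrow> zvec \<Rightarrow> ('a, 'a \<times> zvec \<times> 'a) nerve_point \<Rightarrow> int" where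
  "skew_boundary n f = curry (bd (skew_face (Suc n)) (Suc n) (case_prod f))"

abbreviation nerve_Cc :: "nat \<Rightarrow> (('a, 'a \<times> zvec \<times> 'a) nerve_point \<Rightarrow> int) set" where
  "nerve_Cc n \<equiv> carrier (Cc (nerve G n))"

lemma Cc_point: "F \<in> carrier (Cc (skew_space n)) \<Longrightarrow> F (a, z) \<noteq> 0 \<Longrightarrow> z \<in> topspace (nerve G n)"
  using Cc_zero_outside[of F "skew_space n" "(a, z)"] by auto

lemma bd_Cc:
  assumes "f \<in> carrier (Cc Y)" "\<And>i. i \<le> n \<Longrightarrow> etale Y Z (d i)" "Hausdorff_space Y" "Hausdorff_space Z"
  shows "bd d n f \<in> carrier (Cc Z)"
  unfolding bd_def
  by (rule Cc_sum, rule alt_sign_in_group[OF Cc_zero Cc_diff], assumption+, rule push_Cc) (use assms in auto)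

lemma skew_boundary_in: "f \<in> induced k (nerve_Cc (Suc n)) \<Longrightarrow> skew_boundary n f \<in> induced k (nerve_Cc n)"
  unfolding induced_iff_Cc skew_boundary_def case_prod_curry
  by (rule bd_Cc) (assumption, erule etale_skew_face, rule skew_Hausdorff, rule skew_Hausdorff)

lemma curry_plus: "curry (f + g) = curry f + curry g"
  for f g :: "'x \<times> 'y \<Rightarrow> 'v::plus"
  by (auto simp: fun_eq_iff)

lemma curry_0: "curry (0 :: 'x \<times> 'y \<Rightarrow> 'v::zero) = 0"
  by (auto simp: fun_eq_iff)

lemma skew_boundary_add:
  assumes "f \<in> induced k (nerve_Cc (Suc n))" "g \<in> induced k (nerve_Cc (Suc n))"
  shows "skew_boundary n (f + g) = skew_boundary n f + skew_boundary n g"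
proof -
  have fin: "fin_fibres (skew_face (Suc n) i) (case_prod f)" "fin_fibres (skew_face (Suc n) i) (case_prod g)"
    if "i \<le> Suc n" for i
    using assms etale_fin_fibres[OF _ etale_skew_face[OF that]] unfolding induced_iff_Cc by blast+
  show ?thesis
    unfolding skew_boundary_def case_prod_add curry_plus[symmetric] by (subst bd_add) (use fin in auto)
qed

lemma skew_boundary_shift: "skew_boundary n (shift b f) = shift b (skew_boundary n f)"
proof -
  have "push (skew_face (Suc n) i) (case_prod (shift b f)) (a, z) = push (skew_face (Suc n) i) (case_prod f) (a - b, z)" for i a z
    unfolding push_def
    by (rule sum.reindex_bij_witness[where i = "\<lambda>(a, z). (a + b, z)" and j = "\<lambda>(a, z). (a - b, z)"])
      (auto simp: shift_def skew_face_def algebra_simps)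
  then show ?thesis by (simp add: skew_boundary_def shift_def fun_eq_iff bd_apply)
qed

lemma skew_boundary_boundary:
  assumes f: "f \<in> induced k (nerve_Cc (Suc (Suc n)))"
  shows "skew_boundary n (skew_boundary (Suc n) f) = 0"
proof -
  have F: "case_prod f \<in> carrier (Cc (skew_space (Suc (Suc n))))" using f by (simp add: induced_iff_Cc)
  have "bd (skew_face (Suc n)) (Suc n) (bd (skew_face (Suc (Suc n))) (Suc (Suc n)) (case_prod f)) = 0"
  proof (rule bd_bd)
    fix y i j assume y: "case_prod f y \<noteq> 0" and ij: "i < j" "j \<le> Suc (Suc n)"
    obtain a z where az: "y = (a, z)" by force
    have "z \<in> topspace (nerve G (Suc (Suc n)))" using Cc_point[OF F] y az by blast
    then show "skew_face (Suc n) i (skew_face (Suc (Suc n)) j y) = skew_face (Suc n) (j - 1) (skew_face (Suc (Suc n)) i y)"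
      unfolding az using ij by (rule skew_face_face)
  next
    fix i j assume ij: "i \<le> Suc n" "j \<le> Suc (Suc n)"
    show "fin_fibres (skew_face (Suc n) i \<circ> skew_face (Suc (Suc n)) j) (case_prod f)"
      by (rule etale_fin_fibres[OF F etale_comp[OF etale_skew_face[OF ij(2)] etale_skew_face[OF ij(1)]]])
  qed
  then show ?thesis by (simp only: skew_boundary_def case_prod_curry curry_0)
qed

text \<open>One N serves the whole support of f, and \<open>cone N\<close> then contracts the
  simplices that matter. N depends on f, which exactness tolerates.\<close>

lemma skew_exact:
  assumes f: "f \<in> induced k (nerve_Cc (Suc n))" "skew_boundary n f = 0"
  shows "\<exists>g\<in>induced k (nerve_Cc (Suc (Suc n))). skew_boundary (Suc n) g = f"
proof -
  have F: "case_prod f \<in> carrier (Cc (skew_space (Suc n)))" using f by (simp add: induced_iff_Cc)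
  obtain N where N: "\<And>a z. case_prod f (a, z) \<noteq> 0 \<Longrightarrow> good N a z" using support_good[OF F] by blast
  have b0: "bd (skew_face (Suc n)) (Suc n) (case_prod f) = 0"
    using f(2) by (metis skew_boundary_def curry_inject curry_0)
  let ?h = "push (cone N) (case_prod f)"
  have "bd (skew_face (Suc (Suc n))) (Suc (Suc n)) ?h = case_prod f - push (cone N) (bd (skew_face (Suc n)) (Suc n) (case_prod f))"
  proof (rule bd_cone)
    fix y assume y: "case_prod f y \<noteq> 0"
    obtain a z where az: "y = (a, z)" by force
    have z: "z \<in> topspace (nerve G (Suc n))" and g: "good N a z" using Cc_point[OF F] N y unfolding az by blast+
    show "skew_face (Suc (Suc n)) 0 (cone N y) = y"
      unfolding az by (rule cone_face_0[OF z]) (use g in \<open>simp add: good_def\<close>)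
    show "skew_face (Suc (Suc n)) (Suc i) (cone N y) = cone N (skew_face (Suc n) i y)" if "i \<le> Suc n" for i
      unfolding az by (rule cone_face_Suc[OF z g that])
  next
    fix i assume i: "i \<le> Suc n"
    show "fin_fibres (cone N \<circ> skew_face (Suc n) i) (case_prod f)"
      by (rule etale_fin_fibres[OF F etale_comp[OF etale_skew_face[OF i] etale_cone]])
  qed
  then have "skew_boundary (Suc n) (curry ?h) = f" by (simp add: skew_boundary_def b0)
  moreover have "curry ?h \<in> induced k (nerve_Cc (Suc (Suc n)))"
    unfolding induced_iff_Cc case_prod_curry by (rule push_Cc[OF F etale_cone skew_Hausdorff skew_Hausdorff])
  ultimately show ?thesis by blast
qed

lemma coinv_push_snd:
  fixes f :: "zvec \<Rightarrow> 'y \<Rightarrow> 'v::ab_group_add"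
  assumes "finite {a. f a \<noteq> 0}"
  shows "coinv f = push snd (case_prod f)"
proof
  fix z
  have "push snd (case_prod f) z = sum (case_prod f) ((\<lambda>a. (a, z)) ` {a. f a \<noteq> 0})"
    by (rule push_eq_sum) (use assms in \<open>auto simp: fun_eq_iff\<close>)
  also have "\<dots> = coinv f z"
    by (subst sum.reindex) (auto simp: inj_on_def coinv_def fun_sum_apply)
  finally show "coinv f z = push snd (case_prod f) z" ..
qed

text \<open>Summing over degrees is the pushforward along the projection that forgets them, and this
  projection intertwines the faces.\<close>

lemma skew_boundary_coinv:
  assumes f: "f \<in> induced k (nerve_Cc (Suc n))"
  shows "coinv (skew_boundary n f) = groupoid_boundary G (Suc n) (coinv f)"
proof -
  have F: "case_prod f \<in> carrier (Cc (skew_space (Suc n)))" using f by (simp add: induced_iff_Cc)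
  have "coinv (skew_boundary n f) = push snd (case_prod (skew_boundary n f))"
    using skew_boundary_in[OF f] by (intro coinv_push_snd) (simp add: induced_def)
  also have "\<dots> = push snd (bd (skew_face (Suc n)) (Suc n) (case_prod f))" by (simp add: skew_boundary_def)
  also have "\<dots> = (\<Sum>i\<le>Suc n. alt_sign i (push (face G (Suc n) i) (push snd (case_prod f))))"
  proof -
    have e: "snd \<circ> skew_face (Suc n) i = face G (Suc n) i \<circ> snd" for i by (auto simp: skew_face_def)
    have fin: "fin_fibres (snd \<circ> skew_face (Suc n) i) (case_prod f)" if "i \<le> Suc n" for i
      by (rule etale_fin_fibres[OF F etale_comp[OF etale_skew_face[OF that] etale_snd]])
    have "push snd (push (skew_face (Suc n) i) (case_prod f)) = push (face G (Suc n) i) (push snd (case_prod f))"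
      if "i \<le> Suc n" for i
      using fin[OF that] by (simp only: push_push e)
    then show ?thesis
      unfolding bd_def by (subst push_sum) (auto simp: fin_fibres_push fin push_alt_sign simp del: sum.atMost_Suc)
  qed
  also have "push snd (case_prod f) = coinv f"
    using f by (intro coinv_push_snd[symmetric]) (simp add: induced_def)
  also have "(\<Sum>i\<le>Suc n. alt_sign i (push (face G (Suc n) i) (coinv f))) = groupoid_boundary G (Suc n) (coinv f)"
    by (simp add: groupoid_boundary_bd bd_def)
  finally show ?thesis .
qed

end

section \<open>The module \<open>H\<^sub>0\<close> of the skew product\<close>

lemma homeomorphic_maps_push:
  assumes h: "homeomorphic_maps Y Z \<phi> \<psi>" and f: "f \<in> carrier (Cc Y)"
  shows "push \<psi> (push \<phi> f) = f"
proof -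
  have \<psi>: "homeomorphic_maps Z Y \<psi> \<phi>" by (rule homeomorphic_maps_sym[THEN iffD1, OF h])
  have "push \<psi> (push \<phi> f) = push (\<psi> \<circ> \<phi>) f"
    by (rule push_push[OF etale_fin_fibres[OF f etale_comp[OF homeomorphic_maps_etale[OF h] homeomorphic_maps_etale[OF \<psi>]]]])
  also have "\<dots> = f"
  proof (rule push_ident)
    fix y assume "f y \<noteq> 0"
    then have "y \<in> topspace Y" using Cc_zero_outside[OF f] by blast
    then show "(\<psi> \<circ> \<phi>) y = y" using h by (simp add: homeomorphic_maps_def)
  qed
  finally show ?thesis .
qed

lemma homeomorphic_maps_Hausdorff:
  assumes "homeomorphic_maps Y Z \<phi> \<psi>" "Hausdorff_space Y" shows "Hausdorff_space Z"
  using assms homeomorphic_Hausdorff_space homeomorphic_space_def by blast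

lemma inv_Cc: "f \<in> carrier (Cc Y) \<Longrightarrow> inv\<^bsub>Cc Y\<^esub> f = - f"
proof -
  assume f: "f \<in> carrier (Cc Y)"
  interpret comm_group "Cc Y" by (rule comm_group_Cc)
  have "- f \<in> carrier (Cc Y)" using Cc_diff[OF Cc_zero f] by simp
  then show ?thesis using f by (intro inv_equality) (simp_all add: Cc_mult Cc_one)
qed

lemma continuous_the_unit: "continuous_map (nerve G 0) (units G) the_unit"
proof -
  have "continuous_map (nerve G 0) (units G) (id \<circ> the_unit)"
    unfolding nerve_def if_P[OF refl] by (rule continuous_map_pullback) simp
  then show ?thesis by (simp add: o_def)
qed

lemma continuous_Unit:
  assumes "continuous_map Y (units G) f" shows "continuous_map Y (nerve G 0) (\<lambda>y. Unit (f y))"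
  unfolding nerve_def if_P[OF refl]
  by (rule continuous_map_pullback') (use assms continuous_map_funspace[OF assms] in \<open>auto simp: o_def\<close>)

lemma continuous_hd_tuple:
  fixes G :: "('x, 'g) groupoid"
  shows "continuous_map (nerve G (Suc 0)) (arrows G) (\<lambda>z. hd (the_tuple z))"
proof -
  let ?f = "\<lambda>z :: ('x, 'g) nerve_point. \<lambda>i\<in>{..<Suc 0}. the_tuple z ! i"
  have "continuous_map (nerve G (Suc 0)) (arrows G) ((\<lambda>x. x 0) \<circ> ?f)"
    unfolding nerve_def if_not_P[OF Suc_not_Zero]
    by (rule continuous_map_pullback) (rule continuous_map_product_projection, simp)
  then show ?thesis
  proof (rule continuous_map_eq)
    fix z assume "z \<in> topspace (nerve G (Suc 0))"
    then obtain gs where "z = Tuple gs" "length gs = 1"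
      by (auto simp: nerve_def topspace_pullback_topology composable_def)
    then show "((\<lambda>x. x 0) \<circ> ?f) z = hd (the_tuple z)" by (cases gs) auto
  qed
qed

lemma composable_Suc_0: "composable G (Suc 0) = {[g] | g. g \<in> topspace (arrows G)}"
  by (auto simp: composable_def length_Suc_conv)

lemma continuous_Tuple:
  fixes G :: "('x, 'g) groupoid"
  assumes "continuous_map Y (arrows G) f" shows "continuous_map Y (nerve G (Suc 0)) (\<lambda>y. Tuple [f y])"
  unfolding nerve_def if_not_P[OF Suc_not_Zero]
proof (rule continuous_map_pullback')
  let ?f = "\<lambda>z :: ('x, 'g) nerve_point. \<lambda>i\<in>{..<Suc 0}. the_tuple z ! i"
  have "continuous_map Y (product_topology (\<lambda>_. arrows G) {..<Suc 0}) (\<lambda>y. \<lambda>i\<in>{..<Suc 0}. f y)"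
    using assms by (auto simp: continuous_map_componentwise)
  moreover have "?f \<circ> (\<lambda>y. Tuple [f y]) = (\<lambda>y. \<lambda>i\<in>{..<Suc 0}. f y)" by (auto simp: fun_eq_iff)
  ultimately show "continuous_map Y (product_topology (\<lambda>_. arrows G) {..<Suc 0}) (?f \<circ> (\<lambda>y. Tuple [f y]))" by simp
  show "topspace Y \<subseteq> (\<lambda>y. Tuple [f y]) -` Tuple ` composable G (Suc 0)"
    using continuous_map_funspace[OF assms] by (auto simp: composable_Suc_0)
qed

context dr_action
begin

abbreviation S :: "('a \<times> zvec, ('a \<times> zvec \<times> 'a) \<times> zvec) groupoid" where
  "S \<equiv> skew_product k G DR_cocycle"

text \<open>Together with \<open>arrow_map\<close> this compares Z^k times the nerve of G with the
  nerve of \<open>skew_product\<close> in degrees 0 and 1, whose boundary has H_0 as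
  cokernel.\<close>

definition unit_map :: "zvec \<times> ('a, 'a \<times> zvec \<times> 'a) nerve_point \<Rightarrow> ('a \<times> zvec, ('a \<times> zvec \<times> 'a) \<times> zvec) nerve_point" where
  "unit_map y = Unit (the_unit (snd y), fst y)"

definition unit_map_inv :: "('a \<times> zvec, ('a \<times> zvec \<times> 'a) \<times> zvec) nerve_point \<Rightarrow> zvec \<times> ('a, 'a \<times> zvec \<times> 'a) nerve_point" where
  "unit_map_inv z = (snd (the_unit z), Unit (fst (the_unit z)))"

definition arrow_map :: "zvec \<times> ('a, 'a \<times> zvec \<times> 'a) nerve_point \<Rightarrow> ('a \<times> zvec, ('a \<times> zvec \<times> 'a) \<times> zvec) nerve_point" where
  "arrow_map y = Tuple [(hd (the_tuple (snd y)), fst y)]"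

definition arrow_map_inv :: "('a \<times> zvec, ('a \<times> zvec \<times> 'a) \<times> zvec) nerve_point \<Rightarrow> zvec \<times> ('a, 'a \<times> zvec \<times> 'a) nerve_point" where
  "arrow_map_inv z = (snd (hd (the_tuple z)), Tuple [fst (hd (the_tuple z))])"

lemma S_simps: "units S = prod_topology X (discrete_topology (carrier (Zk k)))"
  "arrows S = prod_topology (arrows G) (discrete_topology (carrier (Zk k)))"
  "grange S (g, a) = (grange G g, a)" "gsource S (g, a) = (gsource G g, a + DR_cocycle g)"
  by (simp_all add: skew_product_def DR_simps)

lemma topspace_S_0: "topspace (nerve S 0) = Unit ` (topspace X \<times> carrier (Zk k))"
  by (auto simp: nerve_def topspace_pullback_topology S_simps)

lemma topspace_S_1: "topspace (nerve S (Suc 0)) = {Tuple [(g, a)] | g a. g \<in> topspace (arrows G) \<and> a \<in> carrier (Zk k)}"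
  by (auto simp: nerve_def topspace_pullback_topology composable_Suc_0 S_simps)

lemma unit_homeo: "homeomorphic_maps (skew_space 0) (nerve S 0) unit_map unit_map_inv"
  unfolding homeomorphic_maps_def
proof (intro conjI ballI)
  show "continuous_map (skew_space 0) (nerve S 0) unit_map"
    unfolding unit_map_def
    by (rule continuous_Unit)
      (use continuous_map_compose[OF continuous_map_snd continuous_the_unit, of "discrete_topology (carrier (Zk k))" G]
        continuous_map_fst[of "discrete_topology (carrier (Zk k))" "nerve G 0"] in
        \<open>simp add: S_simps DR_simps continuous_map_pairwise o_def\<close>)
  have c: "continuous_map (nerve S 0) (prod_topology X (discrete_topology (carrier (Zk k)))) the_unit"
    using continuous_the_unit[of S] by (simp add: S_simps)
  show "continuous_map (nerve S 0) (skew_space 0) unit_map_inv"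
    unfolding unit_map_inv_def continuous_map_pairwise o_def fst_conv snd_conv
    using continuous_map_compose[OF c continuous_map_fst] continuous_map_compose[OF c continuous_map_snd]
    by (auto intro!: continuous_Unit simp: DR_simps o_def)
qed (auto simp: unit_map_def unit_map_inv_def topspace_nerve_0 topspace_S_0)

lemma arrow_homeo: "homeomorphic_maps (skew_space (Suc 0)) (nerve S (Suc 0)) arrow_map arrow_map_inv"
  unfolding homeomorphic_maps_def
proof (intro conjI ballI)
  show "continuous_map (skew_space (Suc 0)) (nerve S (Suc 0)) arrow_map"
    unfolding arrow_map_def
    by (rule continuous_Tuple)
      (use continuous_map_compose[OF continuous_map_snd continuous_hd_tuple, of "discrete_topology (carrier (Zk k))" G]
        continuous_map_fst[of "discrete_topology (carrier (Zk k))" "nerve G (Suc 0)"] in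
        \<open>simp add: S_simps continuous_map_pairwise o_def\<close>)
  have c: "continuous_map (nerve S (Suc 0)) (prod_topology (arrows G) (discrete_topology (carrier (Zk k)))) (\<lambda>z. hd (the_tuple z))"
    using continuous_hd_tuple[of S] by (simp add: S_simps)
  show "continuous_map (nerve S (Suc 0)) (skew_space (Suc 0)) arrow_map_inv"
    unfolding arrow_map_inv_def continuous_map_pairwise o_def fst_conv snd_conv
    using continuous_map_compose[OF c continuous_map_fst] continuous_map_compose[OF c continuous_map_snd]
    by (auto intro!: continuous_Tuple simp: o_def)
qed (auto simp: arrow_map_def arrow_map_inv_def topspace_nerve composable_Suc_0 topspace_S_1)

lemma unit_map_in_Cc: "F \<in> carrier (Cc (skew_space 0)) \<Longrightarrow> push unit_map F \<in> carrier (Cc (nerve S 0))"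
  by (rule push_Cc[OF _ homeomorphic_maps_etale[OF unit_homeo] skew_Hausdorff
        homeomorphic_maps_Hausdorff[OF unit_homeo skew_Hausdorff]])

lemma arrow_map_in_Cc: "F \<in> carrier (Cc (skew_space (Suc 0))) \<Longrightarrow> push arrow_map F \<in> carrier (Cc (nerve S (Suc 0)))"
  by (rule push_Cc[OF _ homeomorphic_maps_etale[OF arrow_homeo] skew_Hausdorff
        homeomorphic_maps_Hausdorff[OF arrow_homeo skew_Hausdorff]])

lemma unit_map_surj:
  assumes "H \<in> carrier (Cc (nerve S 0))"
  shows "push unit_map_inv H \<in> carrier (Cc (skew_space 0))" "push unit_map (push unit_map_inv H) = H"
proof -
  have h: "homeomorphic_maps (nerve S 0) (skew_space 0) unit_map_inv unit_map"
    by (rule homeomorphic_maps_sym[THEN iffD1, OF unit_homeo])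
  show "push unit_map_inv H \<in> carrier (Cc (skew_space 0))"
    by (rule push_Cc[OF assms homeomorphic_maps_etale[OF h] homeomorphic_maps_Hausdorff[OF unit_homeo skew_Hausdorff] skew_Hausdorff])
  show "push unit_map (push unit_map_inv H) = H" by (rule homeomorphic_maps_push[OF h assms])
qed

lemma arrow_map_surj:
  assumes "H \<in> carrier (Cc (nerve S (Suc 0)))"
  shows "push arrow_map_inv H \<in> carrier (Cc (skew_space (Suc 0)))" "push arrow_map (push arrow_map_inv H) = H"
proof -
  have h: "homeomorphic_maps (nerve S (Suc 0)) (skew_space (Suc 0)) arrow_map_inv arrow_map"
    by (rule homeomorphic_maps_sym[THEN iffD1, OF arrow_homeo])
  show "push arrow_map_inv H \<in> carrier (Cc (skew_space (Suc 0)))"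
    by (rule push_Cc[OF assms homeomorphic_maps_etale[OF h] homeomorphic_maps_Hausdorff[OF arrow_homeo skew_Hausdorff] skew_Hausdorff])
  show "push arrow_map (push arrow_map_inv H) = H" by (rule homeomorphic_maps_push[OF h assms])
qed

lemma face_arrow_map:
  assumes "y \<in> topspace (skew_space (Suc 0))" "i \<le> Suc 0"
  shows "face S (Suc 0) i (arrow_map y) = unit_map (skew_face (Suc 0) i y)"
proof -
  obtain a g where "y = (a, Tuple [g])" using assms by (auto simp: topspace_nerve composable_Suc_0)
  then show ?thesis using assms(2)
    by (cases i) (auto simp: arrow_map_def unit_map_def skew_face_def face_def S_simps)
qed

lemma boundary_arrow_map:
  assumes F: "F \<in> carrier (Cc (skew_space (Suc 0)))"
  shows "groupoid_boundary S (Suc 0) (push arrow_map F) = push unit_map (bd (skew_face (Suc 0)) (Suc 0) F)"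
proof -
  have fin: "fin_fibres (unit_map \<circ> skew_face (Suc 0) i) F" if "i \<le> Suc 0" for i
    by (rule etale_fin_fibres[OF F etale_comp[OF etale_skew_face[OF that] homeomorphic_maps_etale[OF unit_homeo]]])
  have eq: "push (face S (Suc 0) i) (push arrow_map F) = push unit_map (push (skew_face (Suc 0) i) F)"
    if i: "i \<le> Suc 0" for i
  proof -
    have e: "(face S (Suc 0) i \<circ> arrow_map) y = (unit_map \<circ> skew_face (Suc 0) i) y" if "F y \<noteq> 0" for y
    proof -
      have "y \<in> topspace (skew_space (Suc 0))" using that Cc_zero_outside[OF F] by blast
      then show ?thesis using face_arrow_map[OF _ i] by simp
    qed
    have "fin_fibres (face S (Suc 0) i \<circ> arrow_map) F"
      using fin[OF i] fin_fibres_cong[of F "face S (Suc 0) i \<circ> arrow_map" "unit_map \<circ> skew_face (Suc 0) i"] e by blast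
    moreover have "push (face S (Suc 0) i \<circ> arrow_map) F = push (unit_map \<circ> skew_face (Suc 0) i) F"
      by (rule push_cong) (rule e)
    ultimately show ?thesis by (simp only: push_push fin[OF i])
  qed
  show ?thesis
    unfolding groupoid_boundary_bd bd_def
    by (subst push_sum) (auto simp: fin_fibres_push fin push_alt_sign eq simp del: sum.atMost_Suc)
qed

section \<open>Classes in H_0 and their translates\<close>

definition H0_boundaries :: "(('a \<times> zvec, ('a \<times> zvec \<times> 'a) \<times> zvec) nerve_point \<Rightarrow> int) set" where
  "H0_boundaries = boundaries (groupoid_chains S) (groupoid_boundary S) 0"

definition unit_chain :: "(zvec \<Rightarrow> ('a, 'a \<times> zvec \<times> 'a) nerve_point \<Rightarrow> int) \<Rightarrow> ('a \<times> zvec, ('a \<times> zvec \<times> 'a) \<times> zvec) nerve_point \<Rightarrow> int" where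
  "unit_chain f = push unit_map (case_prod f)"

lemma unit_chain_in: "f \<in> induced k (nerve_Cc 0) \<Longrightarrow> unit_chain f \<in> carrier (Cc (nerve S 0))"
  unfolding unit_chain_def induced_iff_Cc by (rule unit_map_in_Cc)

lemma unit_chain_surj:
  assumes "H \<in> carrier (Cc (nerve S 0))" shows "\<exists>f\<in>induced k (nerve_Cc 0). unit_chain f = H"
  using unit_map_surj[OF assms]
  by (intro bexI[of _ "curry (push unit_map_inv H)"]) (simp_all only: unit_chain_def induced_iff_Cc case_prod_curry)

lemma unit_chain_inj:
  assumes "f \<in> induced k (nerve_Cc 0)" "g \<in> induced k (nerve_Cc 0)" "unit_chain f = unit_chain g"
  shows "f = g"
proof -
  have "case_prod f = case_prod g"
    using assms homeomorphic_maps_push[OF unit_homeo] unfolding unit_chain_def induced_iff_Cc by metis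
  then show ?thesis by (metis curry_case_prod)
qed

lemma unit_chain_add:
  assumes "f \<in> induced k (nerve_Cc 0)" "g \<in> induced k (nerve_Cc 0)"
  shows "unit_chain (f + g) = unit_chain f + unit_chain g"
  unfolding unit_chain_def case_prod_add
  by (rule push_add) (use assms etale_fin_fibres[OF _ homeomorphic_maps_etale[OF unit_homeo]] in \<open>simp_all only: induced_iff_Cc\<close>)

lemma H0_boundaries_eq: "H0_boundaries = (\<lambda>g. unit_chain (skew_boundary 0 g)) ` induced k (nerve_Cc (Suc 0))"
proof (intro equalityI subsetI)
  fix x assume "x \<in> H0_boundaries"
  then obtain H where H: "H \<in> carrier (Cc (nerve S (Suc 0)))" "x = groupoid_boundary S (Suc 0) H"
    by (auto simp: H0_boundaries_def boundaries_def groupoid_chains_def)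
  let ?g = "curry (push arrow_map_inv H)"
  have "?g \<in> induced k (nerve_Cc (Suc 0))"
    unfolding induced_iff_Cc case_prod_curry by (rule arrow_map_surj(1)[OF H(1)])
  moreover have "x = unit_chain (skew_boundary 0 ?g)"
    using boundary_arrow_map[OF arrow_map_surj(1)[OF H(1)]] arrow_map_surj(2)[OF H(1)] H(2)
    by (simp only: unit_chain_def skew_boundary_def case_prod_curry)
  ultimately show "x \<in> (\<lambda>g. unit_chain (skew_boundary 0 g)) ` induced k (nerve_Cc (Suc 0))" by blast
next
  fix x assume "x \<in> (\<lambda>g. unit_chain (skew_boundary 0 g)) ` induced k (nerve_Cc (Suc 0))"
  then obtain g where g0: "g \<in> induced k (nerve_Cc (Suc 0))" "x = unit_chain (skew_boundary 0 g)" by blast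
  then have g: "case_prod g \<in> carrier (Cc (skew_space (Suc 0)))" "x = unit_chain (skew_boundary 0 g)"
    unfolding induced_iff_Cc .
  have "x = groupoid_boundary S (Suc 0) (push arrow_map (case_prod g))"
    using g(2) by (simp only: boundary_arrow_map[OF g(1)] unit_chain_def skew_boundary_def case_prod_curry)
  then show "x \<in> H0_boundaries"
    using arrow_map_in_Cc[OF g(1)] by (simp add: H0_boundaries_def boundaries_def groupoid_chains_def)
qed

lemma nerve_induced_0: "0 \<in> induced k (nerve_Cc n)"
  by (simp add: induced_def Cc_zero)

lemma nerve_induced_diff:
  assumes "f \<in> induced k (nerve_Cc n)" "g \<in> induced k (nerve_Cc n)" shows "f - g \<in> induced k (nerve_Cc n)"
proof -
  have "case_prod (f - g) = case_prod f - case_prod g" by (auto simp: fun_eq_iff)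
  then show ?thesis using assms Cc_diff unfolding induced_iff_Cc by metis
qed

lemma nerve_induced_minus: "f \<in> induced k (nerve_Cc n) \<Longrightarrow> - f \<in> induced k (nerve_Cc n)"
  using nerve_induced_diff[OF nerve_induced_0, of f n] by simp

lemma nerve_induced_add: "f \<in> induced k (nerve_Cc n) \<Longrightarrow> g \<in> induced k (nerve_Cc n) \<Longrightarrow> f + g \<in> induced k (nerve_Cc n)"
  using nerve_induced_diff[OF _ nerve_induced_minus, of f n g] by simp

lemma unit_chain_0: "unit_chain 0 = 0"
  using unit_chain_add[OF nerve_induced_0 nerve_induced_0] by simp

lemma unit_chain_minus: "f \<in> induced k (nerve_Cc 0) \<Longrightarrow> unit_chain (- f) = - unit_chain f"
  using unit_chain_add[of f "- f"] nerve_induced_minus[of f 0] by (simp add: unit_chain_0 eq_neg_iff_add_eq_0 add.commute)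

lemma skew_boundary_minus:
  assumes "g \<in> induced k (nerve_Cc (Suc n))" shows "skew_boundary n (- g) = - skew_boundary n g"
proof -
  have "skew_boundary n 0 = 0" using skew_boundary_add[OF nerve_induced_0 nerve_induced_0, of n] by simp
  then show ?thesis
    using skew_boundary_add[OF assms nerve_induced_minus[OF assms]] by (simp add: eq_neg_iff_add_eq_0 add.commute)
qed

lemma subgroup_H0_boundaries: "subgroup H0_boundaries (Cc (nerve S 0))"
proof
  have sub: "H0_boundaries \<subseteq> carrier (Cc (nerve S 0))"
    unfolding H0_boundaries_eq using unit_chain_in[OF skew_boundary_in] by blast
  then show "H0_boundaries \<subseteq> carrier (Cc (nerve S 0))" .
  have z: "skew_boundary 0 0 = 0" using skew_boundary_add[OF nerve_induced_0 nerve_induced_0, of 0] by simp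
  have "unit_chain (skew_boundary 0 0) \<in> H0_boundaries" unfolding H0_boundaries_eq using nerve_induced_0 by blast
  then show "\<one>\<^bsub>Cc (nerve S 0)\<^esub> \<in> H0_boundaries" by (simp add: z unit_chain_0 Cc_one)
  fix x assume "x \<in> H0_boundaries"
  then obtain g where g: "g \<in> induced k (nerve_Cc (Suc 0))" "x = unit_chain (skew_boundary 0 g)"
    unfolding H0_boundaries_eq by blast
  have "unit_chain (skew_boundary 0 (- g)) \<in> H0_boundaries"
    unfolding H0_boundaries_eq using nerve_induced_minus[OF g(1)] by blast
  moreover have "unit_chain (skew_boundary 0 (- g)) = - x"
    using g by (simp add: skew_boundary_minus unit_chain_minus skew_boundary_in)
  moreover have "inv\<^bsub>Cc (nerve S 0)\<^esub> x = - x" by (rule inv_Cc) (use sub \<open>x \<in> _\<close> in blast)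
  ultimately show "inv\<^bsub>Cc (nerve S 0)\<^esub> x \<in> H0_boundaries" by simp
  fix y assume "y \<in> H0_boundaries"
  then obtain h where h: "h \<in> induced k (nerve_Cc (Suc 0))" "y = unit_chain (skew_boundary 0 h)"
    unfolding H0_boundaries_eq by blast
  have "unit_chain (skew_boundary 0 (g + h)) \<in> H0_boundaries"
    unfolding H0_boundaries_eq using nerve_induced_add[OF g(1) h(1)] by blast
  moreover have "unit_chain (skew_boundary 0 (g + h)) = x + y"
    using g h by (simp add: skew_boundary_add unit_chain_add skew_boundary_in)
  ultimately show "x \<otimes>\<^bsub>Cc (nerve S 0)\<^esub> y \<in> H0_boundaries" by (simp add: Cc_mult)
qed

lemma H0_eq: "groupoid_homology S 0 = Cc (nerve S 0) Mod H0_boundaries"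
  by (simp add: groupoid_homology_def homology_def cycles_def H0_boundaries_def groupoid_chains_def)

lemma comm_group_H0: "comm_group (groupoid_homology S 0)"
  unfolding H0_eq by (rule comm_group.abelian_FactGroup[OF comm_group_Cc subgroup_H0_boundaries])

definition H0_class :: "(zvec \<Rightarrow> ('a, 'a \<times> zvec \<times> 'a) nerve_point \<Rightarrow> int)
    \<Rightarrow> (('a \<times> zvec, ('a \<times> zvec \<times> 'a) \<times> zvec) nerve_point \<Rightarrow> int) set" where
  "H0_class f = H0_boundaries #>\<^bsub>Cc (nerve S 0)\<^esub> unit_chain f"

lemma normal_H0_boundaries: "H0_boundaries \<lhd> Cc (nerve S 0)"
  by (rule comm_group.subgroup_imp_normal[OF comm_group_Cc subgroup_H0_boundaries])

lemma H0_class_onto: "H0_class ` induced k (nerve_Cc 0) = carrier (groupoid_homology S 0)"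
proof -
  have "unit_chain ` induced k (nerve_Cc 0) = carrier (Cc (nerve S 0))"
    using unit_chain_in unit_chain_surj by blast
  then show ?thesis unfolding H0_eq carrier_FactGroup H0_class_def by (metis image_image)
qed

lemma H0_class_add:
  assumes "f \<in> induced k (nerve_Cc 0)" "g \<in> induced k (nerve_Cc 0)"
  shows "H0_class (f + g) = H0_class f \<otimes>\<^bsub>groupoid_homology S 0\<^esub> H0_class g"
  unfolding H0_eq H0_class_def unit_chain_add[OF assms]
  using normal.rcos_sum[OF normal_H0_boundaries unit_chain_in[OF assms(1)] unit_chain_in[OF assms(2)]]
  by (simp add: Cc_mult)

lemma H0_class_kernel:
  assumes f: "f \<in> induced k (nerve_Cc 0)"
  shows "H0_class f = \<one>\<^bsub>groupoid_homology S 0\<^esub> \<longleftrightarrow> f \<in> skew_boundary 0 ` induced k (nerve_Cc (Suc 0))"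
proof -
  interpret comm_group "Cc (nerve S 0)" by (rule comm_group_Cc)
  have "H0_class f = \<one>\<^bsub>groupoid_homology S 0\<^esub> \<longleftrightarrow> unit_chain f \<in> H0_boundaries"
    unfolding H0_eq H0_class_def one_FactGroup
    using coset_join2[OF unit_chain_in[OF f] subgroup_H0_boundaries]
      rcos_self[OF unit_chain_in[OF f] subgroup_H0_boundaries] by auto
  also have "\<dots> \<longleftrightarrow> f \<in> skew_boundary 0 ` induced k (nerve_Cc (Suc 0))"
    unfolding H0_boundaries_eq using unit_chain_inj[OF f skew_boundary_in] by blast
  finally show ?thesis .
qed

lemma push_translation_unit_chain:
  assumes f: "f \<in> induced k (nerve_Cc 0)"
  shows "push (skew_translation b) (unit_chain f) = unit_chain (shift b f)"
proof -
  let ?t = "\<lambda>(a, z). (a + b, z)"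
  have F: "case_prod f \<in> carrier (Cc (skew_space 0))" using f by (simp add: induced_iff_Cc)
  \<comment> \<open>\<open>unit_map\<close> reads off \<open>the_unit\<close>, so its injectivity is
    argued on genuine units; the support consists of such points.\<close>
  have inj: "inj_on (unit_map \<circ> ?t) {y. case_prod f y \<noteq> 0}"
  proof (rule inj_onI)
    fix y w assume y: "y \<in> {y. case_prod f y \<noteq> 0}" and w: "w \<in> {y. case_prod f y \<noteq> 0}"
      and eq: "(unit_map \<circ> ?t) y = (unit_map \<circ> ?t) w"
    have "y \<in> topspace (skew_space 0)" "w \<in> topspace (skew_space 0)"
      using y w Cc_zero_outside[OF F] by blast+
    then show "y = w" using eq by (auto simp: unit_map_def topspace_nerve_0)
  qed
  have e: "skew_translation b \<circ> unit_map = unit_map \<circ> ?t"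
    by (auto simp: skew_translation_def unit_map_def)
  have s: "push ?t (case_prod f) = case_prod (shift b f)"
  proof
    fix y :: "zvec \<times> ('a, 'a \<times> zvec \<times> 'a) nerve_point"
    obtain a z where y: "y = (a, z)" by force
    have "push ?t (case_prod f) (a, z) = sum (case_prod f) {(a - b, z)}"
      by (rule push_eq_sum) auto
    then show "push ?t (case_prod f) y = case_prod (shift b f) y" by (simp add: y shift_def)
  qed
  have "push (skew_translation b) (unit_chain f) = push (unit_map \<circ> ?t) (case_prod f)"
    unfolding unit_chain_def e[symmetric] by (rule push_push) (unfold e, rule fin_fibres_inj[OF inj])
  also have "\<dots> = push unit_map (push ?t (case_prod f))"
    by (rule push_push[symmetric, OF fin_fibres_inj[OF inj]])
  finally show ?thesis by (simp add: s unit_chain_def)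
qed

text \<open>Translation commutes with the boundary, so translates of boundaries are boundaries;
  adding the boundaries to the translate of a coset then gives exactly one coset.\<close>

lemma skew_action_H0_class:
  assumes b: "b \<in> carrier (Zk k)" and f: "f \<in> induced k (nerve_Cc 0)"
  shows "skew_action k G DR_cocycle b (H0_class f) = H0_class (shift b f)"
proof -
  let ?T = "push (skew_translation b)"
  have mem: "\<exists>w\<in>induced k (nerve_Cc 0). \<beta> = unit_chain w \<and> unit_chain (shift b w) \<in> H0_boundaries" if \<beta>: "\<beta> \<in> H0_boundaries" for \<beta>
  proof -
    obtain g where g: "g \<in> induced k (nerve_Cc (Suc 0))" "\<beta> = unit_chain (skew_boundary 0 g)"
      using \<beta> unfolding H0_boundaries_eq by blast
    have "unit_chain (shift b (skew_boundary 0 g)) \<in> H0_boundaries"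
      unfolding H0_boundaries_eq skew_boundary_shift[symmetric] using induced_shift[OF g(1) b] by blast
    then show ?thesis using g skew_boundary_in[OF g(1)] by blast
  qed
  have T: "\<exists>\<gamma>\<in>H0_boundaries. ?T (\<beta> + unit_chain f) = \<gamma> + unit_chain (shift b f)" if \<beta>: "\<beta> \<in> H0_boundaries" for \<beta>
  proof -
    obtain w where w: "w \<in> induced k (nerve_Cc 0)" "\<beta> = unit_chain w" "unit_chain (shift b w) \<in> H0_boundaries"
      using mem[OF \<beta>] by blast
    have "?T (\<beta> + unit_chain f) = unit_chain (shift b (w + f))"
      using push_translation_unit_chain[OF nerve_induced_add[OF w(1) f]] unit_chain_add[OF w(1) f] w(2) by simp
    also have "\<dots> = unit_chain (shift b w) + unit_chain (shift b f)"
      unfolding shift_add by (rule unit_chain_add[OF induced_shift[OF w(1) b] induced_shift[OF f b]])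
    finally show ?thesis using w(3) by blast
  qed
  have add: "\<beta> + \<gamma> \<in> H0_boundaries" if "\<beta> \<in> H0_boundaries" "\<gamma> \<in> H0_boundaries" for \<beta> \<gamma>
    using subgroup.m_closed[OF subgroup_H0_boundaries that] by (simp add: Cc_mult)
  have zero: "0 \<in> H0_boundaries" using subgroup.one_closed[OF subgroup_H0_boundaries] by (simp add: Cc_one)
  have "skew_action k G DR_cocycle b (H0_class f) = H0_boundaries <#>\<^bsub>Cc (nerve S 0)\<^esub> (?T ` H0_class f)"
    by (simp add: skew_action_def homology_map_def H0_boundaries_def groupoid_chains_def pushforward_eq_push)
  also have "\<dots> = {\<gamma> + ?T (\<beta> + unit_chain f) | \<gamma> \<beta>. \<gamma> \<in> H0_boundaries \<and> \<beta> \<in> H0_boundaries}"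
    by (auto simp: set_mult_def H0_class_def r_coset_def Cc_mult)
  also have "\<dots> = {\<gamma> + unit_chain (shift b f) | \<gamma>. \<gamma> \<in> H0_boundaries}"
  proof (intro equalityI subsetI)
    fix x assume "x \<in> {\<gamma> + ?T (\<beta> + unit_chain f) | \<gamma> \<beta>. \<gamma> \<in> H0_boundaries \<and> \<beta> \<in> H0_boundaries}"
    then obtain \<gamma> \<beta> where "x = \<gamma> + ?T (\<beta> + unit_chain f)" "\<gamma> \<in> H0_boundaries" "\<beta> \<in> H0_boundaries" by blast
    moreover obtain \<delta> where "\<delta> \<in> H0_boundaries" "?T (\<beta> + unit_chain f) = \<delta> + unit_chain (shift b f)"
      using T[OF calculation(3)] by blast
    ultimately have "x = (\<gamma> + \<delta>) + unit_chain (shift b f)" "\<gamma> + \<delta> \<in> H0_boundaries"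
      by (auto simp: add.assoc add)
    then show "x \<in> {\<gamma> + unit_chain (shift b f) | \<gamma>. \<gamma> \<in> H0_boundaries}" by blast
  next
    fix x assume "x \<in> {\<gamma> + unit_chain (shift b f) | \<gamma>. \<gamma> \<in> H0_boundaries}"
    then obtain \<gamma> where x: "x = \<gamma> + unit_chain (shift b f)" "\<gamma> \<in> H0_boundaries" by blast
    have "x = \<gamma> + ?T (0 + unit_chain f)" using x push_translation_unit_chain[OF f] by simp
    then show "x \<in> {\<gamma> + ?T (\<beta> + unit_chain f) | \<gamma> \<beta>. \<gamma> \<in> H0_boundaries \<and> \<beta> \<in> H0_boundaries}"
      using x(2) zero by blast
  qed
  also have "\<dots> = H0_class (shift b f)" by (auto simp: H0_class_def r_coset_def Cc_mult)
  finally show ?thesis .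
qed

text \<open>The resolution by the nerve. Its coinvariants are the groupoid chains themselves, hence
  \<xi> is the identity.\<close>

sublocale skew: induced_resolution k nerve_Cc skew_boundary "\<lambda>n. groupoid_boundary G (Suc n)"
  "groupoid_homology S 0" "skew_action k G DR_cocycle" H0_class "groupoid_chains G" "groupoid_boundary G" "\<lambda>n x. x"
proof (intro induced_resolution.intro)
  show "coinv (skew_boundary n f) = groupoid_boundary G (Suc n) (coinv f)" if "f \<in> induced k (nerve_Cc (Suc n))" for n f
    by (rule skew_boundary_coinv[OF that])
  show "comm_group (groupoid_chains G n)" for n by (simp add: groupoid_chains_def comm_group_Cc)
  show "bij_betw (\<lambda>x. x) (nerve_Cc n) (carrier (groupoid_chains G n))" for n
    by (simp add: groupoid_chains_def bij_betw_def)
  show "skew_boundary n (shift b f) = shift b (skew_boundary n f)" for n b f by (rule skew_boundary_shift)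
  show "groupoid_boundary G (Suc n) x = groupoid_boundary G (Suc n) x" for n x ..
  show "x + y = x \<otimes>\<^bsub>groupoid_chains G n\<^esub> y" for n x y by (simp add: groupoid_chains_def Cc_mult)
  show "\<exists>g\<in>induced k (nerve_Cc (Suc (Suc n))). skew_boundary (Suc n) g = f"
    if "f \<in> induced k (nerve_Cc (Suc n))" "skew_boundary n f = 0" for n f
    by (rule skew_exact[OF that])
qed (fact Cc_zero Cc_diff skew_boundary_in skew_boundary_add skew_boundary_boundary
    comm_group_H0 H0_class_onto H0_class_add H0_class_kernel skew_action_H0_class)+

end

section \<open>Koszul complexes\<close>

lemma antisymmetric_sum_zero:
  fixes g :: "nat \<Rightarrow> nat \<Rightarrow> 'v::ab_group_add"
  assumes A: "finite A" and anti: "\<And>i l. i \<in> A \<Longrightarrow> l \<in> A \<Longrightarrow> i \<noteq> l \<Longrightarrow> g i l = - g l i"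
  shows "(\<Sum>i\<in>A. \<Sum>l\<in>A - {i}. g i l) = 0"
proof -
  define U where "U = {(i, l). i \<in> A \<and> l \<in> A \<and> i < l}"
  define L where "L = {(i, l). i \<in> A \<and> l \<in> A \<and> l < i}"
  have fin: "finite U" "finite L"
    by (rule finite_subset[of _ "A \<times> A"], use A in \<open>auto simp: U_def L_def\<close>)+
  have "(\<Sum>i\<in>A. \<Sum>l\<in>A - {i}. g i l) = (\<Sum>(i, l)\<in>(SIGMA i:A. A - {i}). g i l)"
    using A by (subst sum.Sigma) auto
  also have "(SIGMA i:A. A - {i}) = U \<union> L" by (auto simp: U_def L_def)
  also have "(\<Sum>(i, l)\<in>U \<union> L. g i l) = (\<Sum>(i, l)\<in>U. g i l) + (\<Sum>(i, l)\<in>L. g i l)"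
    by (rule sum.union_disjoint[OF fin]) (auto simp: U_def L_def)
  also have "(\<Sum>(i, l)\<in>L. g i l) = (\<Sum>(i, l)\<in>U. - g i l)"
  proof (rule sum.reindex_bij_witness[where i = "\<lambda>(i, l). (l, i)" and j = "\<lambda>(i, l). (l, i)"])
    fix z assume "z \<in> L"
    then obtain i l where "z = (i, l)" "i \<in> A" "l \<in> A" "l < i" by (auto simp: L_def)
    then show "(case (case z of (i, l) \<Rightarrow> (l, i)) of (i, l) \<Rightarrow> - g i l) = (case z of (i, l) \<Rightarrow> g i l)"
      using anti[of i l] by simp
  qed (auto simp: U_def L_def)
  finally show ?thesis by (simp add: split_def sum_negf)
qed

text \<open>The number of transpositions that bring the i-th basis vector from the front to its
  place in the increasing wedge over T, hence the exponent of the Koszul sign.\<close>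

definition position :: "nat \<Rightarrow> nat set \<Rightarrow> nat" where
  "position i T = card {l \<in> T. l < i}"

lemma position_insert:
  assumes "finite T" "l \<notin> T"
  shows "position i (insert l T) = (if l < i then Suc (position i T) else position i T)"
proof -
  have "{m \<in> insert l T. m < i} = (if l < i then insert l {m \<in> T. m < i} else {m \<in> T. m < i})" by auto
  then show ?thesis using assms by (simp add: position_def)
qed

text \<open>Inserting the smaller of the two indices raises the position of the larger one by one,
  and not conversely.\<close>

lemma position_swap:
  assumes "finite T" "i \<notin> T" "l \<notin> T" "i \<noteq> l"
  shows "alt_sign (position i T + position l (insert i T)) x = - alt_sign (position l T + position i (insert l T)) x"
  using assms by (cases "i < l") (auto simp: position_insert add.commute)

text \<open>The Koszul differential in coordinates: a chain is a function of index sets, and its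
  boundary at T collects the sets with one element more. Only the first j operators take part, which
  prepares an induction on j.\<close>

definition koszul_d :: "(nat \<Rightarrow> 'p \<Rightarrow> 'p) \<Rightarrow> nat \<Rightarrow> (nat set \<Rightarrow> 'p) \<Rightarrow> nat set \<Rightarrow> 'p::ab_group_add" where
  "koszul_d u j F T = (\<Sum>i\<in>{1..j} - T. alt_sign (position i T) (u i (F (insert i T))))"

definition koszul_chains :: "'p::ab_group_add set \<Rightarrow> nat \<Rightarrow> nat \<Rightarrow> (nat set \<Rightarrow> 'p) set" where
  "koszul_chains B j q = {F. \<forall>T. F T \<in> B \<and> (F T \<noteq> 0 \<longrightarrow> T \<subseteq> {1..j} \<and> card T = q)}"

locale commuting_family =
  fixes B :: "'p::ab_group_add set" and u :: "nat \<Rightarrow> 'p \<Rightarrow> 'p" and k :: nat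
  assumes B_0: "0 \<in> B" and B_diff: "x \<in> B \<Longrightarrow> y \<in> B \<Longrightarrow> x - y \<in> B"
    and u_in: "i \<in> {1..k} \<Longrightarrow> x \<in> B \<Longrightarrow> u i x \<in> B"
    and u_add: "i \<in> {1..k} \<Longrightarrow> x \<in> B \<Longrightarrow> y \<in> B \<Longrightarrow> u i (x + y) = u i x + u i y"
    and u_comm: "i \<in> {1..k} \<Longrightarrow> l \<in> {1..k} \<Longrightarrow> x \<in> B \<Longrightarrow> u i (u l x) = u l (u i x)"
begin

lemma B_minus: "x \<in> B \<Longrightarrow> - x \<in> B" using B_diff[OF B_0, of x] by simp

lemma B_add: "x \<in> B \<Longrightarrow> y \<in> B \<Longrightarrow> x + y \<in> B" using B_diff[OF _ B_minus, of x y] by simp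

lemma B_sum: "(\<And>i. i \<in> I \<Longrightarrow> f i \<in> B) \<Longrightarrow> sum f I \<in> B"
  by (rule sum_in_group[OF B_0 B_diff])

lemma B_alt_sign: "x \<in> B \<Longrightarrow> alt_sign i x \<in> B"
  by (rule alt_sign_in_group[OF B_0 B_diff])

lemma u_0: "i \<in> {1..k} \<Longrightarrow> u i 0 = 0"
  using u_add[OF _ B_0 B_0, of i] by simp

lemma u_minus: "i \<in> {1..k} \<Longrightarrow> x \<in> B \<Longrightarrow> u i (- x) = - u i x"
  using u_add[of i x "- x"] u_0[of i] B_minus[of x] by (simp add: eq_neg_iff_add_eq_0 add.commute)

lemma u_alt_sign: "i \<in> {1..k} \<Longrightarrow> x \<in> B \<Longrightarrow> u i (alt_sign n x) = alt_sign n (u i x)"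
  by (simp add: alt_sign_def u_minus)

lemma u_sum: "i \<in> {1..k} \<Longrightarrow> (\<And>l. l \<in> I \<Longrightarrow> f l \<in> B) \<Longrightarrow> u i (sum f I) = (\<Sum>l\<in>I. u i (f l))"
  by (induction I rule: infinite_finite_induct) (simp_all add: u_0 u_add B_sum)

abbreviation K :: "nat \<Rightarrow> nat \<Rightarrow> (nat set \<Rightarrow> 'p) set" where "K \<equiv> koszul_chains B"

abbreviation d :: "nat \<Rightarrow> (nat set \<Rightarrow> 'p) \<Rightarrow> nat set \<Rightarrow> 'p" where "d \<equiv> koszul_d u"

lemma K_B: "F \<in> K j q \<Longrightarrow> F T \<in> B"
  and K_nonzero: "F \<in> K j q \<Longrightarrow> F T \<noteq> 0 \<Longrightarrow> T \<subseteq> {1..j} \<and> card T = q"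
  by (auto simp: koszul_chains_def)

lemma K_0: "0 \<in> K j q" by (simp add: koszul_chains_def B_0)

lemma K_diff: assumes "F \<in> K j q" "F' \<in> K j q" shows "F - F' \<in> K j q"
proof -
  have "T \<subseteq> {1..j} \<and> card T = q" if "(F - F') T \<noteq> 0" for T
    using that K_nonzero[OF assms(1), of T] K_nonzero[OF assms(2), of T] by (cases "F T = 0") simp_all
  then show ?thesis using K_B[OF assms(1)] K_B[OF assms(2)] by (simp add: koszul_chains_def B_diff)
qed

lemma K_minus: "F \<in> K j q \<Longrightarrow> - F \<in> K j q" using K_diff[OF K_0, of F j q] by simp

lemma K_add: "F \<in> K j q \<Longrightarrow> F' \<in> K j q \<Longrightarrow> F + F' \<in> K j q"
  using K_diff[OF _ K_minus, of F j q F'] by simp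

lemma d_in:
  assumes F: "F \<in> K j (Suc q)" and j: "j \<le> k" shows "d j F \<in> K j q"
proof -
  have in_B: "d j F T \<in> B" for T
    unfolding koszul_d_def by (intro B_sum B_alt_sign u_in K_B[OF F]) (use j in auto)
  moreover have "T \<subseteq> {1..j} \<and> card T = q" if nz: "d j F T \<noteq> 0" for T
  proof -
    have "\<exists>i\<in>{1..j} - T. alt_sign (position i T) (u i (F (insert i T))) \<noteq> 0"
      using nz unfolding koszul_d_def by (meson sum.neutral)
    then obtain i where i: "i \<in> {1..j} - T" "u i (F (insert i T)) \<noteq> 0" by auto
    then have "F (insert i T) \<noteq> 0" using u_0[of i] j by auto
    then have T: "insert i T \<subseteq> {1..j}" "card (insert i T) = Suc q" using K_nonzero[OF F] by blast+
    then have "finite T" using finite_subset[OF T(1)] by simp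
    then show ?thesis using T i by simp
  qed
  ultimately show ?thesis by (auto simp: koszul_chains_def)
qed

lemma d_add: "F \<in> K j q \<Longrightarrow> F' \<in> K j q \<Longrightarrow> j \<le> k \<Longrightarrow> d j (F + F') = d j F + d j F'"
  by (auto simp: koszul_d_def fun_eq_iff u_add K_B alt_sign_add sum.distrib[symmetric] intro!: sum.cong)

lemma d_0: "j \<le> k \<Longrightarrow> d j 0 = 0"
  using d_add[OF K_0 K_0, of j] by simp

lemma d_minus: "F \<in> K j q \<Longrightarrow> j \<le> k \<Longrightarrow> d j (- F) = - d j F"
  using d_add[of F j q "- F"] d_0[of j] K_minus[of F j q] by (simp add: eq_neg_iff_add_eq_0 add.commute)

text \<open>Adding i and then l cancels against adding l and then i, as the operators commute and
  \<open>position_swap\<close> reverses the sign.\<close>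

lemma d_d:
  assumes F: "F \<in> K j q" and j: "j \<le> k" shows "d j (d j F) = 0"
proof
  fix T
  show "d j (d j F) T = 0 T"
  proof (cases "finite T")
    case False
    have "F (insert l (insert i T)) = 0" for i l
    proof (rule ccontr)
      assume "F (insert l (insert i T)) \<noteq> 0"
      then have "insert l (insert i T) \<subseteq> {1..j}" using K_nonzero[OF F] by blast
      then have "finite T" using finite_subset[of "insert l (insert i T)" "{1..j}"] by simp
      then show False using False by simp
    qed
    then show ?thesis using u_0 j by (auto simp: koszul_d_def intro!: sum.neutral)
  next
    case T: True
    define A where "A = {1..j} - T"
    define g where "g i l = alt_sign (position i T + position l (insert i T)) (u i (u l (F (insert l (insert i T)))))" for i l
    have Ak: "i \<in> {1..k}" if "i \<in> A" for i using that j by (auto simp: A_def)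
    have "d j (d j F) T = (\<Sum>i\<in>A. alt_sign (position i T) (u i (\<Sum>l\<in>A - {i}. alt_sign (position l (insert i T)) (u l (F (insert l (insert i T)))))))"
    proof -
      have "{1..j} - insert i T = A - {i}" for i by (auto simp: A_def)
      then show ?thesis by (simp add: koszul_d_def A_def)
    qed
    also have "\<dots> = (\<Sum>i\<in>A. \<Sum>l\<in>A - {i}. g i l)"
    proof (rule sum.cong[OF refl])
      fix i assume i: "i \<in> A"
      have "u i (\<Sum>l\<in>A - {i}. alt_sign (position l (insert i T)) (u l (F (insert l (insert i T)))))
          = (\<Sum>l\<in>A - {i}. u i (alt_sign (position l (insert i T)) (u l (F (insert l (insert i T))))))"
        by (intro u_sum B_alt_sign u_in K_B[OF F] Ak) (use i in auto)
      also have "\<dots> = (\<Sum>l\<in>A - {i}. alt_sign (position l (insert i T)) (u i (u l (F (insert l (insert i T))))))"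
        by (intro sum.cong refl u_alt_sign u_in K_B[OF F] Ak) (use i in auto)
      finally show "alt_sign (position i T) (u i (\<Sum>l\<in>A - {i}. alt_sign (position l (insert i T)) (u l (F (insert l (insert i T))))))
          = (\<Sum>l\<in>A - {i}. g i l)"
        by (simp add: alt_sign_sum alt_sign_alt_sign g_def)
    qed
    also have "\<dots> = 0"
    proof (rule antisymmetric_sum_zero)
      show "finite A" by (simp add: A_def)
      fix i l assume il: "i \<in> A" "l \<in> A" "i \<noteq> l"
      have "u i (u l (F (insert l (insert i T)))) = u l (u i (F (insert i (insert l T))))"
        using u_comm[OF Ak[OF il(1)] Ak[OF il(2)] K_B[OF F]] by (simp add: insert_commute)
      then show "g i l = - g l i"
        unfolding g_def using position_swap[OF T, of i l] il by (simp add: A_def)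
    qed
    finally show ?thesis by simp
  qed
qed

text \<open>The sum of the images of the first j operators; regularity of the next operator is
  understood modulo it.\<close>

definition span :: "nat \<Rightarrow> 'p set" where
  "span j = {\<Sum>i\<in>{1..j}. u i (h i) | h. \<forall>i. h i \<in> B}"

lemma spanI: "(\<And>i. h i \<in> B) \<Longrightarrow> (\<Sum>i\<in>{1..j}. u i (h i)) \<in> span j"
  by (auto simp: span_def)

lemma span_0: "j \<le> k \<Longrightarrow> 0 \<in> span j"
  using spanI[of "\<lambda>_. 0" j] B_0 u_0 by (simp add: atLeastAtMost_iff)

lemma span_add: assumes "x \<in> span j" "y \<in> span j" "j \<le> k" shows "x + y \<in> span j"
proof -
  obtain g h where gh: "\<And>i. g i \<in> B" "\<And>i. h i \<in> B" "x = (\<Sum>i\<in>{1..j}. u i (g i))" "y = (\<Sum>i\<in>{1..j}. u i (h i))"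
    using assms by (auto simp: span_def)
  have "x + y = (\<Sum>i\<in>{1..j}. u i (g i + h i))"
    unfolding gh(3,4) sum.distrib[symmetric] by (rule sum.cong) (use gh assms(3) in \<open>auto simp: u_add\<close>)
  then show ?thesis using spanI[of "\<lambda>i. g i + h i" j] gh B_add by simp
qed

lemma span_minus: assumes "x \<in> span j" "j \<le> k" shows "- x \<in> span j"
proof -
  obtain g where g: "\<And>i. g i \<in> B" "x = (\<Sum>i\<in>{1..j}. u i (g i))" using assms by (auto simp: span_def)
  have "- x = (\<Sum>i\<in>{1..j}. u i (- g i))"
    unfolding g(2) sum_negf[symmetric] by (rule sum.cong) (use g assms(2) in \<open>auto simp: u_minus\<close>)
  then show ?thesis using spanI[of "\<lambda>i. - g i" j] g B_minus by simp
qed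

lemma span_diff: "x \<in> span j \<Longrightarrow> y \<in> span j \<Longrightarrow> j \<le> k \<Longrightarrow> x - y \<in> span j"
  using span_add[OF _ span_minus, of x j y] by simp

lemma span_sum: "j \<le> k \<Longrightarrow> (\<And>i. i \<in> I \<Longrightarrow> f i \<in> span j) \<Longrightarrow> sum f I \<in> span j"
  by (rule sum_in_group[OF span_0 span_diff]) auto

lemma span_u: assumes "x \<in> B" "i \<in> {1..j}" "j \<le> k" shows "u i x \<in> span j"
proof -
  have "(\<Sum>l\<in>{1..j}. u l (if l = i then x else 0)) = (\<Sum>l\<in>{1..j}. if l = i then u i x else 0)"
    by (rule sum.cong) (use assms u_0 in auto)
  also have "\<dots> = u i x" using assms by simp
  finally show ?thesis using spanI[of "\<lambda>l. if l = i then x else 0" j] assms B_0 by auto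
qed

lemma span_iff: "x \<in> span j \<longleftrightarrow> (\<exists>H\<in>K j (Suc 0). x = d j H {})"
proof
  assume "x \<in> span j"
  then obtain h where h: "\<And>i. h i \<in> B" "x = (\<Sum>i\<in>{1..j}. u i (h i))" by (auto simp: span_def)
  define H where "H T = (if \<exists>i\<in>{1..j}. T = {i} then h (the_elem T) else 0)" for T
  have "H \<in> K j (Suc 0)" using h(1) B_0 by (auto simp: koszul_chains_def H_def)
  moreover have "d j H {} = x"
    unfolding koszul_d_def h(2) by (rule sum.cong) (auto simp: H_def position_def)
  ultimately show "\<exists>H\<in>K j (Suc 0). x = d j H {}" by blast
next
  assume "\<exists>H\<in>K j (Suc 0). x = d j H {}"
  then obtain H where H: "H \<in> K j (Suc 0)" "x = d j H {}" by blast
  have "x = (\<Sum>i\<in>{1..j}. u i (H {i}))" unfolding H(2) koszul_d_def by (rule sum.cong) (auto simp: position_def)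
  then show "x \<in> span j" using spanI[of "\<lambda>i. H {i}" j] K_B[OF H(1)] by simp
qed

text \<open>With \<open>d_Suc_with\<close> this presents the complex of j + 1 operators, up to
  signs, as the mapping cone of the last operator on the complex of the first j.\<close>

lemma d_Suc_without:
  assumes "T \<subseteq> {1..j}"
  shows "d (Suc j) F T = d j F T + alt_sign (card T) (u (Suc j) (F (insert (Suc j) T)))"
proof -
  have e: "{1..Suc j} - T = insert (Suc j) ({1..j} - T)" using assms by auto
  have "{l \<in> T. l < Suc j} = T" using assms by auto
  then have "position (Suc j) T = card T" by (simp add: position_def)
  then show ?thesis unfolding koszul_d_def e by (subst sum.insert) (auto simp: add.commute)
qed

lemma d_Suc_with:
  assumes "T \<subseteq> {1..j}"
  shows "d (Suc j) F (insert (Suc j) T) = d j (\<lambda>T. F (insert (Suc j) T)) T"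
proof -
  have e: "{1..Suc j} - insert (Suc j) T = {1..j} - T" using assms by auto
  have "position i (insert (Suc j) T) = position i T" if "i \<in> {1..j}" for i
  proof -
    have "{l \<in> insert (Suc j) T. l < i} = {l \<in> T. l < i}" using that by auto
    then show ?thesis by (simp add: position_def)
  qed
  then show ?thesis unfolding koszul_d_def e by (intro sum.cong) (auto simp: insert_commute)
qed

text \<open>Induction on the number of operators. The part F1 of a cycle that involves the index j +
  1 is a boundary for the first j operators; lifting its preimage H1 and subtracting leaves a cycle
  free of that index, to which the induction hypothesis applies.\<close>

theorem koszul_exact:
  assumes regular: "\<And>j x. j < k \<Longrightarrow> x \<in> B \<Longrightarrow> u (Suc j) x \<in> span j \<Longrightarrow> x \<in> span j"
  shows "j \<le> k \<Longrightarrow> F \<in> K j (Suc q) \<Longrightarrow> d j F = 0 \<Longrightarrow> \<exists>H\<in>K j (Suc (Suc q)). d j H = F"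
proof (induction j arbitrary: F q)
  case 0
  have "F T = 0" for T
  proof (rule ccontr)
    assume "F T \<noteq> 0"
    then have "T \<subseteq> {1..0}" "card T = Suc q" using K_nonzero[OF 0(2)] by blast+
    then show False by simp
  qed
  then have "F = 0" by auto
  then show ?case using K_0 d_0[OF 0(1)] by blast
next
  case (Suc j)
  note F = Suc.prems(2) and jk = Suc.prems(1)
  have jk': "j \<le> k" "j < k" and Sj: "Suc j \<in> {1..k}" using jk by auto
  define F1 where "F1 T = (if Suc j \<in> T then 0 else F (insert (Suc j) T))" for T
  have F1: "F1 \<in> K j q"
  proof -
    have "T \<subseteq> {1..j} \<and> card T = q" if "F1 T \<noteq> 0" for T
    proof -
      have T: "Suc j \<notin> T" "F (insert (Suc j) T) \<noteq> 0" using that by (auto simp: F1_def split: if_splits)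
      then have t: "insert (Suc j) T \<subseteq> {1..Suc j}" "card (insert (Suc j) T) = Suc q" using K_nonzero[OF F] by blast+
      have "finite T" using finite_subset[OF t(1)] by simp
      moreover have "T \<subseteq> {1..j}" using t(1) T(1) by (auto simp: le_Suc_eq)
      ultimately show ?thesis using t T(1) by simp
    qed
    then show ?thesis using K_B[OF F] B_0 by (auto simp: koszul_chains_def F1_def)
  qed
  have d_F1: "d j F1 T = d j (\<lambda>T. F (insert (Suc j) T)) T" if "T \<subseteq> {1..j}" for T
    unfolding koszul_d_def using that by (intro sum.cong) (auto simp: F1_def)
  have "\<exists>H\<in>K j (Suc q). d j H = F1"
  proof (cases q)
    \<comment> \<open>Here F1 has degree 0, where every chain is a cycle. The cycle condition on F
      puts \<open>u (Suc j) (F1 {})\<close> in the span of the first j operators, and regularity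
      does the same for \<open>F1 {}\<close>.\<close>
    case 0
    have "d (Suc j) F {} = 0" using Suc.prems(3) by simp
    then have "d j F {} + u (Suc j) (F1 {}) = 0" using d_Suc_without[of "{}" j F] by (simp add: F1_def)
    then have e: "u (Suc j) (F1 {}) = - d j F {}" by (simp add: eq_neg_iff_add_eq_0 add.commute)
    have "d j F {} \<in> span j"
    proof -
      have "d j F {} = (\<Sum>i\<in>{1..j}. u i (F {i}))" unfolding koszul_d_def by (rule sum.cong) (auto simp: position_def)
      then show ?thesis using spanI[of "\<lambda>i. F {i}" j] K_B[OF F] by simp
    qed
    then have "F1 {} \<in> span j" using regular[OF jk'(2) K_B[OF F1]] e span_minus jk'(1) by simp
    then obtain H where H: "H \<in> K j (Suc 0)" "F1 {} = d j H {}" unfolding span_iff by blast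
    have "d j H T = F1 T" for T
    proof (cases "T = {}")
      case False
      have "finite T" if "T \<subseteq> {1..j}" using finite_subset[OF that] by simp
      then have "F1 T = 0" "d j H T = 0"
        using K_nonzero[OF F1, of T] K_nonzero[OF d_in[OF H(1) jk'(1)], of T] False 0 by auto
      then show ?thesis by simp
    qed (use H in simp)
    then show ?thesis using H(1) 0 by auto
  next
    case (Suc q')
    have "d j F1 T = 0" for T
    proof (cases "T \<subseteq> {1..j}")
      case True
      then show ?thesis using d_F1[OF True] d_Suc_with[OF True, of F] Suc.prems(3) by simp
    next
      case False
      then show ?thesis using K_nonzero[OF d_in[OF F1[unfolded Suc] jk'(1)], of T] by blast
    qed
    then have "d j F1 = 0" by auto
    then show ?thesis using Suc.IH[OF jk'(1), of F1 q'] F1 Suc by simp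
  qed
  then obtain H1 where H1: "H1 \<in> K j (Suc q)" "d j H1 = F1" by blast
  \<comment> \<open>H1 is moved to the index sets containing j + 1, so that the boundary of H2
    agrees with F on those sets.\<close>
  define H2 where "H2 T = (if Suc j \<in> T then H1 (T - {Suc j}) else 0)" for T
  have H2: "H2 \<in> K (Suc j) (Suc (Suc q))"
  proof -
    have "T \<subseteq> {1..Suc j} \<and> card T = Suc (Suc q)" if "H2 T \<noteq> 0" for T
    proof -
      have T: "Suc j \<in> T" "H1 (T - {Suc j}) \<noteq> 0" using that by (auto simp: H2_def split: if_splits)
      then have t: "T - {Suc j} \<subseteq> {1..j}" "card (T - {Suc j}) = Suc q" using K_nonzero[OF H1(1)] by blast+
      have "finite (T - {Suc j})" using finite_subset[OF t(1)] by simp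
      then have "card T = Suc (Suc q)" using t(2) T(1) by (metis card_Suc_Diff1 finite_Diff2 finite.emptyI finite_insert)
      moreover have "T \<subseteq> {1..Suc j}" using t(1) by auto
      ultimately show ?thesis by blast
    qed
    then show ?thesis using K_B[OF H1(1)] B_0 by (auto simp: koszul_chains_def H2_def)
  qed
  define F' where "F' = F - d (Suc j) H2"
  have F': "F' \<in> K (Suc j) (Suc q)" unfolding F'_def by (rule K_diff[OF F d_in[OF H2 jk]])
  have dF': "d (Suc j) F' = 0"
  proof -
    have "d (Suc j) F' = d (Suc j) F + d (Suc j) (- d (Suc j) H2)"
      unfolding F'_def using d_add[OF F K_minus[OF d_in[OF H2 jk]] jk] by simp
    then show ?thesis
      unfolding d_minus[OF d_in[OF H2 jk] jk] d_d[OF H2 jk] Suc.prems(3) by (simp only: minus_zero add_0)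
  qed
  \<comment> \<open>By the choice of H2 nothing in F' involves the index j + 1 any more.\<close>
  have F'_with: "F' T = 0" if "Suc j \<in> T" for T
  proof (cases "T - {Suc j} \<subseteq> {1..j}")
    case True
    define T' where "T' = T - {Suc j}"
    have T': "T = insert (Suc j) T'" "T' \<subseteq> {1..j}" "Suc j \<notin> T'" using that True by (auto simp: T'_def)
    have "d (Suc j) H2 T = d j (\<lambda>T. H2 (insert (Suc j) T)) T'" unfolding T'(1) by (rule d_Suc_with[OF T'(2)])
    also have "\<dots> = d j H1 T'"
      unfolding koszul_d_def using T' by (intro sum.cong) (auto simp: H2_def)
    also have "\<dots> = F T" using H1(2) T' by (simp add: F1_def)
    finally show ?thesis by (simp add: F'_def)
  next
    case False
    then show ?thesis using K_nonzero[OF F', of T] by fastforce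
  qed
  have F'j: "F' \<in> K j (Suc q)"
  proof -
    have "T \<subseteq> {1..j} \<and> card T = Suc q" if nz: "F' T \<noteq> 0" for T
    proof -
      have "T \<subseteq> {1..Suc j}" "card T = Suc q" "Suc j \<notin> T" using K_nonzero[OF F' nz] F'_with nz by auto
      moreover from this have "T \<subseteq> {1..j}" by (auto simp: le_Suc_eq)
      ultimately show ?thesis by blast
    qed
    then show ?thesis using K_B[OF F'] by (auto simp: koszul_chains_def)
  qed
  have "d j F' T = 0" for T
  proof (cases "T \<subseteq> {1..j}")
    case True
    have "d (Suc j) F' T = d j F' T + alt_sign (card T) (u (Suc j) (F' (insert (Suc j) T)))" by (rule d_Suc_without[OF True])
    then show ?thesis using dF' F'_with[of "insert (Suc j) T"] u_0[OF Sj] by simp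
  next
    case False
    then show ?thesis using K_nonzero[OF d_in[OF F'j jk'(1)], of T] by blast
  qed
  then have "d j F' = 0" by auto
  then obtain H0 where H0: "H0 \<in> K j (Suc (Suc q))" "d j H0 = F'" using Suc.IH[OF jk'(1) F'j] by blast
  have H0': "H0 \<in> K (Suc j) (Suc (Suc q))"
    using H0(1) by (fastforce simp: koszul_chains_def)
  have "Suc j \<notin> {1..j}" by simp
  then have H0_with: "H0 T = 0" if "Suc j \<in> T" for T using K_nonzero[OF H0(1), of T] that by blast
  have "d (Suc j) H0 T = F' T" for T
  proof (cases "T \<subseteq> {1..j}")
    case True
    then show ?thesis using d_Suc_without[OF True, of H0] H0_with[of "insert (Suc j) T"] u_0[OF Sj] H0(2) by simp
  next
    case False
    have "H0 (insert i T) = 0" for i using K_nonzero[OF H0(1), of "insert i T"] False by auto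
    then have "d (Suc j) H0 T = 0" unfolding koszul_d_def using u_0 jk by (intro sum.neutral) auto
    moreover have "F' T = 0" using K_nonzero[OF F'j, of T] False by blast
    ultimately show ?thesis by simp
  qed
  then have "d (Suc j) H0 = F'" by auto
  then have "d (Suc j) (H2 + H0) = F" using d_add[OF H2 H0' jk] by (simp add: F'_def)
  then show ?case using K_add[OF H2 H0'] by blast
qed

end

section \<open>The Koszul resolution of \<open>H\<^sub>0\<close>\<close>

lemma induced_map:
  assumes "f \<in> induced k Q" "\<And>x. x \<in> Q \<Longrightarrow> \<phi> x \<in> Q'" "\<phi> 0 = 0"
  shows "(\<lambda>a. \<phi> (f a)) \<in> induced k Q'"
proof -
  have "{a. \<phi> (f a) \<noteq> 0} \<subseteq> {a. f a \<noteq> 0}" using assms(3) by auto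
  then have "finite {a. \<phi> (f a) \<noteq> 0}" using assms(1) finite_subset by (auto simp: induced_def)
  moreover have "a \<in> carrier (Zk k)" if "\<phi> (f a) \<noteq> 0" for a
    using assms that by (cases "f a = 0") (auto simp: induced_def)
  ultimately show ?thesis using assms by (auto simp: induced_def)
qed

lemma induced_0: "0 \<in> Q \<Longrightarrow> 0 \<in> induced k Q"
  by (simp add: induced_def)

lemma induced_diff:
  assumes "\<And>x y. x \<in> Q \<Longrightarrow> y \<in> Q \<Longrightarrow> x - y \<in> Q" "f \<in> induced k Q" "g \<in> induced k Q"
  shows "f - g \<in> induced k Q"
proof -
  have "{a. (f - g) a \<noteq> 0} \<subseteq> {a. f a \<noteq> 0} \<union> {a. g a \<noteq> 0}" by auto
  moreover have "finite ({a. f a \<noteq> 0} \<union> {a. g a \<noteq> 0})" using assms by (simp add: induced_def)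
  ultimately have "finite {a. (f - g) a \<noteq> 0}" by (rule finite_subset)
  moreover have "a \<in> carrier (Zk k)" if "f a \<noteq> g a" for a
    using assms that by (cases "f a = 0") (auto simp: induced_def)
  ultimately show ?thesis using assms by (simp add: induced_def)
qed

lemma coinv_eq_sum: "finite S \<Longrightarrow> {a. f a \<noteq> 0} \<subseteq> S \<Longrightarrow> coinv f = sum f S"
  unfolding coinv_def by (rule sum.mono_neutral_left) auto

lemma coinv_plus:
  assumes "finite {a. f a \<noteq> 0}" "finite {a. g a \<noteq> 0}"
  shows "coinv (f + g) = coinv f + coinv g"
proof -
  let ?S = "{a. f a \<noteq> 0} \<union> {a. g a \<noteq> 0}"
  have S: "finite ?S" using assms by simp
  have "coinv f = sum f ?S" "coinv g = sum g ?S" by (rule coinv_eq_sum[OF S], auto)+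
  moreover have "coinv (f + g) = sum (f + g) ?S" by (rule coinv_eq_sum[OF S]) auto
  ultimately show ?thesis by (simp add: sum.distrib)
qed

lemma coinv_uminus: "coinv (- f) = - coinv f"
  by (simp add: coinv_def sum_negf)

lemma coinv_zero [simp]: "coinv 0 = 0"
  by (simp add: coinv_def)

lemma coinv_sum:
  assumes "0 \<in> Q" "\<And>x y. x \<in> Q \<Longrightarrow> y \<in> Q \<Longrightarrow> x - y \<in> Q" "\<And>i. i \<in> I \<Longrightarrow> f i \<in> induced k Q"
  shows "coinv (sum f I) = (\<Sum>i\<in>I. coinv (f i))"
  using assms(3)
proof (induction I rule: infinite_finite_induct)
  case (insert i I)
  have "sum f I \<in> induced k Q"
    by (rule sum_in_group[OF induced_0[OF assms(1)] induced_diff[OF assms(2)]]) (use insert.prems in auto)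
  then have "coinv (f i + sum f I) = coinv (f i) + coinv (sum f I)"
    by (intro coinv_plus) (use insert.prems in \<open>auto simp: induced_def\<close>)
  then show ?case using insert by (simp only: sum.insert insert_iff simp_thms)
qed simp_all

lemma coinv_alt_sign: "coinv (alt_sign n f) = alt_sign n (coinv f)"
  by (simp add: alt_sign_def coinv_uminus)

lemma push_pair: "push (\<lambda>(a, x). (a + c, \<phi> x)) (case_prod g) (b, w) = push \<phi> (g (b - c)) w"
  for c :: "'g::ab_group_add"
  unfolding push_def
  by (rule sum.reindex_bij_witness[where i = "\<lambda>x. (b - c, x)" and j = snd]) auto

definition delta :: "zvec \<Rightarrow> 'q \<Rightarrow> zvec \<Rightarrow> 'q::zero" where
  "delta b w = (\<lambda>a. if a = b then w else 0)"

lemma delta_in: "b \<in> carrier (Zk k) \<Longrightarrow> w \<in> Q \<Longrightarrow> 0 \<in> Q \<Longrightarrow> delta b w \<in> induced k Q"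
proof -
  assume *: "b \<in> carrier (Zk k)" "w \<in> Q" "0 \<in> Q"
  have "finite {a. delta b w a \<noteq> 0}" by (rule finite_subset[of _ "{b}"]) (auto simp: delta_def)
  then show ?thesis using * by (auto simp: induced_def delta_def)
qed

lemma delta_sum: "delta b (sum w I) = (\<Sum>i\<in>I. delta b (w i))" for w :: "'i \<Rightarrow> 'q::ab_group_add"
  by (auto simp: delta_def fun_eq_iff fun_sum_apply)

lemma sum_delta_eq:
  fixes f :: "zvec \<Rightarrow> 'q::ab_group_add"
  assumes "finite S" "{a. f a \<noteq> 0} \<subseteq> S" shows "f = (\<Sum>b\<in>S. delta b (f b))"
proof
  fix a
  have "(\<Sum>b\<in>S. delta b (f b)) a = (\<Sum>b\<in>S. if a = b then f b else 0)" by (simp add: fun_sum_apply delta_def)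
  also have "\<dots> = f a" using assms by (auto simp: sum.delta)
  finally show "f a = (\<Sum>b\<in>S. delta b (f b)) a" ..
qed

lemma push_delta: "push (\<lambda>(a, x). \<phi> a x) (case_prod (delta b w)) = push (\<phi> b) w"
  for w :: "'x \<Rightarrow> 'v::ab_group_add"
proof
  fix z
  show "push (\<lambda>(a, x). \<phi> a x) (case_prod (delta b w)) z = push (\<phi> b) w z"
    unfolding push_def
    by (rule sum.reindex_bij_witness[where i = "\<lambda>x. (b, x)" and j = snd]) (auto simp: delta_def split: if_splits)
qed

lemma Nk_single: "i \<in> {1..k} \<Longrightarrow> Poly_Mapping.single i 1 \<in> Nk k"
  by (simp add: Nk_def)

lemma frag_of_in_Zk: "i \<in> {1..k} \<Longrightarrow> frag_of i \<in> carrier (Zk k)"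
  by (simp add: carrier_Zk)

lemma nk_diff_single: "nk_diff 0 (Poly_Mapping.single i 1) = - frag_of i"
  by (rule poly_mapping_eqI) (simp add: lookup_nk_diff lookup_single when_def)

text \<open>Exchanges degree and index set: induced modules of Koszul chains become Koszul chains of
  the induced module, the form in which \<open>commuting_family\<close> applies.\<close>

definition transposed :: "('x \<Rightarrow> 'y \<Rightarrow> 'v) \<Rightarrow> 'y \<Rightarrow> 'x \<Rightarrow> 'v" where
  "transposed f = (\<lambda>y x. f x y)"

lemma transposed_transposed [simp]: "transposed (transposed f) = f"
  by (simp add: transposed_def)

text \<open>From right to left, finiteness of the support comes from there being only finitely many
  index sets.\<close>

lemma transposed_koszul_iff:
  fixes f :: "zvec \<Rightarrow> nat set \<Rightarrow> 'p::ab_group_add"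
  assumes "0 \<in> C"
  shows "f \<in> induced k (koszul_chains C k q) \<longleftrightarrow> transposed f \<in> koszul_chains (induced k C) k q"
proof
  assume f: "f \<in> induced k (koszul_chains C k q)"
  have "transposed f T \<in> induced k C" for T
    unfolding transposed_def by (rule induced_map[OF f]) (auto simp: koszul_chains_def)
  moreover have "T \<subseteq> {1..k} \<and> card T = q" if nz: "transposed f T \<noteq> 0" for T
  proof -
    obtain a where "f a T \<noteq> 0" using nz by (auto simp: transposed_def fun_eq_iff)
    moreover have "f a \<in> koszul_chains C k q" using f by (simp add: induced_def)
    ultimately show ?thesis by (simp add: koszul_chains_def)
  qed
  ultimately show "transposed f \<in> koszul_chains (induced k C) k q" by (simp add: koszul_chains_def)
next
  assume f: "transposed f \<in> koszul_chains (induced k C) k q"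
  have fin: "finite {a. f a T \<noteq> 0}" and C: "f a T \<in> C" and Zk: "f a T \<noteq> 0 \<Longrightarrow> a \<in> carrier (Zk k)"
    and nz: "f a T \<noteq> 0 \<Longrightarrow> T \<subseteq> {1..k} \<and> card T = q" for a T
  proof -
    have 1: "transposed f T \<in> induced k C" and 2: "transposed f T \<noteq> 0 \<Longrightarrow> T \<subseteq> {1..k} \<and> card T = q"
      using f by (simp_all add: koszul_chains_def)
    show "finite {a. f a T \<noteq> 0}" "f a T \<in> C" "f a T \<noteq> 0 \<Longrightarrow> a \<in> carrier (Zk k)"
      using 1 by (simp_all add: induced_def transposed_def)
    show "f a T \<noteq> 0 \<Longrightarrow> T \<subseteq> {1..k} \<and> card T = q" using 2 by (auto simp: transposed_def fun_eq_iff)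
  qed
  have "{a. f a \<noteq> 0} \<subseteq> (\<Union>T\<in>Pow {1..k}. {a. f a T \<noteq> 0})"
  proof
    fix a assume "a \<in> {a. f a \<noteq> 0}"
    then obtain T where "f a T \<noteq> 0" by (auto simp: fun_eq_iff)
    then show "a \<in> (\<Union>T\<in>Pow {1..k}. {a. f a T \<noteq> 0})" using nz by blast
  qed
  moreover have "finite (\<Union>T\<in>Pow {1..k}. {a. f a T \<noteq> 0})" using fin by (intro finite_UN_I) auto
  ultimately have "finite {a. f a \<noteq> 0}" by (rule finite_subset)
  moreover have "a \<in> carrier (Zk k)" if "f a \<noteq> 0" for a
  proof -
    have "\<exists>T. f a T \<noteq> 0" using that by (auto simp: fun_eq_iff)
    then show ?thesis using Zk by blast
  qed
  ultimately show "f \<in> induced k (koszul_chains C k q)" using C nz by (simp add: induced_def koszul_chains_def)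
qed

context dr_action
begin

section \<open>Transfer operators on compactly supported functions on X x Z^k\<close>

abbreviation X_Cc :: "('a \<Rightarrow> int) set" where "X_Cc \<equiv> carrier (Cc X)"

abbreviation X_induced :: "(zvec \<Rightarrow> 'a \<Rightarrow> int) set" where "X_induced \<equiv> induced k X_Cc"

abbreviation gen :: "nat \<Rightarrow> nvec" where "gen i \<equiv> Poly_Mapping.single i 1"

lemma push_\<sigma>_in: "p \<in> Nk k \<Longrightarrow> f \<in> X_Cc \<Longrightarrow> push (\<sigma> p) f \<in> X_Cc"
  by (rule push_Cc[OF _ \<sigma>_etale Hausdorff Hausdorff])

lemma \<sigma>_fin_fibres: "p \<in> Nk k \<Longrightarrow> f \<in> X_Cc \<Longrightarrow> fin_fibres (\<sigma> p) f"
  by (rule etale_fin_fibres[OF _ \<sigma>_etale])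

lemma push_\<sigma>_\<sigma>:
  assumes "p \<in> Nk k" "q \<in> Nk k" "f \<in> X_Cc" shows "push (\<sigma> p) (push (\<sigma> q) f) = push (\<sigma> (p + q)) f"
proof -
  have "push (\<sigma> p) (push (\<sigma> q) f) = push (\<sigma> p \<circ> \<sigma> q) f"
    by (rule push_push[OF etale_fin_fibres[OF assms(3) etale_comp[OF \<sigma>_etale[OF assms(2)] \<sigma>_etale[OF assms(1)]]]])
  also have "\<dots> = push (\<sigma> (p + q)) f"
  proof (rule push_cong)
    fix x assume "f x \<noteq> 0"
    then have "x \<in> topspace X" using Cc_zero_outside[OF assms(3)] by blast
    then show "(\<sigma> p \<circ> \<sigma> q) x = \<sigma> (p + q) x" using \<sigma>_add assms by simp
  qed
  finally show ?thesis .
qed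

lemma push_\<sigma>_0: assumes "f \<in> X_Cc" shows "push (\<sigma> 0) f = f"
proof (rule push_ident)
  fix x assume "f x \<noteq> 0"
  then have "x \<in> topspace X" using Cc_zero_outside[OF assms] by blast
  then show "\<sigma> 0 x = x" by (rule \<sigma>_0)
qed

text \<open>Mass at (x, a) moves along the i-th generator to a point of the same orbit of the skew
  product, and the i-th degree rises by one; the latter is the source of regularity.\<close>

definition transfer :: "nat \<Rightarrow> (zvec \<Rightarrow> 'a \<Rightarrow> int) \<Rightarrow> zvec \<Rightarrow> 'a \<Rightarrow> int" where
  "transfer i f = (\<lambda>a. push (\<sigma> (gen i)) (shift (frag_of i) f a))"

definition id_minus_transfer :: "nat \<Rightarrow> (zvec \<Rightarrow> 'a \<Rightarrow> int) \<Rightarrow> zvec \<Rightarrow> 'a \<Rightarrow> int" where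
  "id_minus_transfer i f = f - transfer i f"

lemma X_induced_0: "0 \<in> X_induced" by (rule induced_0[OF Cc_zero])

lemma X_induced_diff: "f \<in> X_induced \<Longrightarrow> g \<in> X_induced \<Longrightarrow> f - g \<in> X_induced"
  by (rule induced_diff[OF Cc_diff])

lemma X_induced_Cc: "f \<in> X_induced \<Longrightarrow> f a \<in> X_Cc" by (simp add: induced_def)

lemma transfer_in:
  assumes i: "i \<in> {1..k}" and f: "f \<in> X_induced" shows "transfer i f \<in> X_induced"
  unfolding transfer_def
  by (rule induced_map[OF induced_shift[OF f frag_of_in_Zk[OF i]]]) (rule push_\<sigma>_in[OF Nk_single[OF i]], assumption, simp add: push_def fun_eq_iff)

lemma transfer_add:
  assumes i: "i \<in> {1..k}" and f: "f \<in> X_induced" and g: "g \<in> X_induced"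
  shows "transfer i (f + g) = transfer i f + transfer i g"
proof
  fix a
  have "shift (frag_of i) f a \<in> X_Cc" "shift (frag_of i) g a \<in> X_Cc"
    using f g by (simp_all add: shift_def X_induced_Cc)
  then show "transfer i (f + g) a = (transfer i f + transfer i g) a"
    using push_add[OF \<sigma>_fin_fibres[OF Nk_single[OF i]] \<sigma>_fin_fibres[OF Nk_single[OF i]]]
    by (simp only: transfer_def shift_add plus_fun_apply)
qed

lemma transfer_transfer:
  assumes i: "i \<in> {1..k}" and l: "l \<in> {1..k}" and f: "f \<in> X_induced"
  shows "transfer i (transfer l f) = transfer l (transfer i f)"
proof
  fix a
  have "push (\<sigma> (gen i)) (push (\<sigma> (gen l)) (f (a - frag_of i - frag_of l)))
      = push (\<sigma> (gen l)) (push (\<sigma> (gen i)) (f (a - frag_of l - frag_of i)))"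
    by (simp only: push_\<sigma>_\<sigma>[OF Nk_single[OF i] Nk_single[OF l] X_induced_Cc[OF f]]
        push_\<sigma>_\<sigma>[OF Nk_single[OF l] Nk_single[OF i] X_induced_Cc[OF f]] add.commute[of "gen i"] diff_diff_eq add.commute[of "frag_of i"])
  then show "transfer i (transfer l f) a = transfer l (transfer i f) a"
    by (simp only: transfer_def shift_def)
qed

lemma transfer_minus:
  assumes i: "i \<in> {1..k}" and f: "f \<in> X_induced" and g: "g \<in> X_induced"
  shows "transfer i (f - g) = transfer i f - transfer i g"
proof -
  have "transfer i (f - g + g) = transfer i (f - g) + transfer i g"
    by (rule transfer_add[OF i X_induced_diff[OF f g] g])
  then show ?thesis by (simp add: algebra_simps)
qed

sublocale K: commuting_family X_induced id_minus_transfer k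
proof
  show "id_minus_transfer i x \<in> X_induced" if "i \<in> {1..k}" "x \<in> X_induced" for i x
    unfolding id_minus_transfer_def using that by (intro X_induced_diff transfer_in)
  show "id_minus_transfer i (x + y) = id_minus_transfer i x + id_minus_transfer i y"
    if "i \<in> {1..k}" "x \<in> X_induced" "y \<in> X_induced" for i x y
    using that by (simp add: id_minus_transfer_def transfer_add)
  show "id_minus_transfer i (id_minus_transfer l x) = id_minus_transfer l (id_minus_transfer i x)"
    if "i \<in> {1..k}" "l \<in> {1..k}" "x \<in> X_induced" for i l x
  proof -
    have "id_minus_transfer i (id_minus_transfer l x) = x - transfer l x - (transfer i x - transfer i (transfer l x))"
      using that by (simp add: id_minus_transfer_def transfer_minus transfer_in)
    moreover have "id_minus_transfer l (id_minus_transfer i x) = x - transfer i x - (transfer l x - transfer l (transfer i x))"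
      using that by (simp add: id_minus_transfer_def transfer_minus transfer_in)
    ultimately show ?thesis using transfer_transfer[OF that] by (simp add: fun_eq_iff)
  qed
qed (fact X_induced_0 X_induced_diff)+

definition level :: "nat \<Rightarrow> int \<Rightarrow> (zvec \<Rightarrow> 'a \<Rightarrow> int) \<Rightarrow> zvec \<Rightarrow> 'a \<Rightarrow> int" where
  "level m c f = (\<lambda>a. if Poly_Mapping.lookup a m = c then f a else 0)"

lemma level_in: assumes f: "f \<in> X_induced" shows "level m c f \<in> X_induced"
proof -
  have "{a. level m c f a \<noteq> 0} \<subseteq> {a. f a \<noteq> 0}" by (auto simp: level_def)
  then have "finite {a. level m c f a \<noteq> 0}" using f finite_subset by (auto simp: induced_def)
  then show ?thesis using f Cc_zero by (auto simp: induced_def level_def)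
qed

lemma level_diff: "level m c (f - g) = level m c f - level m c g"
  by (auto simp: level_def fun_eq_iff)

lemma level_sum: "level m c (sum f I) = (\<Sum>i\<in>I. level m c (f i))"
  by (auto simp: level_def fun_eq_iff fun_sum_apply)

lemma level_transfer: "l \<noteq> m \<Longrightarrow> level m c (transfer l f) = transfer l (level m c f)"
  by (auto simp: level_def fun_eq_iff transfer_def shift_def lookup_minus lookup_single when_def
      simp flip: zero_fun_def)

lemma level_transfer_self: "level m c (transfer m f) = transfer m (level m (c - 1) f)"
  by (auto simp: level_def fun_eq_iff transfer_def shift_def lookup_minus lookup_single when_def
      simp flip: zero_fun_def)

text \<open>The operators with index at most j do not move the coordinate m > j, so they commute
  with taking levels.\<close>

lemma span_level:
  assumes x: "x \<in> K.span j" and m: "j < m" shows "level m c x \<in> K.span j"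
proof -
  obtain h where h: "\<And>i. h i \<in> X_induced" "x = (\<Sum>i\<in>{1..j}. id_minus_transfer i (h i))"
    using x by (auto simp: K.span_def)
  have "level m c x = (\<Sum>i\<in>{1..j}. id_minus_transfer i (level m c (h i)))"
    unfolding h(2) level_sum
    by (rule sum.cong) (use m in \<open>auto simp: id_minus_transfer_def level_diff level_transfer\<close>)
  then show ?thesis using K.spanI[of "\<lambda>i. level m c (h i)" j] level_in h(1) by simp
qed

text \<open>The transfer commutes with all the operators, hence preserves the sum of their
  images.\<close>

lemma span_transfer:
  assumes x: "x \<in> K.span j" and m: "m \<in> {1..k}" and j: "j \<le> k" shows "transfer m x \<in> K.span j"
proof -
  obtain h where h: "\<And>i. h i \<in> X_induced" "x = (\<Sum>i\<in>{1..j}. id_minus_transfer i (h i))"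
    using x by (auto simp: K.span_def)
  have t: "transfer m y = y - id_minus_transfer m y" for y by (simp add: id_minus_transfer_def)
  have xin: "x \<in> X_induced" unfolding h(2) by (rule K.B_sum) (use h j K.u_in in auto)
  have "transfer m x = x - id_minus_transfer m x" by (rule t)
  also have "id_minus_transfer m x = (\<Sum>i\<in>{1..j}. id_minus_transfer i (id_minus_transfer m (h i)))"
    unfolding h(2) using m j h(1) K.u_in by (subst K.u_sum) (auto intro!: sum.cong K.u_comm)
  also have "x - \<dots> \<in> K.span j"
    by (rule K.span_diff[OF x _ j]) (rule K.spanI, rule K.u_in[OF m h(1)])
  finally show ?thesis .
qed

text \<open>The operators are homogeneous in every coordinate but one, so a relation can be split by the
  remaining coordinate and solved upwards from below the support.\<close>

lemma regular:
  assumes j: "j < k" and x: "x \<in> X_induced" and u: "id_minus_transfer (Suc j) x \<in> K.span j"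
  shows "x \<in> K.span j"
proof -
  define m where "m = Suc j"
  have m: "m \<in> {1..k}" "j < m" "j \<le> k" using j by (auto simp: m_def)
  define S where "S = {a. x a \<noteq> 0}"
  have S: "finite S" using x by (simp add: S_def induced_def)
  define L where "L = (\<lambda>a. Poly_Mapping.lookup a m) ` S"
  \<comment> \<open>A level strictly below the support, where x vanishes; 0 is inserted to keep the
    set nonempty.\<close>
  define c0 where "c0 = Min (insert 0 L) - 1"
  have c0: "c0 < c" if "c \<in> L" for c
  proof -
    have "Min (insert 0 L) \<le> c" by (rule Min_le) (use S that in \<open>auto simp: L_def\<close>)
    then show ?thesis by (simp add: c0_def)
  qed
  have step: "level m (c0 + int n) x \<in> K.span j" for n
  proof (induction n)
    case 0
    have "level m c0 x a = 0" for a
    proof (cases "x a = 0")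
      case False
      then have "Poly_Mapping.lookup a m \<in> L" by (simp add: L_def S_def)
      then show ?thesis using c0 by (auto simp: level_def)
    qed (simp add: level_def)
    then have "level m c0 x = 0" by (simp only: fun_eq_iff[of _ 0] zero_fun_apply) blast
    then show ?case using K.span_0[OF m(3)] by (simp only: of_nat_0 add_0_right)
  next
    case (Suc n)
    let ?c = "c0 + int (Suc n)"
    have c: "?c - 1 = c0 + int n" by simp
    have "level m ?c (id_minus_transfer m x) \<in> K.span j" using span_level[OF u m(2)] by (simp add: m_def)
    \<comment> \<open>Modulo the span, each level of x is the transfer of the level below, which the
      induction has placed in the span.\<close>
    then have "level m ?c x - transfer m (level m (c0 + int n) x) \<in> K.span j"
      unfolding id_minus_transfer_def level_diff level_transfer_self c .
    from K.span_add[OF this span_transfer[OF Suc m(1,3)] m(3)] show ?case by simp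
  qed
  have "x = (\<Sum>c\<in>L. level m c x)"
  proof
    fix a
    have "(\<Sum>c\<in>L. level m c x) a = (\<Sum>c\<in>L. if Poly_Mapping.lookup a m = c then x a else 0)"
      by (simp add: fun_sum_apply level_def)
    also have "\<dots> = x a"
    proof (cases "x a = 0")
      case False
      then have "Poly_Mapping.lookup a m \<in> L" by (simp add: L_def S_def)
      then show ?thesis using S by (simp add: L_def)
    qed (simp add: sum.neutral)
    finally show "x a = (\<Sum>c\<in>L. level m c x) a" ..
  qed
  also have "\<dots> \<in> K.span j"
  proof (rule K.span_sum[OF m(3)])
    fix c assume "c \<in> L"
    then have "c = c0 + int (nat (c - c0))" using c0[of c] by simp
    then show "level m c x \<in> K.span j" using step[of "nat (c - c0)"] by simp
  qed
  finally show ?thesis .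
qed

section \<open>The Koszul complex of induced modules\<close>

abbreviation koszul :: "nat \<Rightarrow> (nat set \<Rightarrow> 'a \<Rightarrow> int) set" where
  "koszul n \<equiv> koszul_chains X_Cc k n"

definition koszul_boundary :: "nat \<Rightarrow> (zvec \<Rightarrow> nat set \<Rightarrow> 'a \<Rightarrow> int) \<Rightarrow> zvec \<Rightarrow> nat set \<Rightarrow> 'a \<Rightarrow> int" where
  "koszul_boundary n f = transposed (koszul_d id_minus_transfer k (transposed f))"

lemma koszul_iff: "f \<in> induced k (koszul n) \<longleftrightarrow> transposed f \<in> K.K k n"
  by (rule transposed_koszul_iff[OF Cc_zero])

lemma transposed_plus: "transposed (f + g) = transposed f + transposed g"
  for f g :: "'x \<Rightarrow> 'y \<Rightarrow> 'v::plus"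
  by (simp add: transposed_def fun_eq_iff)

lemma transposed_0: "transposed (0 :: 'x \<Rightarrow> 'y \<Rightarrow> 'v::zero) = 0"
  by (simp add: transposed_def fun_eq_iff)

lemma koszul_0: "0 \<in> koszul n"
  by (simp add: koszul_chains_def Cc_zero)

lemma koszul_diff:
  assumes "F \<in> koszul n" "F' \<in> koszul n" shows "F - F' \<in> koszul n"
proof -
  have "T \<subseteq> {1..k} \<and> card T = n" if "(F - F') T \<noteq> 0" for T
    using that assms by (cases "F T = 0") (simp_all add: koszul_chains_def)
  moreover have "(F - F') T \<in> X_Cc" for T
    using assms Cc_diff[of "F T" X "F' T"] by (simp add: koszul_chains_def)
  ultimately show ?thesis by (simp add: koszul_chains_def)
qed

lemma koszul_boundary_in: "f \<in> induced k (koszul (Suc n)) \<Longrightarrow> koszul_boundary n f \<in> induced k (koszul n)"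
  unfolding koszul_iff koszul_boundary_def transposed_transposed by (rule K.d_in) auto

lemma koszul_boundary_add:
  "f \<in> induced k (koszul (Suc n)) \<Longrightarrow> g \<in> induced k (koszul (Suc n)) \<Longrightarrow>
    koszul_boundary n (f + g) = koszul_boundary n f + koszul_boundary n g"
  unfolding koszul_iff koszul_boundary_def transposed_plus by (subst K.d_add) (auto simp: transposed_plus)

lemma koszul_boundary_boundary:
  "f \<in> induced k (koszul (Suc (Suc n))) \<Longrightarrow> koszul_boundary n (koszul_boundary (Suc n) f) = 0"
  unfolding koszul_iff koszul_boundary_def transposed_transposed by (subst K.d_d) (auto simp: transposed_0)

lemma koszul_boundary_exact:
  assumes f: "f \<in> induced k (koszul (Suc n))" "koszul_boundary n f = 0"
  shows "\<exists>g\<in>induced k (koszul (Suc (Suc n))). koszul_boundary (Suc n) g = f"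
proof -
  have "K.d k (transposed f) = 0"
    using f(2) unfolding koszul_boundary_def by (metis transposed_transposed transposed_0)
  then obtain H where H: "H \<in> K.K k (Suc (Suc n))" "K.d k H = transposed f"
    using K.koszul_exact[OF regular, of k "transposed f" n] f(1) unfolding koszul_iff by auto
  show ?thesis
  proof (rule bexI[of _ "transposed H"])
    show "koszul_boundary (Suc n) (transposed H) = f" by (simp add: koszul_boundary_def H(2))
    show "transposed H \<in> induced k (koszul (Suc (Suc n)))" using H(1) by (simp add: koszul_iff)
  qed
qed

lemma shift_sum: "shift b (sum f I) = (\<Sum>i\<in>I. shift b (f i))"
  by (simp add: shift_def fun_eq_iff fun_sum_apply)

lemma koszul_boundary_shift: "koszul_boundary n (shift b f) = shift b (koszul_boundary n f)"
proof -
  have 1: "transposed (shift b f) T = shift b (transposed f T)" for T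
    by (simp add: transposed_def shift_def)
  have 2: "id_minus_transfer i (shift b g) = shift b (id_minus_transfer i g)" for i g
    by (simp add: id_minus_transfer_def transfer_def shift_def fun_eq_iff algebra_simps)
  have "koszul_d id_minus_transfer k (transposed (shift b f)) T = shift b (koszul_d id_minus_transfer k (transposed f) T)" for T
    by (simp only: koszul_d_def 1 2 shift_sum shift_alt_sign)
  then show ?thesis by (simp add: koszul_boundary_def transposed_def shift_def fun_eq_iff)
qed

text \<open>Summation over degrees absorbs the shift, so the transfer becomes the plain
  pushforward.\<close>

lemma coinv_transfer:
  assumes i: "i \<in> {1..k}" and g: "g \<in> X_induced"
  shows "coinv (transfer i g) = push (\<sigma> (gen i)) (coinv g)"
proof -
  define S where "S = {a. g a \<noteq> 0}"
  have S: "finite S" using g by (simp add: S_def induced_def)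
  have "coinv (transfer i g) = sum (transfer i g) ((\<lambda>a. a + frag_of i) ` S)"
  proof (rule coinv_eq_sum)
    show "{a. transfer i g a \<noteq> 0} \<subseteq> (\<lambda>a. a + frag_of i) ` S"
    proof
      fix a assume "a \<in> {a. transfer i g a \<noteq> 0}"
      then have "a - frag_of i \<in> S" by (auto simp: transfer_def shift_def S_def)
      then show "a \<in> (\<lambda>a. a + frag_of i) ` S" by (intro image_eqI[of _ _ "a - frag_of i"]) auto
    qed
  qed (simp add: S)
  also have "\<dots> = (\<Sum>a\<in>S. push (\<sigma> (gen i)) (g a))"
    by (subst sum.reindex) (auto simp: inj_on_def transfer_def shift_def)
  also have "\<dots> = push (\<sigma> (gen i)) (sum g S)"
    by (rule push_sum[symmetric]) (rule \<sigma>_fin_fibres[OF Nk_single[OF i] X_induced_Cc[OF g]])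
  also have "sum g S = coinv g" by (simp add: coinv_def S_def)
  finally show ?thesis .
qed

lemma coinv_id_minus_transfer:
  assumes i: "i \<in> {1..k}" and g: "g \<in> X_induced"
  shows "coinv (id_minus_transfer i g) = id_minus_push \<sigma> i (coinv g)"
proof -
  have "coinv (id_minus_transfer i g + transfer i g) = coinv (id_minus_transfer i g) + coinv (transfer i g)"
    by (rule coinv_plus) (use K.u_in[OF i g] transfer_in[OF i g] in \<open>auto simp: induced_def\<close>)
  then have "coinv (id_minus_transfer i g) = coinv g - coinv (transfer i g)"
    by (simp add: id_minus_transfer_def)
  then show ?thesis
    unfolding coinv_transfer[OF i g] by (simp add: id_minus_push_def pushforward_eq_push fun_eq_iff)
qed

lemma coinv_koszul:
  assumes "f \<in> induced k (koszul n)" shows "coinv f T = coinv (transposed f T)"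
proof -
  let ?S = "{a. f a \<noteq> 0}"
  have "finite ?S" using assms by (simp add: induced_def)
  then have "coinv (transposed f T) = sum (transposed f T) ?S"
    by (rule coinv_eq_sum) (auto simp: transposed_def)
  then show ?thesis by (simp add: coinv_def transposed_def fun_sum_apply)
qed

lemma koszul_boundary_coinv:
  assumes f: "f \<in> induced k (koszul (Suc n))"
  shows "coinv (koszul_boundary n f) = koszul_d (id_minus_push \<sigma>) k (coinv f)"
proof
  fix T
  have in_X: "transposed f T \<in> X_induced" for T using f unfolding koszul_iff by (rule K.K_B)
  have "coinv (koszul_boundary n f) T = coinv (K.d k (transposed f) T)"
    using coinv_koszul[OF koszul_boundary_in[OF f]] by (simp add: koszul_boundary_def)
  also have "\<dots> = (\<Sum>i\<in>{1..k} - T. coinv (alt_sign (position i T) (id_minus_transfer i (transposed f (insert i T)))))"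
    unfolding koszul_d_def
    by (rule coinv_sum[OF Cc_zero Cc_diff]) (auto intro!: K.B_alt_sign K.u_in in_X)
  also have "\<dots> = (\<Sum>i\<in>{1..k} - T. alt_sign (position i T) (id_minus_push \<sigma> i (coinv f (insert i T))))"
    by (rule sum.cong) (auto simp: coinv_alt_sign coinv_id_minus_transfer in_X coinv_koszul[OF f])
  finally show "coinv (koszul_boundary n f) T = koszul_d (id_minus_push \<sigma>) k (coinv f) T"
    by (simp add: koszul_d_def)
qed

section \<open>Comparison of the Koszul cokernel with H_0\<close>

lemma nerve_unit_homeo: "homeomorphic_maps X (nerve G 0) Unit the_unit"
proof -
  have "continuous_map X (nerve G 0) Unit"
    by (rule continuous_Unit) (simp add: DR_simps)
  moreover have "continuous_map (nerve G 0) X the_unit"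
    using continuous_the_unit[of G] by (simp add: DR_simps)
  ultimately show ?thesis by (auto simp: homeomorphic_maps_def topspace_nerve_0 DR_simps)
qed

lemma Unit_etale: "etale X (nerve G 0) Unit"
  by (rule homeomorphic_maps_etale[OF nerve_unit_homeo])

lemma the_unit_etale: "etale (nerve G 0) X the_unit"
  by (rule homeomorphic_maps_etale[OF homeomorphic_maps_sym[THEN iffD1, OF nerve_unit_homeo]])

definition on_units :: "(zvec \<Rightarrow> 'a \<Rightarrow> int) \<Rightarrow> zvec \<Rightarrow> ('a, 'a \<times> zvec \<times> 'a) nerve_point \<Rightarrow> int" where
  "on_units f = (\<lambda>a. push Unit (f a))"

lemma case_prod_on_units: "case_prod (on_units f) = push (\<lambda>(a, x). (a, Unit x)) (case_prod f)"
proof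
  fix y :: "zvec \<times> ('a, 'a \<times> zvec \<times> 'a) nerve_point"
  obtain b w where y: "y = (b, w)" by force
  show "case_prod (on_units f) y = push (\<lambda>(a, x). (a, Unit x)) (case_prod f) y"
    using push_pair[of 0 Unit f b w] by (simp add: y on_units_def)
qed

lemma push_zero: "push \<phi> 0 = 0"
  by (simp add: push_def fun_eq_iff)

lemma bd_Suc_0: "bd d (Suc 0) f = push (d 0) f - push (d (Suc 0)) f"
  by (simp add: bd_def alt_sign_Suc)

lemma on_units_in: "f \<in> X_induced \<Longrightarrow> on_units f \<in> induced k (nerve_Cc 0)"
  unfolding on_units_def
  by (rule induced_map[where \<phi> = "push Unit"]) (assumption, erule push_Cc[OF _ Unit_etale Hausdorff nerve_Hausdorff], rule push_zero)

lemma on_units_onto: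
  assumes F: "F \<in> induced k (nerve_Cc 0)" shows "\<exists>f\<in>X_induced. on_units f = F"
proof (rule bexI[of _ "\<lambda>a. push the_unit (F a)"])
  show "on_units (\<lambda>a. push the_unit (F a)) = F"
    unfolding on_units_def
    using homeomorphic_maps_push[OF homeomorphic_maps_sym[THEN iffD1, OF nerve_unit_homeo]] F
    by (auto simp: induced_def fun_eq_iff)
  show "(\<lambda>a. push the_unit (F a)) \<in> X_induced"
    by (rule induced_map[OF F, where \<phi> = "push the_unit"]) (erule push_Cc[OF _ the_unit_etale nerve_Hausdorff Hausdorff], rule push_zero)
qed

lemma on_units_add:
  assumes "f \<in> X_induced" "g \<in> X_induced" shows "on_units (f + g) = on_units f + on_units g"
  unfolding on_units_def using push_add[OF etale_fin_fibres etale_fin_fibres, OF _ Unit_etale _ Unit_etale] X_induced_Cc assms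
  by (auto simp: fun_eq_iff)

lemma on_units_diff:
  assumes "f \<in> X_induced" "g \<in> X_induced" shows "on_units (f - g) = on_units f - on_units g"
proof -
  have "on_units (f - g + g) = on_units (f - g) + on_units g"
    by (rule on_units_add[OF X_induced_diff[OF assms] assms(2)])
  then show ?thesis by (simp add: algebra_simps)
qed

lemma on_units_transfer:
  assumes i: "i \<in> {1..k}" and g: "g \<in> X_induced"
  shows "case_prod (on_units (transfer i g)) = push (\<lambda>(a, x). (a + frag_of i, Unit (\<sigma> (gen i) x))) (case_prod g)"
proof
  fix y :: "zvec \<times> ('a, 'a \<times> zvec \<times> 'a) nerve_point"
  obtain b w where y: "y = (b, w)" by force
  have c: "g (b - frag_of i) \<in> X_Cc" using g by (rule X_induced_Cc)
  have "push Unit (push (\<sigma> (gen i)) (g (b - frag_of i))) w = push (Unit \<circ> \<sigma> (gen i)) (g (b - frag_of i)) w"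
    by (rule fun_cong[OF push_push[OF etale_fin_fibres[OF c etale_comp[OF \<sigma>_etale[OF Nk_single[OF i]] Unit_etale]]]])
  then show "case_prod (on_units (transfer i g)) y = push (\<lambda>(a, x). (a + frag_of i, Unit (\<sigma> (gen i) x))) (case_prod g) y"
    using push_pair[of "frag_of i" "Unit \<circ> \<sigma> (gen i)" g b w]
    by (simp add: y on_units_def transfer_def shift_def)
qed

text \<open>Spreading g over the arrows that join x to its image under the i-th generator gives a
  1-chain whose two faces are g and its transfer.\<close>

lemma on_units_id_minus_transfer:
  assumes i: "i \<in> {1..k}" and g: "g \<in> X_induced"
  shows "on_units (id_minus_transfer i g) \<in> skew_boundary 0 ` induced k (nerve_Cc (Suc 0))"
proof -
  let ?Z = "discrete_topology (carrier (Zk k))"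
  \<comment> \<open>The degree \<open>a + frag_of i\<close> belongs to the range of the added arrow;
    its source keeps the degree a.\<close>
  let ?E = "\<lambda>(a, x). (a + frag_of i, prefix (gen i) (Unit x))"
  let ?F = "case_prod g"
  have F: "?F \<in> carrier (Cc (prod_topology ?Z X))" using g by (simp add: induced_iff_Cc)
  have pE: "etale X (nerve G (Suc 0)) (\<lambda>x. prefix (gen i) (Unit x))"
    using etale_comp[OF Unit_etale etale_prefix[OF Nk_single[OF i], of 0]] by (simp add: comp_def)
  have E: "etale (prod_topology ?Z X) (skew_space (Suc 0)) ?E"
  proof (rule etale_prod_discrete[OF pE])
    show "a + frag_of i \<in> carrier (Zk k)" if "a \<in> carrier (Zk k)" for a
      using that frag_of_in_Zk[OF i] by (rule Zk_closed(3))
    show "\<exists>U. openin X U \<and> y \<in> U \<and> (\<forall>u\<in>U. a + frag_of i = a + frag_of i)" if "y \<in> topspace X" for a :: zvec and y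
      using that openin_topspace by blast
  qed
  define h where "h = curry (push ?E ?F)"
  have H: "push ?E ?F \<in> carrier (Cc (skew_space (Suc 0)))"
    by (rule push_Cc[OF F E _ skew_Hausdorff]) (simp add: Hausdorff_space_prod_topology Hausdorff)
  have h: "h \<in> induced k (nerve_Cc (Suc 0))" using H by (simp add: h_def induced_iff_Cc)
  have pt: "fst y \<in> carrier (Zk k)" "snd y \<in> topspace X" if "?F y \<noteq> 0" for y
  proof -
    have "y \<in> topspace (prod_topology ?Z X)" using Cc_zero_outside[OF F] that by blast
    then show "fst y \<in> carrier (Zk k)" "snd y \<in> topspace X" by (auto simp: topspace_prod_topology)
  qed
  have p: "prefix (gen i) (Unit x) = Tuple [(\<sigma> (gen i) x, - frag_of i, x)]" for x
    using nk_diff_single[of i] by (simp add: prefix_def first_vertex_def)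
  have d: "push (skew_face (Suc 0) l) (push ?E ?F) = push (skew_face (Suc 0) l \<circ> ?E) ?F" if "l \<le> Suc 0" for l
    by (rule push_push[OF etale_fin_fibres[OF F etale_comp[OF E etale_skew_face[OF that]]]])
  have d0: "push (skew_face (Suc 0) 0) (push ?E ?F) = case_prod (on_units g)"
    unfolding d[OF le0] case_prod_on_units
    by (rule push_cong) (auto simp: skew_face_def face_def p[unfolded One_nat_def] DR_cocycle_def DR_simps)
  have d1: "push (skew_face (Suc 0) (Suc 0)) (push ?E ?F) = case_prod (on_units (transfer i g))"
    unfolding d[OF le_refl] on_units_transfer[OF i g]
    by (rule push_cong) (auto simp: skew_face_def face_def p[unfolded One_nat_def] DR_simps)
  have "bd (skew_face (Suc 0)) (Suc 0) (push ?E ?F) = case_prod (on_units g) - case_prod (on_units (transfer i g))"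
    unfolding bd_Suc_0 d0 d1 ..
  then have "skew_boundary 0 h = on_units g - on_units (transfer i g)"
    by (simp add: skew_boundary_def h_def fun_eq_iff)
  then have "on_units (id_minus_transfer i g) = skew_boundary 0 h"
    unfolding id_minus_transfer_def on_units_diff[OF g transfer_in[OF i g]] ..
  then show ?thesis using h by blast
qed

lemma on_units_span:
  assumes "x \<in> K.span k" shows "on_units x \<in> skew_boundary 0 ` induced k (nerve_Cc (Suc 0))"
proof -
  let ?B = "skew_boundary 0 ` induced k (nerve_Cc (Suc 0))"
  obtain h where h: "\<And>i. h i \<in> X_induced" "x = (\<Sum>i\<in>{1..k}. id_minus_transfer i (h i))"
    using assms by (auto simp: K.span_def)
  have zero: "0 \<in> ?B"
    using skew_boundary_add[OF nerve_induced_0 nerve_induced_0, of 0] nerve_induced_0[of "Suc 0"]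
    by (intro image_eqI[of _ _ 0]) (simp_all only: add_0_right, simp)
  have add: "y + z \<in> ?B" if yz: "y \<in> ?B" "z \<in> ?B" for y z
  proof -
    obtain y' z' where "y = skew_boundary 0 y'" "z = skew_boundary 0 z'" "y' \<in> induced k (nerve_Cc (Suc 0))" "z' \<in> induced k (nerve_Cc (Suc 0))"
      using yz by blast
    then show ?thesis using skew_boundary_add[of y' 0 z'] nerve_induced_add[of y' "Suc 0" z'] by (metis imageI)
  qed
  have "(\<Sum>i\<in>J. id_minus_transfer i (h i)) \<in> X_induced \<and> on_units (\<Sum>i\<in>J. id_minus_transfer i (h i)) \<in> ?B"
    if "finite J" "J \<subseteq> {1..k}" for J
    using that
  proof (induction J rule: finite_induct)
    case empty
    have "on_units 0 = 0" by (simp add: on_units_def push_zero fun_eq_iff)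
    then show ?case using zero X_induced_0 by (simp only: sum.empty simp_thms)
  next
    case (insert i J)
    let ?s = "\<Sum>i\<in>J. id_minus_transfer i (h i)" and ?t = "id_minus_transfer i (h i)"
    have s: "?s \<in> X_induced" "on_units ?s \<in> ?B" and i: "i \<in> {1..k}" using insert by auto
    have t: "?t \<in> X_induced" by (rule K.u_in[OF i h(1)])
    have "on_units (?t + ?s) \<in> ?B"
      unfolding on_units_add[OF t s(1)] by (rule add[OF on_units_id_minus_transfer[OF i h(1)] s(2)])
    moreover have "?t + ?s \<in> X_induced" by (rule K.B_add[OF t s(1)])
    ultimately show ?case by (simp only: sum.insert[OF insert(1,2)] simp_thms)
  qed
  from this[of "{1..k}"] show ?thesis unfolding h(2) by simp
qed

lemma nk_diff_0_add: "nk_diff 0 (p + q) = nk_diff 0 p + nk_diff 0 q"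
  by (rule poly_mapping_eqI) (simp add: lookup_nk_diff lookup_add)

lemma id_minus_transfer_delta: "id_minus_transfer i (delta b w) = delta b w - delta (b + frag_of i) (push (\<sigma> (gen i)) w)"
  by (auto simp: id_minus_transfer_def transfer_def shift_def delta_def fun_eq_iff push_def diff_eq_eq)

text \<open>Modulo the operators, mass in degree b may flow along p: the difference telescopes over
  single generators, by induction on the total exponent. The target degree
  \<open>b - nk_diff 0 p\<close> is b + p.\<close>

lemma delta_moves:
  assumes "p \<in> Nk k" "b \<in> carrier (Zk k)" "w \<in> X_Cc"
  shows "delta b w - delta (b - nk_diff 0 p) (push (\<sigma> p) w) \<in> K.span k"
  using assms
proof (induction "\<Sum>i\<in>{1..k}. Poly_Mapping.lookup p i" arbitrary: p b w)
  case 0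
  have "p = 0"
  proof (rule poly_mapping_eqI)
    fix i show "Poly_Mapping.lookup p i = Poly_Mapping.lookup 0 i"
      using 0(1)[symmetric] Nk_lookup_outside[OF 0(2), of i] by (cases "i \<in> {1..k}") simp_all
  qed
  then show ?case using K.span_0[OF le_refl] push_\<sigma>_0[OF 0(4)] by (simp add: nk_diff_0) (simp add: zero_fun_def)
next
  case (Suc n)
  have "\<exists>i\<in>{1..k}. Poly_Mapping.lookup p i \<noteq> 0"
  proof (rule ccontr)
    assume "\<not> ?thesis"
    then show False using Suc(2) by simp
  qed
  then obtain i where i: "i \<in> {1..k}" "Poly_Mapping.lookup p i \<noteq> 0" by blast
  define q where "q = p - gen i"
  have p: "p = q + gen i"
    by (rule poly_mapping_eqI) (use i(2) in \<open>auto simp: q_def lookup_add lookup_minus lookup_single when_def\<close>)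
  have q: "q \<in> Nk k" using Suc(3) by (auto simp: Nk_def q_def in_keys_iff lookup_minus)
  have gi: "gen i \<in> Nk k" by (rule Nk_single[OF i(1)])
  have "(\<Sum>l\<in>{1..k}. Poly_Mapping.lookup p l) = (\<Sum>l\<in>{1..k}. Poly_Mapping.lookup q l) + (\<Sum>l\<in>{1..k}. if i = l then 1 else 0)"
    unfolding p by (simp add: lookup_add lookup_single when_def sum.distrib)
  then have n: "n = (\<Sum>l\<in>{1..k}. Poly_Mapping.lookup q l)" using Suc(2) i(1) by simp
  let ?w = "push (\<sigma> (gen i)) w"
  have w: "?w \<in> X_Cc" by (rule push_\<sigma>_in[OF gi Suc(5)])
  have "delta (b + frag_of i) ?w - delta (b + frag_of i - nk_diff 0 q) (push (\<sigma> q) ?w) \<in> K.span k"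
    by (rule Suc(1)[OF n q Zk_closed(3)[OF Suc(4) frag_of_in_Zk[OF i(1)]] w])
  moreover have "id_minus_transfer i (delta b w) \<in> K.span k"
    by (rule K.span_u[OF delta_in[OF Suc(4,5) Cc_zero] i(1) le_refl])
  ultimately have "id_minus_transfer i (delta b w) +
      (delta (b + frag_of i) ?w - delta (b + frag_of i - nk_diff 0 q) (push (\<sigma> q) ?w)) \<in> K.span k"
    using K.span_add[OF _ _ le_refl] by blast
  moreover have "b + frag_of i - nk_diff 0 q = b - nk_diff 0 p"
    using nk_diff_single[of i] by (simp add: p nk_diff_0_add)
  moreover have "push (\<sigma> q) ?w = push (\<sigma> p) w"
    unfolding p by (rule push_\<sigma>_\<sigma>[OF q gi Suc(5)])
  ultimately show ?case by (simp add: id_minus_transfer_delta)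
qed

lemma delta_zero: "delta b 0 = 0"
  by (simp add: delta_def fun_eq_iff)

lemma case_prod_sum: "case_prod (sum f I) = (\<Sum>i\<in>I. case_prod (f i))"
  for f :: "'i \<Rightarrow> 'x \<Rightarrow> 'y \<Rightarrow> 'v::comm_monoid_add"
  by (auto simp: fun_eq_iff fun_sum_apply)

text \<open>All mass is made to flow to degree \<open>corner N\<close>. The ends of every arrow in
  the bounding chain g flow to the same point, so the pushforward of f along the flow is zero. By
  \<open>delta_moves\<close>, f agrees with that pushforward modulo the operators.\<close>

lemma span_on_units:
  assumes f: "f \<in> X_induced" and b: "on_units f \<in> skew_boundary 0 ` induced k (nerve_Cc (Suc 0))"
  shows "f \<in> K.span k"
proof -
  let ?Z = "discrete_topology (carrier (Zk k))"
  obtain g where g: "g \<in> induced k (nerve_Cc (Suc 0))" "on_units f = skew_boundary 0 g" using b by blast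
  let ?F = "case_prod g"
  have F: "?F \<in> carrier (Cc (skew_space (Suc 0)))" using g by (simp add: induced_iff_Cc)
  define S where "S = {a. f a \<noteq> 0}"
  have S: "finite S" "S \<subseteq> carrier (Zk k)" using f by (auto simp: S_def induced_def)
  obtain N0 where N0: "\<And>a z. ?F (a, z) \<noteq> 0 \<Longrightarrow> good N0 a z" using support_good[OF F] by blast
  obtain M where M: "\<And>b. b \<in> S \<Longrightarrow> below (M b) b" using below_exists S(2) by (metis subsetD)
  \<comment> \<open>N has to dominate the arrows of g, for their ends to meet, and the degrees of f,
    for them to flow.\<close>
  define N where "N = Max (insert N0 (M ` S))"
  have good: "good N a z" if "?F (a, z) \<noteq> 0" for a z
    by (rule good_mono[OF N0[OF that]]) (simp add: N_def S(1))
  have below: "below N b" if "b \<in> S" for b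
    by (rule below_mono[OF M[OF that]]) (simp add: N_def S(1) that)
  let ?\<chi> = "\<lambda>(b, z). \<sigma> (gap N b) (the_unit z)"
  have \<chi>: "etale (skew_space 0) X ?\<chi>"
  proof (rule etale_discrete_family)
    show "etale (nerve G 0) X (\<lambda>z. \<sigma> (gap N a) (the_unit z))" for a
      using etale_comp[OF the_unit_etale \<sigma>_etale[OF gap_in]] by (simp add: comp_def)
  qed
  have fin: "fin_fibres (?\<chi> \<circ> skew_face (Suc 0) l) ?F" if "l \<le> Suc 0" for l
    by (rule etale_fin_fibres[OF F etale_comp[OF etale_skew_face[OF that] \<chi>]])
  have face: "push (?\<chi> \<circ> skew_face (Suc 0) 0) ?F = push (?\<chi> \<circ> skew_face (Suc 0) (Suc 0)) ?F"
  proof (rule push_cong)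
    fix y assume y: "?F y \<noteq> 0"
    obtain a z where az: "y = (a, z)" by force
    have z: "z \<in> topspace (nerve G (Suc 0))" using Cc_point[OF F] y unfolding az by blast
    obtain x m v where zz: "z = Tuple [(x, m, v)]" using z by (auto simp: topspace_nerve composable_Suc_0)
    have "(v, a + m) \<in> set (vertices a z)" by (simp add: zz vertices_def)
    from good_vertices(2)[OF z good this] y
    have "\<sigma> (gap N (a + m)) v = \<sigma> (gap N a) x" by (simp add: az zz first_vertex_def grange_fst)
    then show "(?\<chi> \<circ> skew_face (Suc 0) 0) y = (?\<chi> \<circ> skew_face (Suc 0) (Suc 0)) y"
      by (simp add: az zz skew_face_def face_def DR_cocycle_def DR_simps)
  qed
  have "push ?\<chi> (case_prod (on_units f)) = push ?\<chi> (bd (skew_face (Suc 0)) (Suc 0) ?F)"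
    by (simp add: g(2) skew_boundary_def)
  also have "bd (skew_face (Suc 0)) (Suc 0) ?F = push (skew_face (Suc 0) 0) ?F + - push (skew_face (Suc 0) (Suc 0)) ?F"
    by (simp add: bd_def alt_sign_Suc)
  also have "push ?\<chi> \<dots> = push ?\<chi> (push (skew_face (Suc 0) 0) ?F) + push ?\<chi> (- push (skew_face (Suc 0) (Suc 0)) ?F)"
  proof (rule push_add)
    show "fin_fibres ?\<chi> (push (skew_face (Suc 0) 0) ?F)"
      by (rule etale_fin_fibres[OF push_Cc[OF F etale_skew_face[OF le0] skew_Hausdorff skew_Hausdorff] \<chi>])
    show "fin_fibres ?\<chi> (- push (skew_face (Suc 0) (Suc 0)) ?F)"
      using etale_fin_fibres[OF push_Cc[OF F etale_skew_face[OF le_refl] skew_Hausdorff skew_Hausdorff] \<chi>]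
      by (simp add: fin_fibres_def)
  qed
  also have "\<dots> = 0" unfolding push_uminus push_push[OF fin[OF le0]] push_push[OF fin[OF le_refl]] face by simp
  finally have z: "push ?\<chi> (case_prod (on_units f)) = 0" .
  have f_sum: "f = (\<Sum>b\<in>S. delta b (f b))" by (rule sum_delta_eq[OF S(1)]) (simp add: S_def)
  let ?\<psi> = "\<lambda>(b, x). \<sigma> (gap N b) x"
  have \<psi>: "etale (prod_topology ?Z X) X ?\<psi>"
    by (rule etale_discrete_family) (rule \<sigma>_etale[OF gap_in])
  have fC: "case_prod h \<in> carrier (Cc (prod_topology ?Z X))" if "h \<in> X_induced" for h
    using that by (simp add: induced_iff_Cc)
  have comp: "?\<chi> \<circ> (\<lambda>(a, x). (a, Unit x)) = ?\<psi>" by auto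
  have "push ?\<chi> (case_prod (on_units f)) = push ?\<psi> (case_prod f)"
    unfolding case_prod_on_units
    by (subst push_push) (simp_all only: comp etale_fin_fibres[OF fC[OF f] \<psi>])
  also have "\<dots> = (\<Sum>b\<in>S. push ?\<psi> (case_prod (delta b (f b))))"
  proof -
    have "push ?\<psi> (case_prod f) = push ?\<psi> (\<Sum>b\<in>S. case_prod (delta b (f b)))"
      using f_sum case_prod_sum[of "\<lambda>b. delta b (f b)" S] by simp
    also have "\<dots> = (\<Sum>b\<in>S. push ?\<psi> (case_prod (delta b (f b))))"
    proof (rule push_sum)
      fix b assume "b \<in> S"
      then show "fin_fibres ?\<psi> (case_prod (delta b (f b)))"
        using S(2) by (intro etale_fin_fibres[OF fC[OF delta_in[OF _ X_induced_Cc[OF f] Cc_zero]] \<psi>]) auto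
    qed
    finally show ?thesis .
  qed
  also have "\<dots> = (\<Sum>b\<in>S. push (\<sigma> (gap N b)) (f b))" by (simp only: push_delta)
  finally have sum0: "(\<Sum>b\<in>S. push (\<sigma> (gap N b)) (f b)) = 0" using z by simp
  \<comment> \<open>A zero is subtracted in the corner degree and then distributed over b, so that
    \<open>delta_moves\<close> applies termwise.\<close>
  have "f = (\<Sum>b\<in>S. delta b (f b)) - delta (corner N) (\<Sum>b\<in>S. push (\<sigma> (gap N b)) (f b))"
    unfolding sum0 delta_zero using f_sum by simp
  also have "\<dots> = (\<Sum>b\<in>S. delta b (f b) - delta (corner N) (push (\<sigma> (gap N b)) (f b)))"
    unfolding delta_sum by (rule sum_subtractf[symmetric])
  also have "\<dots> \<in> K.span k"
  proof (rule K.span_sum[OF le_refl])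
    fix b assume b: "b \<in> S"
    then have "b \<in> carrier (Zk k)" using S(2) by blast
    from delta_moves[OF gap_in[of N b] this X_induced_Cc[OF f], of b]
    show "delta b (f b) - delta (corner N) (push (\<sigma> (gap N b)) (f b)) \<in> K.span k"
      by (simp add: nk_diff_gap[OF below[OF b]])
  qed
  finally show ?thesis .
qed

definition koszul_class :: "(zvec \<Rightarrow> nat set \<Rightarrow> 'a \<Rightarrow> int)
    \<Rightarrow> (('a \<times> zvec, ('a \<times> zvec \<times> 'a) \<times> zvec) nerve_point \<Rightarrow> int) set" where
  "koszul_class f = H0_class (on_units (transposed f {}))"

lemma koszul_degree_0: "f \<in> induced k (koszul 0) \<Longrightarrow> transposed f {} \<in> X_induced"
  unfolding koszul_iff by (rule K.K_B)

lemma koszul_0_eqI: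
  assumes "f \<in> induced k (koszul 0)" "g \<in> induced k (koszul 0)" "transposed f {} = transposed g {}"
  shows "f = g"
proof -
  have "transposed h T = 0" if "h \<in> induced k (koszul 0)" "T \<noteq> {}" for h T
  proof (rule ccontr)
    assume "transposed h T \<noteq> 0"
    then have "T \<subseteq> {1..k} \<and> card T = 0" using that(1) unfolding koszul_iff by (simp add: koszul_chains_def)
    then show False using that(2) finite_subset[of T "{1..k}"] by auto
  qed
  then have "transposed f T = transposed g T" for T using assms by (cases "T = {}") simp_all
  then have "transposed f = transposed g" by blast
  then show ?thesis by (metis transposed_transposed)
qed

lemma koszul_0_exists:
  assumes "f \<in> X_induced" shows "\<exists>g\<in>induced k (koszul 0). transposed g {} = f"
proof (rule bexI[of _ "transposed (\<lambda>T. if T = {} then f else 0)"])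
  show "transposed (\<lambda>T. if T = {} then f else 0) \<in> induced k (koszul 0)"
    unfolding koszul_iff using assms X_induced_0 by (auto simp: koszul_chains_def)
qed simp

lemma koszul_class_onto: "koszul_class ` induced k (koszul 0) = carrier (groupoid_homology S 0)"
proof -
  have "(\<lambda>f. on_units (transposed f {})) ` induced k (koszul 0) = induced k (nerve_Cc 0)"
  proof (intro equalityI subsetI)
    fix F assume "F \<in> induced k (nerve_Cc 0)"
    then obtain f where f: "f \<in> X_induced" "on_units f = F" using on_units_onto by blast
    then obtain g where "g \<in> induced k (koszul 0)" "transposed g {} = f" using koszul_0_exists by blast
    then show "F \<in> (\<lambda>f. on_units (transposed f {})) ` induced k (koszul 0)" using f(2) by blast
  qed (use on_units_in koszul_degree_0 in blast)
  then have "H0_class ` (\<lambda>f. on_units (transposed f {})) ` induced k (koszul 0) = carrier (groupoid_homology S 0)"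
    using H0_class_onto by simp
  then show ?thesis by (simp add: koszul_class_def image_image)
qed

lemma koszul_class_kernel:
  assumes f: "f \<in> induced k (koszul 0)"
  shows "koszul_class f = \<one>\<^bsub>groupoid_homology S 0\<^esub> \<longleftrightarrow> f \<in> koszul_boundary 0 ` induced k (koszul (Suc 0))"
proof -
  note x = koszul_degree_0[OF f]
  have "koszul_class f = \<one>\<^bsub>groupoid_homology S 0\<^esub> \<longleftrightarrow> transposed f {} \<in> K.span k"
    unfolding koszul_class_def H0_class_kernel[OF on_units_in[OF x]]
    using span_on_units[OF x] on_units_span by blast
  also have "\<dots> \<longleftrightarrow> (\<exists>H\<in>K.K k 1. transposed f {} = K.d k H {})" unfolding One_nat_def by (rule K.span_iff)
  also have "\<dots> \<longleftrightarrow> f \<in> koszul_boundary 0 ` induced k (koszul (Suc 0))"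
  proof
    assume "\<exists>H\<in>K.K k 1. transposed f {} = K.d k H {}"
    then obtain H where H: "H \<in> K.K k (Suc 0)" "transposed f {} = K.d k H {}" by auto
    have h: "transposed H \<in> induced k (koszul (Suc 0))" using H(1) by (simp add: koszul_iff)
    have "f = koszul_boundary 0 (transposed H)"
      by (rule koszul_0_eqI[OF f koszul_boundary_in[OF h]]) (simp add: koszul_boundary_def H(2))
    then show "f \<in> koszul_boundary 0 ` induced k (koszul (Suc 0))" using h by blast
  next
    assume "f \<in> koszul_boundary 0 ` induced k (koszul (Suc 0))"
    then obtain h where "h \<in> induced k (koszul (Suc 0))" "f = koszul_boundary 0 h" by blast
    then show "\<exists>H\<in>K.K k 1. transposed f {} = K.d k H {}"
      by (intro bexI[of _ "transposed h"]) (simp_all add: koszul_boundary_def koszul_iff)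
  qed
  finally show ?thesis .
qed

text \<open>\<open>A\<close>, \<open>dA\<close> and \<xi> stay open: the target will be the action
  complex with any boundary d that meets the prescription.\<close>

lemma koszul_resolution:
  assumes "\<And>n. comm_group (A n)" "\<And>n. bij_betw (\<xi> n) (koszul n) (carrier (A n))"
    and "\<And>n x y. x \<in> koszul n \<Longrightarrow> y \<in> koszul n \<Longrightarrow> \<xi> n (x + y) = \<xi> n x \<otimes>\<^bsub>A n\<^esub> \<xi> n y"
    and "\<And>n x. x \<in> koszul (Suc n) \<Longrightarrow> dA (Suc n) (\<xi> (Suc n) x) = \<xi> n (koszul_d (id_minus_push \<sigma>) k x)"
  shows "induced_resolution k koszul koszul_boundary (\<lambda>n. koszul_d (id_minus_push \<sigma>) k)
    (groupoid_homology S 0) (skew_action k G DR_cocycle) koszul_class A dA \<xi>"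
proof (intro induced_resolution.intro)
  show "koszul_boundary n (shift b f) = shift b (koszul_boundary n f)" for n b f by (rule koszul_boundary_shift)
  show "koszul_class (f + g) = koszul_class f \<otimes>\<^bsub>groupoid_homology S 0\<^esub> koszul_class g"
    if "f \<in> induced k (koszul 0)" "g \<in> induced k (koszul 0)" for f g
  proof -
    have "transposed (f + g) {} = transposed f {} + transposed g {}" by (simp add: transposed_plus)
    then show ?thesis
      unfolding koszul_class_def
      by (simp only: on_units_add[OF that[THEN koszul_degree_0]] H0_class_add[OF that[THEN koszul_degree_0, THEN on_units_in]])
  qed
  show "skew_action k G DR_cocycle b (koszul_class f) = koszul_class (shift b f)"
    if "b \<in> carrier (Zk k)" "f \<in> induced k (koszul 0)" for b f
  proof -
    have "on_units (transposed (shift b f) {}) = shift b (on_units (transposed f {}))"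
      by (simp add: on_units_def transposed_def shift_def)
    then show ?thesis
      unfolding koszul_class_def
      by (simp only: skew_action_H0_class[OF that(1) on_units_in[OF koszul_degree_0[OF that(2)]]])
  qed
  show "\<exists>g\<in>induced k (koszul (Suc (Suc n))). koszul_boundary (Suc n) g = f"
    if "f \<in> induced k (koszul (Suc n))" "koszul_boundary n f = 0" for n f
    by (rule koszul_boundary_exact[OF that])
qed (fact assms koszul_0 koszul_diff koszul_boundary_in koszul_boundary_add koszul_boundary_boundary
    koszul_boundary_coinv comm_group_H0 koszul_class_onto koszul_class_kernel)+

end

section \<open>Exterior powers of \<open>\<int>\<^sup>k\<close>\<close>

definition frag_eval :: "('s \<Rightarrow> int) \<Rightarrow> ('s \<Rightarrow>\<^sub>0 int) \<Rightarrow> int" where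
  "frag_eval \<phi> c = (\<Sum>x\<in>Poly_Mapping.keys c. Poly_Mapping.lookup c x * \<phi> x)"

lemma frag_eval_superset:
  "finite A \<Longrightarrow> Poly_Mapping.keys c \<subseteq> A \<Longrightarrow> frag_eval \<phi> c = (\<Sum>x\<in>A. Poly_Mapping.lookup c x * \<phi> x)"
  unfolding frag_eval_def by (rule sum.mono_neutral_left) (auto simp: in_keys_iff)

lemma frag_eval_diff: "frag_eval \<phi> (c - d) = frag_eval \<phi> c - frag_eval \<phi> d"
proof -
  let ?A = "Poly_Mapping.keys c \<union> Poly_Mapping.keys d"
  have A: "finite ?A" by simp
  have "frag_eval \<phi> (c - d) = (\<Sum>x\<in>?A. Poly_Mapping.lookup (c - d) x * \<phi> x)"
    by (rule frag_eval_superset[OF A keys_diff])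
  moreover have "frag_eval \<phi> c = (\<Sum>x\<in>?A. Poly_Mapping.lookup c x * \<phi> x)"
      "frag_eval \<phi> d = (\<Sum>x\<in>?A. Poly_Mapping.lookup d x * \<phi> x)"
    by (rule frag_eval_superset[OF A], simp)+
  ultimately show ?thesis by (simp add: lookup_minus algebra_simps sum_subtractf)
qed

lemma frag_eval_0: "frag_eval \<phi> 0 = 0"
  by (simp add: frag_eval_def)

lemma frag_eval_add: "frag_eval \<phi> (c + d) = frag_eval \<phi> c + frag_eval \<phi> d"
  using frag_eval_diff[of \<phi> "c + d" d] by simp

lemma frag_eval_of: "frag_eval \<phi> (frag_of x) = \<phi> x"
  by (simp add: frag_eval_def)

lemma frag_diff_in:
  "x \<in> carrier (free_Abelian_group S) \<Longrightarrow> y \<in> carrier (free_Abelian_group S) \<Longrightarrow> x - y \<in> carrier (free_Abelian_group S)"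
  using keys_diff[of x y] by auto

text \<open>A presentation of an abelian group; exterior powers and tensor products are both
  instances.\<close>

locale frag_quotient =
  fixes S :: "'s set" and R :: "('s \<Rightarrow>\<^sub>0 int) set"
  assumes relations: "R \<subseteq> carrier (free_Abelian_group S)"
begin

abbreviation "FS \<equiv> free_Abelian_group S"
abbreviation "Ker \<equiv> generate FS R"
abbreviation "Q \<equiv> FS Mod Ker"
abbreviation "cls c \<equiv> Ker #>\<^bsub>FS\<^esub> c"

lemma subgroup_Ker: "subgroup Ker FS"
  by (rule group.generate_is_subgroup[OF group_free_Abelian_group relations])

lemma normal_Ker: "Ker \<lhd> FS"
  by (rule comm_group.subgroup_imp_normal[OF abelian_free_Abelian_group subgroup_Ker])

lemma comm_group_Q: "comm_group Q"
  by (rule comm_group.abelian_FactGroup[OF abelian_free_Abelian_group subgroup_Ker])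

lemma cls_hom: "cls \<in> hom FS Q"
  by (rule normal.r_coset_hom_Mod[OF normal_Ker])

lemma group_hom_cls: "group_hom FS Q cls"
  using comm_group_Q cls_hom by (simp add: group_hom_def group_hom_axioms_def comm_group_def)

lemma cls_in: "c \<in> carrier FS \<Longrightarrow> cls c \<in> carrier Q"
  using cls_hom by (auto simp: hom_def)

lemma cls_add: "c \<in> carrier FS \<Longrightarrow> d \<in> carrier FS \<Longrightarrow> cls (c + d) = cls c \<otimes>\<^bsub>Q\<^esub> cls d"
  using hom_mult[OF cls_hom, of c d] by simp

lemma carrier_Q: "carrier Q = cls ` carrier FS"
  by (auto simp: FactGroup_def RCOSETS_def)

lemma cls_relation: "r \<in> R \<Longrightarrow> cls r = \<one>\<^bsub>Q\<^esub>"
  using group.coset_join2[OF group_free_Abelian_group _ subgroup_Ker, of r] relations generate.incl[of r R FS]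
  by (auto simp: FactGroup_def)

lemma cls_additive:
  assumes "frag_of x - frag_of y - frag_of z \<in> R" "x \<in> S" "y \<in> S" "z \<in> S"
  shows "cls (frag_of x) = cls (frag_of y) \<otimes>\<^bsub>Q\<^esub> cls (frag_of z)"
proof -
  interpret Q: comm_group Q by (rule comm_group_Q)
  have yz: "frag_of y + frag_of z \<in> carrier FS"
    using keys_add[of "frag_of y" "frag_of z"] assms by (auto simp: subset_iff)
  have "cls (frag_of x) = cls ((frag_of x - frag_of y - frag_of z) + (frag_of y + frag_of z))" by simp
  also have "\<dots> = \<one>\<^bsub>Q\<^esub> \<otimes>\<^bsub>Q\<^esub> cls (frag_of y + frag_of z)"
    by (simp only: cls_add[OF subsetD[OF relations assms(1)] yz] cls_relation[OF assms(1)])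
  also have "\<dots> = cls (frag_of y) \<otimes>\<^bsub>Q\<^esub> cls (frag_of z)"
    unfolding Q.l_one[OF cls_in[OF yz]] by (rule cls_add) (use assms in simp_all)
  finally show ?thesis .
qed

lemma Q_generated:
  assumes H: "subgroup H Q" and gen: "\<And>s. s \<in> S \<Longrightarrow> cls (frag_of s) \<in> H" and z: "z \<in> carrier Q"
  shows "z \<in> H"
proof -
  interpret cls: group_hom FS Q cls by (rule group_hom_cls)
  obtain c where c: "Poly_Mapping.keys c \<subseteq> S" "z = cls c" using z by (auto simp: carrier_Q)
  have "cls c \<in> H" using c(1)
  proof (induction c rule: free_Abelian_group_induct[consumes 1, case_names 1 2 3])
    case 1
    show ?case using cls.hom_one subgroup.one_closed[OF H] by simp
  next
    case (2 x y)
    have "cls (x - y) \<otimes>\<^bsub>Q\<^esub> cls y = cls x"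
      using cls_add[of "x - y" y] 2 frag_diff_in[of x S y] by simp
    then have "cls (x - y) = cls x \<otimes>\<^bsub>Q\<^esub> inv\<^bsub>Q\<^esub> cls y"
      using cls.H.inv_solve_right[of "cls (x - y)" "cls x" "cls y"] 2 frag_diff_in[of x S y] cls_in by simp
    then show ?case using 2 subgroup.m_closed[OF H] subgroup.m_inv_closed[OF H] by simp
  next
    case (3 a)
    then show ?case by (rule gen)
  qed
  then show ?thesis using c(2) by simp
qed

lemma frag_eval_Ker:
  assumes \<phi>: "\<And>r. r \<in> R \<Longrightarrow> frag_eval \<phi> r = 0" and z: "z \<in> Ker"
  shows "frag_eval \<phi> z = 0"
  using z
proof induction
  case one
  show ?case by (simp add: frag_eval_0)
next
  case (inv h)
  then have "inv\<^bsub>FS\<^esub> h = 0 - h" using relations by auto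
  then show ?case using \<phi>[OF inv] by (simp only: frag_eval_diff frag_eval_0 diff_zero)
qed (simp_all add: \<phi> frag_eval_add)

text \<open>A functional that kills the relations takes one value on a whole coset, so evaluating it
  at an arbitrary representative gives a coordinate on the quotient.\<close>

lemma frag_eval_cls:
  assumes \<phi>: "\<And>r. r \<in> R \<Longrightarrow> frag_eval \<phi> r = 0" and c: "c \<in> carrier FS"
  shows "frag_eval \<phi> (SOME c'. c' \<in> cls c) = frag_eval \<phi> c"
proof -
  have "c \<in> cls c"
    using group.rcos_self[OF group_free_Abelian_group c subgroup_Ker] .
  then have "(SOME c'. c' \<in> cls c) \<in> cls c" by (rule someI)
  then obtain z where "z \<in> Ker" "(SOME c'. c' \<in> cls c) = z + c" by (auto simp: r_coset_def)
  then show ?thesis using frag_eval_Ker[OF \<phi>] by (simp add: frag_eval_add)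
qed

end

section \<open>Tensor products and exterior powers\<close>

locale tensor_product = A: comm_group A + B: comm_group B for A :: "'a monoid" and B :: "'b monoid"
begin

sublocale frag_quotient "carrier A \<times> carrier B" "tensor_relations A B"
proof
  show "tensor_relations A B \<subseteq> carrier (free_Abelian_group (carrier A \<times> carrier B))"
    unfolding tensor_relations_def
    by (rule Un_least; clarify; intro frag_diff_in) (simp_all only: frag_of_in_free_Abelian_group mem_Times_iff fst_conv snd_conv A.m_closed B.m_closed simp_thms)
qed

lemma tensor_group_eq: "tensor_group A B = Q"
  by (simp add: tensor_group_def tensor_kernel_def)

lemma tensor_eq: "tensor A B a b = cls (frag_of (a, b))"
  by (simp add: tensor_def tensor_kernel_def)

lemma comm_group_tensor: "comm_group (tensor_group A B)"
  unfolding tensor_group_eq by (rule comm_group_Q)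

lemma tensor_in: "a \<in> carrier A \<Longrightarrow> b \<in> carrier B \<Longrightarrow> tensor A B a b \<in> carrier (tensor_group A B)"
  unfolding tensor_group_eq tensor_eq by (rule cls_in) simp

lemma tensor_add_left:
  assumes "a \<in> carrier A" "a' \<in> carrier A" "b \<in> carrier B"
  shows "tensor A B (a \<otimes>\<^bsub>A\<^esub> a') b = tensor A B a b \<otimes>\<^bsub>tensor_group A B\<^esub> tensor A B a' b"
  unfolding tensor_group_eq tensor_eq
  by (rule cls_additive) (use assms in \<open>auto simp: tensor_relations_def\<close>)

lemma tensor_add_right:
  assumes "a \<in> carrier A" "b \<in> carrier B" "b' \<in> carrier B"
  shows "tensor A B a (b \<otimes>\<^bsub>B\<^esub> b') = tensor A B a b \<otimes>\<^bsub>tensor_group A B\<^esub> tensor A B a b'"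
  unfolding tensor_group_eq tensor_eq
  by (rule cls_additive) (use assms in \<open>auto simp: tensor_relations_def\<close>)

end

locale exterior_power = A: comm_group A for A :: "'a monoid" and p :: nat
begin

lemma update_tuple: "xs \<in> ext_tuples p A \<Longrightarrow> a \<in> carrier A \<Longrightarrow> xs[i := a] \<in> ext_tuples p A"
  using set_update_subset_insert[of xs i a] by (auto simp: ext_tuples_def)

sublocale frag_quotient "ext_tuples p A" "ext_relations p A"
proof
  show "ext_relations p A \<subseteq> carrier (free_Abelian_group (ext_tuples p A))"
    unfolding ext_relations_def
    by (rule Un_least; clarify; (intro frag_diff_in)?) (simp_all only: frag_of_in_free_Abelian_group update_tuple A.m_closed)
qed

lemma ext_power_eq: "ext_power p A = Q"
  by (simp add: ext_power_def ext_kernel_def)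

lemma wedge_eq: "wedge p A xs = cls (frag_of xs)"
  by (simp add: wedge_def ext_kernel_def)

lemma comm_group_ext: "comm_group (ext_power p A)"
  unfolding ext_power_eq by (rule comm_group_Q)

lemma wedge_in: "xs \<in> ext_tuples p A \<Longrightarrow> wedge p A xs \<in> carrier (ext_power p A)"
  unfolding ext_power_eq wedge_eq by (rule cls_in) simp

lemma wedge_additive:
  assumes "xs \<in> ext_tuples p A" "i < p" "a \<in> carrier A" "b \<in> carrier A"
  shows "wedge p A (xs[i := a \<otimes>\<^bsub>A\<^esub> b]) = wedge p A (xs[i := a]) \<otimes>\<^bsub>ext_power p A\<^esub> wedge p A (xs[i := b])"
  unfolding ext_power_eq wedge_eq
  by (rule cls_additive) (use assms update_tuple in \<open>auto simp: ext_relations_def\<close>)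

lemma wedge_repeated: "xs \<in> ext_tuples p A \<Longrightarrow> \<not> distinct xs \<Longrightarrow> wedge p A xs = \<one>\<^bsub>ext_power p A\<^esub>"
  unfolding ext_power_eq wedge_eq by (rule cls_relation) (auto simp: ext_relations_def)

end

lemma sorted_list_of_set_props:
  assumes "finite S" shows "sorted_wrt (<) (sorted_list_of_set S)" "length (sorted_list_of_set S) = card S"
    "set (sorted_list_of_set S) = S"
  using assms by simp_all

text \<open>Increasing wedges of basis vectors span. This is phrased for an arbitrary alternating
  multilinear T and a subgroup H, so that it can be used after tensoring with a function.\<close>

lemma alternating_in_subgroup:
  fixes T :: "zvec list \<Rightarrow> 'g"
  assumes "comm_group M" and H: "subgroup H M"
    and T_in: "\<And>xs. xs \<in> ext_tuples n (Zk k) \<Longrightarrow> T xs \<in> carrier M"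
    and T_add: "\<And>xs i a b. xs \<in> ext_tuples n (Zk k) \<Longrightarrow> i < n \<Longrightarrow> a \<in> carrier (Zk k) \<Longrightarrow> b \<in> carrier (Zk k) \<Longrightarrow>
      T (xs[i := a + b]) = T (xs[i := a]) \<otimes>\<^bsub>M\<^esub> T (xs[i := b])"
    and T_rep: "\<And>xs. xs \<in> ext_tuples n (Zk k) \<Longrightarrow> \<not> distinct xs \<Longrightarrow> T xs = \<one>\<^bsub>M\<^esub>"
    and T_basis: "\<And>is. sorted_wrt (<) is \<Longrightarrow> length is = n \<Longrightarrow> set is \<subseteq> {1..k} \<Longrightarrow> T (map frag_of is) \<in> H"
    and xs: "xs \<in> ext_tuples n (Zk k)"
  shows "T xs \<in> H"
proof -
  interpret M: comm_group M by fact
  interpret H: subgroup H M by fact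
  have upd: "xs[i := a] \<in> ext_tuples n (Zk k)" if "xs \<in> ext_tuples n (Zk k)" "a \<in> carrier (Zk k)" for xs :: "zvec list" and i a
    using that set_update_subset_insert[of xs i a] by (auto simp: ext_tuples_def)
  have nth: "xs ! i \<in> carrier (Zk k)" if "xs \<in> ext_tuples n (Zk k)" "i < n" for xs :: "zvec list" and i
    using that by (auto simp: ext_tuples_def)
  \<comment> \<open>Polarisation: the value with a + b in both places is trivial, so exchanging two
    entries inverts the value.\<close>
  have exchange: "T (xs[i := xs ! j, j := xs ! i]) \<in> H"
    if xs: "xs \<in> ext_tuples n (Zk k)" and ij: "i < n" "j < n" "i \<noteq> j" and TH: "T xs \<in> H" for xs i j
  proof -
    define U where "U a b = T (xs[i := a, j := b])" for a b
    let ?a = "xs ! i" and ?b = "xs ! j"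
    have a: "?a \<in> carrier (Zk k)" and b: "?b \<in> carrier (Zk k)" using nth[OF xs] ij by blast+
    have U_in: "U c d \<in> carrier M" if "c \<in> carrier (Zk k)" "d \<in> carrier (Zk k)" for c d
      unfolding U_def by (rule T_in[OF upd[OF upd[OF xs that(1)] that(2)]])
    have U_add2: "U c (d + e) = U c d \<otimes>\<^bsub>M\<^esub> U c e"
      if "c \<in> carrier (Zk k)" "d \<in> carrier (Zk k)" "e \<in> carrier (Zk k)" for c d e
      unfolding U_def by (rule T_add[OF upd[OF xs that(1)] ij(2) that(2,3)])
    have U_add1: "U (d + e) c = U d c \<otimes>\<^bsub>M\<^esub> U e c"
      if "c \<in> carrier (Zk k)" "d \<in> carrier (Zk k)" "e \<in> carrier (Zk k)" for c d e
      using T_add[OF upd[OF xs that(1)] ij(1) that(2,3), of j] ij(3) by (simp add: U_def list_update_swap[of i j])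
    have U_rep: "U c c = \<one>\<^bsub>M\<^esub>" if "c \<in> carrier (Zk k)" for c
      unfolding U_def
    proof (rule T_rep[OF upd[OF upd[OF xs that] that]])
      have "length xs = n" using xs by (simp add: ext_tuples_def)
      then have "xs[i := c, j := c] ! i = xs[i := c, j := c] ! j" "i < length (xs[i := c, j := c])" "j < length (xs[i := c, j := c])"
        using ij by auto
      then show "\<not> distinct (xs[i := c, j := c])" using ij(3) nth_eq_iff_index_eq by blast
    qed
    have ab: "?a + ?b \<in> carrier (Zk k)" using a b by (rule Zk_closed)
    have "\<one>\<^bsub>M\<^esub> = (U ?a ?a \<otimes>\<^bsub>M\<^esub> U ?a ?b) \<otimes>\<^bsub>M\<^esub> (U ?b ?a \<otimes>\<^bsub>M\<^esub> U ?b ?b)"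
      using U_rep[OF ab] by (simp only: U_add1[OF ab a b] U_add2[OF a a b] U_add2[OF b a b])
    then have "\<one>\<^bsub>M\<^esub> = U ?b ?a \<otimes>\<^bsub>M\<^esub> U ?a ?b"
      using U_in a b by (simp add: U_rep M.m_comm)
    then have "U ?b ?a = inv\<^bsub>M\<^esub> U ?a ?b" using M.inv_equality[OF sym] U_in a b by metis
    moreover have "U ?a ?b = T xs" by (simp add: U_def list_update_id)
    ultimately show ?thesis using TH by (simp add: U_def)
  qed
  have tup: "map (\<lambda>l. frag_of (g l)) [0..<n] \<in> ext_tuples n (Zk k)" if "g ` {..<n} \<subseteq> {1..k}" for g
    using that frag_of_in_Zk by (auto simp: ext_tuples_def image_subset_iff)
  \<comment> \<open>A permutation is a product of transpositions, each handled by
    \<open>exchange\<close>.\<close>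
  have perm: "T (map (\<lambda>l. frag_of (g (p l))) [0..<n]) \<in> H"
    if p: "p permutes {..<n}" and "g ` {..<n} \<subseteq> {1..k}" "T (map (\<lambda>l. frag_of (g l)) [0..<n]) \<in> H" for g p
    using p finite_lessThan that(2,3)
  proof (induction arbitrary: g rule: permutes_induct)
    case (swap a b p)
    let ?t = "Transposition.transpose a b"
    let ?xs = "map (\<lambda>l. frag_of (g l)) [0..<n] :: zvec list"
    have "map (\<lambda>l. frag_of (g (?t l))) [0..<n] = ?xs[a := ?xs ! b, b := ?xs ! a]"
      using swap(1,2) by (intro nth_equalityI) (auto simp: nth_list_update Transposition.transpose_def)
    then have "T (map (\<lambda>l. frag_of (g (?t l))) [0..<n]) \<in> H"
      using swap(1-3) swap.prems(2) exchange[OF tup[OF swap.prems(1)], of a b] by simp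
    moreover have "(\<lambda>l. g (?t l)) ` {..<n} \<subseteq> {1..k}"
      using swap.prems(1) swap(1,2) by (auto simp: image_subset_iff Transposition.transpose_def)
    ultimately show ?case using swap.IH[of "\<lambda>l. g (?t l)"] by simp
  qed simp
  have basis: "T (map frag_of is) \<in> H" if "is": "set is \<subseteq> {1..k}" "length is = n" for "is"
  proof (cases "distinct is")
    case False
    have "map frag_of is \<in> ext_tuples n (Zk k)" using "is" frag_of_in_Zk by (auto simp: ext_tuples_def)
    moreover have "\<not> distinct (map frag_of is :: zvec list)" using False by (auto simp: distinct_map)
    ultimately show ?thesis using T_rep by simp
  next
    case True
    define s where "s = sorted_list_of_set (set is)"
    have s: "sorted_wrt (<) s" "length s = n" "set s = set is" "distinct s"
      using sorted_list_of_set_props[of "set is"] True "is"(2) by (simp_all add: s_def distinct_card)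
    have "mset is = mset s" using s True set_eq_iff_mset_eq_distinct[of "is" s] by simp
    then obtain p where p: "p permutes {..<length s}" "permute_list p s = is" by (rule mset_eq_permutation)
    have "map (\<lambda>l. frag_of (s ! l)) [0..<n] = map frag_of s"
      by (rule nth_equalityI) (simp_all add: s(2))
    moreover have "(!) s ` {..<n} \<subseteq> {1..k}"
    proof (rule image_subsetI)
      fix l assume "l \<in> {..<n}"
      then show "s ! l \<in> {1..k}" using nth_mem[of l s] s(2,3) "is"(1) by (simp only: lessThan_iff) blast
    qed
    ultimately have "T (map (\<lambda>l. frag_of (s ! p l)) [0..<n]) \<in> H"
      using perm[of p "(!) s"] p(1) s T_basis[OF s(1,2)] "is"(1) by simp
    moreover have "map (\<lambda>l. frag_of (s ! p l)) [0..<n] = map frag_of is"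
      using p(2) s(2) by (auto simp: permute_list_def)
    ultimately show ?thesis by simp
  qed
  \<comment> \<open>Only the first m entries may still be arbitrary, the others being basis vectors.
    The induction step resolves the last arbitrary entry by additivity.\<close>
  have "T xs \<in> H" if "m \<le> n" "xs \<in> ext_tuples n (Zk k)" "\<forall>l. m \<le> l \<and> l < n \<longrightarrow> xs ! l \<in> frag_of ` {1..k}" for m xs
    using that
  proof (induction m arbitrary: xs)
    case 0
    have "set xs \<subseteq> frag_of ` {1..k}" using 0 by (auto simp: ext_tuples_def in_set_conv_nth)
    then have "xs \<in> map frag_of ` lists {1..k}" by (simp flip: lists_image) blast
    then obtain "is" where "xs = map frag_of is" "set is \<subseteq> {1..k}" by blast
    then show ?case using basis 0(2) by (simp add: ext_tuples_def)
  next
    case (Suc m)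
    have len: "length xs = n" using Suc(3) by (simp add: ext_tuples_def)
    have "T (xs[m := a]) \<in> H" if "Poly_Mapping.keys a \<subseteq> {1..k}" for a
      using that
    proof (induction a rule: free_Abelian_group_induct[consumes 1, case_names 1 2 3])
      case 1
      have "T (xs[m := 0]) = T (xs[m := 0]) \<otimes>\<^bsub>M\<^esub> T (xs[m := 0])"
        using T_add[OF Suc(3), of m 0 0] Suc(2) Zk_closed(1) by simp
      then have "T (xs[m := 0]) = \<one>\<^bsub>M\<^esub>"
        using M.l_cancel_one[of "T (xs[m := 0])" "T (xs[m := 0])"] T_in[OF upd[OF Suc(3) Zk_closed(1)]] by simp
      then show ?case by simp
    next
      case (2 x y)
      have xy: "x \<in> carrier (Zk k)" "y \<in> carrier (Zk k)" "x - y \<in> carrier (Zk k)"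
        using 2 Zk_closed(4)[of x k y] by (simp_all add: carrier_Zk)
      have "T (xs[m := x]) = T (xs[m := x - y]) \<otimes>\<^bsub>M\<^esub> T (xs[m := y])"
        using T_add[OF Suc(3), of m "x - y" y] Suc(2) xy by simp
      then have "T (xs[m := x - y]) = T (xs[m := x]) \<otimes>\<^bsub>M\<^esub> inv\<^bsub>M\<^esub> T (xs[m := y])"
        using M.inv_solve_right[of "T (xs[m := x - y])" "T (xs[m := x])" "T (xs[m := y])"] T_in[OF upd[OF Suc(3)]] xy by simp
      then show ?case using 2 by simp
    next
      case (3 i)
      show ?case
      proof (rule Suc.IH)
        show "xs[m := frag_of i] \<in> ext_tuples n (Zk k)" by (rule upd[OF Suc(3) frag_of_in_Zk[OF 3]])
        show "\<forall>l. m \<le> l \<and> l < n \<longrightarrow> xs[m := frag_of i] ! l \<in> frag_of ` {1..k}"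
        proof (intro allI impI)
          fix l assume l: "m \<le> l \<and> l < n"
          show "xs[m := frag_of i] ! l \<in> frag_of ` {1..k}"
            using l Suc(4) 3 len by (cases "l = m") auto
        qed
      qed (use Suc(2) in simp)
    qed
    from this[of "xs ! m"] show ?case using nth[OF Suc(3), of m] Suc(2) by (simp add: carrier_Zk)
  qed
  from this[OF le_refl xs] show ?thesis by simp
qed

text \<open>The coordinates of a wedge are given by Laplace expansion along its first entry.\<close>

fun minor :: "zvec list \<Rightarrow> nat set \<Rightarrow> int" where
  "minor [] S = (if S = {} then 1 else 0)"
| "minor (v # vs) S = (\<Sum>i\<in>S. (-1) ^ position i S * (Poly_Mapping.lookup v i * minor vs (S - {i})))"

lemma minor_additive: "i < length xs \<Longrightarrow> minor (xs[i := a + b]) S = minor (xs[i := a]) S + minor (xs[i := b]) S"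
proof (induction xs arbitrary: i S)
  case (Cons x xs)
  then show ?case by (cases i) (simp_all add: lookup_add algebra_simps sum.distrib)
qed simp

text \<open>After expanding twice, the ordered pair (i, j) of chosen indices on one side matches (j,
  i) on the other, with opposite sign by \<open>position_swap\<close>.\<close>

lemma minor_swap:
  assumes "finite S" shows "minor (v # w # vs) S = - minor (w # v # vs) S"
proof -
  define t where "t v w i j = (-1) ^ position i S * (Poly_Mapping.lookup v i * ((-1) ^ position j (S - {i}) *
    (Poly_Mapping.lookup w j * minor vs (S - {i} - {j}))))" for v w :: zvec and i j
  have e: "minor (v # w # vs) S = (\<Sum>i\<in>S. \<Sum>j\<in>S. if i = j then 0 else t v w i j)" for v w
    unfolding minor.simps sum_distrib_left t_def
    by (intro sum.cong refl sum.mono_neutral_cong_left) (use assms in auto)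
  have sgn: "t w v j i = - t v w i j" if "i \<in> S" "j \<in> S" "i \<noteq> j" for i j
  proof -
    define T where "T = S - {i} - {j}"
    have T: "S - {i} = insert j T" "S - {j} = insert i T" "S - {j} - {i} = T" "finite T" "i \<notin> T" "j \<notin> T"
      using that assms by (auto simp: T_def)
    have p: "position l (insert l V) = position l V" "position l (V - {l}) = position l V" for l V
      unfolding position_def by (rule arg_cong[where f = card], auto)+
    have "position i S = position i (insert j T)" "position j S = position j (insert i T)"
      using p(2)[of i S] p(2)[of j S] by (simp_all add: T)
    moreover have "(-1) ^ position i T * (-1) ^ position j (insert i T) = - ((-1) ^ position j T * (-1) ^ position i (insert j T) :: int)"
      using position_swap[OF T(4-6) that(3), of "1::int"] by (simp flip: alt_sign_int power_add)
    moreover have "t v w i j = (-1) ^ position j T * (-1) ^ position i S * (Poly_Mapping.lookup v i * Poly_Mapping.lookup w j * minor vs T)"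
      unfolding t_def unfolding T_def[symmetric] unfolding T(1) p(1) by (simp only: mult_ac)
    moreover have "t w v j i = (-1) ^ position i T * (-1) ^ position j S * (Poly_Mapping.lookup v i * Poly_Mapping.lookup w j * minor vs T)"
      unfolding t_def unfolding T(3) unfolding T(2) p(1) by (simp only: mult_ac)
    ultimately show ?thesis by (simp only: minus_mult_left)
  qed
  have "minor (w # v # vs) S = (\<Sum>i\<in>S. \<Sum>j\<in>S. if j = i then 0 else t w v j i)"
    unfolding e by (rule sum.swap)
  also have "\<dots> = (\<Sum>i\<in>S. \<Sum>j\<in>S. - (if i = j then 0 else t v w i j))"
    by (intro sum.cong refl) (simp add: sgn)
  also have "\<dots> = - minor (v # w # vs) S" unfolding e by (simp add: sum_negf)
  finally show ?thesis by simp
qed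

lemma minor_infinite: "infinite S \<Longrightarrow> minor vs S = 0"
  by (cases vs) auto

text \<open>v is moved past the entries in front of its equal; once the two are adjacent, the swap
  shows that an integer equals its negative.\<close>

lemma minor_member: "v \<in> set vs \<Longrightarrow> minor (v # vs) S = 0"
proof (induction vs arbitrary: S)
  case (Cons w vs)
  show ?case
  proof (cases "finite S")
    case True
    show ?thesis
    proof (cases "w = v")
      case True
      then show ?thesis using minor_swap[OF \<open>finite S\<close>, of v v vs] by simp
    next
      case False
      then have "minor (v # vs) S' = 0" for S' using Cons by simp
      then have "minor (w # v # vs) S = 0" by (simp only: minor.simps(2)[of w "v # vs"] mult_zero_right sum.neutral_const)
      then show ?thesis using minor_swap[OF True, of v w vs] by simp
    qed
  qed (rule minor_infinite)
qed simp

lemma minor_repeated: "\<not> distinct xs \<Longrightarrow> minor xs S = 0"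
proof (induction xs arbitrary: S)
  case (Cons x xs)
  show ?case
  proof (cases "x \<in> set xs")
    case False
    then show ?thesis using Cons by simp
  qed (rule minor_member)
qed simp

lemma minor_basis: "sorted_wrt (<) is \<Longrightarrow> minor (map frag_of is) S = (if S = set is then 1 else 0)"
proof (induction "is" arbitrary: S)
  case (Cons i "is")
  show ?case
  proof (cases "finite S")
    case True
    have "minor (map frag_of (i # is)) S
        = (\<Sum>j\<in>S. if i = j then (-1) ^ position i S * (if S - {i} = set is then 1 else 0) else 0)"
      unfolding list.map minor.simps
    proof (rule sum.cong)
      fix j assume "j \<in> S"
      show "(-1) ^ position j S * (Poly_Mapping.lookup (frag_of i) j * minor (map frag_of is) (S - {j}))
          = (if i = j then (-1) ^ position i S * (if S - {i} = set is then 1 else 0) else 0)"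
        using Cons by (simp add: lookup_single when_def)
    qed simp
    also have "\<dots> = (if i \<in> S then (-1) ^ position i S * (if S - {i} = set is then 1 else 0) else 0)"
      using True by simp
    also have "\<dots> = (if S = set (i # is) then 1 else 0)"
    proof (cases "S = set (i # is)")
      case True
      \<comment> \<open>The first index of an increasing list is the least, so the sign is
        +1.\<close>
      have "{l \<in> S. l < i} = {}" using Cons(2) True by auto
      then have "position i S = 0" by (simp add: position_def)
      moreover have "S - {i} = set is" using Cons(2) True by auto
      ultimately show ?thesis using True by simp
    qed auto
    finally show ?thesis .
  next
    case False
    then have "S \<noteq> set (i # is)" by auto
    then show ?thesis using minor_infinite[OF False] by simp
  qed
qed simp

section \<open>The complex of the action\<close>

text \<open>Turns the coordinate form of the differential into the deletion form on a basis element,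
  in which the boundary of the action complex is prescribed.\<close>

lemma koszul_d_single:
  fixes f :: "'p::ab_group_add"
  assumes S: "S \<subseteq> {1..k}" and u0: "\<And>i. i \<in> {1..k} \<Longrightarrow> u i 0 = 0"
  shows "koszul_d u k (\<lambda>T. if T = S then f else 0) T
    = (\<Sum>i\<in>S. if S - {i} = T then alt_sign (position i S) (u i f) else 0)"
proof -
  have fin: "finite S" using S finite_subset by blast
  have "koszul_d u k (\<lambda>T. if T = S then f else 0) T
      = (\<Sum>i\<in>{1..k} - T. if i \<in> S \<and> S - {i} = T then alt_sign (position i S) (u i f) else 0)"
    unfolding koszul_d_def
  proof (rule sum.cong)
    fix i assume i: "i \<in> {1..k} - T"
    have c: "(i \<in> S \<and> S - {i} = T) = (insert i T = S)" using i by auto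
    have "position i T = position i S" if "insert i T = S"
      unfolding position_def that[symmetric] by (rule arg_cong[where f = card]) auto
    then show "alt_sign (position i T) (u i (if insert i T = S then f else 0))
        = (if i \<in> S \<and> S - {i} = T then alt_sign (position i S) (u i f) else 0)"
      unfolding c using u0[of i] i by (cases "insert i T = S") simp_all
  qed simp
  also have "\<dots> = (\<Sum>i\<in>S. if S - {i} = T then alt_sign (position i S) (u i f) else 0)"
  proof (rule sum.mono_neutral_cong)
    fix i assume "i \<in> S - ({1..k} - T)"
    then have "i \<in> T" using S by auto
    then show "(if S - {i} = T then alt_sign (position i S) (u i f) else 0) = 0" by auto
  qed (use fin in auto)
  finally show ?thesis .
qed

text \<open>Matches the Koszul sign with the alternating sign of the omitted place in an increasing
  list.\<close>

lemma position_nth: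
  assumes "sorted_wrt (<) is" "l < length is" shows "position (is ! l) (set is) = l"
proof -
  have "{x \<in> set is. x < is ! l} = (!) is ` {..<l}"
  proof (intro equalityI subsetI)
    fix x assume "x \<in> {x \<in> set is. x < is ! l}"
    then obtain m where m: "m < length is" "x = is ! m" "is ! m < is ! l" by (auto simp: in_set_conv_nth)
    have "m < l"
    proof (rule ccontr)
      assume "\<not> m < l"
      then have "l = m \<or> is ! l < is ! m" using sorted_wrt_nth_less[OF assms(1), of l m] m(1) by (cases "l = m") auto
      then show False using m(3) by auto
    qed
    then show "x \<in> (!) is ` {..<l}" using m(2) by blast
  next
    fix x assume "x \<in> (!) is ` {..<l}"
    then show "x \<in> {x \<in> set is. x < is ! l}" using sorted_wrt_nth_less[OF assms(1)] assms(2) by auto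
  qed
  moreover have "inj_on ((!) is) {..<l}"
    using assms strict_sorted_iff[of "is"] by (auto intro!: inj_on_nth)
  ultimately show ?thesis by (simp add: position_def card_image)
qed

lemma removed_index:
  fixes "is" :: "nat list"
  assumes s: "sorted_wrt (<) is" and l: "l < length is"
  shows "sorted_wrt (<) (take l is @ drop (Suc l) is)" "set (take l is @ drop (Suc l) is) = set is - {is ! l}"
    "length (take l is @ drop (Suc l) is) = length is - 1"
proof -
  have e: "is = take l is @ is ! l # drop (Suc l) is" using l by (rule id_take_nth_drop)
  define a b x where "a = take l is" and "b = drop (Suc l) is" and "x = is ! l"
  have e': "is = a @ x # b" using e by (simp add: a_def b_def x_def)
  have "sorted_wrt (<) (a @ x # b)" using s e' by simp
  then show "sorted_wrt (<) (take l is @ drop (Suc l) is)" by (simp add: sorted_wrt_append flip: a_def b_def)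
  have "distinct (a @ x # b)" using s e' strict_sorted_iff[of "is"] by simp
  then have "set (a @ b) = set (a @ x # b) - {x}" by auto
  then show "set (take l is @ drop (Suc l) is) = set is - {is ! l}" unfolding e'[symmetric] by (simp add: a_def b_def x_def)
  show "length (take l is @ drop (Suc l) is) = length is - 1" using l by simp
qed

lemma comm_group_Zk: "comm_group (Zk k)"
  by (simp add: Zk_def abelian_free_Abelian_group)

context dr_action
begin

section \<open>Coordinates on the chain groups of the action\<close>

sublocale ext: exterior_power "Zk k" n for n
  by (intro exterior_power.intro comm_group_Zk)

sublocale tens: tensor_product "ext_power n (Zk k)" "Cc X" for n
  by (intro tensor_product.intro ext.comm_group_ext comm_group_Cc)

text \<open>The coefficient at the increasing wedge over U, read off by minors from an arbitrary
  representative of the coset.\<close>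

definition ext_coord :: "(zvec list \<Rightarrow>\<^sub>0 int) set \<Rightarrow> nat set \<Rightarrow> int" where
  "ext_coord C U = frag_eval (\<lambda>xs. minor xs U) (SOME c. c \<in> C)"

definition action_coords :: "'a action_chain \<Rightarrow> nat set \<Rightarrow> 'a \<Rightarrow> int" where
  "action_coords z U x = frag_eval (\<lambda>(C, f). ext_coord C U * f x) (SOME c. c \<in> z)"

lemma ext_coord_cls:
  "c \<in> carrier (free_Abelian_group (ext_tuples n (Zk k))) \<Longrightarrow>
    ext_coord (ext.cls n c) U = frag_eval (\<lambda>xs. minor xs U) c"
  unfolding ext_coord_def
  by (rule ext.frag_eval_cls)
    (auto simp: ext_relations_def frag_eval_diff frag_eval_of minor_additive minor_repeated mult_Zk ext_tuples_def)

lemma ext_coord_wedge: "xs \<in> ext_tuples n (Zk k) \<Longrightarrow> ext_coord (wedge n (Zk k) xs) U = minor xs U"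
  unfolding ext.wedge_eq by (subst ext_coord_cls) (simp_all add: frag_eval_of)

lemma ext_coord_add:
  assumes "C \<in> carrier (ext_power n (Zk k))" "D \<in> carrier (ext_power n (Zk k))"
  shows "ext_coord (C \<otimes>\<^bsub>ext_power n (Zk k)\<^esub> D) U = ext_coord C U + ext_coord D U"
proof -
  let ?F = "free_Abelian_group (ext_tuples n (Zk k))"
  obtain c d where cd: "c \<in> carrier ?F" "d \<in> carrier ?F" "C = ext.cls n c" "D = ext.cls n d"
    using assms unfolding ext.ext_power_eq ext.carrier_Q by blast
  have "c + d \<in> carrier ?F" using monoid.m_closed[OF group.is_monoid[OF group_free_Abelian_group] cd(1,2)] by simp
  then show ?thesis
    unfolding cd(3,4) ext.ext_power_eq ext.cls_add[OF cd(1,2), symmetric]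
    by (simp only: ext_coord_cls cd(1,2) frag_eval_add)
qed

lemma action_coords_cls:
  "c \<in> carrier (free_Abelian_group (carrier (ext_power n (Zk k)) \<times> carrier (Cc X))) \<Longrightarrow>
    action_coords (tens.cls n c) U x = frag_eval (\<lambda>(C, f). ext_coord C U * f x) c"
  unfolding action_coords_def
  by (rule tens.frag_eval_cls)
    (auto simp: tensor_relations_def frag_eval_diff frag_eval_of ext_coord_add Cc_mult ring_distribs)

abbreviation "AG n \<equiv> tensor_group (ext_power n (Zk k)) (Cc X)"

lemma action_coords_add:
  assumes "z \<in> carrier (AG n)" "w \<in> carrier (AG n)"
  shows "action_coords (z \<otimes>\<^bsub>AG n\<^esub> w) = action_coords z + action_coords w"
proof -
  let ?F = "free_Abelian_group (carrier (ext_power n (Zk k)) \<times> carrier (Cc X))"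
  obtain c d where cd: "c \<in> carrier ?F" "d \<in> carrier ?F" "z = tens.cls n c" "w = tens.cls n d"
    using assms unfolding tens.tensor_group_eq tens.carrier_Q by blast
  have "c + d \<in> carrier ?F" using monoid.m_closed[OF group.is_monoid[OF group_free_Abelian_group] cd(1,2)] by simp
  then have "action_coords (z \<otimes>\<^bsub>AG n\<^esub> w) U x = action_coords z U x + action_coords w U x" for U x
    unfolding cd(3,4) tens.tensor_group_eq tens.cls_add[OF cd(1,2), symmetric]
    by (simp only: action_coords_cls cd(1,2) frag_eval_add)
  then show ?thesis by (simp add: fun_eq_iff)
qed

lemma basis_tuple: "set is \<subseteq> {1..k} \<Longrightarrow> length is = n \<Longrightarrow> map frag_of is \<in> ext_tuples n (Zk k)"
  using frag_of_in_Zk by (auto simp: ext_tuples_def)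

lemma action_elem_in: "set is \<subseteq> {1..k} \<Longrightarrow> length is = n \<Longrightarrow> f \<in> X_Cc \<Longrightarrow> action_elem k X n is f \<in> carrier (AG n)"
  unfolding action_elem_def by (intro tens.tensor_in ext.wedge_in basis_tuple)

lemma action_elem_add:
  "set is \<subseteq> {1..k} \<Longrightarrow> length is = n \<Longrightarrow> f \<in> X_Cc \<Longrightarrow> g \<in> X_Cc \<Longrightarrow>
    action_elem k X n is (f + g) = action_elem k X n is f \<otimes>\<^bsub>AG n\<^esub> action_elem k X n is g"
  unfolding action_elem_def Cc_mult[of X f g, symmetric]
  by (intro tens.tensor_add_right ext.wedge_in basis_tuple)

lemma action_elem_0:
  assumes "set is \<subseteq> {1..k}" "length is = n" shows "action_elem k X n is 0 = \<one>\<^bsub>AG n\<^esub>"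
proof -
  interpret A: comm_group "AG n" by (rule tens.comm_group_tensor)
  show ?thesis
    using action_elem_add[OF assms Cc_zero Cc_zero] action_elem_in[OF assms Cc_zero]
      A.l_cancel_one[of "action_elem k X n is 0" "action_elem k X n is 0"] by simp
qed

lemma action_coords_elem:
  assumes s: "sorted_wrt (<) is" and i: "set is \<subseteq> {1..k}" "length is = n" and f: "f \<in> X_Cc"
  shows "action_coords (action_elem k X n is f) = (\<lambda>T. if T = set is then f else 0)"
proof -
  have w: "wedge n (Zk k) (map frag_of is) \<in> carrier (ext_power n (Zk k))"
    by (intro ext.wedge_in basis_tuple i)
  have "action_coords (action_elem k X n is f) T x = (if T = set is then f x else 0)" for T x
    unfolding action_elem_def tens.tensor_eq
    by (subst action_coords_cls) (use w f s in \<open>simp_all add: frag_eval_of ext_coord_wedge[OF basis_tuple[OF i]] minor_basis\<close>)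
  then show ?thesis by (simp add: fun_eq_iff)
qed

lemma action_coords_one: "action_coords \<one>\<^bsub>AG n\<^esub> = 0"
proof -
  interpret A: comm_group "AG n" by (rule tens.comm_group_tensor)
  show ?thesis using action_coords_add[of "\<one>\<^bsub>AG n\<^esub>" n "\<one>\<^bsub>AG n\<^esub>"] by simp
qed

lemma action_coords_finprod:
  "(\<And>i. i \<in> I \<Longrightarrow> e i \<in> carrier (AG n)) \<Longrightarrow> action_coords (finprod (AG n) e I) = (\<Sum>i\<in>I. action_coords (e i))"
proof (induction I rule: infinite_finite_induct)
  case (infinite I)
  interpret A: comm_group "AG n" by (rule tens.comm_group_tensor)
  show ?case using infinite by (simp add: action_coords_one)
next
  case empty
  interpret A: comm_group "AG n" by (rule tens.comm_group_tensor)
  show ?case by (simp add: action_coords_one)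
next
  case (insert i I)
  interpret A: comm_group "AG n" by (rule tens.comm_group_tensor)
  have "finprod (AG n) e I \<in> carrier (AG n)" using insert.prems by (intro A.finprod_closed) auto
  moreover have "finprod (AG n) e (insert i I) = e i \<otimes>\<^bsub>AG n\<^esub> finprod (AG n) e I"
    using insert by (intro A.finprod_insert) auto
  ultimately show ?case using insert by (simp add: action_coords_add)
qed

lemma action_coords_sign:
  assumes z: "z \<in> carrier (AG n)"
  shows "action_coords (z [^]\<^bsub>AG n\<^esub> ((-1 :: int) ^ m)) = alt_sign m (action_coords z)"
proof -
  interpret A: comm_group "AG n" by (rule tens.comm_group_tensor)
  have "action_coords z + action_coords (inv\<^bsub>AG n\<^esub> z) = 0"
    using action_coords_add[OF z A.inv_closed[OF z]] z by (simp add: action_coords_one)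
  then have "action_coords (inv\<^bsub>AG n\<^esub> z) = - action_coords z" by (metis minus_unique)
  then show ?thesis
    using z by (cases "even m") (simp_all add: alt_sign_def A.int_pow_neg)
qed

text \<open>Two stages: for fixed f, the exterior elements whose tensor with f lies in H form a
  subgroup containing all wedges; then the pure tensors generate the group.\<close>

lemma action_generated:
  assumes H: "subgroup H (AG n)"
    and basis: "\<And>is f. sorted_wrt (<) is \<Longrightarrow> length is = n \<Longrightarrow> set is \<subseteq> {1..k} \<Longrightarrow> f \<in> X_Cc \<Longrightarrow> action_elem k X n is f \<in> H"
    and z: "z \<in> carrier (AG n)"
  shows "z \<in> H"
proof -
  let ?E = "ext_power n (Zk k)"
  let ?t = "tensor ?E (Cc X)"
  interpret A: comm_group "AG n" by (rule tens.comm_group_tensor)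
  have "?t C f \<in> H" if C: "C \<in> carrier ?E" and f: "f \<in> X_Cc" for C f
  proof -
    have hom: "(\<lambda>C. ?t C f) \<in> hom ?E (AG n)"
      using tens.tensor_in[OF _ f] tens.tensor_add_left[OF _ _ f] by (auto simp: hom_def)
    interpret t: group_hom ?E "AG n" "\<lambda>C. ?t C f"
      using hom by (intro group_hom.intro group_hom_axioms.intro tens.A.is_group A.is_group)
    have "subgroup {C \<in> carrier ?E. ?t C f \<in> H} ?E"
      using t.hom_one subgroup.one_closed[OF H] subgroup.m_closed[OF H] subgroup.m_inv_closed[OF H]
      by (intro tens.A.subgroupI) auto
    moreover have "wedge n (Zk k) xs \<in> {C \<in> carrier ?E. ?t C f \<in> H}" if xs: "xs \<in> ext_tuples n (Zk k)" for xs
    proof -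
      have "?t (wedge n (Zk k) xs) f \<in> H"
      proof (rule alternating_in_subgroup[OF tens.comm_group_tensor H _ _ _ _ xs])
        fix xs :: "zvec list" assume xs: "xs \<in> ext_tuples n (Zk k)"
        show "?t (wedge n (Zk k) xs) f \<in> carrier (AG n)" by (rule tens.tensor_in[OF ext.wedge_in[OF xs] f])
        show "?t (wedge n (Zk k) xs) f = \<one>\<^bsub>AG n\<^esub>" if "\<not> distinct xs"
          unfolding ext.wedge_repeated[OF xs that] by (rule t.hom_one)
        show "?t (wedge n (Zk k) (xs[i := a + b])) f
            = ?t (wedge n (Zk k) (xs[i := a])) f \<otimes>\<^bsub>AG n\<^esub> ?t (wedge n (Zk k) (xs[i := b])) f"
          if "i < n" "a \<in> carrier (Zk k)" "b \<in> carrier (Zk k)" for i a b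
          using ext.wedge_additive[OF xs that] tens.tensor_add_left[OF ext.wedge_in ext.wedge_in f, OF ext.update_tuple[OF xs that(2)] ext.update_tuple[OF xs that(3)]]
          by (simp only: mult_Zk)
      next
        fix "is" :: "nat list" assume "sorted_wrt (<) is" "length is = n" "set is \<subseteq> {1..k}"
        then show "?t (wedge n (Zk k) (map frag_of is)) f \<in> H"
          using basis[OF _ _ _ f] by (simp add: action_elem_def)
      qed
      then show ?thesis using ext.wedge_in[OF xs] by simp
    qed
    ultimately have "C \<in> {C \<in> carrier ?E. ?t C f \<in> H}"
      using C unfolding ext.ext_power_eq ext.wedge_eq by (rule ext.Q_generated)
    then show ?thesis by simp
  qed
  then have gen: "tens.cls n (frag_of s) \<in> H" if "s \<in> carrier ?E \<times> X_Cc" for s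
    using that by (cases s) (simp add: tens.tensor_eq)
  show ?thesis
    by (rule tens.Q_generated[OF H[unfolded tens.tensor_group_eq] gen z[unfolded tens.tensor_group_eq]])
qed

definition degree_sets :: "nat \<Rightarrow> nat set set" where
  "degree_sets n = {U. U \<subseteq> {1..k} \<and> card U = n}"

lemma finite_degree_sets: "finite (degree_sets n)"
  by (rule finite_subset[of _ "Pow {1..k}"]) (auto simp: degree_sets_def)

lemma degree_sets_list:
  assumes "U \<in> degree_sets n"
  shows "sorted_wrt (<) (sorted_list_of_set U)" "set (sorted_list_of_set U) \<subseteq> {1..k}"
    "length (sorted_list_of_set U) = n" "set (sorted_list_of_set U) = U"
  using assms sorted_list_of_set_props[of U] finite_subset[of U "{1..k}"] by (simp_all add: degree_sets_def)

text \<open>The inverse of \<open>action_coords\<close> in degrees up to k. Above k the target is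
  the one-element group, whose element is \<open>undefined\<close>.\<close>

definition action_chain_of :: "nat \<Rightarrow> (nat set \<Rightarrow> 'a \<Rightarrow> int) \<Rightarrow> 'a action_chain" where
  "action_chain_of n F = (if n \<le> k
     then finprod (AG n) (\<lambda>U. action_elem k X n (sorted_list_of_set U) (F U)) (degree_sets n) else undefined)"

lemma koszul_Cc: "F \<in> koszul n \<Longrightarrow> F T \<in> X_Cc"
  by (simp add: koszul_chains_def)

lemma action_elem_degree: "U \<in> degree_sets n \<Longrightarrow> f \<in> X_Cc \<Longrightarrow> action_elem k X n (sorted_list_of_set U) f \<in> carrier (AG n)"
  by (rule action_elem_in[OF degree_sets_list(2,3)])

lemma action_chain_of_in: 
  assumes "n \<le> k" "F \<in> koszul n" shows "action_chain_of n F \<in> carrier (AG n)"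
proof -
  interpret A: comm_group "AG n" by (rule tens.comm_group_tensor)
  show ?thesis unfolding action_chain_of_def if_P[OF assms(1)]
    by (rule A.finprod_closed) (use action_elem_degree koszul_Cc[OF assms(2)] in blast)
qed

lemma koszul_add: "F \<in> koszul n \<Longrightarrow> F' \<in> koszul n \<Longrightarrow> F + F' \<in> koszul n"
  using koszul_diff[of F n "0 - F'"] koszul_diff[OF koszul_0, of F' n] by simp

lemma action_chain_of_add:
  assumes n: "n \<le> k" and F: "F \<in> koszul n" "F' \<in> koszul n"
  shows "action_chain_of n (F + F') = action_chain_of n F \<otimes>\<^bsub>AG n\<^esub> action_chain_of n F'"
proof -
  interpret A: comm_group "AG n" by (rule tens.comm_group_tensor)
  let ?e = "\<lambda>F U. action_elem k X n (sorted_list_of_set U) (F U)"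
  have e: "?e F \<in> degree_sets n \<rightarrow> carrier (AG n)" if "F \<in> koszul n" for F
    using action_elem_degree koszul_Cc[OF that] by blast
  have "finprod (AG n) (?e (F + F')) (degree_sets n) = finprod (AG n) (\<lambda>U. ?e F U \<otimes>\<^bsub>AG n\<^esub> ?e F' U) (degree_sets n)"
  proof (rule A.finprod_cong')
    show "(\<lambda>U. ?e F U \<otimes>\<^bsub>AG n\<^esub> ?e F' U) \<in> degree_sets n \<rightarrow> carrier (AG n)" using e[OF F(1)] e[OF F(2)] by blast
    show "?e (F + F') U = ?e F U \<otimes>\<^bsub>AG n\<^esub> ?e F' U" if "U \<in> degree_sets n" for U
      using action_elem_add[OF degree_sets_list(2,3)[OF that] koszul_Cc[OF F(1)] koszul_Cc[OF F(2)]] by simp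
  qed simp
  also have "\<dots> = finprod (AG n) (?e F) (degree_sets n) \<otimes>\<^bsub>AG n\<^esub> finprod (AG n) (?e F') (degree_sets n)"
    by (rule A.finprod_multf[OF e[OF F(1)] e[OF F(2)]])
  finally show ?thesis using n by (simp add: action_chain_of_def)
qed

lemma action_coords_chain_of:
  assumes n: "n \<le> k" and F: "F \<in> koszul n"
  shows "action_coords (action_chain_of n F) = F"
proof
  fix T
  have "action_coords (action_chain_of n F) = (\<Sum>U\<in>degree_sets n. action_coords (action_elem k X n (sorted_list_of_set U) (F U)))"
    unfolding action_chain_of_def if_P[OF n]
    by (rule action_coords_finprod) (use action_elem_degree koszul_Cc[OF F] in blast)
  also have "\<dots> = (\<Sum>U\<in>degree_sets n. (\<lambda>T. if T = U then F U else 0))"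
    by (rule sum.cong) (simp_all add: action_coords_elem[OF degree_sets_list(1-3) koszul_Cc[OF F]] degree_sets_list(4))
  finally have "action_coords (action_chain_of n F) T = (\<Sum>U\<in>degree_sets n. if T = U then F U else 0)"
    by (simp add: fun_sum_apply)
  also have "\<dots> = F T"
  proof (cases "T \<in> degree_sets n")
    case False
    then have "F T = 0" using F by (auto simp: koszul_chains_def degree_sets_def)
    then show ?thesis using False finite_degree_sets by simp
  qed (simp add: finite_degree_sets)
  finally show "action_coords (action_chain_of n F) T = F T" .
qed

definition koszul_single :: "nat set \<Rightarrow> ('a \<Rightarrow> int) \<Rightarrow> nat set \<Rightarrow> 'a \<Rightarrow> int" where
  "koszul_single U f = (\<lambda>T. if T = U then f else 0)"

lemma koszul_single_in: "U \<in> degree_sets n \<Longrightarrow> f \<in> X_Cc \<Longrightarrow> koszul_single U f \<in> koszul n"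
  using Cc_zero by (auto simp: koszul_single_def koszul_chains_def degree_sets_def)

lemma action_chain_of_single:
  assumes n: "n \<le> k" and i: "sorted_wrt (<) is" "length is = n" "set is \<subseteq> {1..k}" and f: "f \<in> X_Cc"
  shows "action_chain_of n (koszul_single (set is) f) = action_elem k X n is f"
proof -
  interpret A: comm_group "AG n" by (rule tens.comm_group_tensor)
  have d: "distinct is" using i(1) strict_sorted_iff by blast
  have U: "set is \<in> degree_sets n" using i d by (simp add: degree_sets_def distinct_card)
  have l: "sorted_list_of_set (set is) = is"
    using i(1) strict_sorted_iff[of "is"] by (simp add: sorted_list_of_set.idem_if_sorted_distinct)
  let ?e = "\<lambda>U. action_elem k X n (sorted_list_of_set U) f"
  have "action_chain_of n (koszul_single (set is) f)
      = finprod (AG n) (\<lambda>U. if set is = U then ?e U else \<one>\<^bsub>AG n\<^esub>) (degree_sets n)"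
    unfolding action_chain_of_def if_P[OF n]
  proof (rule A.finprod_cong')
    show "(\<lambda>U. if set is = U then ?e U else \<one>\<^bsub>AG n\<^esub>) \<in> degree_sets n \<rightarrow> carrier (AG n)"
      using action_elem_degree f by auto
    show "action_elem k X n (sorted_list_of_set U) (koszul_single (set is) f U) = (if set is = U then ?e U else \<one>\<^bsub>AG n\<^esub>)"
      if "U \<in> degree_sets n" for U
      using action_elem_0[OF degree_sets_list(2,3)[OF that]] by (simp add: koszul_single_def)
  qed simp
  also have "\<dots> = ?e (set is)"
    by (rule A.finprod_singleton[OF U finite_degree_sets]) (use action_elem_degree f in blast)
  finally show ?thesis by (simp add: l)
qed

text \<open>The image is a subgroup containing the basis elements, so
  \<open>action_generated\<close> applies.\<close>

lemma action_chain_of_onto: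
  assumes n: "n \<le> k" and z: "z \<in> carrier (AG n)" shows "\<exists>F\<in>koszul n. z = action_chain_of n F"
proof -
  interpret A: comm_group "AG n" by (rule tens.comm_group_tensor)
  note c_in = action_chain_of_in[OF n] and c_add = action_chain_of_add[OF n]
  have zero: "action_chain_of n 0 = \<one>\<^bsub>AG n\<^esub>"
    using c_add[OF koszul_0 koszul_0] c_in[OF koszul_0] A.l_cancel_one[of "action_chain_of n 0" "action_chain_of n 0"] by simp
  have "subgroup (action_chain_of n ` koszul n) (AG n)"
  proof (rule A.subgroupI)
    fix a assume "a \<in> action_chain_of n ` koszul n"
    then obtain F where F: "F \<in> koszul n" "a = action_chain_of n F" by blast
    have m: "0 - F \<in> koszul n" by (rule koszul_diff[OF koszul_0 F(1)])
    have "action_chain_of n (0 - F) \<otimes>\<^bsub>AG n\<^esub> a = \<one>\<^bsub>AG n\<^esub>"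
      using c_add[OF m F(1)] F(2) zero by simp
    then have "inv\<^bsub>AG n\<^esub> a = action_chain_of n (0 - F)"
      using c_in[OF m] c_in[OF F(1)] F(2) by (intro A.inv_equality) simp_all
    then show "inv\<^bsub>AG n\<^esub> a \<in> action_chain_of n ` koszul n" using m by blast
  next
    fix a b assume "a \<in> action_chain_of n ` koszul n" "b \<in> action_chain_of n ` koszul n"
    then obtain F F' where F: "F \<in> koszul n" "F' \<in> koszul n" "a = action_chain_of n F" "b = action_chain_of n F'" by blast
    then have "a \<otimes>\<^bsub>AG n\<^esub> b = action_chain_of n (F + F')" using c_add[OF F(1,2)] by simp
    then show "a \<otimes>\<^bsub>AG n\<^esub> b \<in> action_chain_of n ` koszul n" using koszul_add[OF F(1,2)] by blast
  qed (use c_in koszul_0 in blast)+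
  then have "z \<in> action_chain_of n ` koszul n"
  proof (rule action_generated[OF _ _ z])
    fix "is" :: "nat list" and f assume i: "sorted_wrt (<) is" "length is = n" "set is \<subseteq> {1..k}" and f: "f \<in> X_Cc"
    have "set is \<in> degree_sets n" using i strict_sorted_iff[of "is"] by (simp add: degree_sets_def distinct_card)
    then show "action_elem k X n is f \<in> action_chain_of n ` koszul n"
      using action_chain_of_single[OF n i f] koszul_single_in f by (metis imageI)
  qed
  then show ?thesis by blast
qed

lemma action_chain_of_coords:
  assumes "n \<le> k" "z \<in> carrier (AG n)" shows "action_chain_of n (action_coords z) = z"
proof -
  obtain F where "F \<in> koszul n" "z = action_chain_of n F" using action_chain_of_onto[OF assms] by blast
  then show ?thesis by (simp only: action_coords_chain_of[OF assms(1)])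
qed

lemma action_complex_le: "n \<le> k \<Longrightarrow> action_complex k X n = AG n"
  and action_complex_gt: "k < n \<Longrightarrow> action_complex k X n = singleton_group undefined"
  by (simp_all add: action_complex_def)

lemma koszul_gt: "k < n \<Longrightarrow> koszul n = {0}"
proof -
  assume n: "k < n"
  have "F = 0" if "F \<in> koszul n" for F
  proof -
    have "F T = 0" for T
    proof (rule ccontr)
      assume "F T \<noteq> 0"
      then have "T \<subseteq> {1..k}" "card T = n" using that by (simp_all add: koszul_chains_def)
      then show False using n card_mono[of "{1..k}" T] by simp
    qed
    then show ?thesis by (simp add: fun_eq_iff)
  qed
  then show ?thesis using koszul_0 by blast
qed

lemma comm_group_action_complex: "comm_group (action_complex k X n)"
  by (simp add: action_complex_def tens.comm_group_tensor)

lemma action_chain_of_bij: "bij_betw (action_chain_of n) (koszul n) (carrier (action_complex k X n))"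
proof (cases "n \<le> k")
  case True
  have "inj_on (action_chain_of n) (koszul n)"
    by (rule inj_on_inverseI[of _ action_coords]) (rule action_coords_chain_of[OF True])
  moreover have "action_chain_of n ` koszul n = carrier (action_complex k X n)"
    unfolding action_complex_le[OF True]
    using action_chain_of_in[OF True] action_chain_of_onto[OF True] by blast
  ultimately show ?thesis by (simp add: bij_betw_def)
next
  case False
  then have n: "k < n" by simp
  show ?thesis unfolding action_complex_gt[OF n] koszul_gt[OF n] using n by (simp add: bij_betw_def action_chain_of_def)
qed

lemma action_chain_of_mult:
  assumes "F \<in> koszul n" "F' \<in> koszul n"
  shows "action_chain_of n (F + F') = action_chain_of n F \<otimes>\<^bsub>action_complex k X n\<^esub> action_chain_of n F'"
proof (cases "n \<le> k")
  case False
  then show ?thesis by (simp add: action_complex_gt action_chain_of_def singleton_group_def)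
qed (simp add: action_complex_le action_chain_of_add assms)

lemma id_minus_push_eq: "id_minus_push \<sigma> i f = f - push (\<sigma> (gen i)) f"
  by (simp add: id_minus_push_def pushforward_eq_push fun_eq_iff)

sublocale C: commuting_family X_Cc "id_minus_push \<sigma>" k
proof
  show u_in: "id_minus_push \<sigma> i x \<in> X_Cc" if "i \<in> {1..k}" "x \<in> X_Cc" for i x
    unfolding id_minus_push_eq using that by (intro Cc_diff push_\<sigma>_in Nk_single)
  show add: "id_minus_push \<sigma> i (x + y) = id_minus_push \<sigma> i x + id_minus_push \<sigma> i y"
    if "i \<in> {1..k}" "x \<in> X_Cc" "y \<in> X_Cc" for i x y
    unfolding id_minus_push_eq push_add[OF \<sigma>_fin_fibres[OF Nk_single[OF that(1)] that(2)] \<sigma>_fin_fibres[OF Nk_single[OF that(1)] that(3)]]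
    by simp
  show "id_minus_push \<sigma> i (id_minus_push \<sigma> l x) = id_minus_push \<sigma> l (id_minus_push \<sigma> i x)"
    if il: "i \<in> {1..k}" "l \<in> {1..k}" and x: "x \<in> X_Cc" for i l x
  proof -
    have p: "push (\<sigma> (gen a)) x \<in> X_Cc" if "a \<in> {1..k}" for a by (rule push_\<sigma>_in[OF Nk_single[OF that] x])
    have m: "push (\<sigma> (gen a)) (x - push (\<sigma> (gen b)) x) = push (\<sigma> (gen a)) x - push (\<sigma> (gen a)) (push (\<sigma> (gen b)) x)"
      if "a \<in> {1..k}" "b \<in> {1..k}" for a b
    proof -
      have "push (\<sigma> (gen a)) ((x - push (\<sigma> (gen b)) x) + push (\<sigma> (gen b)) x)
          = push (\<sigma> (gen a)) (x - push (\<sigma> (gen b)) x) + push (\<sigma> (gen a)) (push (\<sigma> (gen b)) x)"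
        by (rule push_add; rule \<sigma>_fin_fibres[OF Nk_single[OF that(1)]]) (intro Cc_diff p[OF that(2)] x)+
      then show ?thesis by (simp add: algebra_simps)
    qed
    have "push (\<sigma> (gen i)) (push (\<sigma> (gen l)) x) = push (\<sigma> (gen l)) (push (\<sigma> (gen i)) x)"
      unfolding push_\<sigma>_\<sigma>[OF Nk_single[OF il(1)] Nk_single[OF il(2)] x] push_\<sigma>_\<sigma>[OF Nk_single[OF il(2)] Nk_single[OF il(1)] x]
      by (simp only: add.commute)
    then show ?thesis
      unfolding id_minus_push_eq by (simp only: m[OF il] m[OF il(2,1)]) (simp add: fun_eq_iff)
  qed
qed (rule Cc_zero, rule Cc_diff)

text \<open>The Koszul differential transported along the coordinates, which provides the existence
  of a boundary with the prescribed values.\<close>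

definition action_boundary :: "nat \<Rightarrow> 'a action_chain \<Rightarrow> 'a action_chain" where
  "action_boundary p z = (if p \<le> k then action_chain_of (p - 1) (koszul_d (id_minus_push \<sigma>) k (action_coords z))
     else \<one>\<^bsub>action_complex k X (p - 1)\<^esub>)"

lemma action_chain_of_0: "action_chain_of n 0 = \<one>\<^bsub>action_complex k X n\<^esub>"
proof -
  interpret A: comm_group "action_complex k X n" by (rule comm_group_action_complex)
  have "action_chain_of n 0 \<in> carrier (action_complex k X n)"
    using action_chain_of_bij koszul_0 by (auto simp: bij_betw_def)
  then show ?thesis
    using action_chain_of_mult[OF koszul_0 koszul_0] A.l_cancel_one[of "action_chain_of n 0" "action_chain_of n 0"] by simp
qed

lemma koszul_d_0: "koszul_d (id_minus_push \<sigma>) k 0 = 0"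
  using C.d_add[of 0 k 0 0] koszul_0 by simp

lemma action_boundary_chain_of:
  assumes F: "F \<in> koszul (Suc n)"
  shows "action_boundary (Suc n) (action_chain_of (Suc n) F) = action_chain_of n (koszul_d (id_minus_push \<sigma>) k F)"
proof (cases "Suc n \<le> k")
  case True
  then show ?thesis by (simp add: action_boundary_def action_coords_chain_of[OF True F])
next
  case False
  then have "F = 0" using F koszul_gt[of "Suc n"] by simp
  then show ?thesis using False by (simp add: action_boundary_def koszul_d_0 action_chain_of_0)
qed

lemma action_boundary_hom: "action_boundary (Suc n) \<in> hom (action_complex k X (Suc n)) (action_complex k X n)"
proof (rule homI)
  have ex: "\<exists>F\<in>koszul (Suc n). z = action_chain_of (Suc n) F" if "z \<in> carrier (action_complex k X (Suc n))" for z
    using that action_chain_of_bij[of "Suc n"] by (auto simp: bij_betw_def)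
  fix z assume "z \<in> carrier (action_complex k X (Suc n))"
  then obtain F where F: "F \<in> koszul (Suc n)" "z = action_chain_of (Suc n) F" using ex by blast
  have dF: "koszul_d (id_minus_push \<sigma>) k F \<in> koszul n" by (rule C.d_in[OF F(1) le_refl])
  then show "action_boundary (Suc n) z \<in> carrier (action_complex k X n)"
    unfolding F(2) action_boundary_chain_of[OF F(1)] using action_chain_of_bij by (auto simp: bij_betw_def)
  fix w assume "w \<in> carrier (action_complex k X (Suc n))"
  then obtain F' where F': "F' \<in> koszul (Suc n)" "w = action_chain_of (Suc n) F'" using ex by blast
  have dF': "koszul_d (id_minus_push \<sigma>) k F' \<in> koszul n" by (rule C.d_in[OF F'(1) le_refl])
  show "action_boundary (Suc n) (z \<otimes>\<^bsub>action_complex k X (Suc n)\<^esub> w)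
      = action_boundary (Suc n) z \<otimes>\<^bsub>action_complex k X n\<^esub> action_boundary (Suc n) w"
    unfolding F(2) F'(2) action_chain_of_mult[OF F(1) F'(1), symmetric] action_boundary_chain_of[OF F(1)]
      action_boundary_chain_of[OF F'(1)] action_boundary_chain_of[OF koszul_add[OF F(1) F'(1)]]
      action_chain_of_mult[OF dF dF', symmetric] C.d_add[OF F(1) F'(1) le_refl] ..
qed

text \<open>Both sides are compared through their coordinates, which determine a chain.\<close>

lemma action_boundary_elem:
  assumes n: "Suc n \<le> k" and i: "sorted_wrt (<) is" "length is = Suc n" "set is \<subseteq> {1..k}" and f: "f \<in> X_Cc"
  shows "action_boundary (Suc n) (action_elem k X (Suc n) is f) =
    finprod (AG n) (\<lambda>j. action_elem k X n (take (j - 1) is @ drop j is) (id_minus_push \<sigma> (is ! (j - 1)) f)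
      [^]\<^bsub>AG n\<^esub> ((-1 :: int) ^ (j + 1))) {1..Suc n}"
proof -
  interpret A: comm_group "AG n" by (rule tens.comm_group_tensor)
  let ?u = "\<lambda>i. id_minus_push \<sigma> i f"
  let ?e = "\<lambda>j. action_elem k X n (take (j - 1) is @ drop j is) (?u (is ! (j - 1)))"
  let ?P = "finprod (AG n) (\<lambda>j. ?e j [^]\<^bsub>AG n\<^esub> ((-1 :: int) ^ (j + 1))) {1..Suc n}"
  have u: "?u (is ! l) \<in> X_Cc" if "l < Suc n" for l
    using that i(2,3) nth_mem[of l "is"] by (intro C.u_in[OF _ f]) (simp only:, blast)
  have r: "sorted_wrt (<) (take l is @ drop (Suc l) is)" "length (take l is @ drop (Suc l) is) = n"
      "set (take l is @ drop (Suc l) is) \<subseteq> {1..k}" if "l < Suc n" for l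
    using removed_index[OF i(1), of l] that i(2,3) by auto
  have e: "?e j \<in> carrier (AG n)" if "j \<in> {1..Suc n}" for j
    using that by (cases j) (auto intro!: action_elem_in[OF r(3,2) u])
  have P: "?P \<in> carrier (AG n)" by (rule A.finprod_closed) (rule Pi_I, rule A.int_pow_closed[OF e])
  have U: "set is \<in> degree_sets (Suc n)" using i strict_sorted_iff[of "is"] by (simp add: degree_sets_def distinct_card)
  have bij: "bij_betw ((!) is) {..<Suc n} (set is)"
    using i(1,2) strict_sorted_iff[of "is"] by (intro bij_betw_nth) auto
  have "action_coords ?P T = koszul_d (id_minus_push \<sigma>) k (koszul_single (set is) f) T" for T
  proof -
    have "action_coords ?P = (\<Sum>j\<in>{1..Suc n}. action_coords (?e j [^]\<^bsub>AG n\<^esub> ((-1 :: int) ^ (j + 1))))"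
      by (rule action_coords_finprod) (rule A.int_pow_closed[OF e])
    also have "\<dots> = (\<Sum>j\<in>{1..Suc n}. alt_sign (j + 1) (action_coords (?e j)))"
      by (rule sum.cong[OF refl]) (rule action_coords_sign[OF e])
    \<comment> \<open>Places are counted from 1 in the prescription: j = l + 1 gives the sign
      (-1)^(l + 2), which is (-1)^l.\<close>
    also have "\<dots> = (\<Sum>l<Suc n. alt_sign l (action_coords (action_elem k X n (take l is @ drop (Suc l) is) (?u (is ! l)))))"
      unfolding One_nat_def sum.atLeast1_atMost_eq by (rule sum.cong) simp_all
    also have "\<dots> = (\<Sum>l<Suc n. alt_sign (position (is ! l) (set is)) (koszul_single (set is - {is ! l}) (?u (is ! l))))"
    proof (rule sum.cong)
      fix l assume "l \<in> {..<Suc n}"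
      then have l: "l < Suc n" by simp
      show "alt_sign l (action_coords (action_elem k X n (take l is @ drop (Suc l) is) (?u (is ! l))))
          = alt_sign (position (is ! l) (set is)) (koszul_single (set is - {is ! l}) (?u (is ! l)))"
        unfolding action_coords_elem[OF r(1)[OF l] r(3)[OF l] r(2)[OF l] u[OF l]] koszul_single_def
        using position_nth[OF i(1), of l] removed_index(2)[OF i(1), of l] l i(2) by simp
    qed simp
    also have "\<dots> = (\<Sum>i\<in>set is. alt_sign (position i (set is)) (koszul_single (set is - {i}) (?u i)))"
      by (rule sum.reindex_bij_betw[OF bij])
    finally have "action_coords ?P T = (\<Sum>i\<in>set is. alt_sign (position i (set is)) (koszul_single (set is - {i}) (?u i) T))"
      by (simp add: fun_sum_apply alt_sign_apply)
    also have "\<dots> = (\<Sum>i\<in>set is. if set is - {i} = T then alt_sign (position i (set is)) (?u i) else 0)"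
      by (rule sum.cong) (auto simp: koszul_single_def)
    also have "\<dots> = koszul_d (id_minus_push \<sigma>) k (koszul_single (set is) f) T"
      unfolding koszul_single_def by (rule koszul_d_single[where u = "id_minus_push \<sigma>", OF i(3) C.u_0, symmetric])
    finally show ?thesis .
  qed
  then have coords: "action_coords ?P = koszul_d (id_minus_push \<sigma>) k (koszul_single (set is) f)" by blast
  have "action_boundary (Suc n) (action_elem k X (Suc n) is f)
      = action_chain_of n (koszul_d (id_minus_push \<sigma>) k (koszul_single (set is) f))"
    unfolding action_chain_of_single[OF n i f, symmetric] by (rule action_boundary_chain_of[OF koszul_single_in[OF U f]])
  also have "\<dots> = ?P"
    unfolding coords[symmetric] by (rule action_chain_of_coords[OF Suc_leD[OF n] P])
  finally show ?thesis .
qed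

lemma is_action_boundary_action_boundary: "is_action_boundary k X \<sigma> action_boundary"
  unfolding is_action_boundary_def
proof (intro conjI allI impI ballI)
  fix p :: nat assume "1 \<le> p"
  then show "action_boundary p \<in> hom (action_complex k X p) (action_complex k X (p - 1))"
    using action_boundary_hom[of "p - 1"] by simp
next
  fix p "is" f
  assume *: "1 \<le> p \<and> p \<le> k \<and> length is = p \<and> sorted_wrt (<) is \<and> set is \<subseteq> {1..k} \<and> f \<in> X_Cc"
  then obtain n where p: "p = Suc n" by (cases p) auto
  have "p - 1 \<le> k" using * by (meson diff_le_self le_trans)
  then show "action_boundary p (action_elem k X p is f) =
          finprod (action_complex k X (p - 1))
            (\<lambda>j. action_elem k X (p - 1) (take (j - 1) is @ drop j is)
                   (id_minus_push \<sigma> (is ! (j - 1)) f)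
                 [^]\<^bsub>action_complex k X (p - 1)\<^esub> ((-1 :: int) ^ (j + 1)))
            {1..p}"
    using action_boundary_elem[of n "is" f] * unfolding p by (simp only: action_complex_le diff_Suc_1 simp_thms)
qed (simp add: action_boundary_def)

text \<open>Two homomorphisms agree on a subgroup, and this one contains the generators on which the
  values are prescribed.\<close>

lemma action_boundary_unique:
  assumes d: "is_action_boundary k X \<sigma> d" and z: "z \<in> carrier (action_complex k X (Suc n))"
  shows "d (Suc n) z = action_boundary (Suc n) z"
proof (cases "Suc n \<le> k")
  case False
  then have n: "k < Suc n" by simp
  have "\<forall>p>k. \<forall>z\<in>carrier (action_complex k X p). 1 \<le> p \<longrightarrow> d p z = \<one>\<^bsub>action_complex k X (p - 1)\<^esub>"
    using d unfolding is_action_boundary_def by (elim conjE)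
  from this[rule_format, OF n z] show ?thesis unfolding action_boundary_def if_not_P[OF False] by simp
next
  case True
  let ?A = "action_complex k X (Suc n)" and ?B = "action_complex k X n"
  interpret A: comm_group ?A by (rule comm_group_action_complex)
  interpret B: comm_group ?B by (rule comm_group_action_complex)
  have "\<forall>p\<ge>1. d p \<in> hom (action_complex k X p) (action_complex k X (p - 1))"
    using d unfolding is_action_boundary_def by (elim conjE)
  from this[rule_format, of "Suc n"] have "d (Suc n) \<in> hom ?A ?B" by simp
  then interpret d: group_hom ?A ?B "d (Suc n)"
    by (intro group_hom.intro group_hom_axioms.intro A.is_group B.is_group)
  interpret e: group_hom ?A ?B "action_boundary (Suc n)"
    by (intro group_hom.intro group_hom_axioms.intro A.is_group B.is_group action_boundary_hom)
  let ?H = "{z \<in> carrier ?A. d (Suc n) z = action_boundary (Suc n) z}"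
  have "subgroup ?H ?A"
    by (rule A.subgroupI) (use d.hom_one e.hom_one in auto)
  then have "z \<in> ?H"
    unfolding action_complex_le[OF True]
  proof (rule action_generated)
    fix "is" :: "nat list" and f
    assume i: "sorted_wrt (<) is" "length is = Suc n" "set is \<subseteq> {1..k}" and f: "f \<in> X_Cc"
    have *: "\<forall>p is f. 1 \<le> p \<and> p \<le> k \<and> length is = p \<and> sorted_wrt (<) is \<and> set is \<subseteq> {1..k} \<and> f \<in> X_Cc \<longrightarrow>
        d' p (action_elem k X p is f) =
          finprod (action_complex k X (p - 1))
            (\<lambda>j. action_elem k X (p - 1) (take (j - 1) is @ drop j is) (id_minus_push \<sigma> (is ! (j - 1)) f)
                 [^]\<^bsub>action_complex k X (p - 1)\<^esub> ((-1 :: int) ^ (j + 1))) {1..p}"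
      if "is_action_boundary k X \<sigma> d'" for d'
      using that unfolding is_action_boundary_def by (elim conjE)
    have **: "1 \<le> Suc n \<and> Suc n \<le> k \<and> length is = Suc n \<and> sorted_wrt (<) is \<and> set is \<subseteq> {1..k} \<and> f \<in> X_Cc"
      by (intro conjI i f True) simp
    have "d (Suc n) (action_elem k X (Suc n) is f) = action_boundary (Suc n) (action_elem k X (Suc n) is f)"
      by (rule trans[OF *[OF d, rule_format, OF **] *[OF is_action_boundary_action_boundary, rule_format, OF **, symmetric]])
    then show "action_elem k X (Suc n) is f \<in> {z \<in> carrier (AG (Suc n)). d (Suc n) z = action_boundary (Suc n) z}"
      using action_elem_in[OF i(3,2) f] by simp
  qed (use z in \<open>simp add: action_complex_le[OF True]\<close>)
  then show ?thesis by simp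
qed

lemma action_resolution:
  assumes d: "is_action_boundary k X \<sigma> d"
  shows "induced_resolution k koszul koszul_boundary (\<lambda>n. koszul_d (id_minus_push \<sigma>) k)
    (groupoid_homology S 0) (skew_action k G DR_cocycle) koszul_class (action_complex k X) d action_chain_of"
proof (rule koszul_resolution[OF comm_group_action_complex action_chain_of_bij action_chain_of_mult])
  fix n F assume F: "F \<in> koszul (Suc n)"
  then have "action_chain_of (Suc n) F \<in> carrier (action_complex k X (Suc n))"
    using action_chain_of_bij[of "Suc n"] by (auto simp: bij_betw_def)
  then show "d (Suc n) (action_chain_of (Suc n) F) = action_chain_of n (koszul_d (id_minus_push \<sigma>) k F)"
    using action_boundary_unique[OF d] action_boundary_chain_of[OF F] by simp
qed

lemma group_homology_group: "group (group_homology (Zk k) (groupoid_homology S 0) (skew_action k G DR_cocycle) n)"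
  unfolding group_homology_def
  using comm_group_homology[OF skew.bar.chain_complex_A] by (simp add: comm_group_def)

lemma action_homology_trivial:
  assumes d: "is_action_boundary k X \<sigma> d" and p: "k < p"
  shows "trivial_group (homology (action_complex k X) d p)"
proof -
  have cc: "chain_complex (action_complex k X) d"
    by (rule induced_resolution.chain_complex_A[OF action_resolution[OF d]])
  interpret H: comm_group "homology (action_complex k X) d p" by (rule comm_group_homology[OF cc])
  have "cycles (action_complex k X) d p \<subseteq> {undefined}"
    using p by (auto simp: cycles_def kernel_def action_complex_gt)
  moreover have "undefined \<in> cycles (action_complex k X) d p"
    using subgroup.one_closed[OF subgroup_cycles[OF cc, of p]] p by (simp add: action_complex_gt singleton_group_def)
  ultimately have "cycles (action_complex k X) d p = {undefined}" by blast
  then have "carrier (homology (action_complex k X) d p) = {boundaries (action_complex k X) d p #>\<^bsub>(action_complex k X p)\<lparr>carrier := {undefined}\<rparr>\<^esub> undefined}"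
    by (simp add: homology_def FactGroup_def RCOSETS_def)
  then show ?thesis using H.one_closed H.is_group by (auto simp: trivial_group_def)
qed

end

text \<open>The boundary is characterised by its values on generators; its existence is claimed
  separately, so that the statement for every such d is not vacuous. Vanishing above k is carried
  over from the action complex along the isomorphism.\<close>

theorem theorem6p5:
  fixes X :: "'a topology" and k :: nat and \<sigma> :: "(nat \<Rightarrow>\<^sub>0 nat) \<Rightarrow> 'a \<Rightarrow> 'a"
  assumes "second_countable X" and "totally_disconnected_space X"
    and "locally_compact_space X" and "Hausdorff_space X"
    and "Nk_action k X \<sigma>"
  shows
    "let G = DR_groupoid k X \<sigma>;
         M = groupoid_homology (skew_product k G DR_cocycle) 0;
         act = skew_action k G DR_cocycle
     in (\<exists>d. is_action_boundary k X \<sigma> d) \<and>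
        (\<forall>d. is_action_boundary k X \<sigma> d \<longrightarrow>
           chain_complex (action_complex k X) d \<and>
           (\<forall>n. groupoid_homology G n \<cong> group_homology (Zk k) M act n \<and>
                group_homology (Zk k) M act n \<cong> homology (action_complex k X) d n)) \<and>
        (\<forall>p>k. trivial_group (group_homology (Zk k) M act p))"
proof -
  interpret dr_action k X \<sigma> by (rule dr_action.intro[OF assms(5,4)])
  let ?GH = "group_homology (Zk k) (groupoid_homology S 0) (skew_action k G DR_cocycle)"
  have 1: "groupoid_homology G n \<cong> ?GH n" for n
    unfolding groupoid_homology_def[of G] by (rule group.iso_sym[OF group_homology_group skew.group_homology_iso])
  have 2: "chain_complex (action_complex k X) d" "?GH n \<cong> homology (action_complex k X) d n"
    if "is_action_boundary k X \<sigma> d" for d n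
    using induced_resolution.chain_complex_A[OF action_resolution[OF that]]
      induced_resolution.group_homology_iso[OF action_resolution[OF that]] by blast+
  have 3: "trivial_group (?GH p)" if "k < p" for p
  proof (rule isomorphic_group_triviality1[OF group.iso_sym[OF group_homology_group 2(2)] group_homology_group])
    show "is_action_boundary k X \<sigma> action_boundary" by (rule is_action_boundary_action_boundary)
    then show "trivial_group (homology (action_complex k X) action_boundary p)" using that by (rule action_homology_trivial)
  qed
  show ?thesis
    unfolding Let_def using is_action_boundary_action_boundary 1 2 3 by blast
qed

end
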